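(* Let $G$ be a finite group, let $H\le G$ be a subgroup, and let $\mu$ be a random rooted simplicial $H$-complex (on $\mathcal{SC}_*^D(H)$). If $\mu$ is sofic, then $\mathrm{ind}_H^G(\mu)$ is sofic and, moreover, \[ m^{(2)}_n(\rho,\mathrm{ind}_H^G(\mu)) = \frac{|H|}{|G|} \sum_{\theta\in \mathrm{Irr}(H)} m(\theta,\rho_{|H})\; m_n^{(2)}(\theta, \mu)\] for every $\rho \in \mathrm{Irr}(G)$ and all $n\in \mathbb{N}_0$.
   Context: **Representations.** $\mathrm{Irr}(G)$ is the set of (isomorphism classes of) irreducible complex representations of a finite group $G$. For a finite-dimensional complex representation $\sigma$ of $H$ and $\theta\in\mathrm{Irr}(H)$, $m(\theta,\sigma)$ is the multiplicity of $\theta$ in $\sigma$; $\rho_{|H}$ is the restriction of $\rho$ to $H$. **Rooted $G$-complexes.** In what follows $G$ is an arbitrary finite group (the definitions are also applied to subgroups $H$) and $D>0$ a fixed constant. Simplicial complexes are nonempty; $K^{(0)}$ is the vertex set of $K$; the degree of a vertex is the number of $1$-simplices containing it, and the vertex degree of $K$ is the supremum of the degrees. A simplicial $G$-complex is a simplicial complex with an action of $G$ by simplicial automorphisms. For $\emptyset\neq V\subseteq K^{(0)}$ and $r>0$, $B_r(K,V)$ is the full subcomplex of $K$ on all vertices of path distance at most $r$ from some vertex of $V$. A rooted simplicial $G$-complex is a pair $(K,o)$ of a simplicial $G$-complex $K$ and a $G$-orbit $o\subseteq K^{(0)}$ meeting every connected component of $K$. An isomorphism $(K,o)\cong_G(L,o')$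 is a $G$-equivariant simplicial isomorphism $K\to L$ mapping $o$ onto $o'$. $\mathcal{SC}_*^D(G)$ is the set of isomorphism classes $[K,o]$ with vertex degree at most $D$, with the (possibly infinite-valued) metric $d([K,o],[L,o'])=\inf\{2^{-r} : (B_r(K,o),o)\cong_G (B_r(L,o'),o')\}$; it is compact and totally disconnected. Similarly, $\mathcal{SC}_{**}^D(G)$ is the space of isomorphism classes $[K,o,o']$ of simplicial $G$-complexes of vertex degree at most $D$ with two vertex orbits each meeting every connected component (isomorphisms preserve both orbits; the topology is defined in the same way using balls $B_r(K,o\cup o')$). A random rooted simplicial $G$-complex is a Borel probability measure $\mu$ on $\mathcal{SC}_*^D(G)$ that is unimodular: for all Borel $f\colon\mathcal{SC}_{**}^D(G)\to\mathbb{R}_{\ge0}$, \[\int\sum_{x\in K^{(0)}}f([K,o,Gx])\,d\mu([K,o])=\int\sum_{x\in K^{(0)}}f([K,Gx,o])\,d\mu([K,o]).\] **Sofic.** For a finite simplicial $G$-complex $K$ of vertex degree at most $D$, let $\mu_K^G=\frac{1}{|K^{(0)}|}\sum_{x\in K^{(0)}}\delta_{[K,Gx]}$, where $[K,Gx]$ denotes the class of the union of those connected components of $K$ that meet $Gx$, rooted at $Gx$. A random rooted simplicial $G$-complex is sofic if it is the weak limit of $\mu^G_{K_j}$ for some sequence $(K_j)_j$ of finite simplicial $G$-complexes of vertex degree at most $D$. **Induction.** For a subgroup $H\le G$ and an $H$-set $Y$, $G\times_H Y$ is the quotient of $G\times Y$ by $(g,y)\sim(gh,h^{-1}y)$, $h\in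 H$; the class of $(g,y)$ is $\lfloor g,y\rfloor$ and $g_2\lfloor g_1,y\rfloor=\lfloor g_2g_1,y\rfloor$. For a simplicial $H$-complex $K$, $G\times_HK$ is the simplicial $G$-complex with vertex set $G\times_HK^{(0)}$ and simplices $\{\lfloor g,x\rfloor: x\in\sigma\}$ for $g\in G$ and $\sigma$ a simplex of $K$. The map $\mathrm{ind}_H^G\colon\mathcal{SC}_*^D(H)\to\mathcal{SC}_*^D(G)$, $[K,o]\mapsto[G\times_HK,G\lfloor1,o\rfloor]$ is continuous, and for a random rooted simplicial $H$-complex $\mu$, $\mathrm{ind}_H^G(\mu)$ denotes the push-forward measure, a random rooted simplicial $G$-complex. **$\ell^2$-chains.** Let $\mathrm{Orb}(G)$ be the finite set of isomorphism classes of transitive $G$-sets (with fixed representatives), $\mathbb{N}_G=\bigsqcup_{X\in\mathrm{Orb}(G)}\mathbb{N}_0\times X$ with $G$ acting on the second coordinate, and $\Delta^D(\mathbb{N}_G)$ the simplicial $G$-complex of all nonempty subsets of $\mathbb{N}_G$ with at most $D+1$ elements; $\Delta^D(\mathbb{N}_G)(n)$ is its set of $n$-simplices. Let $\mathrm{Sub}(\Delta^D(\mathbb{N}_G))\subseteq\{0,1\}^{\Delta^D(\mathbb{N}_G)}$ (product topology) be the space of (indicator functions of) $G$-invariant subcomplexes containing exactly one orbit of the form $\{0\}\times X$. Fix a continuous map $\Psi\colon\mathcal{SC}_*^D(G)\to\mathrm{Sub}(\Delta^D(\mathbb{N}_G))$ such that $(\Psi([K,o]),\{0\}\times X)$ represents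 $[K,o]$, where $X\cong o$ (such a map exists). For a simplicial complex $L$, $C_n^{(2)}(L)$ is the complex Hilbert space of square-summable oriented $n$-chains. For an oriented $n$-simplex $s$ of $\Delta^D(\mathbb{N}_G)$ put $\xi_s([K,o])=s$ if $s$ belongs to $\Psi([K,o])$ and $0$ otherwise. The $\xi_s$ form a fundamental sequence of a measurable field of Hilbert spaces $[K,o]\mapsto C_n^{(2)}(\Psi([K,o]))$; let $C_n^{(2)}(\mathcal{SC}_*^D(G),\mu)=\int^\oplus C_n^{(2)}(\Psi([K,o]))\,d\mu$ be the direct integral, with the fibrewise unitary $G$-action. The fibrewise boundary maps and their adjoints give bounded $G$-equivariant operators $\partial_n\colon C_n^{(2)}\to C_{n-1}^{(2)}$ and $d_n=\partial_n^*$; the Laplacian is $\Delta_n=\partial_{n+1}d_{n+1}+d_n\partial_n$, and $H_n^{(2)}(\mathcal{SC}_*^D(G),\mu)=\ker\Delta_n$. **Trace and multiplicities.** Let $\mathcal{A}_n(\mu)$ be the von Neumann algebra of bounded decomposable operators $T=\int^\oplus T_{[K,o]}d\mu$ on $C_n^{(2)}(\mathcal{SC}_*^D(G),\mu)$ which are compatible (almost everywhere) with all isomorphisms of simplicial $G$-complexes $\phi\colon\Psi([K,o])\to\Psi([K,o'])$, i.e. $\langle T_{[K,o]}\sigma,\sigma\rangle=\langle T_{[K,o']}\phi_\sharp\sigma,\phi_\sharp\sigma\rangle$, where $\phi_\sharp$ is the induced chain map. It carries the finite faithful normal trace \[\mathrm{tr}(T)=\sum_{X\in\mathrm{Orb}(G)}\sum_{x\in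 X}\ \sum_{s\in\Delta^D(\mathbb{N}_G)(n),\,(0,x)\in s}\frac{\langle T\xi_s,\xi_s\rangle}{|X|(n+1)}\] (each $s$ given an arbitrary orientation). For a subspace $\mathcal{K}$ whose orthogonal projection $\mathrm{pr}_{\mathcal{K}}$ lies in $\mathcal{A}_n(\mu)$, $\dim_{\mathrm{vN}}\mathcal{K}=\mathrm{tr}(\mathrm{pr}_{\mathcal{K}})$. For $\rho\in\mathrm{Irr}(G)$ with character $\chi_\rho$, the $\ell^2$-multiplicity is $m_n^{(2)}(\rho,\mu)=\frac{1}{\chi_\rho(1)}\dim_{\mathrm{vN}}H_n^{(2)}(\mathcal{SC}_*^D(G),\mu)_\rho$, where the subscript $\rho$ denotes the $\rho$-isotypic component, i.e. the image of $P_\rho=\frac{\chi_\rho(1)}{|G|}\sum_{g\in G}\overline{\chi_\rho(g)}\,g$. *)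

theory Defs
  imports
    "HOL-Probability.Probability"
    "HOL-Algebra.Group_Action"
    "HOL-Combinatorics.Permutations"
    "Jordan_Normal_Form.VS_Connect"
begin

section \<open>Simplicial G-complexes\<close>

text \<open>
  A complex is given by its set of (nonempty, finite) simplices; its vertex set is their union.
  \<open>group_action\<close> requires each \<open>act K g\<close> to be extensional on the vertex set.
\<close>

record ('g, 'v) gcomplex =
  faces :: "'v set set"
  act :: "'g \<Rightarrow> 'v \<Rightarrow> 'v"

definition verts :: "('g, 'v, 'm) gcomplex_scheme \<Rightarrow> 'v set"
  where "verts K = \<Union> (faces K)"

definition simplicial_complex :: "'v set set \<Rightarrow> bool"
  where "simplicial_complex S \<longleftrightarrow>
    S \<noteq> {} \<and> (\<forall>s\<in>S. finite s \<and> s \<noteq> {} \<and> (\<forall>t. t \<subseteq> s \<and> t \<noteq> {} \<longrightarrow> t \<in> S))"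

definition G_complex :: "('g, 'b) monoid_scheme \<Rightarrow> ('g, 'v) gcomplex \<Rightarrow> bool"
  where "G_complex G K \<longleftrightarrow>
    simplicial_complex (faces K) \<and> group_action G (verts K) (act K) \<and>
    (\<forall>g\<in>carrier G. \<forall>s\<in>faces K. act K g ` s \<in> faces K)"

definition degree_le :: "nat \<Rightarrow> ('g, 'v) gcomplex \<Rightarrow> bool"
  where "degree_le D K \<longleftrightarrow>
    (\<forall>x\<in>verts K. finite {e \<in> faces K. card e = 2 \<and> x \<in> e} \<and>
                  card {e \<in> faces K. card e = 2 \<and> x \<in> e} \<le> D)"

definition adjacent :: "('g, 'v) gcomplex \<Rightarrow> 'v \<Rightarrow> 'v \<Rightarrow> bool"
  where "adjacent K x y \<longleftrightarrow> x \<noteq> y \<and> {x, y} \<in> faces K"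

definition full_subcomplex :: "('g, 'v) gcomplex \<Rightarrow> 'v set \<Rightarrow> ('g, 'v) gcomplex"
  where "full_subcomplex K W =
    \<lparr>faces = {s \<in> faces K. s \<subseteq> W}, act = (\<lambda>g. restrict (act K g) W)\<rparr>"

definition cball_complex :: "('g, 'v) gcomplex \<Rightarrow> 'v set \<Rightarrow> real \<Rightarrow> ('g, 'v) gcomplex"
  where "cball_complex K V r = full_subcomplex K
    {x \<in> verts K. \<exists>v\<in>V. \<exists>k. real k \<le> r \<and> (adjacent K ^^ k) v x}"

definition components_meeting :: "('g, 'v) gcomplex \<Rightarrow> 'v set \<Rightarrow> ('g, 'v) gcomplex"
  where "components_meeting K V = full_subcomplex K
    {x \<in> verts K. \<exists>v\<in>V. (adjacent K)\<^sup>*\<^sup>* v x}"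


section \<open>The spaces of rooted complexes\<close>

text \<open>
  A marked complex carries a list of vertex orbits: lists of length 1 give rooted complexes
  \<open>(K, o)\<close>, lists of length 2 give the doubly rooted complexes \<open>(K, o, o')\<close>.
\<close>

type_synonym ('g, 'v) marked = "('g, 'v) gcomplex \<times> 'v set list"

definition marked_complex :: "nat \<Rightarrow> ('g, 'b) monoid_scheme \<Rightarrow> ('g, 'v) marked \<Rightarrow> bool"
  where "marked_complex D G = (\<lambda>(K, os).
    G_complex G K \<and> degree_le D K \<and>
    (\<forall>O'\<in>set os. O' \<in> orbits G (verts K) (act K) \<and>
       (\<forall>x\<in>verts K. \<exists>v\<in>O'. (adjacent K)\<^sup>*\<^sup>* v x)))"

definition marked_iso ::
    "('g, 'b) monoid_scheme \<Rightarrow> ('g, 'v) marked \<Rightarrow> ('g, 'w) marked \<Rightarrow> bool"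
  where "marked_iso G = (\<lambda>(K, os) (L, os'). \<exists>f.
    bij_betw f (verts K) (verts L) \<and> (\<lambda>s. f ` s) ` faces K = faces L \<and>
    (\<forall>g\<in>carrier G. \<forall>x\<in>verts K. f (act K g x) = act L g (f x)) \<and>
    map (\<lambda>O'. f ` O') os = os')"

text \<open>
  A marked complex with at least one root orbit, finite \<open>G\<close> and bounded degree has countably many
  vertices. So every isomorphism class has representatives whose vertices are natural numbers, and
  the class \<open>[K, os]\<close> of a marked complex on any vertex type is encoded as the set of all these
  representatives.
\<close>

type_synonym 'g iso_class = "('g, nat) marked set"

definition mclass ::
    "nat \<Rightarrow> ('g, 'b) monoid_scheme \<Rightarrow> ('g, 'v) gcomplex \<Rightarrow> 'v set list \<Rightarrow> 'g iso_class"
  where "mclass D G K os = {M. marked_complex D G M \<and> marked_iso G (K, os) M}"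

definition SC :: "nat \<Rightarrow> nat \<Rightarrow> ('g, 'b) monoid_scheme \<Rightarrow> 'g iso_class set"
  where "SC k D G =
    {mclass D G K os | (K :: ('g, nat) gcomplex) os. length os = k \<and> marked_complex D G (K, os)}"

text \<open>Any representative \<open>(K, o)\<close> of a class in \<open>SC 1 D G\<close>.\<close>

definition rep :: "'g iso_class \<Rightarrow> ('g, nat) gcomplex \<times> nat set"
  where "rep c = (SOME (K, O'). (K, [O']) \<in> c)"

definition SC_dist :: "('g, 'b) monoid_scheme \<Rightarrow> 'g iso_class \<Rightarrow> 'g iso_class \<Rightarrow> ennreal"
  where "SC_dist G c c' = Inf {ennreal (2 powr (- r)) | r. r > 0 \<and>
    (\<exists>(K, os)\<in>c. \<exists>(L, os')\<in>c'.
       marked_iso G (cball_complex K (\<Union> (set os)) r, os) (cball_complex L (\<Union> (set os')) r, os'))}"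

definition SC_topology :: "nat \<Rightarrow> nat \<Rightarrow> ('g, 'b) monoid_scheme \<Rightarrow> 'g iso_class topology"
  where "SC_topology k D G = topology (\<lambda>U. U \<subseteq> SC k D G \<and>
    (\<forall>c\<in>U. \<exists>e>0. \<forall>c'\<in>SC k D G. SC_dist G c c' < e \<longrightarrow> c' \<in> U))"

lemma openin_SC_topology:
  "openin (SC_topology k D G) U \<longleftrightarrow> U \<subseteq> SC k D G \<and>
     (\<forall>c\<in>U. \<exists>e>0. \<forall>c'\<in>SC k D G. SC_dist G c c' < e \<longrightarrow> c' \<in> U)"
proof -
  define P where "P U \<longleftrightarrow> U \<subseteq> SC k D G \<and>
     (\<forall>c\<in>U. \<exists>e>0. \<forall>c'\<in>SC k D G. SC_dist G c c' < e \<longrightarrow> c' \<in> U)" for U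
  have inter: "P (S \<inter> T)" if S: "P S" and T: "P T" for S T
    unfolding P_def
  proof (intro conjI ballI)
    show "S \<inter> T \<subseteq> SC k D G" using S unfolding P_def by blast
    fix c assume c: "c \<in> S \<inter> T"
    obtain e1 where e1: "e1 > 0" "\<forall>c'\<in>SC k D G. SC_dist G c c' < e1 \<longrightarrow> c' \<in> S"
      using c S unfolding P_def by blast
    obtain e2 where e2: "e2 > 0" "\<forall>c'\<in>SC k D G. SC_dist G c c' < e2 \<longrightarrow> c' \<in> T"
      using c T unfolding P_def by blast
    show "\<exists>e>0. \<forall>c'\<in>SC k D G. SC_dist G c c' < e \<longrightarrow> c' \<in> S \<inter> T"
      using e1 e2 by (intro exI[of _ "min e1 e2"]) simp
  qed
  have union: "P (\<Union>\<K>)" if \<K>: "\<forall>S\<in>\<K>. P S" for \<K>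
    unfolding P_def
  proof (intro conjI ballI)
    show "\<Union>\<K> \<subseteq> SC k D G" using \<K> unfolding P_def by blast
    fix c assume "c \<in> \<Union>\<K>"
    then obtain S where S: "S \<in> \<K>" "c \<in> S" by blast
    with \<K> have "P S" by blast
    with S(2) obtain e where e: "e > 0" "\<forall>c'\<in>SC k D G. SC_dist G c c' < e \<longrightarrow> c' \<in> S"
      unfolding P_def by blast
    show "\<exists>e>0. \<forall>c'\<in>SC k D G. SC_dist G c c' < e \<longrightarrow> c' \<in> \<Union>\<K>"
      using e S(1) by (intro exI[of _ e] conjI ballI impI UnionI[of S]) simp_all
  qed
  have "istopology P"
    unfolding istopology_def
  proof (intro conjI allI impI)
    show "P (S \<inter> T)" if "P S" "P T" for S T using that by (rule inter)
    show "P (\<Union>\<K>)" if "\<forall>S\<in>\<K>. P S" for \<K> using that by (rule union)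
  qed
  then have "openin (topology P) = P" by (rule topology_inverse')
  moreover have "SC_topology k D G = topology P"
    unfolding SC_topology_def P_def ..
  ultimately show ?thesis by (simp only: P_def)
qed

lemma topspace_SC_topology: "topspace (SC_topology k D G) = SC k D G"
proof (rule antisym)
  show "topspace (SC_topology k D G) \<subseteq> SC k D G"
    unfolding topspace_def openin_SC_topology by blast
  have "openin (SC_topology k D G) (SC k D G)"
    unfolding openin_SC_topology by (intro conjI ballI exI[of _ 1]) simp_all
  then show "SC k D G \<subseteq> topspace (SC_topology k D G)" by (rule openin_subset)
qed

definition SC_borel :: "nat \<Rightarrow> nat \<Rightarrow> ('g, 'b) monoid_scheme \<Rightarrow> 'g iso_class measure"
  where "SC_borel k D G = sigma (SC k D G) {U. openin (SC_topology k D G) U}"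


section \<open>Random rooted complexes and soficity\<close>

definition unimodular :: "nat \<Rightarrow> ('g, 'b) monoid_scheme \<Rightarrow> 'g iso_class measure \<Rightarrow> bool"
  where "unimodular D G \<mu> \<longleftrightarrow>
    (\<forall>f :: 'g iso_class \<Rightarrow> real.
       f \<in> borel_measurable (SC_borel 2 D G) \<and> (\<forall>c\<in>SC 2 D G. 0 \<le> f c) \<longrightarrow>
       (\<integral>\<^sup>+c. (case rep c of (K, O') \<Rightarrow>
           \<integral>\<^sup>+x. ennreal (f (mclass D G K [O', orbit G (act K) x])) \<partial>count_space (verts K)) \<partial>\<mu>) =
       (\<integral>\<^sup>+c. (case rep c of (K, O') \<Rightarrow>
           \<integral>\<^sup>+x. ennreal (f (mclass D G K [orbit G (act K) x, O'])) \<partial>count_space (verts K)) \<partial>\<mu>))"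

definition random_rooted_complex ::
    "nat \<Rightarrow> ('g, 'b) monoid_scheme \<Rightarrow> 'g iso_class measure \<Rightarrow> bool"
  where "random_rooted_complex D G \<mu> \<longleftrightarrow>
    prob_space \<mu> \<and> space \<mu> = SC 1 D G \<and> sets \<mu> = sets (SC_borel 1 D G) \<and> unimodular D G \<mu>"

text \<open>The measure \<open>\<mu>\<^sub>K\<^sup>G\<close>, an average of Dirac measures.\<close>

definition empirical_measure ::
    "nat \<Rightarrow> ('g, 'b) monoid_scheme \<Rightarrow> ('g, 'v) gcomplex \<Rightarrow> 'g iso_class measure"
  where "empirical_measure D G K =
    measure_of (SC 1 D G) (sets (SC_borel 1 D G)) (\<lambda>A.
      (\<Sum>x\<in>verts K. emeasure (return (SC_borel 1 D G)
          (let O' = orbit G (act K) x in mclass D G (components_meeting K O') [O'])) A)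
        / of_nat (card (verts K)))"

definition weak_limit ::
    "'a topology \<Rightarrow> (nat \<Rightarrow> 'a measure) \<Rightarrow> 'a measure \<Rightarrow> bool"
  where "weak_limit X M N \<longleftrightarrow>
    (\<forall>f :: 'a \<Rightarrow> real. continuous_map X euclideanreal f \<and> bounded (f ` topspace X) \<longrightarrow>
       (\<lambda>j. \<integral>x. f x \<partial>M j) \<longlonglongrightarrow> (\<integral>x. f x \<partial>N))"

definition sofic :: "nat \<Rightarrow> ('g, 'b) monoid_scheme \<Rightarrow> 'g iso_class measure \<Rightarrow> bool"
  where "sofic D G \<mu> \<longleftrightarrow>
    random_rooted_complex D G \<mu> \<and>
    (\<exists>K :: nat \<Rightarrow> ('g, nat) gcomplex.
       (\<forall>j. G_complex G (K j) \<and> finite (verts (K j)) \<and> degree_le D (K j)) \<and>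
       weak_limit (SC_topology 1 D G) (\<lambda>j. empirical_measure D G (K j)) \<mu>)"


section \<open>Induction\<close>

text \<open>The class of \<open>(g, y)\<close> under \<open>(g, y) \<sim> (gh, h\<^sup>-\<^sup>1y)\<close>; \<open>a\<close> is the action of \<open>H\<close>.\<close>

definition ind_point ::
    "('g, 'b) monoid_scheme \<Rightarrow> 'g set \<Rightarrow> ('g \<Rightarrow> 'v \<Rightarrow> 'v) \<Rightarrow> 'g \<Rightarrow> 'v \<Rightarrow> ('g \<times> 'v) set"
  where "ind_point G H a g y = {(g \<otimes>\<^bsub>G\<^esub> h, a (inv\<^bsub>G\<^esub> h) y) | h. h \<in> H}"

definition ind_complex ::
    "('g, 'b) monoid_scheme \<Rightarrow> 'g set \<Rightarrow> ('g, 'v) gcomplex \<Rightarrow> ('g, ('g \<times> 'v) set) gcomplex"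
  where "ind_complex G H K =
    \<lparr>faces = {ind_point G H (act K) g ` s | g s. g \<in> carrier G \<and> s \<in> faces K},
     act = (\<lambda>g. restrict ((`) (\<lambda>(g', y). (g \<otimes>\<^bsub>G\<^esub> g', y)))
        {ind_point G H (act K) g' x | g' x. g' \<in> carrier G \<and> x \<in> verts K})\<rparr>"

lemma ind_complex_act:
  assumes "group G" "H \<subseteq> carrier G" "g \<in> carrier G" "g' \<in> carrier G" "x \<in> verts K"
  shows "act (ind_complex G H K) g (ind_point G H (act K) g' x) =
    ind_point G H (act K) (g \<otimes>\<^bsub>G\<^esub> g') x"
proof -
  interpret group G by fact
  have *: "(\<lambda>(k, y). (g \<otimes>\<^bsub>G\<^esub> k, y)) ` ind_point G H (act K) g' x = ind_point G H (act K) (g \<otimes>\<^bsub>G\<^esub> g') x"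
    (is "?f ` _ = _")
  proof -
    have "?f ` ind_point G H (act K) g' x = (\<lambda>h. (g \<otimes>\<^bsub>G\<^esub> (g' \<otimes>\<^bsub>G\<^esub> h), act K (inv\<^bsub>G\<^esub> h) x)) ` H"
      unfolding ind_point_def Setcompr_eq_image image_image by simp
    also have "\<dots> = (\<lambda>h. (g \<otimes>\<^bsub>G\<^esub> g' \<otimes>\<^bsub>G\<^esub> h, act K (inv\<^bsub>G\<^esub> h) x)) ` H"
      using assms by (intro image_cong refl) (simp add: m_assoc subset_iff)
    finally show ?thesis unfolding ind_point_def Setcompr_eq_image .
  qed
  have "ind_point G H (act K) g' x \<in>
      {ind_point G H (act K) g' x | g' x. g' \<in> carrier G \<and> x \<in> verts K}"
    using assms(4,5) by blast
  then show ?thesis unfolding ind_complex_def by (simp only: gcomplex.simps restrict_apply if_True *)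
qed

definition ind_map ::
    "nat \<Rightarrow> ('g, 'b) monoid_scheme \<Rightarrow> 'g set \<Rightarrow> 'g iso_class \<Rightarrow> 'g iso_class"
  where "ind_map D G H c = (case rep c of (K, O') \<Rightarrow>
    mclass D G (ind_complex G H K) [{ind_point G H (act K) g x | g x. g \<in> carrier G \<and> x \<in> O'}])"

definition ind_measure ::
    "nat \<Rightarrow> ('g, 'b) monoid_scheme \<Rightarrow> 'g set \<Rightarrow> 'g iso_class measure \<Rightarrow> 'g iso_class measure"
  where "ind_measure D G H \<mu> = distr \<mu> (SC_borel 1 D G) (ind_map D G H)"


section \<open>Realisation inside the complex on \<open>\<nat>\<^sub>G\<close>\<close>

type_synonym 'g gset = "nat set \<times> ('g \<Rightarrow> nat \<Rightarrow> nat)"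

definition transitive_gset :: "('g, 'b) monoid_scheme \<Rightarrow> 'g gset \<Rightarrow> bool"
  where "transitive_gset G = (\<lambda>(X, a). transitive_action G X a \<and> X \<noteq> {})"

definition gset_iso ::
    "('g, 'b) monoid_scheme \<Rightarrow> 'v set \<times> ('g \<Rightarrow> 'v \<Rightarrow> 'v) \<Rightarrow> 'w set \<times> ('g \<Rightarrow> 'w \<Rightarrow> 'w) \<Rightarrow> bool"
  where "gset_iso G = (\<lambda>(X, a) (Y, b). \<exists>f.
    bij_betw f X Y \<and> (\<forall>g\<in>carrier G. \<forall>x\<in>X. f (a g x) = b g (f x)))"

text \<open>
  \<open>R\<close> is a system of representatives of the isomorphism classes of transitive \<open>G\<close>-sets. These are
  finite for finite \<open>G\<close>, so carriers consisting of natural numbers suffice.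
\<close>

definition orbit_reps :: "('g, 'b) monoid_scheme \<Rightarrow> 'g gset set \<Rightarrow> bool"
  where "orbit_reps G R \<longleftrightarrow>
    (\<forall>X\<in>R. transitive_gset G X) \<and>
    (\<forall>Y :: 'g gset. transitive_gset G Y \<longrightarrow> (\<exists>!X. X \<in> R \<and> gset_iso G X Y))"

text \<open>The element \<open>(k, X, x)\<close> is \<open>(k, x)\<close> in the summand \<open>\<nat>\<^sub>0 \<times> X\<close> of \<open>\<nat>\<^sub>G\<close>.\<close>

type_synonym 'g nvert = "nat \<times> 'g gset \<times> nat"

definition NG :: "'g gset set \<Rightarrow> 'g nvert set"
  where "NG R = {(k, X, x). X \<in> R \<and> x \<in> fst X}"

definition NG_act :: "'g \<Rightarrow> 'g nvert \<Rightarrow> 'g nvert"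
  where "NG_act g = (\<lambda>(k, X, x). (k, X, snd X g x))"

definition Delta :: "nat \<Rightarrow> 'g gset set \<Rightarrow> 'g nvert set set"
  where "Delta D R = {s. s \<subseteq> NG R \<and> s \<noteq> {} \<and> finite s \<and> card s \<le> D + 1}"

definition base_orbit :: "'g gset \<Rightarrow> 'g nvert set"
  where "base_orbit X = {(0, X, x) | x. x \<in> fst X}"

definition Sub_Delta ::
    "nat \<Rightarrow> ('g, 'b) monoid_scheme \<Rightarrow> 'g gset set \<Rightarrow> 'g nvert set set set"
  where "Sub_Delta D G R = {L. L \<subseteq> Delta D R \<and> simplicial_complex L \<and>
    (\<forall>g\<in>carrier G. \<forall>s\<in>L. NG_act g ` s \<in> L) \<and>
    (\<exists>!X. X \<in> R \<and> base_orbit X \<subseteq> \<Union> L)}"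

definition indicator_on :: "'s set \<Rightarrow> 's set \<Rightarrow> 's \<Rightarrow> bool"
  where "indicator_on S L = restrict (\<lambda>s. s \<in> L) S"

definition Sub_topology ::
    "nat \<Rightarrow> ('g, 'b) monoid_scheme \<Rightarrow> 'g gset set \<Rightarrow> ('g nvert set \<Rightarrow> bool) topology"
  where "Sub_topology D G R = subtopology
    (product_topology (\<lambda>_. discrete_topology UNIV) (Delta D R))
    (indicator_on (Delta D R) ` Sub_Delta D G R)"

definition NG_complex :: "'g nvert set set \<Rightarrow> ('g, 'g nvert) gcomplex"
  where "NG_complex L = \<lparr>faces = L, act = (\<lambda>g. restrict (NG_act g) (\<Union> L))\<rparr>"

definition realisation ::
    "nat \<Rightarrow> ('g, 'b) monoid_scheme \<Rightarrow> 'g gset set \<Rightarrow> ('g iso_class \<Rightarrow> 'g nvert set set) \<Rightarrow> bool"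
  where "realisation D G R \<Psi> \<longleftrightarrow>
    (\<forall>c\<in>SC 1 D G. \<Psi> c \<in> Sub_Delta D G R) \<and>
    continuous_map (SC_topology 1 D G) (Sub_topology D G R) (\<lambda>c. indicator_on (Delta D R) (\<Psi> c)) \<and>
    (\<forall>c\<in>SC 1 D G. \<forall>K O'. (K, [O']) \<in> c \<longrightarrow>
       (\<exists>X\<in>R. gset_iso G X (O', act K) \<and> base_orbit X \<subseteq> \<Union> (\<Psi> c) \<and>
          marked_iso G (NG_complex (\<Psi> c), [base_orbit X]) (K, [O'])))"


section \<open>Square-summable oriented chains\<close>

text \<open>
  An ordered \<open>n\<close>-simplex is a list of its \<open>n + 1\<close> vertices. An oriented \<open>n\<close>-chain is an alternating
  function on ordered \<open>n\<close>-simplices (zero on all other lists). Every \<open>n\<close>-simplex has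
  \<open>(n + 1)!\<close> orderings, whence the normalisation of the inner product, for which an oriented
  simplex has norm 1.
\<close>

definition ordered_simplices :: "nat \<Rightarrow> 'v set set \<Rightarrow> 'v list set"
  where "ordered_simplices n L = {t. length t = n + 1 \<and> distinct t \<and> set t \<in> L}"

definition chain_inner :: "nat \<Rightarrow> ('v list \<Rightarrow> complex) \<Rightarrow> ('v list \<Rightarrow> complex) \<Rightarrow> complex"
  where "chain_inner n c d = (\<Sum>\<^sub>\<infinity>t. c t * cnj (d t)) / fact (n + 1)"

definition l2_chains :: "nat \<Rightarrow> 'v set set \<Rightarrow> ('v list \<Rightarrow> complex) set"
  where "l2_chains n L = {c.
    (\<forall>t. t \<notin> ordered_simplices n L \<longrightarrow> c t = 0) \<and>
    (\<forall>t\<in>ordered_simplices n L. \<forall>p. p permutes {..n} \<longrightarrow>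
       c (permute_list p t) = of_int (sign p) * c t) \<and>
    (\<lambda>t. (norm (c t))\<^sup>2) summable_on UNIV}"

text \<open>The oriented simplex \<open>[v\<^sub>0, \<dots>, v\<^sub>n]\<close> as a chain.\<close>

definition oriented :: "'v list \<Rightarrow> 'v list \<Rightarrow> complex"
  where "oriented t = (\<lambda>u. if distinct t
    then (\<Sum>p | p permutes {..<length t} \<and> permute_list p t = u. of_int (sign p)) else 0)"

text \<open>
  The linear extension of
  \<open>[v\<^sub>0, \<dots>, v\<^sub>n] \<mapsto> \<Sum>i\<le>n. (-1)^i [v\<^sub>0, \<dots>, v\<^sub>i\<^sub>-\<^sub>1, v\<^sub>i\<^sub>+\<^sub>1, \<dots>, v\<^sub>n]\<close>, using that a chain \<open>c\<close> is
  \<open>(\<Sum>t. c t \<cdot> [t]) / (n + 1)!\<close>. For \<open>n = 0\<close> the boundary is zero; formally it then takes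
  values in degree \<open>0 - 1 = 0\<close> instead of the zero space in degree \<open>-1\<close>, with no effect on the
  Laplacian. Only finitely many terms are nonzero if \<open>L\<close> has bounded vertex degree.
\<close>

definition boundary :: "nat \<Rightarrow> 'v set set \<Rightarrow> ('v list \<Rightarrow> complex) \<Rightarrow> 'v list \<Rightarrow> complex"
  where "boundary n L c = (\<lambda>u. if n = 0 then 0 else
    (\<Sum>\<^sub>\<infinity>t\<in>ordered_simplices n L.
       c t * (\<Sum>i\<le>n. (-1) ^ i * oriented (take i t @ drop (Suc i) t) u)) / fact (n + 1))"

definition hilbert_adjoint ::
    "'a set \<Rightarrow> ('a \<Rightarrow> 'a \<Rightarrow> complex) \<Rightarrow> ('b \<Rightarrow> 'b \<Rightarrow> complex) \<Rightarrow> ('a \<Rightarrow> 'b) \<Rightarrow> 'b \<Rightarrow> 'a"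
  where "hilbert_adjoint V ipV ipW T w = (THE v. v \<in> V \<and> (\<forall>u\<in>V. ipW (T u) w = ipV u v))"

definition coboundary :: "nat \<Rightarrow> 'v set set \<Rightarrow> ('v list \<Rightarrow> complex) \<Rightarrow> 'v list \<Rightarrow> complex"
  where "coboundary n L =
    hilbert_adjoint (l2_chains n L) (chain_inner n) (chain_inner (n - 1)) (boundary n L)"

definition laplacian :: "nat \<Rightarrow> 'v set set \<Rightarrow> ('v list \<Rightarrow> complex) \<Rightarrow> 'v list \<Rightarrow> complex"
  where "laplacian n L c = (\<lambda>t.
    boundary (n + 1) L (coboundary (n + 1) L c) t + coboundary n L (boundary n L c) t)"

definition chain_act ::
    "('g, 'b) monoid_scheme \<Rightarrow> ('g, 'v) gcomplex \<Rightarrow> 'g \<Rightarrow> ('v list \<Rightarrow> complex) \<Rightarrow> 'v list \<Rightarrow> complex"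
  where "chain_act G K g c = (\<lambda>t.
    if set t \<in> faces K then c (map (act K (inv\<^bsub>G\<^esub> g)) t) else 0)"


section \<open>The direct integral\<close>

text \<open>
  Elements of the direct integral are represented by square-integrable measurable fields; the
  passage to classes modulo equality almost everywhere is left implicit, as all the notions
  below only depend on fields up to almost everywhere equality.
\<close>

type_synonym 'g field = "'g iso_class \<Rightarrow> 'g nvert list \<Rightarrow> complex"

definition xi :: "('g iso_class \<Rightarrow> 'g nvert set set) \<Rightarrow> 'g nvert list \<Rightarrow> 'g field"
  where "xi \<Psi> s c = (if set s \<in> \<Psi> c then oriented s else (\<lambda>_. 0))"

definition direct_integral ::
    "nat \<Rightarrow> 'g gset set \<Rightarrow> ('g iso_class \<Rightarrow> 'g nvert set set) \<Rightarrow> 'g iso_class measure \<Rightarrow> nat \<Rightarrow> 'g field set"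
  where "direct_integral D R \<Psi> \<mu> n = {\<sigma>.
    (\<forall>c\<in>space \<mu>. \<sigma> c \<in> l2_chains n (\<Psi> c)) \<and>
    (\<forall>s\<in>ordered_simplices n (Delta D R).
       (\<lambda>c. chain_inner n (\<sigma> c) (xi \<Psi> s c)) \<in> borel_measurable \<mu>) \<and>
    (\<integral>\<^sup>+c. ennreal (Re (chain_inner n (\<sigma> c) (\<sigma> c))) \<partial>\<mu>) < \<infinity>}"

definition field_inner :: "'g iso_class measure \<Rightarrow> nat \<Rightarrow> 'g field \<Rightarrow> 'g field \<Rightarrow> complex"
  where "field_inner \<mu> n \<sigma> \<tau> = (\<integral>c. chain_inner n (\<sigma> c) (\<tau> c) \<partial>\<mu>)"

definition l2_harmonic ::
    "nat \<Rightarrow> 'g gset set \<Rightarrow> ('g iso_class \<Rightarrow> 'g nvert set set) \<Rightarrow> 'g iso_class measure \<Rightarrow> nat \<Rightarrow> 'g field set"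
  where "l2_harmonic D R \<Psi> \<mu> n = {\<sigma> \<in> direct_integral D R \<Psi> \<mu> n.
    AE c in \<mu>. laplacian n (\<Psi> c) (\<sigma> c) = (\<lambda>_. 0)}"

definition orthogonal_projection ::
    "'a::minus set \<Rightarrow> ('a \<Rightarrow> 'a \<Rightarrow> complex) \<Rightarrow> 'a \<Rightarrow> 'a"
  where "orthogonal_projection W ip v = (SOME w. w \<in> W \<and> (\<forall>u\<in>W. ip (v - w) u = 0))"

text \<open>
  The trace, with an arbitrary orientation chosen for each simplex \<open>s\<close>; the formula is used for
  every operator on fields, not only for those in the von Neumann algebra on which it is a trace.
\<close>

definition vN_trace ::
    "nat \<Rightarrow> 'g gset set \<Rightarrow> ('g iso_class \<Rightarrow> 'g nvert set set) \<Rightarrow> 'g iso_class measure \<Rightarrow> nat \<Rightarrow>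
      ('g field \<Rightarrow> 'g field) \<Rightarrow> complex"
  where "vN_trace D R \<Psi> \<mu> n T =
    (\<Sum>X\<in>R. \<Sum>x\<in>fst X. \<Sum>\<^sub>\<infinity>s\<in>{s \<in> Delta D R. card s = n + 1 \<and> (0, X, x) \<in> s}.
       let \<xi> = xi \<Psi> (SOME t. distinct t \<and> set t = s)
       in field_inner \<mu> n (T \<xi>) \<xi> / (of_nat (card (fst X)) * of_nat (n + 1)))"

definition vN_dim ::
    "nat \<Rightarrow> 'g gset set \<Rightarrow> ('g iso_class \<Rightarrow> 'g nvert set set) \<Rightarrow> 'g iso_class measure \<Rightarrow> nat \<Rightarrow>
      'g field set \<Rightarrow> complex"
  where "vN_dim D R \<Psi> \<mu> n W = vN_trace D R \<Psi> \<mu> n (orthogonal_projection W (field_inner \<mu> n))"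


section \<open>Representations and multiplicities\<close>

text \<open>Finite-dimensional complex representations are matrix representations, up to equivalence.\<close>

definition rep_dim :: "('g, 'b) monoid_scheme \<Rightarrow> ('g \<Rightarrow> complex mat) \<Rightarrow> nat"
  where "rep_dim G \<rho> = dim_row (\<rho> \<one>\<^bsub>G\<^esub>)"

definition is_rep :: "('g, 'b) monoid_scheme \<Rightarrow> ('g \<Rightarrow> complex mat) \<Rightarrow> bool"
  where "is_rep G \<rho> \<longleftrightarrow>
    (\<forall>g\<in>carrier G. \<rho> g \<in> carrier_mat (rep_dim G \<rho>) (rep_dim G \<rho>)) \<and>
    \<rho> \<one>\<^bsub>G\<^esub> = 1\<^sub>m (rep_dim G \<rho>) \<and>
    (\<forall>g\<in>carrier G. \<forall>h\<in>carrier G. \<rho> (g \<otimes>\<^bsub>G\<^esub> h) = \<rho> g * \<rho> h)"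

definition rep_equiv ::
    "('g, 'b) monoid_scheme \<Rightarrow> ('g \<Rightarrow> complex mat) \<Rightarrow> ('g \<Rightarrow> complex mat) \<Rightarrow> bool"
  where "rep_equiv G \<rho> \<sigma> \<longleftrightarrow> rep_dim G \<rho> = rep_dim G \<sigma> \<and>
    (\<exists>P\<in>carrier_mat (rep_dim G \<rho>) (rep_dim G \<rho>). invertible_mat P \<and>
       (\<forall>g\<in>carrier G. P * \<rho> g = \<sigma> g * P))"

definition irreducible_rep :: "('g, 'b) monoid_scheme \<Rightarrow> ('g \<Rightarrow> complex mat) \<Rightarrow> bool"
  where "irreducible_rep G \<rho> \<longleftrightarrow> is_rep G \<rho> \<and> rep_dim G \<rho> > 0 \<and>
    (\<forall>W. VectorSpace.subspace class_ring W (module_vec TYPE(complex) (rep_dim G \<rho>)) \<and>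
       (\<forall>g\<in>carrier G. \<forall>w\<in>W. \<rho> g *\<^sub>v w \<in> W) \<longrightarrow>
       W = {0\<^sub>v (rep_dim G \<rho>)} \<or> W = carrier_vec (rep_dim G \<rho>))"

definition Irr :: "('g, 'b) monoid_scheme \<Rightarrow> ('g \<Rightarrow> complex mat) set set"
  where "Irr G = {{\<sigma>. is_rep G \<sigma> \<and> rep_equiv G \<rho> \<sigma>} | \<rho>. irreducible_rep G \<rho>}"

text \<open>
  The number of summands equivalent to \<open>\<theta>\<close> in a decomposition of \<open>\<sigma>\<close> into irreducible ones.
\<close>

definition multiplicity_in ::
    "('g, 'b) monoid_scheme \<Rightarrow> ('g \<Rightarrow> complex mat) \<Rightarrow> ('g \<Rightarrow> complex mat) \<Rightarrow> nat"
  where "multiplicity_in G \<theta> \<sigma> = (THE m. \<exists>\<tau>s.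
    (\<forall>\<tau>\<in>set \<tau>s. irreducible_rep G \<tau>) \<and>
    rep_equiv G \<sigma> (\<lambda>g. diag_block_mat (map (\<lambda>\<tau>. \<tau> g) \<tau>s)) \<and>
    m = length (filter (rep_equiv G \<theta>) \<tau>s))"

definition character :: "('g \<Rightarrow> complex mat) \<Rightarrow> 'g \<Rightarrow> complex"
  where "character \<rho> g = (\<Sum>i<dim_row (\<rho> g). \<rho> g $$ (i, i))"

definition isotypic_projector ::
    "('g, 'b) monoid_scheme \<Rightarrow> ('g iso_class \<Rightarrow> 'g nvert set set) \<Rightarrow> ('g \<Rightarrow> complex mat) \<Rightarrow>
      'g field \<Rightarrow> 'g field"
  where "isotypic_projector G \<Psi> \<rho> \<sigma> = (\<lambda>c t.
    character \<rho> \<one>\<^bsub>G\<^esub> / of_nat (card (carrier G)) *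
    (\<Sum>g\<in>carrier G. cnj (character \<rho> g) * chain_act G (NG_complex (\<Psi> c)) g (\<sigma> c) t))"

definition l2_multiplicity ::
    "nat \<Rightarrow> ('g, 'b) monoid_scheme \<Rightarrow> 'g gset set \<Rightarrow> ('g iso_class \<Rightarrow> 'g nvert set set) \<Rightarrow> nat \<Rightarrow>
      ('g \<Rightarrow> complex mat) \<Rightarrow> 'g iso_class measure \<Rightarrow> complex"
  where "l2_multiplicity D G R \<Psi> n \<rho> \<mu> =
    vN_dim D R \<Psi> \<mu> n (isotypic_projector G \<Psi> \<rho> ` l2_harmonic D R \<Psi> \<mu> n) /
    character \<rho> \<one>\<^bsub>G\<^esub>"

end

theory Submission
  imports Defs "Jordan_Normal_Form.Spectral_Radius"
begin

text \<open>
  The \<open>\<ell>\<^sup>2\<close>-multiplicity of \<open>\<rho>\<close> is the integral of a function of the rooted complex \<open>[K, o]\<close> alone,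
  a sum over the simplices containing a root of the averages over \<open>g\<close> of \<open>\<chi>(g)\<close> against matrix
  coefficients of the projection onto the harmonic chains of \<open>K\<close>. In \<open>G \<times>\<^sub>H K\<close> this projection is block
  diagonal with blocks indexed by \<open>G/H\<close>, so near \<open>\<lfloor>1, x\<rfloor>\<close> only the elements of \<open>H\<close> contribute:
  the function for \<open>\<rho>\<close> pulls back to \<open>|H|/|G|\<close> times the function for the character of \<open>\<rho>\<close> on \<open>H\<close>,
  which is \<open>\<Sum> m(\<theta>, \<rho>) \<chi>(\<theta>)\<close>. Soficity is inherited because induction is continuous and commutes
  with forming the empirical measures.
\<close>

section \<open>Characters of finite groups\<close>

text \<open>The obstacle is that harmonic projections must be computed fibre by fibre and depend
  measurably on the fibre, whereas \<open>orthogonal_projection\<close> is a choice among fields. So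
  the projection onto the kernel of the Laplacian is built as a pointwise limit of powers of 1 -
  \<Delta>/C. The constant C depends only on the degree bound and the dimension, and every value of
  a power is a finite sum. Hence the limit is measurable in the complex and natural for inclusions
  of unions of components, and its coefficients do not depend on \<Psi>. A coefficient against \<xi>
  then does not see the choice made in \<open>orthogonal_projection\<close>. Characters enter twice:
  they make the isotypic average a self-adjoint idempotent that preserves harmonic chains, and they
  expand \<rho> on H. The expansion needs complete reducibility, as \<rho> restricted to H is in
  general reducible. That the induced measure is unimodular is a separate matter. The mass transport
  identity is pulled back to H, and for this the sums over all vertices of a function of doubly
  rooted classes must be shown to be measurable.\<close>

locale fin_group = group G for G (structure) +
 assumes fin [simp]: "finite (carrier G)"

lemma index_mult_mat_sum:
 assumes "A\<in>carrier_mat n m" "B\<in>carrier_mat m l" "i < n" "j < l"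
 shows "(A * B) $$ (i, j)=(\<Sum>k<m. A $$ (i, k) * B $$ (k, j))"
 using assms by (auto simp: scalar_prod_def lessThan_atLeast0 intro!: sum.cong)

section \<open>Traces and equivalence of matrix representations\<close>

definition tr :: "complex mat => complex"
 where "tr A=(\<Sum>i<dim_row A. A $$ (i, i))"

lemma character_eq_tr: "character \<rho> g=tr (\<rho> g)"
 by (simp add: character_def tr_def)

lemma tr_comm:
 assumes A: "A\<in>carrier_mat n m" and B: "B\<in>carrier_mat m n"
 shows "tr (A * B)=tr (B * A)"
proof -
 have "tr (A * B)=(\<Sum>i<n. \<Sum>k<m. A $$ (i, k) * B $$ (k, i))"
  unfolding tr_def using A B by (auto simp: index_mult_mat_sum[OF A B] simp del: index_mult_mat(1) intro!: sum.cong)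
 also have "...=(\<Sum>k<m. \<Sum>i<n. B $$ (k, i) * A $$ (i, k))"
  by (subst sum.swap) (simp add: mult.commute)
 also have "...=tr (B * A)"
  unfolding tr_def using A B by (auto simp: index_mult_mat_sum[OF B A] simp del: index_mult_mat(1) intro!: sum.cong)
 finally show ?thesis .
qed

lemma tr_one: "tr (1\<^sub>m n) = of_nat n"
 by (simp add: tr_def)

lemma invertible_matE:
 assumes "invertible_mat P" "P\<in>carrier_mat n n"
 obtains Q where "Q\<in>carrier_mat n n" "P * Q=1\<^sub>m n" "Q * P=1\<^sub>m n"
proof -
 obtain Q where Q: "P * Q=1\<^sub>m (dim_row P)" "Q * P=1\<^sub>m (dim_row Q)"
  using assms(1) unfolding invertible_mat_def inverts_mat_def by blast
 have "dim_col Q=n" "dim_row Q=n"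
  using arg_cong[OF Q(1), of dim_col] arg_cong[OF Q(2), of dim_col] assms(2) by auto
 with Q assms(2) show thesis by (intro that[of Q]) auto
qed

lemma invertible_matI:
 assumes "P\<in>carrier_mat n n" "Q\<in>carrier_mat n n" "P * Q=1\<^sub>m n" "Q * P=1\<^sub>m n"
 shows "invertible_mat P"
 using assms unfolding invertible_mat_def inverts_mat_def by auto

lemma is_rep_closed: "is_rep G \<rho> ==> g\<in>carrier G ==> \<rho> g\<in>carrier_mat (rep_dim G \<rho>) (rep_dim G \<rho>)"
 by (simp add: is_rep_def)

lemma is_rep_mult: "is_rep G \<rho> ==> g\<in>carrier G ==> h\<in>carrier G ==> \<rho> (g \<otimes>\<^bsub>G\<^esub> h)=\<rho> g*\<rho> h"
 by (simp add: is_rep_def)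

lemma is_rep_one: "is_rep G \<rho> ==> \<rho> \<one>\<^bsub>G\<^esub>=1\<^sub>m (rep_dim G \<rho>)"
 by (simp add: is_rep_def)

lemma character_one: "is_rep G \<rho> ==> character \<rho> \<one>\<^bsub>G\<^esub> = of_nat (rep_dim G \<rho>)"
 by (simp add: character_eq_tr is_rep_one tr_one)

lemma rep_equiv_sym:
 assumes "is_rep G \<rho>" "is_rep G \<sigma>" "rep_equiv G \<rho> \<sigma>"
 shows "rep_equiv G \<sigma> \<rho>"
proof -
 define n where "n = rep_dim G \<rho>"
 have n': "rep_dim G \<sigma>=n" using assms(3) by (simp add: rep_equiv_def n_def)
 obtain P where P: "P\<in>carrier_mat n n" "invertible_mat P"
   and eq: "!!g. g\<in>carrier G ==> P*\<rho> g=\<sigma> g * P"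
  using assms(3) unfolding rep_equiv_def n_def by auto
 obtain Q where Q: "Q\<in>carrier_mat n n" "P * Q=1\<^sub>m n" "Q * P=1\<^sub>m n"
  using invertible_matE[OF P(2,1)] .
 have "Q*\<sigma> g=\<rho> g * Q" if g: "g\<in>carrier G" for g
 proof -
  have r: "\<rho> g\<in>carrier_mat n n" "\<sigma> g\<in>carrier_mat n n"
   using is_rep_closed[OF assms(1) g] is_rep_closed[OF assms(2) g] by (simp_all add: n_def n'[unfolded n_def])
  have "Q*\<sigma> g=Q*\<sigma> g*(P * Q)" using Q r by simp
  also have "...=Q*(\<sigma> g * P) * Q" using Q r P by (simp add: assoc_mult_mat[of _ n n _ n _ n])
  also have "...=Q*(P*\<rho> g) * Q" by (simp add: eq[OF g])
  also have "...=(Q * P)*\<rho> g * Q" using Q(1) r P by (simp add: assoc_mult_mat[of _ n n _ n _ n])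
  also have "...=\<rho> g * Q" unfolding Q(3) using r by simp
  finally show ?thesis .
 qed
 thus ?thesis unfolding rep_equiv_def n' n_def[symmetric]
  using Q P(1) by (auto intro!: bexI[of _ Q] intro: invertible_matI)
qed

lemma rep_equiv_trans:
 assumes "is_rep G \<rho>" "is_rep G \<sigma>" "is_rep G \<tau>" "rep_equiv G \<rho> \<sigma>" "rep_equiv G \<sigma> \<tau>"
 shows "rep_equiv G \<rho> \<tau>"
proof -
 define n where "n = rep_dim G \<rho>"
 have n': "rep_dim G \<sigma>=n" "rep_dim G \<tau>=n" using assms(4,5) by (simp_all add: rep_equiv_def n_def)
 obtain P where P: "P\<in>carrier_mat n n" "invertible_mat P"
   and eq: "!!g. g\<in>carrier G ==> P*\<rho> g=\<sigma> g * P"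
  using assms(4) unfolding rep_equiv_def n_def by auto
 obtain P' where P': "P'\<in>carrier_mat n n" "invertible_mat P'"
   and eq': "!!g. g\<in>carrier G ==> P'*\<sigma> g=\<tau> g * P'"
  using assms(5) unfolding rep_equiv_def n' by auto
 obtain Q where Q: "Q\<in>carrier_mat n n" "P * Q=1\<^sub>m n" "Q * P=1\<^sub>m n"
  using invertible_matE[OF P(2,1)] .
 obtain Q' where Q': "Q'\<in>carrier_mat n n" "P' * Q'=1\<^sub>m n" "Q' * P'=1\<^sub>m n"
  using invertible_matE[OF P'(2,1)] .
 have "P' * P*\<rho> g=\<tau> g*(P' * P)" if g: "g\<in>carrier G" for g
 proof -
  have r: "\<rho> g\<in>carrier_mat n n" "\<sigma> g\<in>carrier_mat n n" "\<tau> g\<in>carrier_mat n n"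
   using is_rep_closed[OF assms(1) g] is_rep_closed[OF assms(2) g] is_rep_closed[OF assms(3) g]
   by (simp_all add: n_def n'[unfolded n_def])
  have "P' * P*\<rho> g=P'*(\<sigma> g * P)" using r P P' by (simp add: assoc_mult_mat[of _ n n _ n _ n] eq[OF g])
  also have "...=P'*\<sigma> g * P" using r P P' by (simp add: assoc_mult_mat[of _ n n _ n _ n])
  also have "...=\<tau> g*(P' * P)" using r P P' by (simp add: assoc_mult_mat[of _ n n _ n _ n] eq'[OF g])
  finally show ?thesis .
 qed
 moreover have "invertible_mat (P' * P)"
 proof (rule invertible_matI[of _ n "Q * Q'"])
  have "P' * P*(Q * Q')=P'*(P * Q) * Q'" "Q * Q'*(P' * P)=Q*(Q' * P') * P"
   using P P' Q(1) Q'(1) by (simp_all add: assoc_mult_mat[of _ n n _ n _ n])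
  thus "P' * P*(Q * Q')=1\<^sub>m n" "Q * Q'*(P' * P)=1\<^sub>m n"
   using P P' Q Q' by simp_all
 qed (use P P' Q Q' in auto)
 moreover have "P' * P\<in>carrier_mat n n" using P P' by simp
 ultimately show ?thesis unfolding rep_equiv_def n' n_def[symmetric] by blast
qed

lemma rep_equiv_refl:
 assumes "is_rep G \<rho>" shows "rep_equiv G \<rho> \<rho>"
proof -
 have "1\<^sub>m (rep_dim G \<rho>)*\<rho> g=\<rho> g*1\<^sub>m (rep_dim G \<rho>)" if "g\<in>carrier G" for g
  using is_rep_closed[OF assms that] by simp
 moreover have "invertible_mat (1\<^sub>m (rep_dim G \<rho>))"
  by (rule invertible_matI[of _ "rep_dim G \<rho>" "1\<^sub>m (rep_dim G \<rho>)"]) auto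
 ultimately show ?thesis unfolding rep_equiv_def by auto
qed

lemma rep_equiv_character:
 assumes "is_rep G \<rho>" "is_rep G \<sigma>" "rep_equiv G \<rho> \<sigma>" "g\<in>carrier G"
 shows "character \<rho> g=character \<sigma> g"
proof -
 define n where "n = rep_dim G \<rho>"
 have n': "rep_dim G \<sigma>=n" using assms(3) by (simp add: rep_equiv_def n_def)
 obtain P where P: "P\<in>carrier_mat n n" "invertible_mat P"
   and eq: "P*\<rho> g=\<sigma> g * P"
  using assms(3,4) unfolding rep_equiv_def n_def by auto
 obtain Q where Q: "Q\<in>carrier_mat n n" "P * Q=1\<^sub>m n" "Q * P=1\<^sub>m n"
  using invertible_matE[OF P(2,1)] .
 have r: "\<rho> g\<in>carrier_mat n n" "\<sigma> g\<in>carrier_mat n n"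
  using is_rep_closed[OF assms(1,4)] is_rep_closed[OF assms(2,4)] by (simp_all add: n_def n'[unfolded n_def])
 have "tr (\<sigma> g)=tr (\<sigma> g*(P * Q))" using Q r by simp
 also have "...=tr (P*\<rho> g * Q)" using P Q r by (simp add: assoc_mult_mat[of _ n n _ n _ n] eq)
 also have "...=tr (Q*(P*\<rho> g))" using P Q r by (subst tr_comm[of _ n n]) auto
 also have "...=tr ((Q * P)*\<rho> g)" using P Q(1) r by (simp add: assoc_mult_mat[of _ n n _ n _ n])
 also have "...=tr (\<rho> g)" using Q r by simp
 finally show ?thesis by (simp add: character_eq_tr)
qed

section \<open>Averaging over the group and Schur's lemma\<close>

context fin_group
begin

lemma is_rep_inv:
 assumes "is_rep G \<rho>" "g\<in>carrier G"
 shows "\<rho> (inv g)*\<rho> g=1\<^sub>m (rep_dim G \<rho>)" "\<rho> g*\<rho> (inv g)=1\<^sub>m (rep_dim G \<rho>)"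
 using assms by (simp_all flip: is_rep_mult add: is_rep_one)

lemma bij_mult_right: "h\<in>carrier G ==> bij_betw (%g. g \<otimes> h) (carrier G) (carrier G)"
 by (rule bij_betwI[of _ _ _ "%g. g \<otimes> inv h"]) (auto simp: m_assoc)

lemma bij_mult_left: "h\<in>carrier G ==> bij_betw (%g. h \<otimes> g) (carrier G) (carrier G)"
 by (rule bij_betwI[of _ _ _ "%g. inv h \<otimes> g"]) (auto simp flip: m_assoc)

lemma bij_inv: "bij_betw (%g. inv g) (carrier G) (carrier G)"
 by (rule bij_betwI[of _ _ _ "%g. inv g"]) auto

text \<open>The sum is taken entrywise with the shape n x m prescribed, since the zero matrix
  depends on the shape.\<close>

definition gsum :: "nat => nat => ('a => complex mat) => complex mat"
 where "gsum n m F=mat n m (%p. \<Sum>g\<in>carrier G. F g $$ p)"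

lemma gsum_carrier [simp]: "gsum n m F\<in>carrier_mat n m"
 by (simp add: gsum_def)

lemma gsum_cong: "(!!g. g\<in>carrier G ==> F g=F' g) ==> gsum n m F=gsum n m F'"
 unfolding gsum_def by (intro arg_cong[of _ _ "mat n m"] ext sum.cong) auto

lemma gsum_mult_right:
 assumes "!!g. g\<in>carrier G ==> F g\<in>carrier_mat n m" "B\<in>carrier_mat m l"
 shows "gsum n m F * B=gsum n l (%g. F g * B)"
proof (rule eq_matI)
 fix i j assume ij: "i < dim_row (gsum n l (%g. F g * B))" "j < dim_col (gsum n l (%g. F g * B))"
 hence ij': "i < n" "j < l" by (auto simp: gsum_def)
 have "(gsum n m F * B) $$ (i, j)=(\<Sum>k<m. \<Sum>g\<in>carrier G. F g $$ (i, k) * B $$ (k, j))"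
  by (subst index_mult_mat_sum[OF gsum_carrier assms(2) ij']) (simp add: gsum_def ij' sum_distrib_right)
 also have "...=(\<Sum>g\<in>carrier G. (F g * B) $$ (i, j))"
  by (subst sum.swap, intro sum.cong refl, subst index_mult_mat_sum[OF assms(1) assms(2) ij']) auto
 finally show "(gsum n m F * B) $$ (i, j)=gsum n l (%g. F g * B) $$ (i, j)"
  using ij' by (simp add: gsum_def)
qed (use assms in \<open>auto simp: gsum_def\<close>)

lemma gsum_mult_left:
 assumes "!!g. g\<in>carrier G ==> F g\<in>carrier_mat m l" "B\<in>carrier_mat n m"
 shows "B * gsum m l F=gsum n l (%g. B * F g)"
proof (rule eq_matI)
 fix i j assume ij: "i < dim_row (gsum n l (%g. B * F g))" "j < dim_col (gsum n l (%g. B * F g))"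
 hence ij': "i < n" "j < l" by (auto simp: gsum_def)
 have "(B * gsum m l F) $$ (i, j)=(\<Sum>k<m. \<Sum>g\<in>carrier G. B $$ (i, k) * F g $$ (k, j))"
  by (subst index_mult_mat_sum[OF assms(2) gsum_carrier ij']) (simp add: gsum_def ij' sum_distrib_left)
 also have "...=(\<Sum>g\<in>carrier G. (B * F g) $$ (i, j))"
  by (subst sum.swap, intro sum.cong refl, subst index_mult_mat_sum[OF assms(2) assms(1) ij']) auto
 finally show "(B * gsum m l F) $$ (i, j)=gsum n l (%g. B * F g) $$ (i, j)"
  using ij' by (simp add: gsum_def)
qed (use assms in \<open>auto simp: gsum_def\<close>)

lemma gsum_reindex:
 assumes "bij_betw f (carrier G) (carrier G)"
 shows "gsum n m (%g. F (f g))=gsum n m F"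
 unfolding gsum_def
 by (intro arg_cong[of _ _ "mat n m"] ext sum.reindex_bij_betw[OF assms, of "%g. F g $$ _"])

text \<open>Multiplying by \<rho>(h) on the right turns \<rho>(g) into \<rho>(gh); the substitution
  of g for gh then moves h into \<theta>(h g^-1), where it splits off on the left.\<close>

lemma average_intertwines:
 assumes \<rho>: "is_rep G \<rho>" and \<theta>: "is_rep G \<theta>" and E: "E\<in>carrier_mat (rep_dim G \<theta>) (rep_dim G \<rho>)"
  and h: "h\<in>carrier G"
 defines "T \<equiv> gsum (rep_dim G \<theta>) (rep_dim G \<rho>) (%g. \<theta> (inv g) * E*\<rho> g)"
 shows "T*\<rho> h=\<theta> h * T"
proof -
 define n m where nm: "n = rep_dim G \<theta>" "m = rep_dim G \<rho>"
 have c: "\<theta> g\<in>carrier_mat n n" "\<rho> g\<in>carrier_mat m m" if "g\<in>carrier G" for g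
  using is_rep_closed[OF \<theta> that] is_rep_closed[OF \<rho> that] by (simp_all add: nm)
 have E': "E\<in>carrier_mat n m" using E by (simp add: nm)
 have "T*\<rho> h=gsum n m (%g. \<theta> (inv g) * E*\<rho> g*\<rho> h)"
  unfolding T_def nm[symmetric] using c E' h
  by (intro gsum_mult_right mult_carrier_mat[of _ n m] mult_carrier_mat[of _ n n]) auto
 also have "...=gsum n m (%g. \<theta> (h \<otimes> inv (g \<otimes> h)) * E*\<rho> (g \<otimes> h))"
 proof (rule gsum_cong)
  fix g assume g: "g\<in>carrier G"
  have "h \<otimes> inv (g \<otimes> h)=inv g" using g h by (simp add: inv_mult_group flip: m_assoc)
  thus "\<theta> (inv g) * E*\<rho> g*\<rho> h=\<theta> (h \<otimes> inv (g \<otimes> h)) * E*\<rho> (g \<otimes> h)"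
   using g h assoc_mult_mat[OF mult_carrier_mat[OF c(1)[OF inv_closed[OF g]] E'] c(2)[OF g] c(2)[OF h]]
   by (simp add: is_rep_mult[OF \<rho>])
 qed
 also have "...=gsum n m (%g. \<theta> (h \<otimes> inv g) * E*\<rho> g)"
  by (rule gsum_reindex[OF bij_mult_right[OF h], of n m "%g. \<theta> (h \<otimes> inv g) * E*\<rho> g"])
 also have "...=gsum n m (%g. \<theta> h*(\<theta> (inv g) * E*\<rho> g))"
 proof (rule gsum_cong)
  fix g assume g: "g\<in>carrier G"
  thus "\<theta> (h \<otimes> inv g) * E*\<rho> g=\<theta> h*(\<theta> (inv g) * E*\<rho> g)"
   using h c[OF h] c[OF g] c[OF inv_closed[OF g]] E'
   by (simp add: is_rep_mult[OF \<theta>] assoc_mult_mat[of _ n n _ m _ m] assoc_mult_mat[of _ n n _ n _ m])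
 qed
 also have "...=\<theta> h * T"
  unfolding T_def nm[symmetric] using c E' h
  by (intro gsum_mult_left[symmetric] mult_carrier_mat[of _ n m] mult_carrier_mat[of _ n n]) auto
 finally show ?thesis .
qed


lemma irr_is_rep: "irreducible_rep G \<rho> ==> is_rep G \<rho>"
 by (simp add: irreducible_rep_def)

lemma irreducible_repD:
 assumes "irreducible_rep G \<rho>" "W \<subseteq> carrier_vec (rep_dim G \<rho>)" "0\<^sub>v (rep_dim G \<rho>)\<in>W"
  and "!!v w. v\<in>W ==> w\<in>W ==> v + w\<in>W" "!!a v. v\<in>W ==> a \<cdot>\<^sub>v v\<in>W"
  and "!!g w. g\<in>carrier G ==> w\<in>W ==> \<rho> g *\<^sub>v w\<in>W"
 shows "W={0\<^sub>v (rep_dim G \<rho>)} \<or> W=carrier_vec (rep_dim G \<rho>)"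
proof -
 have "VectorSpace.subspace class_ring W (module_vec TYPE(complex) (rep_dim G \<rho>))"
  unfolding VectorSpace.subspace_def submodule_def
  using vec_vs vec_module assms(2-5) by (auto simp: module_vec_simps class_ring_simps)
 thus ?thesis using assms(1,6) unfolding irreducible_rep_def by blast
qed

lemma eq_zero_matI:
 fixes A :: "complex mat"
 assumes "A\<in>carrier_mat n m" "!!v. v\<in>carrier_vec m ==> A *\<^sub>v v=0\<^sub>v n"
 shows "A=0\<^sub>m n m"
proof (rule eq_matI)
 fix i j assume ij: "i < dim_row (0\<^sub>m n m)" "j < dim_col (0\<^sub>m n m)"
 hence "A $$ (i, j)=(A *\<^sub>v unit_vec m j) $ i"
  using assms(1) by (auto simp: scalar_prod_right_unit)
 thus "A $$ (i, j)=0\<^sub>m n m $$ (i, j)" using ij assms(2)[of "unit_vec m j"] by simp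
qed (use assms(1) in auto)

text \<open>The kernel and the image of \<open>T\<close> are invariant subspaces, so irreducibility
  and \<open>T\<close> being nonzero make \<open>T\<close> injective and surjective. An inverse is
  assembled from preimages of the unit vectors.\<close>

theorem schur:
 assumes \<rho>: "irreducible_rep G \<rho>" and \<theta>: "irreducible_rep G \<theta>"
  and T: "T\<in>carrier_mat (rep_dim G \<theta>) (rep_dim G \<rho>)"
  and comm: "!!g. g\<in>carrier G ==> T*\<rho> g=\<theta> g * T"
  and nz: "T ~= 0\<^sub>m (rep_dim G \<theta>) (rep_dim G \<rho>)"
 shows "rep_equiv G \<rho> \<theta> & invertible_mat T"
proof -
 define n m where nm: "n = rep_dim G \<theta>" "m = rep_dim G \<rho>"
 have T': "T\<in>carrier_mat n m" using T by (simp add: nm)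
 have c: "\<theta> g\<in>carrier_mat n n" "\<rho> g\<in>carrier_mat m m" if "g\<in>carrier G" for g
  using is_rep_closed[OF irr_is_rep[OF \<theta>] that]
   is_rep_closed[OF irr_is_rep[OF \<rho>] that] by (simp_all add: nm)
 have comm': "T *\<^sub>v (\<rho> g *\<^sub>v v)=\<theta> g *\<^sub>v (T *\<^sub>v v)" if "g\<in>carrier G" "v\<in>carrier_vec m" for g v
  using comm[OF that(1)] assoc_mult_mat_vec[OF T' c(2)[OF that(1)] that(2)]
   assoc_mult_mat_vec[OF c(1)[OF that(1)] T' that(2)] by simp
 obtain v where v: "v\<in>carrier_vec m" "T *\<^sub>v v ~= 0\<^sub>v n"
  using eq_zero_matI[OF T'] nz[folded nm] by metis
 let ?K = "{v\<in>carrier_vec m. T *\<^sub>v v=0\<^sub>v n}"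
 have "?K={0\<^sub>v m} \<or> ?K=carrier_vec m"
  unfolding nm(2)
 proof (intro irreducible_repD[OF \<rho>], goal_cases)
  case 1 thus ?case by (simp add: nm(2)[symmetric])
 next
  case 2 thus ?case using T' by (auto simp: nm(2)[symmetric])
 next
  case (3 v w) thus ?case using T' by (simp add: nm(2)[symmetric] mult_add_distrib_mat_vec[of T n m])
 next
  case (4 a v) thus ?case using T' by (auto simp: nm(2)[symmetric] mult_mat_vec[of T n m])
 next
  case (5 g w)
  hence w: "w\<in>carrier_vec m" "T *\<^sub>v w=0\<^sub>v n" by (auto simp: nm(2)[symmetric])
  have "T *\<^sub>v (\<rho> g *\<^sub>v w)=0\<^sub>v n" using comm'[OF 5(1) w(1)] c(1)[OF 5(1)] w(2) by auto
  thus ?case using w(1) c(2)[OF 5(1)] by (simp add: nm(2)[symmetric])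
 qed
 hence ker: "w=0\<^sub>v m" if "w\<in>carrier_vec m" "T *\<^sub>v w=0\<^sub>v n" for w
  using v that by blast
 let ?I = "(%v. T *\<^sub>v v) ` carrier_vec m"
 have "?I={0\<^sub>v n} \<or> ?I=carrier_vec n"
  unfolding nm(1)
 proof (intro irreducible_repD[OF \<theta>], goal_cases)
  case 1 thus ?case using T' by (auto simp: nm(1)[symmetric])
 next
  case 2
  have "0\<^sub>v n=T *\<^sub>v 0\<^sub>v m" using T' by auto
  thus ?case unfolding nm(1)[symmetric] by (rule image_eqI) simp
 next
  case (3 v w)
  then obtain x y where "x\<in>carrier_vec m" "y\<in>carrier_vec m" "v=T *\<^sub>v x" "w=T *\<^sub>v y" by blast
  hence "v + w=T *\<^sub>v (x + y)" "x + y\<in>carrier_vec m" using T' by (simp_all add: mult_add_distrib_mat_vec)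
  thus ?case by blast
 next
  case (4 a v)
  then obtain x where "x\<in>carrier_vec m" "v=T *\<^sub>v x" by blast
  hence "a \<cdot>\<^sub>v v=T *\<^sub>v (a \<cdot>\<^sub>v x)" "a \<cdot>\<^sub>v x\<in>carrier_vec m" using T' by (simp_all add: mult_mat_vec)
  thus ?case by blast
 next
  case (5 g w)
  then obtain x where "x\<in>carrier_vec m" "w=T *\<^sub>v x" by blast
  hence "\<rho> g *\<^sub>v x\<in>carrier_vec m" "\<theta> g *\<^sub>v w=T *\<^sub>v (\<rho> g *\<^sub>v x)"
   using comm'[OF 5(1), of x] c(2)[OF 5(1)] by auto
  thus ?case by blast
 qed
 hence surj: "?I=carrier_vec n" using v by blast
 \<comment> \<open>The chosen preimages become the columns of \<open>S\<close>, which makes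
   \<open>S\<close> a right inverse at once. It is a left inverse because T(STw - w) = 0 and
   \<open>T\<close> is injective.\<close>
 have "\<exists>x. x\<in>carrier_vec m & T *\<^sub>v x=unit_vec n j" for j
 proof -
  have "unit_vec n j\<in>?I" unfolding surj by simp
  thus ?thesis by (auto simp: image_iff)
 qed
 then obtain x where x: "!!j. x j\<in>carrier_vec m & T *\<^sub>v x j=unit_vec n j" by metis
 define S where "S=mat m n (%(i, j). x j $ i)"
 have S: "S\<in>carrier_mat m n" by (simp add: S_def)
 have colS: "col S j=x j" if "j < n" for j using x[of j] that by (auto simp: S_def intro!: eq_vecI)
 have TS: "T * S=1\<^sub>m n"
 proof (rule eq_matI)
  fix i j assume ij: "i < dim_row (1\<^sub>m n)" "j < dim_col (1\<^sub>m n)"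
  hence "(T * S) $$ (i, j)=(T *\<^sub>v x j) $ i" using T' S colS by simp
  also have "...=1\<^sub>m n $$ (i, j)" using x[of j] ij by (auto simp: unit_vec_def)
  finally show "(T * S) $$ (i, j)=1\<^sub>m n $$ (i, j)" .
 qed (use T' S in auto)
 have "S * T - 1\<^sub>m m=0\<^sub>m m m"
 proof (rule eq_zero_matI)
  fix w :: "complex vec" assume w: "w\<in>carrier_vec m"
  have "(S * T - 1\<^sub>m m) *\<^sub>v w=S *\<^sub>v (T *\<^sub>v w) - w"
   using T' S w by (subst minus_mult_distrib_mat_vec[of _ m m]) (auto simp: assoc_mult_mat_vec[OF S T'])
  hence "T *\<^sub>v ((S * T - 1\<^sub>m m) *\<^sub>v w)=T *\<^sub>v (S *\<^sub>v (T *\<^sub>v w)) - T *\<^sub>v w"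
   using T' S w by (simp add: mult_minus_distrib_mat_vec[OF T'])
  also have "T *\<^sub>v (S *\<^sub>v (T *\<^sub>v w))=(T * S) *\<^sub>v (T *\<^sub>v w)"
   using T' w by (intro assoc_mult_mat_vec[OF T' S, symmetric]) auto
  also have "(T * S) *\<^sub>v (T *\<^sub>v w) - T *\<^sub>v w=0\<^sub>v n" unfolding TS using T' w by simp
  finally show "(S * T - 1\<^sub>m m) *\<^sub>v w=0\<^sub>v m" using T' S w
   by (intro ker mult_mat_vec_carrier[of _ m m] minus_carrier_mat) auto
 qed (use S T' in auto)
 hence "S * T=1\<^sub>m m"
 proof (intro eq_matI)
  fix i j assume z: "S * T - 1\<^sub>m m=0\<^sub>m m m" and ij: "i < dim_row (1\<^sub>m m)" "j < dim_col (1\<^sub>m m)"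
  have "(S * T - 1\<^sub>m m) $$ (i, j)=0" unfolding z using ij by simp
  moreover have "(S * T - 1\<^sub>m m) $$ (i, j)=(S * T) $$ (i, j) - 1\<^sub>m m $$ (i, j)"
   using ij S T' by (intro index_minus_mat) auto
  ultimately show "(S * T) $$ (i, j)=1\<^sub>m m $$ (i, j)" by simp
 qed (use S T' in auto)
 note ST = this
 \<comment> \<open>The two products have the same trace, and the identities they equal have traces n
   and m.\<close>
 have "of_nat n=(of_nat m :: complex)"
  using tr_comm[OF T' S] by (simp add: TS ST tr_one)
 hence "n=m" by simp
 hence "invertible_mat T" using invertible_matI[of T n S] T' S TS ST by simp
 moreover have "rep_equiv G \<rho> \<theta>" unfolding rep_equiv_def
  using T' comm \<open>n = m\<close> \<open>invertible_mat T\<close> unfolding nm by auto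
 ultimately show ?thesis by simp
qed


text \<open>Over the complex numbers \<open>T\<close> has an eigenvalue a. Then T - a also
  intertwines but kills an eigenvector, so it is not invertible and vanishes by
  \<open>schur\<close>.\<close>

lemma schur_scalar:
 assumes \<rho>: "irreducible_rep G \<rho>" and T: "T\<in>carrier_mat (rep_dim G \<rho>) (rep_dim G \<rho>)"
  and comm: "!!g. g\<in>carrier G ==> T*\<rho> g=\<rho> g * T"
 obtains a where "T=a \<cdot>\<^sub>m 1\<^sub>m (rep_dim G \<rho>)"
proof -
 define n where "n = rep_dim G \<rho>"
 have T': "T\<in>carrier_mat n n" using T by (simp add: n_def)
 have "n > 0" using \<rho> by (simp add: n_def irreducible_rep_def)
 then obtain a where "eigenvalue T a" using spectrum_non_empty[OF T'] by (auto simp: spectrum_def)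
 then obtain v where v: "v\<in>carrier_vec n" "v ~= 0\<^sub>v n" "T *\<^sub>v v=a \<cdot>\<^sub>v v"
  using T' by (auto simp: eigenvalue_def eigenvector_def)
 define S where "S=T - a \<cdot>\<^sub>m 1\<^sub>m n"
 have S: "S\<in>carrier_mat n n" using T' by (auto simp: S_def intro: minus_carrier_mat)
 have "S=0\<^sub>m n n"
 proof (rule ccontr)
  assume nz: "S ~= 0\<^sub>m n n"
  have "S*\<rho> g=\<rho> g * S" if g: "g\<in>carrier G" for g
   using is_rep_closed[OF irr_is_rep[OF \<rho>] g] comm[OF g] T'
    mult_smult_distrib[of "\<rho> g" n n "1\<^sub>m n" n a] mult_smult_assoc_mat[of "1\<^sub>m n" n n "\<rho> g" n a]
   by (simp add: S_def n_def[symmetric] minus_mult_distrib_mat[of _ n n _ _ n] mult_minus_distrib_mat[of _ n n _ n])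
  hence "invertible_mat S"
   using schur[OF \<rho> \<rho>, of S] S nz by (simp add: n_def)
  then obtain Q where Q: "Q\<in>carrier_mat n n" "Q * S=1\<^sub>m n" using invertible_matE[OF _ S] by metis
  have "(a \<cdot>\<^sub>m 1\<^sub>m n) *\<^sub>v v=a \<cdot>\<^sub>v v" using v(1) by (intro eq_vecI) auto
  hence "S *\<^sub>v v=0\<^sub>v n" using T' v by (simp add: S_def minus_mult_distrib_mat_vec[of _ n n])
  moreover have "Q *\<^sub>v 0\<^sub>v n=0\<^sub>v n" using Q(1) by auto
  ultimately have "(Q * S) *\<^sub>v v=0\<^sub>v n" using Q(1) S v(1) by (simp add: assoc_mult_mat_vec[of _ n n _ n])
  thus False using Q v by simp
 qed
 have "T=a \<cdot>\<^sub>m 1\<^sub>m n"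
 proof (rule eq_matI)
  fix i j assume ij: "i < dim_row (a \<cdot>\<^sub>m 1\<^sub>m n)" "j < dim_col (a \<cdot>\<^sub>m 1\<^sub>m n)"
  have "S $$ (i, j)=T $$ (i, j) - (a \<cdot>\<^sub>m 1\<^sub>m n) $$ (i, j)"
   unfolding S_def using ij by (intro index_minus_mat) auto
  thus "T $$ (i, j)=(a \<cdot>\<^sub>m 1\<^sub>m n) $$ (i, j)" using ij \<open>S = 0\<^sub>m n n\<close> by simp
 qed (use T' in auto)
 thus thesis using that n_def by simp
qed

text \<open>Matrix units: A E B has entries A(i,k) B(l,j), so averaging them yields sums of products
  of single matrix coefficients.\<close>

definition unit_mat :: "nat => nat => nat => nat => complex mat"
 where "unit_mat n m k l=mat n m (%p. if p=(k, l) then 1 else 0)"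

lemma sandwich_unit_mat:
 assumes A: "A\<in>carrier_mat n' n" and B: "B\<in>carrier_mat m m'" and "k < n" "l < m" "i < n'" "j < m'"
 shows "(A * unit_mat n m k l * B) $$ (i, j)=A $$ (i, k) * B $$ (l, j)"
proof -
 have U: "unit_mat n m k l\<in>carrier_mat n m" by (simp add: unit_mat_def)
 have 1: "(A * unit_mat n m k l) $$ (i, q)=(if q=l then A $$ (i, k) else 0)" if q: "q < m" for q
 proof -
  have "(A * unit_mat n m k l) $$ (i, q)=(\<Sum>p<n. A $$ (i, p) * unit_mat n m k l $$ (p, q))"
   using q assms by (intro index_mult_mat_sum[OF A U]) auto
  also have "...=(\<Sum>p<n. if p=k then (if q=l then A $$ (i, k) else 0) else 0)"
   using q by (intro sum.cong refl) (auto simp: unit_mat_def)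
  also have "...=(if q=l then A $$ (i, k) else 0)" using assms by simp
  finally show ?thesis .
 qed
 have "(A * unit_mat n m k l * B) $$ (i, j)=(\<Sum>q<m. (A * unit_mat n m k l) $$ (i, q) * B $$ (q, j))"
  using assms by (intro index_mult_mat_sum[OF mult_carrier_mat[OF A U] B]) auto
 also have "...=(\<Sum>q<m. if q=l then A $$ (i, k) * B $$ (l, j) else 0)"
  by (intro sum.cong refl) (simp add: 1 del: index_mult_mat)
 also have "...=A $$ (i, k) * B $$ (l, j)" using assms by simp
 finally show ?thesis .
qed

text \<open>The sum is an entry of the averaged matrix unit, which intertwines inequivalent
  irreducibles and so is 0.\<close>

lemma schur_orthogonality:
 assumes \<rho>: "irreducible_rep G \<rho>" and \<theta>: "irreducible_rep G \<theta>" and neq: "\<not> rep_equiv G \<rho> \<theta>"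
  and "i < rep_dim G \<theta>" "k < rep_dim G \<theta>" "l < rep_dim G \<rho>" "j < rep_dim G \<rho>"
 shows "(\<Sum>g\<in>carrier G. \<theta> (inv g) $$ (i, k)*\<rho> g $$ (l, j))=0"
proof -
 let ?n = "rep_dim G \<theta>" and ?m = "rep_dim G \<rho>"
 let ?T = "gsum ?n ?m (%g. \<theta> (inv g) * unit_mat ?n ?m k l*\<rho> g)"
 have "?T=0\<^sub>m ?n ?m"
  using schur[OF \<rho> \<theta>, of ?T] neq
   average_intertwines[OF irr_is_rep[OF \<rho>] irr_is_rep[OF \<theta>], of "unit_mat ?n ?m k l"]
  by (auto simp: unit_mat_def)
 hence "?T $$ (i, j)=0" using assms by simp
 moreover have "?T $$ (i, j)=(\<Sum>g\<in>carrier G. \<theta> (inv g) $$ (i, k)*\<rho> g $$ (l, j))"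
  unfolding gsum_def using assms
  by (auto intro!: sum.cong sandwich_unit_mat is_rep_closed irr_is_rep simp del: index_mult_mat)
 ultimately show ?thesis by simp
qed

text \<open>Here the averaged matrix unit is a scalar a. Its trace is n a on one side, and on the
  other the sum over g of the (l,k) entry of \<rho>(g) \<rho>(g^-1), which is the order of the group
  if k = l and 0 otherwise.\<close>

lemma schur_orthogonality_same:
 assumes \<rho>: "irreducible_rep G \<rho>"
  and ijkl: "i < rep_dim G \<rho>" "k < rep_dim G \<rho>" "l < rep_dim G \<rho>" "j < rep_dim G \<rho>"
 shows "(\<Sum>g\<in>carrier G. \<rho> (inv g) $$ (i, k)*\<rho> g $$ (l, j)) =
  (if i=j & k=l then of_nat (card (carrier G)) / of_nat (rep_dim G \<rho>) else 0)"
proof -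
 let ?n = "rep_dim G \<rho>"
 have r: "is_rep G \<rho>" using \<rho> by (rule irr_is_rep)
 let ?T = "gsum ?n ?n (%g. \<rho> (inv g) * unit_mat ?n ?n k l*\<rho> g)"
 have Tij: "?T $$ (i, j)=(\<Sum>g\<in>carrier G. \<rho> (inv g) $$ (i, k)*\<rho> g $$ (l, j))" if "i < ?n" "j < ?n" for i j
  unfolding gsum_def using that ijkl r
  by (auto intro!: sum.cong sandwich_unit_mat is_rep_closed irr_is_rep simp del: index_mult_mat)
 obtain a where a: "?T=a \<cdot>\<^sub>m 1\<^sub>m ?n"
  using schur_scalar[OF \<rho>, of ?T] average_intertwines[OF r r, of "unit_mat ?n ?n k l"]
  by (auto simp: unit_mat_def)
 have "of_nat ?n * a=(\<Sum>i<?n. ?T $$ (i, i))" unfolding a by simp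
 also have "...=(\<Sum>g\<in>carrier G. \<Sum>i<?n. \<rho> g $$ (l, i)*\<rho> (inv g) $$ (i, k))"
  by (subst sum.swap) (simp add: Tij mult.commute)
 also have "...=(\<Sum>g\<in>carrier G. (\<rho> g*\<rho> (inv g)) $$ (l, k))"
  using ijkl by (intro sum.cong refl index_mult_mat_sum[symmetric]) (auto intro: is_rep_closed[OF r])
 also have "...=(\<Sum>g\<in>carrier G. if k=l then 1 else 0)"
  using ijkl by (intro sum.cong refl) (auto simp: is_rep_inv[OF r])
 finally have "of_nat ?n * a=(if k=l then of_nat (card (carrier G)) else 0)" by simp
 moreover have "?n > 0" using ijkl by simp
 ultimately have a': "a=(if k=l then of_nat (card (carrier G)) / of_nat ?n else 0)"
  by (auto simp: field_simps)
 show ?thesis unfolding Tij[OF ijkl(1,4), symmetric] a using ijkl by (simp add: a')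
qed

section \<open>Orthogonality and convolution of characters\<close>

lemma character_eq_sum: "is_rep G \<rho> ==> g\<in>carrier G ==> character \<rho> g=(\<Sum>i<rep_dim G \<rho>. \<rho> g $$ (i, i))"
 using is_rep_closed[of G \<rho> g] by (simp add: character_def)

lemma character_orthogonal:
 assumes \<rho>: "irreducible_rep G \<rho>" and \<theta>: "irreducible_rep G \<theta>" and neq: "\<not> rep_equiv G \<rho> \<theta>"
 shows "(\<Sum>g\<in>carrier G. character \<theta> (inv g) * character \<rho> g)=0"
proof -
 note r = irr_is_rep[OF \<rho>] irr_is_rep[OF \<theta>]
 have 1: "character \<theta> (inv g) * character \<rho> g =
   (\<Sum>i<rep_dim G \<theta>. \<Sum>j<rep_dim G \<rho>. \<theta> (inv g) $$ (i, i)*\<rho> g $$ (j, j))"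
  if g: "g\<in>carrier G" for g
  unfolding character_eq_sum[OF r(1) g] character_eq_sum[OF r(2) inv_closed[OF g]] by (rule sum_product)
 have 2: "(\<Sum>g\<in>carrier G. \<theta> (inv g) $$ (i, i)*\<rho> g $$ (j, j))=0"
  if "i < rep_dim G \<theta>" "j < rep_dim G \<rho>" for i j
  by (rule schur_orthogonality[OF \<rho> \<theta> neq that(1) that(1) that(2) that(2)])
 have "(\<Sum>g\<in>carrier G. character \<theta> (inv g) * character \<rho> g) =
  (\<Sum>g\<in>carrier G. \<Sum>i<rep_dim G \<theta>. \<Sum>j<rep_dim G \<rho>. \<theta> (inv g) $$ (i, i)*\<rho> g $$ (j, j))"
  by (rule sum.cong[OF refl 1])
 also have "...=(\<Sum>i<rep_dim G \<theta>. \<Sum>j<rep_dim G \<rho>. \<Sum>g\<in>carrier G. \<theta> (inv g) $$ (i, i)*\<rho> g $$ (j, j))"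
  by (subst sum.swap, rule sum.cong[OF refl], rule sum.swap)
 also have "...=0" by (intro sum.neutral ballI 2) auto
 finally show ?thesis .
qed

text \<open>Expanding \<rho>(gh) as a matrix product leaves sums covered by
  \<open>schur_orthogonality_same\<close>. At h = 1 this gives the norm of the character; for
  general h it makes the isotypic average idempotent.\<close>

lemma character_convolution:
 assumes \<rho>: "irreducible_rep G \<rho>" and h: "h\<in>carrier G"
 shows "(\<Sum>g\<in>carrier G. character \<rho> (inv g) * character \<rho> (g \<otimes> h)) =
  of_nat (card (carrier G)) / of_nat (rep_dim G \<rho>) * character \<rho> h"
proof -
 define n where "n = rep_dim G \<rho>"
 have r: "is_rep G \<rho>" using \<rho> by (auto dest: irr_is_rep)
 have 1: "character \<rho> (inv g) * character \<rho> (g \<otimes> h) =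
   (\<Sum>i<n. \<Sum>j<n. \<Sum>k<n. \<rho> (inv g) $$ (i, i)*\<rho> g $$ (j, k)*\<rho> h $$ (k, j))"
  if g: "g\<in>carrier G" for g
 proof -
  have "\<rho> (g \<otimes> h) $$ (j, j)=(\<Sum>k<n. \<rho> g $$ (j, k)*\<rho> h $$ (k, j))" if "j < n" for j
   unfolding is_rep_mult[OF r g h] using that g h
   by (intro index_mult_mat_sum) (auto intro: is_rep_closed[OF r, folded n_def])
  hence "(\<Sum>j<n. \<rho> (g \<otimes> h) $$ (j, j))=(\<Sum>j<n. \<Sum>k<n. \<rho> g $$ (j, k)*\<rho> h $$ (k, j))" by simp
  thus ?thesis
   unfolding character_eq_sum[OF r inv_closed[OF g]] character_eq_sum[OF r m_closed[OF g h]] n_def[symmetric]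
   by (simp only: sum_product) (simp only: sum_distrib_left mult.assoc)
 qed
 have 2: "(\<Sum>g\<in>carrier G. \<rho> (inv g) $$ (i, i)*\<rho> g $$ (j, k)*\<rho> h $$ (k, j)) =
   (if k=i then (if j=i then of_nat (card (carrier G)) / of_nat n*\<rho> h $$ (i, i) else 0) else 0)"
  if "i < n" "j < n" "k < n" for i j k
  unfolding sum_distrib_right[symmetric]
  using schur_orthogonality_same[OF \<rho>, of i i j k] that by (simp add: n_def)
 have "(\<Sum>g\<in>carrier G. character \<rho> (inv g) * character \<rho> (g \<otimes> h)) =
  (\<Sum>g\<in>carrier G. \<Sum>i<n. \<Sum>j<n. \<Sum>k<n. \<rho> (inv g) $$ (i, i)*\<rho> g $$ (j, k)*\<rho> h $$ (k, j))"
  by (rule sum.cong[OF refl 1])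
 also have "...=(\<Sum>i<n. \<Sum>j<n. \<Sum>k<n. \<Sum>g\<in>carrier G. \<rho> (inv g) $$ (i, i)*\<rho> g $$ (j, k)*\<rho> h $$ (k, j))"
  by (subst sum.swap, rule sum.cong[OF refl], subst sum.swap, rule sum.cong[OF refl], rule sum.swap)
 also have "...=(\<Sum>i<n. \<Sum>j<n. \<Sum>k<n. if k=i then (if j=i then of_nat (card (carrier G)) / of_nat n*\<rho> h $$ (i, i) else 0) else 0)"
  by (rule sum.cong[OF refl], rule sum.cong[OF refl], rule sum.cong[OF refl], rule 2) auto
 also have "...=(\<Sum>i<n. of_nat (card (carrier G)) / of_nat n*\<rho> h $$ (i, i))"
  by (rule sum.cong[OF refl]) (simp only: sum.delta finite_lessThan if_True simp_thms lessThan_iff split: if_split)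
 also have "... = of_nat (card (carrier G)) / of_nat n * character \<rho> h"
  unfolding character_eq_sum[OF r h] n_def by (rule sum_distrib_left[symmetric])
 finally show ?thesis unfolding n_def .
qed

lemma character_norm:
 assumes \<rho>: "irreducible_rep G \<rho>"
 shows "(\<Sum>g\<in>carrier G. character \<rho> (inv g) * character \<rho> g) = of_nat (card (carrier G))"
proof -
 have "rep_dim G \<rho> > 0" using \<rho> unfolding irreducible_rep_def by blast
 have "(\<Sum>g\<in>carrier G. character \<rho> (inv g) * character \<rho> g) =
  (\<Sum>g\<in>carrier G. character \<rho> (inv g) * character \<rho> (g \<otimes> \<one>))" by simp
 also have "... = of_nat (card (carrier G))"
  unfolding character_convolution[OF \<rho> one_closed] character_one[OF irr_is_rep[OF \<rho>]]
  using \<open>rep_dim G \<rho> > 0\<close> by simp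
 finally show ?thesis .
qed


section \<open>Invariant Hermitian forms and the character at inverses\<close>

definition cadj :: "complex mat => complex mat"
 where "cadj A=mat (dim_col A) (dim_row A) (%(i, j). cnj (A $$ (j, i)))"

lemma cadj_carrier [simp]: "A\<in>carrier_mat n m ==> cadj A\<in>carrier_mat m n"
 by (auto simp: cadj_def)

lemma cadj_mult:
 assumes A: "A\<in>carrier_mat n m" and B: "B\<in>carrier_mat m l"
 shows "cadj (A * B)=cadj B * cadj A"
proof (rule eq_matI)
 fix i j assume ij: "i < dim_row (cadj B * cadj A)" "j < dim_col (cadj B * cadj A)"
 hence ij': "i < l" "j < n" using A B by (auto simp: cadj_def)
 have "cadj (A * B) $$ (i, j)=cnj ((A * B) $$ (j, i))"
  unfolding cadj_def using ij' A B by (subst index_mat) auto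
 also have "...=(\<Sum>k<m. cadj B $$ (i, k) * cadj A $$ (k, j))"
  unfolding index_mult_mat_sum[OF A B ij'(2,1)] using A B ij' by (auto simp: cadj_def intro!: sum.cong)
 also have "...=(cadj B * cadj A) $$ (i, j)"
  using A B ij' by (intro index_mult_mat_sum[symmetric]) auto
 finally show "cadj (A * B) $$ (i, j)=(cadj B * cadj A) $$ (i, j)" .
qed (use A B in \<open>auto simp: cadj_def\<close>)

text \<open>A null vector v makes the form vanish at v. The value of the form at v is the sum over g
  of the squared norms of \<rho>(g)v, and its term at g = 1 is the squared norm of v itself.\<close>

lemma invariant_form_invertible:
 assumes \<rho>: "is_rep G \<rho>"
 defines "n \<equiv> rep_dim G \<rho>"
 shows "det (gsum n n (%g. cadj (\<rho> g)*\<rho> g)) ~= 0"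
proof
 let ?M = "gsum n n (%g. cadj (\<rho> g)*\<rho> g)"
 assume "det ?M=0"
 then obtain v where v: "v\<in>carrier_vec n" "v ~= 0\<^sub>v n" "?M *\<^sub>v v=0\<^sub>v n"
  using det_0_iff_vec_prod_zero_field[OF gsum_carrier] by metis
 have c: "\<rho> g\<in>carrier_mat n n" if "g\<in>carrier G" for g
  using is_rep_closed[OF \<rho> that] by (simp add: n_def)
 define q where "q g l=(\<Sum>j<n. \<rho> g $$ (l, j) * v $ j)" for g l
 have M: "?M $$ (i, j)=(\<Sum>g\<in>carrier G. \<Sum>l<n. cnj (\<rho> g $$ (l, i))*\<rho> g $$ (l, j))" if "i < n" "j < n" for i j
 proof -
  have "?M $$ (i, j)=(\<Sum>g\<in>carrier G. (cadj (\<rho> g)*\<rho> g) $$ (i, j))"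
   unfolding gsum_def using that by simp
  also have "...=(\<Sum>g\<in>carrier G. \<Sum>l<n. cadj (\<rho> g) $$ (i, l)*\<rho> g $$ (l, j))"
   by (rule sum.cong[OF refl], rule index_mult_mat_sum[of _ n n _ n]) (use c that in auto)
  also have "...=(\<Sum>g\<in>carrier G. \<Sum>l<n. cnj (\<rho> g $$ (l, i))*\<rho> g $$ (l, j))"
  proof (rule sum.cong[OF refl], rule sum.cong[OF refl])
   fix g l assume "g\<in>carrier G" "l\<in>{..<n}"
   hence "cadj (\<rho> g) $$ (i, l)=cnj (\<rho> g $$ (l, i))" using c[of g] that by (auto simp: cadj_def)
   thus "cadj (\<rho> g) $$ (i, l)*\<rho> g $$ (l, j)=cnj (\<rho> g $$ (l, i))*\<rho> g $$ (l, j)" by simp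
  qed
  finally show ?thesis .
 qed
 have row: "(\<Sum>j<n. ?M $$ (i, j) * v $ j)=0" if "i < n" for i
 proof -
  have "(?M *\<^sub>v v) $ i=(\<Sum>j<n. ?M $$ (i, j) * v $ j)"
   using that v(1) by (auto simp: scalar_prod_def gsum_def lessThan_atLeast0 intro!: sum.cong)
  thus ?thesis using v(3) that by simp
 qed
 have "(\<Sum>g\<in>carrier G. \<Sum>l<n. complex_of_real ((cmod (q g l))\<^sup>2)) =
  (\<Sum>g\<in>carrier G. \<Sum>l<n. \<Sum>i<n. cnj (v $ i)*(cnj (\<rho> g $$ (l, i)) * q g l))"
  by (rule sum.cong[OF refl], rule sum.cong[OF refl])
   (simp only: complex_norm_square, simp add: q_def sum_distrib_left sum_distrib_right mult_ac)
 also have "...=(\<Sum>i<n. cnj (v $ i)*(\<Sum>g\<in>carrier G. \<Sum>l<n. cnj (\<rho> g $$ (l, i)) * q g l))"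
  unfolding sum_distrib_left
  by (rule trans[OF _ sum.swap], rule sum.cong[OF refl], rule sum.swap)
 also have "...=(\<Sum>i<n. cnj (v $ i)*(\<Sum>j<n. ?M $$ (i, j) * v $ j))"
 proof (rule sum.cong[OF refl], rule arg_cong[of _ _ "%x. _ * x"])
  fix i assume "i\<in>{..<n}"
  hence "(\<Sum>j<n. ?M $$ (i, j) * v $ j)=(\<Sum>j<n. \<Sum>g\<in>carrier G. \<Sum>l<n. cnj (\<rho> g $$ (l, i))*(\<rho> g $$ (l, j) * v $ j))"
   by (intro sum.cong[OF refl]) (simp add: M sum_distrib_right mult.assoc)
  also have "...=(\<Sum>g\<in>carrier G. \<Sum>l<n. cnj (\<rho> g $$ (l, i)) * q g l)"
   unfolding q_def sum_distrib_left by (subst sum.swap, rule sum.cong[OF refl], rule sum.swap)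
  finally show "(\<Sum>g\<in>carrier G. \<Sum>l<n. cnj (\<rho> g $$ (l, i)) * q g l)=(\<Sum>j<n. ?M $$ (i, j) * v $ j)" by simp
 qed
 also have "...=0" by (intro sum.neutral ballI) (simp add: row)
 finally have "complex_of_real (\<Sum>g\<in>carrier G. \<Sum>l<n. (cmod (q g l))\<^sup>2)=0" by simp
 hence z: "(\<Sum>g\<in>carrier G. \<Sum>l<n. (cmod (q g l))\<^sup>2)=0" by (simp only: of_real_eq_0_iff)
 hence "(\<Sum>l<n. (cmod (q \<one> l))\<^sup>2)=0"
  by (subst (asm) sum_nonneg_eq_0_iff) (auto intro: sum_nonneg)
 hence q0: "q \<one> l=0" if "l < n" for l
  using that by (subst (asm) sum_nonneg_eq_0_iff) auto
 have "v $ l=0" if l: "l < n" for l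
 proof -
  have "q \<one> l=(\<Sum>j<n. if j=l then v $ l else 0)"
   unfolding q_def by (rule sum.cong[OF refl]) (use l in \<open>auto simp: is_rep_one[OF \<rho>] n_def[symmetric]\<close>)
  thus ?thesis using q0[OF l] l by simp
 qed
 hence "v=0\<^sub>v n" using v(1) by (intro eq_vecI) auto
 thus False using v(2) by simp
qed

text \<open>The averaged form M satisfies M \<rho>(h^-1) = \<rho>(h)' M, with ' the conjugate
  transpose. So \<rho>(h)' is conjugate to \<rho>(h^-1) and has the same trace. This avoids
  diagonalising \<rho>(h).\<close>

lemma cnj_character:
 assumes \<rho>: "is_rep G \<rho>" and h: "h\<in>carrier G"
 shows "cnj (character \<rho> h)=character \<rho> (inv h)"
proof -
 define n where "n = rep_dim G \<rho>"
 have c: "\<rho> g\<in>carrier_mat n n" if "g\<in>carrier G" for g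
  using is_rep_closed[OF \<rho> that] by (simp add: n_def)
 define M where "M=gsum n n (%g. cadj (\<rho> g)*\<rho> g)"
 have M: "M\<in>carrier_mat n n" by (simp add: M_def)
 have "det M ~= 0" using invariant_form_invertible[OF \<rho>] by (simp add: M_def n_def)
 from det_non_zero_imp_unit[OF M this, of "()"] obtain Q where Q: "Q\<in>carrier_mat n n" "Q * M=1\<^sub>m n" "M * Q=1\<^sub>m n"
  unfolding Units_def ring_mat_def by auto
 have MM: "M*\<rho> (inv h)=cadj (\<rho> h) * M"
 proof -
  have "M*\<rho> (inv h)=gsum n n (%g. cadj (\<rho> g)*\<rho> g*\<rho> (inv h))"
   unfolding M_def using c h by (intro gsum_mult_right mult_carrier_mat[of _ n n]) auto
  also have "...=gsum n n (%g. cadj (\<rho> ((g \<otimes> inv h) \<otimes> h))*\<rho> (g \<otimes> inv h))"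
  proof (rule gsum_cong)
   fix g assume g: "g\<in>carrier G"
   have "cadj (\<rho> g)*\<rho> g*\<rho> (inv h)=cadj (\<rho> g)*(\<rho> g*\<rho> (inv h))"
    using c g h by (intro assoc_mult_mat[of _ n n _ n _ n]) auto
   moreover have "(g \<otimes> inv h) \<otimes> h=g" using g h by (simp add: m_assoc)
   ultimately show "cadj (\<rho> g)*\<rho> g*\<rho> (inv h)=cadj (\<rho> ((g \<otimes> inv h) \<otimes> h))*\<rho> (g \<otimes> inv h)"
    using g h by (simp add: is_rep_mult[OF \<rho>, of g "inv h"])
  qed
  also have "...=gsum n n (%g. cadj (\<rho> (g \<otimes> h))*\<rho> g)"
   by (rule gsum_reindex[OF bij_mult_right[OF inv_closed[OF h]], of n n "%g. cadj (\<rho> (g \<otimes> h))*\<rho> g"])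
  also have "...=gsum n n (%g. cadj (\<rho> h)*(cadj (\<rho> g)*\<rho> g))"
  proof (rule gsum_cong)
   fix g assume g: "g\<in>carrier G"
   have "cadj (\<rho> (g \<otimes> h))=cadj (\<rho> h) * cadj (\<rho> g)"
    unfolding is_rep_mult[OF \<rho> g h] by (rule cadj_mult[OF c[OF g] c[OF h]])
   thus "cadj (\<rho> (g \<otimes> h))*\<rho> g=cadj (\<rho> h)*(cadj (\<rho> g)*\<rho> g)"
    using assoc_mult_mat[OF cadj_carrier[OF c[OF h]] cadj_carrier[OF c[OF g]] c[OF g]] by simp
  qed
  also have "...=cadj (\<rho> h) * M"
   unfolding M_def using c h by (intro gsum_mult_left[symmetric] mult_carrier_mat[of _ n n]) auto
  finally show ?thesis .
 qed
 have "cnj (character \<rho> h)=tr (cadj (\<rho> h))"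
  using c[OF h] by (simp add: character_eq_tr tr_def cadj_def)
 also have "...=tr (cadj (\<rho> h)*(M * Q))" using cadj_carrier[OF c[OF h]] unfolding Q(3) by simp
 also have "cadj (\<rho> h)*(M * Q)=(M*\<rho> (inv h)) * Q"
  unfolding MM using c[OF h] M Q by (intro assoc_mult_mat[symmetric, of _ n n _ n _ n]) auto
 also have "tr ((M*\<rho> (inv h)) * Q)=tr (Q*(M*\<rho> (inv h)))"
  using c h M Q by (intro tr_comm[of _ n n] mult_carrier_mat[of _ n n]) auto
 also have "Q*(M*\<rho> (inv h))=\<rho> (inv h)"
  using assoc_mult_mat[OF Q(1) M c[OF inv_closed[OF h]]] c[OF inv_closed[OF h]] unfolding Q(2) by simp
 finally show ?thesis by (simp add: character_eq_tr)
qed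

end

text \<open>Columns of an invertible matrix lying in \<open>W\<close> can be exchanged until they span \<open>W\<close>.\<close>

lemma adapted_basis:
 fixes W :: "complex vec set"
 assumes W: "W \<subseteq> carrier_vec d" "0\<^sub>v d\<in>W"
  and add: "!!v w. v\<in>W ==> w\<in>W ==> v + w\<in>W" and smult: "!!a v. v\<in>W ==> a \<cdot>\<^sub>v v\<in>W"
  and proper: "W ~= {0\<^sub>v d}" "W ~= carrier_vec d"
 obtains k Q Q' where "0 < k" "k < d" "Q\<in>carrier_mat d d" "Q'\<in>carrier_mat d d"
  "Q * Q'=1\<^sub>m d" "Q' * Q=1\<^sub>m d" "!!j. j < k ==> col Q j\<in>W"
  "!!w i. w\<in>W ==> k \<le> i ==> i < d ==> (Q' *\<^sub>v w) $ i=0"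
proof -
 \<comment> \<open>\<open>P k\<close> says that some invertible matrix has its first k columns in
   \<open>W\<close>. The greatest such k is the dimension of \<open>W\<close>.\<close>
 define P where "P k \<longleftrightarrow> k \<le> d & (\<exists>Q Q'. Q\<in>carrier_mat d d & Q'\<in>carrier_mat d d &
  Q * Q'=1\<^sub>m d & Q' * Q=1\<^sub>m d & (\<forall>j<k. col Q j\<in>W))" for k
 have "P 0" unfolding P_def by (auto intro!: exI[of _ "1\<^sub>m d"])
 moreover have "\<forall>k. P k --> k \<le> d" by (auto simp: P_def)
 ultimately obtain k where k: "P k" "!!k'. P k' ==> k' \<le> k"
  using Nat.ex_has_greatest_nat[of P 0 d] by blast
 then obtain Q Q' where Q: "Q\<in>carrier_mat d d" "Q'\<in>carrier_mat d d"
  "Q * Q'=1\<^sub>m d" "Q' * Q=1\<^sub>m d" "!!j. j < k ==> col Q j\<in>W" unfolding P_def by blast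
 have QQ: "Q *\<^sub>v (Q' *\<^sub>v w)=w" "Q' *\<^sub>v (Q *\<^sub>v w)=w" if "w\<in>carrier_vec d" for w
  using assoc_mult_mat_vec[OF Q(1,2) that] assoc_mult_mat_vec[OF Q(2,1) that] that by (simp_all add: Q(3,4))
 \<comment> \<open>A vector supported on the first k coordinates is mapped by \<open>Q\<close> to a
   combination of columns lying in \<open>W\<close>.\<close>
 have in_W: "Q *\<^sub>v v\<in>W" if v: "v\<in>carrier_vec d" "m \<le> k" "!!i. m \<le> i ==> i < d ==> v $ i=0" for v m
  using v
 proof (induction m arbitrary: v)
  case 0
  hence "v=0\<^sub>v d" by (intro eq_vecI) auto
  moreover have "Q *\<^sub>v 0\<^sub>v d=0\<^sub>v d" using Q(1) by auto
  ultimately show ?case using W by simp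
 next
  case (Suc m)
  have md: "m < d" using Suc.prems(2) k(1) by (auto simp: P_def)
  define u where "u=vec d (%i. if i=m then 0 else v $ i)"
  have u: "u\<in>carrier_vec d" by (simp add: u_def)
  have v: "v=u + (v $ m) \<cdot>\<^sub>v unit_vec d m"
   using Suc.prems(1) md by (intro eq_vecI) (auto simp: u_def)
  have "Q *\<^sub>v u\<in>W" using Suc.prems by (intro Suc.IH) (auto simp: u_def)
  moreover have "Q *\<^sub>v unit_vec d m\<in>W"
  proof -
   have "Q *\<^sub>v unit_vec d m=col Q m" using Q(1) md by (intro eq_vecI) auto
   thus ?thesis using Q(5)[of m] Suc.prems(2) by simp
  qed
  ultimately have "Q *\<^sub>v u + (v $ m) \<cdot>\<^sub>v (Q *\<^sub>v unit_vec d m)\<in>W" using add smult by blast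
  also have "Q *\<^sub>v u + (v $ m) \<cdot>\<^sub>v (Q *\<^sub>v unit_vec d m)=Q *\<^sub>v (u + (v $ m) \<cdot>\<^sub>v unit_vec d m)"
   using u by (subst mult_add_distrib_mat_vec[OF Q(1)]) (auto simp: mult_mat_vec[OF Q(1)])
  finally show ?case by (simp only: v[symmetric])
 qed
 have "k < d"
 proof (rule ccontr)
  assume "\<not> k < d"
  hence "k=d" using k(1) by (auto simp: P_def)
  have "w\<in>W" if "w\<in>carrier_vec d" for w
   using in_W[of "Q' *\<^sub>v w" k] that Q(2) QQ(1)[OF that] \<open>k = d\<close> by auto
  thus False using W(1) proper(2) by blast
 qed
 have coord: "(Q' *\<^sub>v w) $ i=0" if w: "w\<in>W" and i: "k \<le> i" "i < d" for w i
 proof (rule ccontr)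
  define v where "v=Q' *\<^sub>v w"
  assume "(Q' *\<^sub>v w) $ i ~= 0"
  hence vi: "v $ i ~= 0" by (simp add: v_def)
  have wc: "w\<in>carrier_vec d" using w W by blast
  have v: "v\<in>carrier_vec d" "Q *\<^sub>v v=w" using Q(2) wc QQ(1)[OF wc] by (auto simp: v_def)
  \<comment> \<open>Exchange step: if w has a nonzero coordinate at some i beyond the first k, then
    in \<open>Q * M\<close> column k is w and, unless i = k, column i is the old column k. The
    matrix \<open>M\<close> is invertible because v at i is nonzero, and \<open>Q * M\<close> has k
    + 1 columns in \<open>W\<close>, against the choice of k.\<close>
  define s where "s=(%j. if j=i then k else j)"
  define M where "M=mat d d (%(r, j). if j=k then v $ r else if r = s j then 1 else 0)"
  have M: "M\<in>carrier_mat d d" by (simp add: M_def)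
  have "det M ~= 0"
  proof
   assume "det M=0"
   then obtain x where x: "x\<in>carrier_vec d" "x ~= 0\<^sub>v d" "M *\<^sub>v x=0\<^sub>v d"
    using det_0_iff_vec_prod_zero_field[OF M] by metis
   have row: "(\<Sum>j<d. M $$ (r, j) * x $ j)=0" if "r < d" for r
   proof -
    have "(M *\<^sub>v x) $ r=(\<Sum>j<d. M $$ (r, j) * x $ j)"
     using that x(1) M by (auto simp: scalar_prod_def lessThan_atLeast0 intro!: sum.cong)
    thus ?thesis using x(3) that by simp
   qed
   have "(\<Sum>j<d. M $$ (i, j) * x $ j)=(\<Sum>j<d. if j=k then v $ i * x $ k else 0)"
    using i by (intro sum.cong refl) (auto simp: M_def s_def)
   hence "v $ i * x $ k=0" using row[OF i(2)] \<open>k < d\<close> by simp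
   hence xk: "x $ k=0" using vi by simp
   have "x $ j=0" if j: "j < d" "j ~= k" for j
   proof -
    have sj: "s j < d" using j \<open>k < d\<close> by (auto simp: s_def)
    have inj: "s j' = s j ==> j' ~= k ==> j'=j" for j' using j by (auto simp: s_def split: if_splits)
    have "(\<Sum>j'<d. M $$ (s j, j') * x $ j')=(\<Sum>j'<d. if j'=j then x $ j else 0)"
     using sj xk inj j by (intro sum.cong refl) (auto simp: M_def)
    thus ?thesis using row[OF sj] j by simp
   qed
   hence "x $ j=0" if "j < d" for j using xk that by (cases "j=k") auto
   hence "x=0\<^sub>v d" using x(1) by (intro eq_vecI) auto
   thus False using x(2) by simp
  qed
  from det_non_zero_imp_unit[OF M this, of "()"]
  obtain M' where M': "M'\<in>carrier_mat d d" "M' * M=1\<^sub>m d" "M * M'=1\<^sub>m d"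
   unfolding Units_def ring_mat_def by auto
  have eqs: "Q * M*(M' * Q')=Q*(M * M') * Q'" "M' * Q'*(Q * M)=M'*(Q' * Q) * M"
   using Q(1,2) M M'(1) by (simp_all add: assoc_mult_mat[of _ d d _ d _ d])
  have inv: "Q * M*(M' * Q')=1\<^sub>m d" "M' * Q'*(Q * M)=1\<^sub>m d"
   unfolding eqs Q(4) M'(3) using Q M M' by simp_all
  have cols: "col (Q * M) j\<in>W" if j: "j < Suc k" for j
  proof -
   have jd: "j < d" using j \<open>k < d\<close> by simp
   have "j ~= i" if "j ~= k" using that j i by simp
   hence "col M j=(if j=k then v else unit_vec d j)"
    using jd v(1) by (auto simp: M_def s_def intro!: eq_vecI)
   moreover have "col (Q * M) j=Q *\<^sub>v col M j"
    using jd Q(1) M by (intro eq_vecI) (auto simp: col_def)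
   moreover have "Q *\<^sub>v unit_vec d j=col Q j" using Q(1) jd by (intro eq_vecI) auto
   ultimately show ?thesis
    using j Q(5) v(2) w by (cases "j=k") auto
  qed
  have "Suc k \<le> d" "Q * M\<in>carrier_mat d d" "M' * Q'\<in>carrier_mat d d" using \<open>k < d\<close> Q M M' by auto
  hence "P (Suc k)" unfolding P_def using inv cols by blast
  thus False using k(2)[of "Suc k"] by simp
 qed
 have "k > 0"
 proof (rule ccontr)
  assume "\<not> k > 0"
  have "w=0\<^sub>v d" if w: "w\<in>W" for w
  proof -
   have wc: "w\<in>carrier_vec d" using w W by blast
   have "Q' *\<^sub>v w=0\<^sub>v d" using coord[OF w] \<open>\<not> k > 0\<close> Q(2) wc by (intro eq_vecI) auto
   moreover have "Q *\<^sub>v 0\<^sub>v d=0\<^sub>v d" using Q(1) by auto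
   ultimately show ?thesis using QQ(1)[OF wc] by simp
  qed
  thus False using W(2) proper(1) by blast
 qed
 show thesis by (rule that[OF \<open>0 < k\<close> \<open>k < d\<close> Q coord])
qed

section \<open>Block matrices and complete reducibility\<close>

lemma four_block_mat_inject:
 assumes "A\<in>carrier_mat n n" "B\<in>carrier_mat n m" "C\<in>carrier_mat m n" "D\<in>carrier_mat m m"
  "A'\<in>carrier_mat n n" "B'\<in>carrier_mat n m" "C'\<in>carrier_mat m n" "D'\<in>carrier_mat m m"
  and eq: "four_block_mat A B C D=four_block_mat A' B' C' D'"
 shows "A=A'" "B=B'" "D=D'"
proof -
 have e: "four_block_mat A B C D $$ (i, j)=four_block_mat A' B' C' D' $$ (i, j)" for i j
  by (simp only: eq)
 show "A=A'"
 proof (rule eq_matI)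
  fix i j assume "i < dim_row A'" "j < dim_col A'"
  thus "A $$ (i, j)=A' $$ (i, j)" using e[of i j] assms(1-8) by (simp split: if_splits)
 qed (use assms in auto)
 show "B=B'"
 proof (rule eq_matI)
  fix i j assume "i < dim_row B'" "j < dim_col B'"
  thus "B $$ (i, j)=B' $$ (i, j)" using e[of i "n + j"] assms(1-8) by (simp split: if_splits)
 qed (use assms in auto)
 show "D=D'"
 proof (rule eq_matI)
  fix i j assume "i < dim_row D'" "j < dim_col D'"
  thus "D $$ (i, j)=D' $$ (i, j)" using e[of "n + i" "n + j"] assms(1-8) by (simp split: if_splits)
 qed (use assms in auto)
qed

lemma mult_upper_blocks:
 fixes A A' B B' D D' :: "complex mat"
 assumes c: "A\<in>carrier_mat n n" "B\<in>carrier_mat n m" "D\<in>carrier_mat m m"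
  "A'\<in>carrier_mat n n" "B'\<in>carrier_mat n m" "D'\<in>carrier_mat m m"
 shows "four_block_mat A B (0\<^sub>m m n) D * four_block_mat A' B' (0\<^sub>m m n) D' =
  four_block_mat (A * A') (A * B' + B * D') (0\<^sub>m m n) (D * D')"
proof -
 have "four_block_mat A B (0\<^sub>m m n) D * four_block_mat A' B' (0\<^sub>m m n) D' =
  four_block_mat (A * A' + B*0\<^sub>m m n) (A * B' + B * D')
   (0\<^sub>m m n * A' + D*0\<^sub>m m n) (0\<^sub>m m n * B' + D * D')"
  using c by (intro mult_four_block_mat[of _ n n _ m _ m _ _ n _ m]) auto
 also have "A * A' + B*0\<^sub>m m n=A * A'"
  using c right_add_zero_mat[OF mult_carrier_mat[OF c(1,4)]] by simp
 also have "0\<^sub>m m n * A' + D*0\<^sub>m m n=0\<^sub>m m n" using c by simp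
 also have "0\<^sub>m m n * B' + D * D'=D * D'"
  using c left_add_zero_mat[OF mult_carrier_mat[OF c(3,6)]] by simp
 finally show ?thesis .
qed

context fin_group
begin

text \<open>The intertwining relation forces \<sigma>(g) = P \<rho>(g) Q, so multiplicativity is
  inherited and need not be checked for the matrices \<sigma>(g) at hand.\<close>

lemma rep_equivI:
 assumes \<rho>: "is_rep G \<rho>" and n: "rep_dim G \<rho>=n"
  and P: "P\<in>carrier_mat n n" "Q\<in>carrier_mat n n" "P * Q=1\<^sub>m n" "Q * P=1\<^sub>m n"
  and \<sigma>: "!!g. g\<in>carrier G ==> \<sigma> g\<in>carrier_mat n n" "!!g. g\<in>carrier G ==> P*\<rho> g=\<sigma> g * P"
 shows "is_rep G \<sigma> & rep_equiv G \<rho> \<sigma>"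
proof -
 have c: "\<rho> g\<in>carrier_mat n n" if "g\<in>carrier G" for g
  using is_rep_closed[OF \<rho> that] by (simp add: n)
 have \<sigma>_eq: "\<sigma> g=P*\<rho> g * Q" if g: "g\<in>carrier G" for g
  unfolding \<sigma>(2)[OF g] using assoc_mult_mat[OF \<sigma>(1)[OF g] P(1,2)] \<sigma>(1)[OF g] by (simp add: P(3))
 have dim: "rep_dim G \<sigma>=n" using \<sigma>(1)[of \<one>] by (simp add: rep_dim_def)
 have "\<sigma> (g \<otimes> h)=\<sigma> g*\<sigma> h" if gh: "g\<in>carrier G" "h\<in>carrier G" for g h
 proof -
  have "\<sigma> g*\<sigma> h=\<sigma> g*(P*\<rho> h) * Q"
   using gh \<sigma>(1) c P(1,2) by (simp add: \<sigma>_eq[OF gh(2)] assoc_mult_mat[of _ n n _ n _ n])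
  also have "...=\<sigma> g * P*\<rho> h * Q"
   using gh \<sigma>(1) c P(1,2) by (simp add: assoc_mult_mat[of _ n n _ n _ n])
  also have "...=P*(\<rho> g*\<rho> h) * Q"
   unfolding \<sigma>(2)[OF gh(1), symmetric]
   using gh \<sigma>(1) c P(1,2) by (simp add: assoc_mult_mat[of _ n n _ n _ n])
  finally show ?thesis using gh by (simp add: \<sigma>_eq is_rep_mult[OF \<rho>])
 qed
 moreover have "\<sigma> \<one>=1\<^sub>m n"
  using P by (simp add: \<sigma>_eq is_rep_one[OF \<rho>] n)
 ultimately have "is_rep G \<sigma>" unfolding is_rep_def dim using \<sigma>(1) by blast
 moreover have "rep_equiv G \<rho> \<sigma>"
  unfolding rep_equiv_def dim n using P \<sigma>(2) invertible_matI[OF P] by auto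
 ultimately show ?thesis ..
qed

text \<open>Maschke: averaging \<open>B(g) C(g\<^sup>-\<^sup>1)\<close> removes the off-diagonal block of a triangular representation.\<close>

lemma block_decomposition:
 assumes \<rho>: "is_rep G \<rho>" and n: "rep_dim G \<rho>=d" and red: "d > 0" "\<not> irreducible_rep G \<rho>"
 obtains A C k where "0 < k" "k < d" "is_rep G A" "is_rep G C" "rep_dim G A=k" "rep_dim G C=d - k"
  "is_rep G (%g. four_block_mat (A g) (0\<^sub>m k (d - k)) (0\<^sub>m (d - k) k) (C g))"
  "rep_equiv G \<rho> (%g. four_block_mat (A g) (0\<^sub>m k (d - k)) (0\<^sub>m (d - k) k) (C g))"
proof -
 have c: "\<rho> g\<in>carrier_mat d d" if "g\<in>carrier G" for g
  using is_rep_closed[OF \<rho> that] by (simp add: n)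
 obtain W where W: "VectorSpace.subspace class_ring W (module_vec TYPE(complex) d)"
  and inv: "!!g w. g\<in>carrier G ==> w\<in>W ==> \<rho> g *\<^sub>v w\<in>W" and
  proper: "W ~= {0\<^sub>v d}" "W ~= carrier_vec d"
  using red \<rho> unfolding irreducible_rep_def n by blast
 have sub: "submodule class_ring W (module_vec TYPE(complex) d)"
  using W by (simp add: VectorSpace.subspace_def)
 have W1: "W \<subseteq> carrier_vec d" "0\<^sub>v d\<in>W"
  using submodule.subset[OF sub] submodule.zero_closed[OF sub] by (simp_all add: module_vec_simps)
 have W2: "v + w\<in>W" "a \<cdot>\<^sub>v v\<in>W" if "v\<in>W" "w\<in>W" for v w a
  using submodule.m_closed[OF sub that] submodule.smult_closed[OF sub _ that(1), of a]
  by (simp_all add: module_vec_simps class_ring_simps)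
 obtain k Q Q' where k: "0 < k" "k < d" and Q: "Q\<in>carrier_mat d d" "Q'\<in>carrier_mat d d"
  "Q * Q'=1\<^sub>m d" "Q' * Q=1\<^sub>m d" and colQ: "!!j. j < k ==> col Q j\<in>W"
  and coord: "!!w i. w\<in>W ==> k \<le> i ==> i < d ==> (Q' *\<^sub>v w) $ i=0"
  using adapted_basis[OF W1 W2(1) W2(2) proper, of "%a v. v"] by metis
 define m where "m=d - k"
 have d: "d=k + m" using k by (simp add: m_def)
 define R where "R g=Q'*\<rho> g * Q" for g
 have Rc: "R g\<in>carrier_mat d d" if "g\<in>carrier G" for g using Q(1,2) c[OF that] by (auto simp: R_def)
 have comm: "Q'*\<rho> g=R g * Q'" if g: "g\<in>carrier G" for g
 proof -
  have "R g * Q'=Q'*\<rho> g*(Q * Q')"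
   unfolding R_def using Q(1,2) c[OF g] by (intro assoc_mult_mat[of _ d d _ d _ d]) auto
  thus ?thesis using Q(2) c[OF g] by (simp add: Q(3))
 qed
 have R: "is_rep G R" "rep_equiv G \<rho> R"
  using rep_equivI[OF \<rho> n Q(2,1,4,3) Rc comm] by auto
 have Rdim: "rep_dim G R=d" using Rc[of \<one>] by (simp add: rep_dim_def)
 \<comment> \<open>Column j of \<open>Q\<close> lies in \<open>W\<close>, hence so does its image
   under \<rho>(g), and elements of \<open>W\<close> have no coordinates from k on.\<close>
 have Rz: "R g $$ (i, j)=0" if g: "g\<in>carrier G" and "k \<le> i" "i < d" "j < k" for g i j
 proof -
  have jd: "j < d" using that k by simp
  have "R g=Q'*(\<rho> g * Q)" unfolding R_def using Q c[OF g] by (intro assoc_mult_mat) auto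
  hence "R g $$ (i, j)=(Q' *\<^sub>v col (\<rho> g * Q) j) $ i" using Q c[OF g] that jd by simp
  also have "col (\<rho> g * Q) j=\<rho> g *\<^sub>v col Q j" using Q c[OF g] jd by (intro eq_vecI) auto
  also have "(Q' *\<^sub>v (\<rho> g *\<^sub>v col Q j)) $ i=0" using coord[OF inv[OF g colQ[OF that(4)]]] that by simp
  finally show ?thesis .
 qed
 define A where "A g=mat k k (%(i, j). R g $$ (i, j))" for g
 define B where "B g=mat k m (%(i, j). R g $$ (i, k + j))" for g
 define C where "C g=mat m m (%(i, j). R g $$ (k + i, k + j))" for g
 have [simp]: "A g\<in>carrier_mat k k" "B g\<in>carrier_mat k m" "C g\<in>carrier_mat m m" for g
  by (simp_all add: A_def B_def C_def)
 have blk: "R g=four_block_mat (A g) (B g) (0\<^sub>m m k) (C g)" if g: "g\<in>carrier G" for g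
  using Rc[OF g] Rz[OF g] by (intro eq_matI) (auto simp: A_def B_def C_def d)
 have mult: "A (g \<otimes> h)=A g * A h" "B (g \<otimes> h)=A g * B h + B g * C h" "C (g \<otimes> h)=C g * C h"
  if g: "g\<in>carrier G" and h: "h\<in>carrier G" for g h
 proof -
  have "four_block_mat (A (g \<otimes> h)) (B (g \<otimes> h)) (0\<^sub>m m k) (C (g \<otimes> h)) =
   four_block_mat (A g * A h) (A g * B h + B g * C h) (0\<^sub>m m k) (C g * C h)"
   using is_rep_mult[OF R(1) g h] blk[OF g] blk[OF h] blk[OF m_closed[OF g h]]
    mult_upper_blocks[of "A g" k "B g" m "C g" "A h" "B h" "C h"] by simp
  note inject = four_block_mat_inject[OF _ _ _ _ _ _ _ _ this, of k m]
  show "A (g \<otimes> h)=A g * A h" "B (g \<otimes> h)=A g * B h + B g * C h" "C (g \<otimes> h)=C g * C h"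
   using inject mult_carrier_mat[of "A g" k k "A h" k] mult_carrier_mat[of "C g" m m "C h" m]
    mult_carrier_mat[of "A g" k k "B h" m] mult_carrier_mat[of "B g" k m "C h" m]
   by (simp_all add: add_carrier_mat)
 qed
 have one: "A \<one>=1\<^sub>m k" "C \<one>=1\<^sub>m m"
  using is_rep_one[OF R(1)] by (auto simp: A_def C_def Rdim d)
 have dims: "rep_dim G A=k" "rep_dim G C=m" by (simp_all add: rep_dim_def one)
 have AC: "is_rep G A" "is_rep G C" unfolding is_rep_def dims by (simp_all add: one mult)
 \<comment> \<open>The unipotent matrix with upper right block X conjugates the representation to
   block diagonal form as soon as A(h) X + B(h) = X C(h). The rule B(hg) = A(h) B(g) + B(h) C(g)
   gives B(hg) C((hg)^-1) C(h) = A(h) B(g) C(g^-1) + B(h); averaging over g shows that X = S/|G|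
   solves the equation.\<close>
 define S where "S=gsum k m (%g. B g * C (inv g))"
 define X where "X=(1 / of_nat (card (carrier G)) :: complex) \<cdot>\<^sub>m S"
 have Sc [simp]: "S\<in>carrier_mat k m" by (simp add: S_def)
 have Xc [simp]: "X\<in>carrier_mat k m" by (simp add: X_def)
 have AX: "A h * X + B h=X * C h" if h: "h\<in>carrier G" for h
 proof -
  have "A h * S=gsum k m (%g. A h*(B g * C (inv g)))"
   unfolding S_def by (intro gsum_mult_left mult_carrier_mat[of _ k m]) auto
  moreover have "S * C h=gsum k m (%g. B g * C (inv g) * C h)"
   unfolding S_def by (intro gsum_mult_right mult_carrier_mat[of _ k m]) auto
  moreover have "gsum k m (%g. B g * C (inv g) * C h)=gsum k m (%g. B (h \<otimes> g) * C (inv (h \<otimes> g)) * C h)"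
   by (rule gsum_reindex[OF bij_mult_left[OF h], symmetric])
  moreover have "gsum k m (%g. B (h \<otimes> g) * C (inv (h \<otimes> g)) * C h)=gsum k m (%g. A h*(B g * C (inv g)) + B h)"
  proof (rule gsum_cong)
   fix g assume g: "g\<in>carrier G"
   have "B (h \<otimes> g) * C (inv (h \<otimes> g)) * C h=B (h \<otimes> g)*(C (inv (h \<otimes> g)) * C h)"
    by (rule assoc_mult_mat[of _ k m _ m _ m]) auto
   also have "C (inv (h \<otimes> g)) * C h=C (inv g)"
    using g h by (simp add: mult(3)[symmetric] inv_mult_group m_assoc)
   also have "B (h \<otimes> g) * C (inv g)=A h * B g * C (inv g) + B h * C g * C (inv g)"
    unfolding mult(2)[OF h g] by (rule add_mult_distrib_mat[of _ k m _ _ m]) (auto intro: mult_carrier_mat[of _ k k _ m] mult_carrier_mat[of _ k m _ m])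
   also have "A h * B g * C (inv g)=A h*(B g * C (inv g))"
    by (rule assoc_mult_mat[of _ k k _ m _ m]) auto
   also have "B h * C g * C (inv g)=B h*(C g * C (inv g))"
    by (rule assoc_mult_mat[of _ k m _ m _ m]) auto
   also have "C g * C (inv g)=1\<^sub>m m" using g by (simp add: mult(3)[symmetric] one)
   also have "B h*1\<^sub>m m=B h" by (rule right_mult_one_mat[of _ k m]) simp
   finally show "B (h \<otimes> g) * C (inv (h \<otimes> g)) * C h=A h*(B g * C (inv g)) + B h" .
  qed
  moreover have "gsum k m (%g. A h*(B g * C (inv g)) + B h) =
   gsum k m (%g. A h*(B g * C (inv g))) + of_nat (card (carrier G)) \<cdot>\<^sub>m B h"
  proof (rule eq_matI)
   fix i j
   assume "i < dim_row (gsum k m (%g. A h*(B g * C (inv g))) + of_nat (card (carrier G)) \<cdot>\<^sub>m B h)"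
    "j < dim_col (gsum k m (%g. A h*(B g * C (inv g))) + of_nat (card (carrier G)) \<cdot>\<^sub>m B h)"
   hence ij: "i < k" "j < m" by (simp_all add: B_def)
   have "(A h*(B g * C (inv g)) + B h) $$ (i, j)=(A h*(B g * C (inv g))) $$ (i, j) + B h $$ (i, j)" for g
    using ij by (intro index_add_mat) (auto simp: B_def)
   thus "gsum k m (%g. A h*(B g * C (inv g)) + B h) $$ (i, j) =
    (gsum k m (%g. A h*(B g * C (inv g))) + of_nat (card (carrier G)) \<cdot>\<^sub>m B h) $$ (i, j)"
    using ij by (simp add: gsum_def B_def sum.distrib del: index_mult_mat index_add_mat(1))
     (simp add: B_def)
  qed (auto simp: gsum_def B_def)
  ultimately have "S * C h=A h * S + of_nat (card (carrier G)) \<cdot>\<^sub>m B h" by simp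
  hence "X * C h=(1 / of_nat (card (carrier G)) :: complex) \<cdot>\<^sub>m (A h * S + of_nat (card (carrier G)) \<cdot>\<^sub>m B h)"
   unfolding X_def by (subst mult_smult_assoc_mat[of _ k m _ m]) auto
  also have "...=A h * X + B h"
  proof -
   have "card (carrier G) ~= 0" using one_closed by (metis card_eq_0_iff empty_iff fin)
   moreover have "A h * X=(1 / of_nat (card (carrier G)) :: complex) \<cdot>\<^sub>m (A h * S)"
    unfolding X_def by (rule mult_smult_distrib[of _ k k _ m]) auto
   moreover have "A h * S\<in>carrier_mat k m" by (rule mult_carrier_mat[of _ k k]) auto
   ultimately show ?thesis
    by (simp add: add_smult_distrib_left_mat[of _ k m]) (auto intro!: eq_matI simp: B_def)
  qed
  finally show ?thesis by simp
 qed
 define U where "U=four_block_mat (1\<^sub>m k) X (0\<^sub>m m k) (1\<^sub>m m)"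
 define U' where "U'=four_block_mat (1\<^sub>m k) (- X) (0\<^sub>m m k) (1\<^sub>m m)"
 define blk where "blk g=four_block_mat (A g) (0\<^sub>m k m) (0\<^sub>m m k) (C g)" for g
 have Uc: "U\<in>carrier_mat d d" "U'\<in>carrier_mat d d" by (simp_all add: U_def U'_def d)
 have bc: "blk g\<in>carrier_mat d d" for g by (simp add: blk_def d)
 have UU: "U * U'=1\<^sub>m d" "U' * U=1\<^sub>m d"
  unfolding U_def U'_def d
  by (subst mult_upper_blocks[of _ k _ m]; simp add: right_mult_one_mat[of _ k m] left_mult_one_mat[of _ k m] uminus_l_inv_mat[of _ k m] add_uminus_minus_mat[of _ k m] minus_r_inv_mat[of _ k m])+
 have RU: "R g * U=U * blk g" if g: "g\<in>carrier G" for g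
 proof -
  have "R g * U=four_block_mat (A g) (A g * X + B g) (0\<^sub>m m k) (C g)"
   unfolding \<open>!!g. g \<in> carrier G ==> R g = four_block_mat (A g) (B g) (0\<^sub>m m k) (C g)\<close>[OF g] U_def
   by (subst mult_upper_blocks[of _ k _ m]) (simp_all add: right_mult_one_mat[of _ k k] right_mult_one_mat[of _ k m] right_mult_one_mat[of _ m m])
  also have "...=U * blk g"
   unfolding AX[OF g] U_def blk_def
   by (subst mult_upper_blocks[of _ k _ m])
    (simp_all add: left_mult_one_mat[of _ k k] left_mult_one_mat[of _ m m] left_add_zero_mat[OF mult_carrier_mat[of X k m "C g" m]])
  finally show ?thesis .
 qed
 have UR: "U' * R g=blk g * U'" if g: "g\<in>carrier G" for g
 proof -
  have "U' * R g=U'*(R g*(U * U'))" using Rc[OF g] Uc by (simp add: UU(1))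
  also have "R g*(U * U')=R g * U * U'" using Rc[OF g] Uc by (intro assoc_mult_mat[symmetric]) auto
  also have "R g * U * U'=U*(blk g * U')"
   unfolding RU[OF g] by (rule assoc_mult_mat[OF Uc(1) bc Uc(2)])
  also have "U'*(U*(blk g * U'))=(U' * U)*(blk g * U')"
   by (rule assoc_mult_mat[OF Uc(2,1) mult_carrier_mat[OF bc Uc(2)], symmetric])
  finally show ?thesis using left_mult_one_mat[OF mult_carrier_mat[OF bc[of g] Uc(2)]] by (simp only: UU(2))
 qed
 have "is_rep G blk" "rep_equiv G R blk"
  using rep_equivI[OF R(1) Rdim Uc(2,1) UU(2,1) bc UR] by auto
 moreover from this have "rep_equiv G \<rho> blk" using rep_equiv_trans[OF \<rho> R(1)] R(2) by blast
 ultimately show thesis using that[OF k AC] dims unfolding m_def blk_def by simp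
qed


definition diag_rep :: "('a => complex mat) list => 'a => complex mat"
 where "diag_rep \<tau>s=(%g. diag_block_mat (map (%\<tau>. \<tau> g) \<tau>s))"

text \<open>Strong induction on the dimension, with \<open>block_decomposition\<close> as the
  splitting step. Dimension 0 is excluded from irreducibility and is the empty list of
  summands.\<close>

lemma maschke:
 assumes "is_rep G \<rho>"
 shows "\<exists>\<tau>s. (\<forall>\<tau>\<in>set \<tau>s. irreducible_rep G \<tau>) & is_rep G (diag_rep \<tau>s) & rep_equiv G \<rho> (diag_rep \<tau>s)"
 using assms
proof (induction "rep_dim G \<rho>" arbitrary: \<rho> rule: less_induct)
 case (less \<rho>)
 note \<rho> = less.prems
 define d where "d = rep_dim G \<rho>"
 consider "d=0" | "irreducible_rep G \<rho>" | "d > 0" "\<not> irreducible_rep G \<rho>" by blast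
 thus ?case
 proof cases
  case 1
  have "\<rho> g=0\<^sub>m 0 0" if "g\<in>carrier G" for g
   using is_rep_closed[OF \<rho> that] 1 by (intro eq_matI) (auto simp: d_def)
  hence "is_rep G (diag_rep []) & rep_equiv G \<rho> (diag_rep [])"
   using 1 by (intro rep_equivI[OF \<rho>, of 0 "1\<^sub>m 0" "1\<^sub>m 0"]) (auto simp: diag_rep_def d_def)
  thus ?thesis by (intro exI[of _ "[]"]) auto
 next
  case 2
  have "diag_rep [\<rho>]=\<rho>" by (simp add: diag_rep_def del: diag_block_mat.simps)
  thus ?thesis using 2 \<rho> rep_equiv_refl[OF \<rho>] by (intro exI[of _ "[\<rho>]"]) auto
 next
  case 3
  obtain A C k where k: "0 < k" "k < d" and AC: "is_rep G A" "is_rep G C" "rep_dim G A=k" "rep_dim G C=d - k"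
   and blk: "is_rep G (%g. four_block_mat (A g) (0\<^sub>m k (d - k)) (0\<^sub>m (d - k) k) (C g))"
   "rep_equiv G \<rho> (%g. four_block_mat (A g) (0\<^sub>m k (d - k)) (0\<^sub>m (d - k) k) (C g))"
   by (rule block_decomposition[OF \<rho> d_def[symmetric] 3])
  define m where "m=d - k"
  have m: "d=k + m" using k by (simp add: m_def)
  note AC = AC[folded m_def] and blk = blk[folded m_def]
  obtain xs where xs: "\<forall>\<tau>\<in>set xs. irreducible_rep G \<tau>" "is_rep G (diag_rep xs)" "rep_equiv G A (diag_rep xs)"
   using less.hyps[of A] AC k by (auto simp: d_def)
  obtain ys where ys: "\<forall>\<tau>\<in>set ys. irreducible_rep G \<tau>" "is_rep G (diag_rep ys)" "rep_equiv G C (diag_rep ys)"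
   using less.hyps[of C] AC k m by (auto simp: d_def)
  obtain P where P: "P\<in>carrier_mat k k" "invertible_mat P" "!!g. g\<in>carrier G ==> P * A g=diag_rep xs g * P"
   using xs(3) unfolding rep_equiv_def AC by auto
  obtain P' where P': "P'\<in>carrier_mat k k" "P * P'=1\<^sub>m k" "P' * P=1\<^sub>m k"
   using invertible_matE[OF P(2,1)] .
  obtain Q where Q: "Q\<in>carrier_mat m m" "invertible_mat Q" "!!g. g\<in>carrier G ==> Q * C g=diag_rep ys g * Q"
   using ys(3) unfolding rep_equiv_def AC by auto
  obtain Q' where Q': "Q'\<in>carrier_mat m m" "Q * Q'=1\<^sub>m m" "Q' * Q=1\<^sub>m m"
   using invertible_matE[OF Q(2,1)] .
  have dx: "rep_dim G (diag_rep xs)=k" "rep_dim G (diag_rep ys)=m"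
   using xs(3) ys(3) AC by (simp_all add: rep_equiv_def)
  have c: "A g\<in>carrier_mat k k" "C g\<in>carrier_mat m m" "diag_rep xs g\<in>carrier_mat k k" "diag_rep ys g\<in>carrier_mat m m"
   if "g\<in>carrier G" for g
   using is_rep_closed[OF AC(1) that] is_rep_closed[OF AC(2) that] is_rep_closed[OF xs(2) that] is_rep_closed[OF ys(2) that]
   by (simp_all add: AC dx)
  have app: "diag_rep (xs @ ys) g=four_block_mat (diag_rep xs g) (0\<^sub>m k m) (0\<^sub>m m k) (diag_rep ys g)"
   if "g\<in>carrier G" for g
   using c[OF that] by (simp add: diag_rep_def diag_block_mat_append Let_def)
  define blk' where "blk'=(%g. four_block_mat (A g) (0\<^sub>m k m) (0\<^sub>m m k) (C g))"
  note blk = blk[folded blk'_def]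
  have dim: "rep_dim G blk'=k + m" using blk(2) by (simp add: rep_equiv_def d_def[symmetric] m)
  have mult0: "four_block_mat a (0\<^sub>m k m) (0\<^sub>m m k) b * four_block_mat a' (0\<^sub>m k m) (0\<^sub>m m k) b' =
    four_block_mat (a * a') (0\<^sub>m k m) (0\<^sub>m m k) (b * b')"
   if "a\<in>carrier_mat k k" "b\<in>carrier_mat m m" "a'\<in>carrier_mat k k" "b'\<in>carrier_mat m m" for a b a' b' :: "complex mat"
   using that by (subst mult_upper_blocks[of _ k _ m]) (simp_all add: right_mult_zero_mat[of _ k k] left_mult_zero_mat[of _ m m])
  have "is_rep G (diag_rep (xs @ ys)) & rep_equiv G blk' (diag_rep (xs @ ys))"
  proof (rule rep_equivI[OF blk(1) dim, where P = "four_block_mat P (0\<^sub>m k m) (0\<^sub>m m k) Q" and Q = "four_block_mat P' (0\<^sub>m k m) (0\<^sub>m m k) Q'"])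
   fix g assume g: "g\<in>carrier G"
   show "diag_rep (xs @ ys) g\<in>carrier_mat (k + m) (k + m)" using c[OF g] by (simp add: app[OF g])
   show "four_block_mat P (0\<^sub>m k m) (0\<^sub>m m k) Q * blk' g=diag_rep (xs @ ys) g * four_block_mat P (0\<^sub>m k m) (0\<^sub>m m k) Q"
    unfolding app[OF g] blk'_def mult0[OF P(1) Q(1) c(1)[OF g] c(2)[OF g]] mult0[OF c(3)[OF g] c(4)[OF g] P(1) Q(1)]
    by (simp only: P(3)[OF g] Q(3)[OF g])
  qed (use P(1) Q(1) P' Q' in \<open>simp_all add: mult0\<close>)
  moreover from this have "rep_equiv G \<rho> (diag_rep (xs @ ys))"
   using rep_equiv_trans[OF \<rho> blk(1) _ blk(2)] by blast
  ultimately show ?thesis using xs(1) ys(1) by (intro exI[of _ "xs @ ys"]) auto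
 qed
qed

lemma sum_lessThan_split:
 fixes a b :: "nat => complex"
 shows "(\<Sum>i<n + m. if i < n then a i else b (i - n))=(\<Sum>i<n. a i) + (\<Sum>i<m. b i)"
 by (induction m) auto

lemma character_diag_rep:
 assumes "\<forall>\<tau>\<in>set \<tau>s. irreducible_rep G \<tau>" "g\<in>carrier G"
 shows "character (diag_rep \<tau>s) g=(\<Sum>\<tau>\<leftarrow>\<tau>s. character \<tau> g)"
 using assms
proof (induction \<tau>s)
 case Nil
 thus ?case by (simp add: character_def diag_rep_def)
next
 case (Cons \<tau> \<tau>s)
 let ?D = "diag_rep \<tau>s g"
 have \<tau>: "\<tau> g\<in>carrier_mat (rep_dim G \<tau>) (rep_dim G \<tau>)"
  using Cons.prems by (intro is_rep_closed irr_is_rep) auto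
 have sq: "\<forall>\<tau>\<in>set \<tau>s. square_mat (\<tau> g)"
  using Cons.prems is_rep_closed irr_is_rep by (metis carrier_matD list.set_intros(2) square_mat.simps)
 have D: "?D\<in>carrier_mat (dim_row ?D) (dim_row ?D)"
  using diag_block_mat_square[of "map (%\<tau>. \<tau> g) \<tau>s"] sq by (auto simp: diag_rep_def)
 have "diag_rep (\<tau> # \<tau>s) g=four_block_mat (\<tau> g) (0\<^sub>m (rep_dim G \<tau>) (dim_row ?D)) (0\<^sub>m (dim_row ?D) (rep_dim G \<tau>)) ?D"
 proof -
  have "diag_rep (\<tau> # \<tau>s) g=four_block_mat (\<tau> g) (0\<^sub>m (dim_row (\<tau> g)) (dim_col ?D)) (0\<^sub>m (dim_row ?D) (dim_col (\<tau> g))) ?D"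
   by (simp add: diag_rep_def Let_def)
  moreover have "dim_row (\<tau> g) = rep_dim G \<tau>" "dim_col (\<tau> g) = rep_dim G \<tau>" "dim_col ?D=dim_row ?D"
   by (rule carrier_matD(1)[OF \<tau>] carrier_matD(2)[OF \<tau>] carrier_matD(2)[OF D])+
  ultimately show ?thesis by (simp only:)
 qed
 moreover have "tr (four_block_mat (\<tau> g) (0\<^sub>m n m) (0\<^sub>m m n) B)=tr (\<tau> g) + tr B"
  if B: "B\<in>carrier_mat m m" and n: "\<tau> g\<in>carrier_mat n n" for B n m
 proof -
  have "tr (four_block_mat (\<tau> g) (0\<^sub>m n m) (0\<^sub>m m n) B) =
   (\<Sum>i<n + m. if i < n then \<tau> g $$ (i, i) else B $$ (i - n, i - n))"
   unfolding tr_def using B n by (intro sum.cong) auto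
  also have "...=tr (\<tau> g) + tr B"
   unfolding tr_def using B n
   using sum_lessThan_split[where n = n and m = m and a = "%i. \<tau> g $$ (i, i)" and b = "%i. B $$ (i, i)"] by simp
  finally show ?thesis .
 qed
 ultimately have "character (diag_rep (\<tau> # \<tau>s)) g=character \<tau> g + character (diag_rep \<tau>s) g"
  unfolding character_eq_tr using \<tau> D by metis
 thus ?case using Cons by simp
qed

section \<open>Multiplicities, finiteness of the dual, and the expansion of a character\<close>

lemma multiplicity_in_eq:
 assumes \<rho>: "is_rep G \<rho>" and \<theta>0: "irreducible_rep G \<theta>0" and \<theta>: "is_rep G \<theta>" "rep_equiv G \<theta>0 \<theta>"
  and \<tau>s: "\<forall>\<tau>\<in>set \<tau>s. irreducible_rep G \<tau>" "is_rep G (diag_rep \<tau>s)" "rep_equiv G \<rho> (diag_rep \<tau>s)"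
 shows "multiplicity_in G \<theta> \<rho>=length (filter (rep_equiv G \<theta>0) \<tau>s)"
proof -
 have r0: "is_rep G \<theta>0" using \<theta>0 by (rule irr_is_rep)
 have eq: "rep_equiv G \<theta> \<tau> \<longleftrightarrow> rep_equiv G \<theta>0 \<tau>" if "is_rep G \<tau>" for \<tau>
  using rep_equiv_trans[OF r0 \<theta>(1) that] rep_equiv_trans[OF \<theta>(1) r0 that] rep_equiv_sym[OF r0 \<theta>] \<theta>(2) by blast
 \<comment> \<open>In every decomposition, the order of the group times the number of summands
   equivalent to \<theta>0 equals \<open>S\<close> by orthogonality. Since \<open>S\<close> depends
   on \<rho> only, the count is the same for all decompositions and the definite description in
   \<open>multiplicity_in\<close> has a value.\<close>
 define S where "S=(\<Sum>g\<in>carrier G. character \<theta>0 (inv g) * character \<rho> g)"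
 have card: "of_nat (card (carrier G)) ~= (0::complex)" using one_closed fin by (auto simp: card_eq_0_iff)
 have count: "of_nat (card (carrier G)) * of_nat (length (filter (rep_equiv G \<theta>) \<sigma>s))=S"
  if irr: "\<forall>\<tau>\<in>set \<sigma>s. irreducible_rep G \<tau>" and eqv: "rep_equiv G \<rho> (diag_rep \<sigma>s)" for \<sigma>s
 proof -
  \<comment> \<open>In \<open>multiplicity_in\<close> the block sum is only required to be
    intertwined with \<rho>; that it is itself a representation follows from the intertwiner, once
    its matrices are seen to have the right size.\<close>
  have dr: "is_rep G (diag_rep \<sigma>s)"
  proof -
   have n: "rep_dim G (diag_rep \<sigma>s) = rep_dim G \<rho>" using eqv by (simp add: rep_equiv_def)
   have sum_dim: "diag_rep \<sigma>s g\<in>carrier_mat (\<Sum>\<tau>\<leftarrow>\<sigma>s. rep_dim G \<tau>) (\<Sum>\<tau>\<leftarrow>\<sigma>s. rep_dim G \<tau>)"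
    if g: "g\<in>carrier G" for g
   proof -
    have "dim_row (\<tau> g) = rep_dim G \<tau> & dim_col (\<tau> g) = rep_dim G \<tau>" if "\<tau>\<in>set \<sigma>s" for \<tau>
     using is_rep_closed[OF irr_is_rep g, of \<tau>] irr that by auto
    hence "map dim_row (map (%\<tau>. \<tau> g) \<sigma>s)=map (rep_dim G) \<sigma>s" "map dim_col (map (%\<tau>. \<tau> g) \<sigma>s)=map (rep_dim G) \<sigma>s"
     by simp_all
    hence "dim_row (diag_rep \<sigma>s g)=(\<Sum>\<tau>\<leftarrow>\<sigma>s. rep_dim G \<tau>)" "dim_col (diag_rep \<sigma>s g)=(\<Sum>\<tau>\<leftarrow>\<sigma>s. rep_dim G \<tau>)"
     unfolding diag_rep_def dim_diag_block_mat by (simp_all only:)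
    thus ?thesis by (rule carrier_matI)
   qed
   have "diag_rep \<sigma>s g\<in>carrier_mat (rep_dim G \<rho>) (rep_dim G \<rho>)" if "g\<in>carrier G" for g
    using sum_dim[OF that] sum_dim[OF one_closed] n by (auto simp: rep_dim_def)
   moreover obtain P where "P\<in>carrier_mat (rep_dim G \<rho>) (rep_dim G \<rho>)" "invertible_mat P"
    "!!g. g\<in>carrier G ==> P*\<rho> g=diag_rep \<sigma>s g * P" using eqv unfolding rep_equiv_def by auto
   moreover from this(1,2) obtain Q where "Q\<in>carrier_mat (rep_dim G \<rho>) (rep_dim G \<rho>)"
    "P * Q=1\<^sub>m (rep_dim G \<rho>)" "Q * P=1\<^sub>m (rep_dim G \<rho>)" using invertible_matE by metis
   ultimately show ?thesis using rep_equivI[OF \<rho> refl] by metis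
  qed
  have "S=(\<Sum>g\<in>carrier G. character \<theta>0 (inv g)*(\<Sum>\<tau>\<leftarrow>\<sigma>s. character \<tau> g))"
   unfolding S_def
   by (intro sum.cong refl arg_cong[of _ _ "%x. _ * x"]) (simp add: rep_equiv_character[OF \<rho> dr eqv] character_diag_rep[OF irr])
  also have "...=(\<Sum>\<tau>\<leftarrow>\<sigma>s. \<Sum>g\<in>carrier G. character \<theta>0 (inv g) * character \<tau> g)"
   by (induction \<sigma>s) (simp_all add: sum.distrib distrib_left)
  also have "...=(\<Sum>\<tau>\<leftarrow>\<sigma>s. if rep_equiv G \<theta> \<tau> then of_nat (card (carrier G)) else 0)"
  proof (rule arg_cong[of _ _ sum_list], rule map_cong[OF refl])
   fix \<tau> assume "\<tau>\<in>set \<sigma>s"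
   hence \<tau>: "irreducible_rep G \<tau>" "is_rep G \<tau>" using irr irr_is_rep by auto
   show "(\<Sum>g\<in>carrier G. character \<theta>0 (inv g) * character \<tau> g) =
    (if rep_equiv G \<theta> \<tau> then of_nat (card (carrier G)) else 0)"
   proof (cases "rep_equiv G \<theta>0 \<tau>")
    case True
    have "(\<Sum>g\<in>carrier G. character \<theta>0 (inv g) * character \<tau> g) =
     (\<Sum>g\<in>carrier G. character \<theta>0 (inv g) * character \<theta>0 g)"
     by (intro sum.cong refl arg_cong[of _ _ "%x. _ * x"]) (simp add: rep_equiv_character[OF r0 \<tau>(2) True])
    thus ?thesis using True eq[OF \<tau>(2)] character_norm[OF \<theta>0] by simp
   next
    case False
    hence "\<not> rep_equiv G \<tau> \<theta>0" using rep_equiv_sym[OF \<tau>(2) r0] by blast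
    thus ?thesis using character_orthogonal[OF \<tau>(1) \<theta>0] False eq[OF \<tau>(2)] by simp
   qed
  qed
  also have "... = of_nat (card (carrier G)) * of_nat (length (filter (rep_equiv G \<theta>) \<sigma>s))"
   by (induction \<sigma>s) (simp_all add: distrib_left)
  finally show ?thesis by simp
 qed
 have "multiplicity_in G \<theta> \<rho>=length (filter (rep_equiv G \<theta>) \<tau>s)"
  unfolding multiplicity_in_def
 proof (rule the_equality)
  show "\<exists>\<tau>s'. (\<forall>\<tau>\<in>set \<tau>s'. irreducible_rep G \<tau>) &
    rep_equiv G \<rho> (%g. diag_block_mat (map (%\<tau>. \<tau> g) \<tau>s')) &
    length (filter (rep_equiv G \<theta>) \<tau>s)=length (filter (rep_equiv G \<theta>) \<tau>s')"
   using \<tau>s unfolding diag_rep_def by blast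
  fix k
  assume "\<exists>\<tau>s'. (\<forall>\<tau>\<in>set \<tau>s'. irreducible_rep G \<tau>) &
    rep_equiv G \<rho> (%g. diag_block_mat (map (%\<tau>. \<tau> g) \<tau>s')) &
    k=length (filter (rep_equiv G \<theta>) \<tau>s')"
  then obtain \<tau>s' where "\<forall>\<tau>\<in>set \<tau>s'. irreducible_rep G \<tau>" "rep_equiv G \<rho> (diag_rep \<tau>s')"
   "k=length (filter (rep_equiv G \<theta>) \<tau>s')" unfolding diag_rep_def by blast
  with count[of \<tau>s'] count[OF \<tau>s(1,3)] have "of_nat k=(of_nat (length (filter (rep_equiv G \<theta>) \<tau>s)) :: complex)"
   using card by (metis mult_cancel_left)
  thus "k=length (filter (rep_equiv G \<theta>) \<tau>s)" by simp
 qed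
 also have "filter (rep_equiv G \<theta>) \<tau>s=filter (rep_equiv G \<theta>0) \<tau>s"
  using \<tau>s(1) eq irr_is_rep by (intro filter_cong) auto
 finally show ?thesis .
qed

lemma IrrE:
 assumes "C\<in>Irr G"
 obtains \<rho> where "irreducible_rep G \<rho>" "C={\<sigma>. is_rep G \<sigma> & rep_equiv G \<rho> \<sigma>}" "\<rho>\<in>C"
proof -
 obtain \<rho> where \<rho>: "irreducible_rep G \<rho>" "C={\<sigma>. is_rep G \<sigma> & rep_equiv G \<rho> \<sigma>}"
  using assms unfolding Irr_def by blast
 moreover have "\<rho>\<in>C" using \<rho> irr_is_rep[OF \<rho>(1)] rep_equiv_refl by auto
 ultimately show thesis using that by blast
qed

lemma Irr_eqI:
 assumes "C\<in>Irr G" "C'\<in>Irr G" "\<sigma>\<in>C" "\<sigma>\<in>C'"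
 shows "C=C'"
proof -
 have "C1 \<subseteq> C2" if C: "C1\<in>Irr G" "C2\<in>Irr G" "\<sigma>\<in>C1" "\<sigma>\<in>C2" for C1 C2
 proof
  fix \<tau> assume \<tau>: "\<tau>\<in>C1"
  obtain \<rho>1 where 1: "irreducible_rep G \<rho>1" "C1={\<sigma>. is_rep G \<sigma> & rep_equiv G \<rho>1 \<sigma>}" using IrrE[OF C(1)] by metis
  obtain \<rho>2 where 2: "irreducible_rep G \<rho>2" "C2={\<sigma>. is_rep G \<sigma> & rep_equiv G \<rho>2 \<sigma>}" using IrrE[OF C(2)] by metis
  have r: "is_rep G \<rho>1" "is_rep G \<rho>2" "is_rep G \<sigma>" "is_rep G \<tau>"
   and e: "rep_equiv G \<rho>1 \<sigma>" "rep_equiv G \<rho>1 \<tau>" "rep_equiv G \<rho>2 \<sigma>"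
   using 1 2 C \<tau> by (auto intro: irr_is_rep)
  have "rep_equiv G \<rho>2 \<rho>1" by (rule rep_equiv_trans[OF r(2,3,1) e(3) rep_equiv_sym[OF r(1,3) e(1)]])
  hence "rep_equiv G \<rho>2 \<tau>" by (rule rep_equiv_trans[OF r(2,1,4) _ e(2)])
  thus "\<tau>\<in>C2" using r 2 by simp
 qed
 from this[of C C'] this[of C' C] assms show ?thesis by blast
qed

lemma Irr_class: "irreducible_rep G \<rho> ==> {\<sigma>. is_rep G \<sigma> & rep_equiv G \<rho> \<sigma>}\<in>Irr G"
 unfolding Irr_def by blast

lemma Irr_some:
 assumes "C\<in>Irr G"
 shows "(SOME \<theta>. \<theta>\<in>C)\<in>C"
 using IrrE[OF assms] someI by metis

text \<open>Bessel's inequality for the indicator function of the identity bounds \<open>\<Sum> n\<^sub>C\<^sup>2\<close> by the order of the group.\<close>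

lemma finite_Irr: "finite (Irr G)"
proof -
 let ?N = "card (carrier G)"
 have N: "?N > 0" using one_closed fin by (auto simp: card_gt_0_iff)
 have "card F\<le>?N" if F: "F \<subseteq> Irr G" "finite F" for F
 proof -
  have "\<exists>\<rho>. irreducible_rep G \<rho> & \<rho>\<in>C" if "C\<in>F" for C using IrrE[of C] F that by blast
  then obtain \<rho> where \<rho>: "!!C. C\<in>F ==> irreducible_rep G (\<rho> C) & \<rho> C\<in>C" by metis
  define n where "n C = rep_dim G (\<rho> C)" for C
  have n: "n C \<ge> 1" if "C\<in>F" for C using \<rho>[OF that] by (simp add: n_def irreducible_rep_def Suc_le_eq)
  have orth: "(\<Sum>g\<in>carrier G. cnj (character (\<rho> C) g) * character (\<rho> C') g)=(if C=C' then of_nat ?N else 0)"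
   if "C\<in>F" "C'\<in>F" for C C'
  proof -
   have "(\<Sum>g\<in>carrier G. cnj (character (\<rho> C) g) * character (\<rho> C') g) =
    (\<Sum>g\<in>carrier G. character (\<rho> C) (inv g) * character (\<rho> C') g)"
    using \<rho>[OF that(1)] by (intro sum.cong refl) (simp add: cnj_character irr_is_rep)
   moreover have "\<not> rep_equiv G (\<rho> C') (\<rho> C)" if "C ~= C'"
   proof
    assume e: "rep_equiv G (\<rho> C') (\<rho> C)"
    let ?C = "{\<sigma>. is_rep G \<sigma> & rep_equiv G (\<rho> C') \<sigma>}"
    have r: "is_rep G (\<rho> C)" "is_rep G (\<rho> C')" using \<rho>[OF \<open>C \<in> F\<close>] \<rho>[OF \<open>C' \<in> F\<close>] irr_is_rep by blast+
    have "?C\<in>Irr G" using Irr_class \<rho>[OF \<open>C' \<in> F\<close>] by blast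
    moreover have "\<rho> C\<in>?C" "\<rho> C'\<in>?C" using e r rep_equiv_refl by auto
    ultimately have "C=?C" "C'=?C"
     using Irr_eqI \<rho>[OF \<open>C \<in> F\<close>] \<rho>[OF \<open>C' \<in> F\<close>] F \<open>C \<in> F\<close> \<open>C' \<in> F\<close> by blast+
    thus False using that by simp
   qed
   ultimately show ?thesis
    using character_orthogonal[of "\<rho> C'" "\<rho> C"] character_norm[of "\<rho> C"] \<rho> that by auto
  qed
  \<comment> \<open>Up to the factor |G|, this is the orthogonal projection of the indicator
    function of 1 onto the span of the characters from \<open>F\<close>.\<close>
  define f where "f g=(\<Sum>C\<in>F. of_nat (n C) * character (\<rho> C) g)" for g
  have one: "character (\<rho> C) \<one> = of_nat (n C)" if "C\<in>F" for C
   using \<rho>[OF that] by (simp add: n_def character_one irr_is_rep)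
  define s where "s=(\<Sum>C\<in>F. (n C)\<^sup>2)"
  have f1: "f \<one> = of_nat s" unfolding f_def s_def by (simp add: one power2_eq_square)
  have ff: "(\<Sum>g\<in>carrier G. cnj (f g) * f g) = of_nat ?N * of_nat s"
  proof -
   have "(\<Sum>g\<in>carrier G. cnj (f g) * f g) =
    (\<Sum>g\<in>carrier G. \<Sum>C\<in>F. \<Sum>C'\<in>F. of_nat (n C) * of_nat (n C')*(cnj (character (\<rho> C) g) * character (\<rho> C') g))"
    unfolding f_def cnj_sum complex_cnj_mult complex_cnj_of_nat sum_product
    by (rule sum.cong[OF refl], rule sum.cong[OF refl], rule sum.cong[OF refl]) simp
   also have "...=(\<Sum>C\<in>F. \<Sum>C'\<in>F. of_nat (n C) * of_nat (n C')*(\<Sum>g\<in>carrier G. cnj (character (\<rho> C) g) * character (\<rho> C') g))"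
    unfolding sum_distrib_left by (subst sum.swap, rule sum.cong[OF refl], rule sum.swap)
   also have "...=(\<Sum>C\<in>F. \<Sum>C'\<in>F. if C'=C then of_nat (n C) * of_nat (n C) * of_nat ?N else 0)"
    by (rule sum.cong[OF refl], rule sum.cong[OF refl]) (simp add: orth)
   also have "... = of_nat ?N * of_nat s"
    using F(2) by (simp add: s_def sum_distrib_left power2_eq_square mult_ac)
   finally show ?thesis .
  qed
  \<comment> \<open>With N = |G|, the cross terms see only f(1) = s, so the sum of squares is N^2 -
    2 N s + N s.\<close>
  have "(\<Sum>g\<in>carrier G. (cmod (of_nat ?N*(if g=\<one> then 1 else 0) - f g))\<^sup>2) =
   Re (\<Sum>g\<in>carrier G. (of_nat ?N*(if g=\<one> then 1 else 0) - f g) * cnj (of_nat ?N*(if g=\<one> then 1 else 0) - f g))"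
   by (simp only: complex_norm_square[symmetric] of_real_sum[symmetric] Re_complex_of_real)
  also have "(\<Sum>g\<in>carrier G. (of_nat ?N*(if g=\<one> then 1 else 0) - f g) * cnj (of_nat ?N*(if g=\<one> then 1 else 0) - f g)) =
   (\<Sum>g\<in>carrier G. (if g=\<one> then of_nat ?N * of_nat ?N - of_nat ?N * cnj (f g) - of_nat ?N * f g else 0) + cnj (f g) * f g)"
   by (intro sum.cong refl) (simp add: algebra_simps)
  also have "... = of_nat ?N * of_nat ?N - of_nat ?N * of_nat s"
   unfolding sum.distrib ff using fin by (simp add: f1)
  finally have "real ?N * real ?N - real ?N * real s \<ge> 0"
   using sum_nonneg[of "carrier G" "%g. (cmod (of_nat ?N*(if g=\<one> then 1 else 0) - f g))\<^sup>2"] by simp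
  hence "s\<le>?N" using N by (simp flip: of_nat_mult)
  moreover have "card F \<le> s"
  proof -
   have "card F=(\<Sum>C\<in>F. 1)" by simp
   also have "... \<le> s" unfolding s_def by (rule sum_mono) (use n in \<open>simp add: one_le_power\<close>)
   finally show ?thesis .
  qed
  ultimately show ?thesis by simp
 qed
 thus ?thesis using infinite_arbitrarily_large[of "Irr G" "Suc ?N"] by (metis Suc_n_not_le_n)
qed

text \<open>The multiplicity of a class counts the summands of a fixed decomposition lying in it,
  and every summand lies in exactly one class, so exchanging the two sums returns the character. By
  \<open>finite_Irr\<close> the sum over classes is a genuine finite sum and not the default
  0.\<close>

theorem character_decomposition:
 assumes \<rho>: "is_rep G \<rho>" and g: "g\<in>carrier G"
 shows "character \<rho> g=(\<Sum>C\<in>Irr G. let \<theta>=(SOME \<theta>. \<theta>\<in>C) in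
  of_nat (multiplicity_in G \<theta> \<rho>) * character \<theta> g)"
proof -
 obtain \<tau>s where \<tau>s: "\<forall>\<tau>\<in>set \<tau>s. irreducible_rep G \<tau>" "is_rep G (diag_rep \<tau>s)" "rep_equiv G \<rho> (diag_rep \<tau>s)"
  using maschke[OF \<rho>] by blast
 define \<theta> where "\<theta> C=(SOME \<theta>. \<theta>\<in>C)" for C :: "('a => complex mat) set"
 have m: "of_nat (multiplicity_in G (\<theta> C) \<rho>)=(\<Sum>\<tau>\<leftarrow>\<tau>s. if \<tau>\<in>C then 1 else (0::complex))" if C: "C\<in>Irr G" for C
 proof -
  obtain \<theta>0 where \<theta>0: "irreducible_rep G \<theta>0" "C={\<sigma>. is_rep G \<sigma> & rep_equiv G \<theta>0 \<sigma>}" using IrrE[OF C] by metis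
  have "\<theta> C\<in>C" unfolding \<theta>_def by (rule Irr_some[OF C])
  hence "multiplicity_in G (\<theta> C) \<rho>=length (filter (rep_equiv G \<theta>0) \<tau>s)"
   using \<theta>0 by (intro multiplicity_in_eq[OF \<rho> \<theta>0(1) _ _ \<tau>s]) auto
  also have "filter (rep_equiv G \<theta>0) \<tau>s=filter (%\<tau>. \<tau>\<in>C) \<tau>s"
   using \<tau>s(1) \<theta>0(2) irr_is_rep by (intro filter_cong) auto
  also have "of_nat (length (filter (%\<tau>. \<tau>\<in>C) \<tau>s))=(\<Sum>\<tau>\<leftarrow>\<tau>s. if \<tau>\<in>C then 1 else (0::complex))"
   by (induction \<tau>s) auto
  finally show ?thesis .
 qed
 have "(\<Sum>C\<in>Irr G. of_nat (multiplicity_in G (\<theta> C) \<rho>) * character (\<theta> C) g) =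
  (\<Sum>C\<in>Irr G. \<Sum>\<tau>\<leftarrow>\<tau>s. if \<tau>\<in>C then character (\<theta> C) g else 0)"
  by (intro sum.cong refl) (simp add: m sum_list_mult_const[symmetric] if_distrib[of "%x. x*_"] cong: if_cong)
 also have "...=(\<Sum>\<tau>\<leftarrow>\<tau>s. \<Sum>C\<in>Irr G. if \<tau>\<in>C then character (\<theta> C) g else 0)"
  by (induction \<tau>s) (simp_all add: sum.distrib)
 also have "...=(\<Sum>\<tau>\<leftarrow>\<tau>s. character \<tau> g)"
 proof (rule arg_cong[of _ _ sum_list], rule map_cong[OF refl])
  fix \<tau> assume "\<tau>\<in>set \<tau>s"
  hence \<tau>: "irreducible_rep G \<tau>" "is_rep G \<tau>" using \<tau>s irr_is_rep by auto
  define C0 where "C0={\<sigma>. is_rep G \<sigma> & rep_equiv G \<tau> \<sigma>}"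
  have C0: "C0\<in>Irr G" "\<tau>\<in>C0" using Irr_class[OF \<tau>(1)] \<tau>(2) rep_equiv_refl by (auto simp: C0_def)
  have "(\<Sum>C\<in>Irr G. if \<tau>\<in>C then character (\<theta> C) g else 0) =
   (\<Sum>C\<in>Irr G. if C=C0 then character (\<theta> C0) g else 0)"
  proof (rule sum.cong[OF refl])
   fix C assume "C\<in>Irr G"
   hence "\<tau>\<in>C \<longleftrightarrow> C=C0" using Irr_eqI[OF _ C0(1) _ C0(2)] C0(2) by metis
   thus "(if \<tau>\<in>C then character (\<theta> C) g else 0)=(if C=C0 then character (\<theta> C0) g else 0)"
    by (cases "C=C0") simp_all
  qed
  also have "...=character (\<theta> C0) g" using C0 finite_Irr by simp
  also have "\<theta> C0\<in>C0" unfolding \<theta>_def by (rule Irr_some[OF C0(1)])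
  hence "character (\<theta> C0) g=character \<tau> g"
   using rep_equiv_character[OF \<tau>(2) _ _ g] unfolding C0_def by (metis (mono_tags, lifting) mem_Collect_eq)
  finally show "(\<Sum>C\<in>Irr G. if \<tau>\<in>C then character (\<theta> C) g else 0)=character \<tau> g" .
 qed
 also have "...=character \<rho> g"
  using rep_equiv_character[OF \<rho> \<tau>s(2,3) g] character_diag_rep[OF \<tau>s(1) g] by simp
 finally show ?thesis unfolding \<theta>_def Let_def by simp
qed

end

section \<open>Positive operators and kernel operators\<close>

definition l2 :: "('a => complex) => bool"
 where "l2 f \<longleftrightarrow> (%t. (norm (f t))\<^sup>2) summable_on UNIV"

definition ip :: "('a => complex) => ('a => complex) => complex"
 where "ip f g=(\<Sum>\<^sub>\<infinity>t. f t * cnj (g t))"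

definition nsq :: "('a => complex) => real"
 where "nsq f=(\<Sum>\<^sub>\<infinity>t. (norm (f t))\<^sup>2)"

lemma nsq_nonneg [simp]: "0 \<le> nsq f"
 unfolding nsq_def by (rule infsum_nonneg) simp

lemma finite_sum_le_nsq:
 assumes "l2 f" "finite F"
 shows "(\<Sum>t\<in>F. (norm (f t))\<^sup>2) \<le> nsq f"
 using assms unfolding l2_def nsq_def by (intro finite_sum_le_infsum) auto

lemma norm_le_nsq: "l2 f ==> (norm (f t))\<^sup>2 \<le> nsq f"
 using finite_sum_le_nsq[of f "{t}"] by simp

lemma l2I:
 assumes "!!F. finite F ==> (\<Sum>t\<in>F. (norm (f t))\<^sup>2) \<le> b"
 shows "l2 f" "nsq f \<le> b"
proof -
 show l: "l2 f" unfolding l2_def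
  by (rule nonneg_bdd_above_summable_on) (auto intro!: bdd_aboveI[of _ b] assms)
 show "nsq f \<le> b" using l unfolding l2_def nsq_def by (rule infsum_le_finite_sums) (rule assms)
qed

text \<open>Fatou's lemma for counting measure: finite partial sums pass to the pointwise
  limit.\<close>

lemma l2_limit:
 assumes "!!k. l2 (f k)" "!!k. nsq (f k) \<le> b" "!!t. (%k. f k t) \<longlonglongrightarrow> g t"
 shows "l2 g" "nsq g \<le> b"
proof -
 have "(\<Sum>t\<in>F. (norm (g t))\<^sup>2) \<le> b" if F: "finite F" for F
 proof (rule LIMSEQ_le_const2)
  show "(%k. \<Sum>t\<in>F. (norm (f k t))\<^sup>2) \<longlonglongrightarrow> (\<Sum>t\<in>F. (norm (g t))\<^sup>2)"
   by (intro tendsto_intros assms)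
  show "\<exists>N. \<forall>k\<ge>N. (\<Sum>t\<in>F. (norm (f k t))\<^sup>2) \<le> b"
   using finite_sum_le_nsq[OF assms(1) F] assms(2) order_trans by blast
 qed
 from l2I[of g b, OF this] show "l2 g" "nsq g \<le> b" by blast+
qed

lemma mult_le_sum_squares: "x * y \<le> x\<^sup>2 + y\<^sup>2" for x y :: real
proof -
 have "2*(x * y) \<le> x\<^sup>2 + y\<^sup>2" using sum_squares_bound[of x y] by simp
 moreover have "0 \<le> x\<^sup>2 + y\<^sup>2" by simp
 ultimately show ?thesis by linarith
qed

lemma l2_prod:
 assumes "l2 f" "l2 g"
 shows "(%t. norm (f t * cnj (g t))) summable_on UNIV" "(%t. f t * cnj (g t)) summable_on UNIV"
proof -
 show 1: "(%t. norm (f t * cnj (g t))) summable_on UNIV"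
 proof (rule Infinite_Sum.abs_summable_on_comparison_test')
  show "(%t. (norm (f t))\<^sup>2 + (norm (g t))\<^sup>2) summable_on UNIV"
   using assms unfolding l2_def by (rule summable_on_add)
  show "norm (f t * cnj (g t))\<le>(norm (f t))\<^sup>2 + (norm (g t))\<^sup>2" for t
   using mult_le_sum_squares[of "norm (f t)" "norm (g t)"] by (simp add: norm_mult)
 qed
 thus "(%t. f t * cnj (g t)) summable_on UNIV" by (rule abs_summable_summable)
qed

lemma nsq_add_le:
 assumes "l2 f" "l2 g"
 shows "l2 (%t. f t + g t)" "nsq (%t. f t + g t)\<le>2 * nsq f + 2 * nsq g"
proof -
 have "(\<Sum>t\<in>F. (norm (f t + g t))\<^sup>2)\<le>2 * nsq f + 2 * nsq g" if F: "finite F" for F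
 proof -
  have "(norm (f t + g t))\<^sup>2\<le>2*(norm (f t))\<^sup>2 + 2*(norm (g t))\<^sup>2" for t
  proof -
   have "(norm (f t + g t))\<^sup>2\<le>(norm (f t) + norm (g t))\<^sup>2"
    by (intro power_mono norm_triangle_ineq) simp
   also have "...\<le>2*(norm (f t))\<^sup>2 + 2*(norm (g t))\<^sup>2"
    using sum_squares_bound[of "norm (f t)" "norm (g t)"] by (simp add: power2_sum)
   finally show ?thesis .
  qed
  hence "(\<Sum>t\<in>F. (norm (f t + g t))\<^sup>2)\<le>(\<Sum>t\<in>F. 2*(norm (f t))\<^sup>2 + 2*(norm (g t))\<^sup>2)"
   by (rule sum_mono)
  also have "...\<le>2 * nsq f + 2 * nsq g"
   unfolding sum.distrib sum_distrib_left[symmetric]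
   using finite_sum_le_nsq[OF assms(1) F] finite_sum_le_nsq[OF assms(2) F] by simp
  finally show ?thesis .
 qed
 from l2I[of "%t. f t + g t", OF this] show "l2 (%t. f t + g t)" "nsq (%t. f t + g t)\<le>2 * nsq f + 2 * nsq g" by blast+
qed

lemma l2_scale: "l2 f ==> l2 (%t. a * f t)" and nsq_scale: "nsq (%t. a * f t)=(norm a)\<^sup>2 * nsq f"
 unfolding l2_def nsq_def norm_mult power_mult_distrib
 by (auto intro: summable_on_cmult_right simp only: infsum_cmult_right')

lemma l2_zero [simp]: "l2 (%_. 0)" by (simp add: l2_def)

lemma l2_diff: "l2 f ==> l2 g ==> l2 (%t. f t - g t)"
 using nsq_add_le(1)[of f "%t. -1 * g t"] l2_scale[of g "-1"] by simp

text \<open>If f is not summable then neither is its complex version, and both sides take the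
  default value 0.\<close>

lemma infsum_complex_of_real: "(\<Sum>\<^sub>\<infinity>t\<in>S. complex_of_real (f t)) = of_real (\<Sum>\<^sub>\<infinity>t\<in>S. f t)"
proof (cases "f summable_on S")
 case True
 thus ?thesis by (intro infsumI) (simp add: has_sum_of_real_iff)
next
 case False
 hence "\<not> (%t. complex_of_real (f t)) summable_on S" using summable_on_Re[of "%t. complex_of_real (f t)" S] by auto
 thus ?thesis using False by (simp add: infsum_not_exists)
qed

lemma ip_self: "ip f f = of_real (nsq f)"
 unfolding ip_def nsq_def infsum_complex_of_real[symmetric] complex_norm_square ..

lemma ip_cnj: "ip g f=cnj (ip f g)"
 unfolding ip_def infsum_cnj[symmetric] by (simp add: mult.commute)

lemma ip_add_left: "l2 f ==> l2 g ==> l2 h ==> ip (%t. f t + g t) h=ip f h + ip g h"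
 unfolding ip_def distrib_right by (intro infsum_add l2_prod)

lemma ip_scale_left: "ip (%t. a * f t) h=a * ip f h"
 unfolding ip_def mult.assoc by (rule infsum_cmult_right')

lemma ip_diff_left: "l2 f ==> l2 g ==> l2 h ==> ip (%t. f t - g t) h=ip f h - ip g h"
 using ip_add_left[of f "%t. -1 * g t" h] l2_scale[of g "-1"] ip_scale_left[of "-1" g h] by simp

lemma ip_diff_right: "l2 f ==> l2 g ==> l2 h ==> ip h (%t. f t - g t)=ip h f - ip h g"
 using ip_diff_left[of f g h] by (metis complex_cnj_diff ip_cnj)

lemma ip_scale_right: "ip h (%t. a * f t)=cnj a * ip h f"
 using ip_scale_left[of a f h] by (metis complex_cnj_mult ip_cnj)

lemma ip_zero_left [simp]: "ip (%_. 0) h=0" by (simp add: ip_def)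

lemma nsq_diff:
 assumes "l2 f" "l2 g"
 shows "nsq (%t. f t - g t)=nsq f - 2 * Re (ip f g) + nsq g"
proof -
 have "complex_of_real (nsq (%t. f t - g t))=ip f f - ip f g - (ip g f - ip g g)"
  using assms by (simp add: ip_self[symmetric] ip_diff_left ip_diff_right l2_diff)
 also have "...=ip f f - ip f g - cnj (ip f g) + ip g g" by (simp add: ip_cnj[of g f])
 finally have "Re (complex_of_real (nsq (%t. f t - g t)))=Re (ip f f - ip f g - cnj (ip f g) + ip g g)" by simp
 thus ?thesis by (simp add: ip_self)
qed

lemma nsq_zero_imp:
 assumes "l2 f" "nsq f\<le>0"
 shows "f=(%_. 0)"
proof
 fix t
 have "(norm (f t))\<^sup>2\<le>0" using norm_le_nsq[OF assms(1), of t] assms(2) by linarith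
 thus "f t=0" by simp
qed

text \<open>Weighted arithmetic-geometric mean inequality in each coordinate. The free weight c does
  the work of the Cauchy-Schwarz inequality: one term can be made small at the expense of the
  other.\<close>

lemma norm_ip_le:
 assumes "l2 f" "l2 g" "c > 0"
 shows "norm (ip f g) \<le> c * nsq f + nsq g / c"
proof -
 have "norm (ip f g)\<le>(\<Sum>\<^sub>\<infinity>t. norm (f t * cnj (g t)))"
  unfolding ip_def by (rule norm_infsum_bound[OF l2_prod(1)[OF assms(1,2)]])
 also have "...\<le>(\<Sum>\<^sub>\<infinity>t. c*(norm (f t))\<^sup>2 + (1 / c)*(norm (g t))\<^sup>2)"
 proof (rule infsum_mono)
  show "(%t. c*(norm (f t))\<^sup>2 + (1 / c)*(norm (g t))\<^sup>2) summable_on UNIV"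
   using assms unfolding l2_def by (intro summable_on_add summable_on_cmult_right)
  fix t
  have "0\<le>(sqrt c * norm (f t) - norm (g t) / sqrt c)\<^sup>2" by simp
  also have "...=c*(norm (f t))\<^sup>2 + (1 / c)*(norm (g t))\<^sup>2 - 2*(norm (f t) * norm (g t))"
   using assms(3) by (simp add: power2_diff power_mult_distrib power_divide)
  finally show "norm (f t * cnj (g t)) \<le> c*(norm (f t))\<^sup>2 + (1 / c)*(norm (g t))\<^sup>2"
   using mult_nonneg_nonneg[OF norm_ge_zero[of "f t"] norm_ge_zero[of "g t"]] unfolding norm_mult complex_mod_cnj by linarith
 qed (rule l2_prod(1)[OF assms(1,2)])
 also have "...=(\<Sum>\<^sub>\<infinity>t. c*(norm (f t))\<^sup>2) + (\<Sum>\<^sub>\<infinity>t. (1 / c)*(norm (g t))\<^sup>2)"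
  using assms(1,2) unfolding l2_def by (intro infsum_add summable_on_cmult_right)
 also have "...=c * nsq f + (1 / c) * nsq g"
  unfolding nsq_def infsum_cmult_right' ..
 finally show ?thesis by simp
qed

text \<open>
 The kernel of a positive operator \<open>T\<close>: with \<open>A = 1 - T/C\<close> a self-adjoint contraction, the numbers
 \<open>\<parallel>A\<^sup>j v\<parallel>\<^sup>2\<close> decrease, and \<open>\<parallel>A\<^sup>2\<^sup>k v - A\<^sup>2\<^sup>m v\<parallel>\<^sup>2\<close> is a combination of them, so the even iterates converge.
\<close>

locale pos_op =
 fixes V :: "('a => complex) set" and T :: "('a => complex) => 'a => complex" and C :: real
 assumes V_l2: "v\<in>V ==> l2 v"
  and V_comb: "v\<in>V ==> w\<in>V ==> (%t. v t - a * w t)\<in>V"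
  and V_lim: "(!!k. f k\<in>V) ==> (!!t. (%k. f k t) \<longlonglongrightarrow> g t) ==> l2 g ==> g\<in>V"
  and T_in: "v\<in>V ==> T v\<in>V"
  and T_sym: "v\<in>V ==> w\<in>V ==> ip (T v) w=ip v (T w)"
  and T_bound: "v\<in>V ==> nsq (T v) \<le> C * Re (ip (T v) v)"
  and T_cont: "(!!k. f k\<in>V) ==> g\<in>V ==> (!!t. (%k. f k t) \<longlonglongrightarrow> g t) ==> (%k. T (f k) t) \<longlonglongrightarrow> T g t"
  and C_pos: "C > 0"
begin

definition a :: complex
 where "a = of_real (1 / C)"

lemma a_simps: "cnj a=a" "norm a=1 / C" "Re (a * z)=Re z / C"
 using C_pos unfolding a_def by (simp_all del: of_real_divide add: norm_of_real)

lemma Re_ip_scale: "Re (ip v (%t. a * w t))=Re (ip v w) / C"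
 unfolding ip_scale_right a_simps ..

definition A :: "('a => complex) => 'a => complex"
 where "A v=(%t. v t - a * T v t)"

definition proj :: "('a => complex) => 'a => complex"
 where "proj v=(%t. lim (%k. (A ^^ (2 * k)) v t))"

lemma A_in: "v\<in>V ==> A v\<in>V"
 unfolding A_def by (intro V_comb T_in)

lemma A_pow_in: "v\<in>V ==> (A ^^ k) v\<in>V"
 by (induction k) (simp_all add: A_in)

lemma A_sym:
 assumes "v\<in>V" "w\<in>V"
 shows "ip (A v) w=ip v (A w)"
 unfolding A_def using assms
 by (simp add: ip_diff_left ip_diff_right V_l2 T_in l2_scale ip_scale_left ip_scale_right T_sym a_simps)

lemma A_pow_sym:
 assumes "v\<in>V" "w\<in>V"
 shows "ip ((A ^^ k) v) w=ip v ((A ^^ k) w)"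
 using assms
proof (induction k arbitrary: w)
 case (Suc k)
 have "ip ((A ^^ Suc k) v) w=ip ((A ^^ k) v) (A w)" using Suc.prems A_sym A_pow_in by simp
 also have "...=ip v ((A ^^ Suc k) w)" using Suc A_in by (simp add: funpow_swap1)
 finally show ?case .
qed simp

text \<open>Expanding gives the squared norm of v, minus twice the form of T at v over C, plus the
  squared norm of Tv over C^2. By \<open>T_bound\<close> the last term cancels half of the middle
  one.\<close>

lemma nsq_A:
 assumes v: "v\<in>V"
 shows "nsq (A v) \<le> nsq v - Re (ip (T v) v) / C" "nsq (A v) \<le> nsq v"
proof -
 have "nsq (A v)=nsq v - 2 * Re (ip v (T v)) / C + nsq (T v) / C\<^sup>2"
  unfolding A_def using v C_pos
  by (subst nsq_diff) (simp_all add: V_l2 T_in l2_scale Re_ip_scale nsq_scale a_simps(2) power_divide)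
 also have "nsq (T v) / C\<^sup>2 \<le> Re (ip (T v) v) / C"
  using T_bound[OF v] C_pos by (simp add: field_simps power2_eq_square)
 finally show 1: "nsq (A v) \<le> nsq v - Re (ip (T v) v) / C"
  unfolding T_sym[OF v v] by simp
 have "0 \<le> C * Re (ip (T v) v)" using T_bound[OF v] nsq_nonneg[of "T v"] by linarith
 hence "0 \<le> Re (ip (T v) v)" using C_pos by (simp add: zero_le_mult_iff)
 hence "0 \<le> Re (ip (T v) v) / C" using C_pos by simp
 thus "nsq (A v) \<le> nsq v" using 1 by linarith
qed

lemma nsq_A_pow_mono: "v\<in>V ==> j \<le> k ==> nsq ((A ^^ k) v) \<le> nsq ((A ^^ j) v)"
 by (rule lift_Suc_antimono_le[of "%k. nsq ((A ^^ k) v)"]) (simp_all add: nsq_A(2) A_pow_in)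

text \<open>Self-adjointness distributes the 2k + 2m factors of the cross term evenly, so it becomes
  the squared norm of the (k+m)-th iterate. This is why only even exponents are used.\<close>

lemma nsq_A_pow_diff:
 assumes v: "v\<in>V"
 shows "nsq (%t. (A ^^ (2 * k)) v t - (A ^^ (2 * m)) v t) =
  nsq ((A ^^ (2 * k)) v) - 2 * nsq ((A ^^ (k + m)) v) + nsq ((A ^^ (2 * m)) v)"
proof -
 have "ip ((A ^^ (2 * k)) v) ((A ^^ (2 * m)) v)=ip v ((A ^^ (2 * k)) ((A ^^ (2 * m)) v))"
  by (rule A_pow_sym[OF v A_pow_in[OF v]])
 also have "(A ^^ (2 * k)) ((A ^^ (2 * m)) v)=(A ^^ (k + m)) ((A ^^ (k + m)) v)"
 proof -
  have "2 * k + 2 * m=(k + m) + (k + m)" by simp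
  thus ?thesis by (metis comp_apply funpow_add)
 qed
 also have "ip v ((A ^^ (k + m)) ((A ^^ (k + m)) v))=ip ((A ^^ (k + m)) v) ((A ^^ (k + m)) v)"
  by (rule A_pow_sym[OF v A_pow_in[OF v], symmetric])
 finally show ?thesis by (simp add: nsq_diff V_l2 A_pow_in v ip_self)
qed

text \<open>The squared norms of the iterates decrease to some l. Two of them lie below l + e/2 and
  the one counted with factor -2 is at least l, so the combination is below e.\<close>

lemma nsq_A_pow_Cauchy:
 assumes v: "v\<in>V" and e: "e > 0"
 obtains N where "!!k m. k \<ge> N ==> m \<ge> N ==> nsq (%t. (A ^^ (2 * k)) v t - (A ^^ (2 * m)) v t) < e"
proof -
 have "decseq (%k. nsq ((A ^^ k) v))" using nsq_A_pow_mono[OF v] by (simp add: decseq_def)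
 then obtain l where l: "(%k. nsq ((A ^^ k) v)) \<longlonglongrightarrow> l" "!!i. l \<le> nsq ((A ^^ i) v)"
  using decseq_convergent[of "%k. nsq ((A ^^ k) v)" 0] nsq_nonneg by metis
 then obtain N where N: "!!k. k \<ge> N ==> nsq ((A ^^ k) v) < l + e / 2"
  using order_tendstoD(2)[OF l(1), of "l + e / 2"] e unfolding eventually_sequentially by auto
 show thesis
 proof (rule that)
  fix k m assume "k \<ge> N" "m \<ge> N"
  thus "nsq (%t. (A ^^ (2 * k)) v t - (A ^^ (2 * m)) v t) < e"
   using N[of "2 * k"] N[of "2 * m"] l(2)[of "k + m"] unfolding nsq_A_pow_diff[OF v] by auto
 qed
qed

lemma tendsto_proj:
 assumes v: "v\<in>V"
 shows "(%k. (A ^^ (2 * k)) v t) \<longlonglongrightarrow> proj v t"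
proof -
 have "Cauchy (%k. (A ^^ (2 * k)) v t)"
 proof (rule metric_CauchyI)
  fix e :: real assume e: "e > 0"
  obtain N where N: "!!k m. k \<ge> N ==> m \<ge> N ==> nsq (%t. (A ^^ (2 * k)) v t - (A ^^ (2 * m)) v t) < e\<^sup>2"
   using nsq_A_pow_Cauchy[OF v, of "e\<^sup>2"] e by auto
  have "dist ((A ^^ (2 * k)) v t) ((A ^^ (2 * m)) v t) < e" if "k \<ge> N" "m \<ge> N" for k m
  proof -
   have "(norm ((A ^^ (2 * k)) v t - (A ^^ (2 * m)) v t))\<^sup>2 \<le> nsq (%t. (A ^^ (2 * k)) v t - (A ^^ (2 * m)) v t)"
    by (rule norm_le_nsq[of "%t. (A ^^ (2 * k)) v t - (A ^^ (2 * m)) v t"]) (intro l2_diff V_l2 A_pow_in v)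
   also have "... < e\<^sup>2" by (rule N[OF that])
   finally show ?thesis using e by (simp add: dist_norm power_less_imp_less_base)
  qed
  thus "\<exists>M. \<forall>k\<ge>M. \<forall>m\<ge>M. dist ((A ^^ (2 * k)) v t) ((A ^^ (2 * m)) v t) < e" by blast
 qed
 thus ?thesis unfolding proj_def by (simp add: Cauchy_convergent convergent_LIMSEQ_iff[symmetric])
qed

lemma proj_in: "proj v\<in>V" and nsq_proj: "nsq (proj v) \<le> nsq v" if v: "v\<in>V"
proof -
 have b: "nsq ((A ^^ (2 * k)) v) \<le> nsq v" for k using nsq_A_pow_mono[OF v, of 0 "2 * k"] by simp
 note l = l2_limit[of "%k. (A ^^ (2 * k)) v", OF V_l2[OF A_pow_in[OF v]] b tendsto_proj[OF v]]
 show "nsq (proj v) \<le> nsq v" by (rule l(2))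
 show "proj v\<in>V" by (rule V_lim[OF A_pow_in[OF v] tendsto_proj[OF v] l(1)])
qed

lemma A_tendsto:
 assumes "!!k. f k\<in>V" "g\<in>V" "!!t. (%k. f k t) \<longlonglongrightarrow> g t"
 shows "(%k. A (f k) t) \<longlonglongrightarrow> A g t"
 unfolding A_def by (intro tendsto_intros assms T_cont)

text \<open>The limit h is fixed by A applied twice, so its norm does not drop under A, whereas
  \<open>nsq_A\<close> says that it drops by at least the form of T at h over C. So that form is not
  positive, and \<open>T_bound\<close> makes Th vanish.\<close>

lemma T_proj:
 assumes v: "v\<in>V"
 shows "T (proj v)=(%_. 0)"
proof -
 let ?h = "proj v"
 have h: "?h\<in>V" by (rule proj_in[OF v])
 have AA: "A (A ?h)=?h"
 proof
  fix t
  have "(%k. A (A ((A ^^ (2 * k)) v)) t) \<longlonglongrightarrow> A (A ?h) t"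
   by (intro A_tendsto A_in A_pow_in v h tendsto_proj)
  moreover have "(%k. A (A ((A ^^ (2 * k)) v)) t)=(%k. (A ^^ (2 * Suc k)) v t)" by simp
  moreover have "(%k. (A ^^ (2 * Suc k)) v t) \<longlonglongrightarrow> ?h t"
   using LIMSEQ_Suc[OF tendsto_proj[OF v, of t]] .
  ultimately show "A (A ?h) t=?h t" by (simp only: LIMSEQ_unique)
 qed
 have "nsq ?h \<le> nsq ?h - Re (ip (T ?h) ?h) / C"
  using nsq_A(2)[OF A_in[OF h]] nsq_A(1)[OF h] unfolding AA by linarith
 hence "Re (ip (T ?h) ?h)\<le>0" using C_pos by (simp add: divide_le_0_iff)
 hence "nsq (T ?h)\<le>0"
  using T_bound[OF h] mult_nonneg_nonpos[of C "Re (ip (T ?h) ?h)"] C_pos by linarith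
 thus ?thesis by (intro nsq_zero_imp V_l2 T_in h)
qed

text \<open>\<open>A\<close> fixes the kernel of \<open>T\<close>, so by symmetry all iterates of v
  have the same inner product with u; the error in passing to the limit is controlled by
  \<open>norm_ip_le\<close>.\<close>

lemma proj_orth:
 assumes v: "v\<in>V" and u: "u\<in>V" "T u=(%_. 0)"
 shows "ip (%t. v t - proj v t) u=0"
proof -
 have "A u=u" using u by (simp add: A_def)
 hence Au: "(A ^^ k) u=u" for k by (induction k) simp_all
 have ipk: "ip ((A ^^ (2 * k)) v) u=ip v u" for k
  using A_pow_sym[OF v u(1)] Au by simp
 have l: "l2 v" "l2 u" "l2 (proj v)" by (intro V_l2 v u proj_in)+
 have *: "norm (ip (%t. v t - proj v t) u) \<le> e" if e: "e > 0" for e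
 proof -
  \<comment> \<open>Chosen so that nsq u / c is at most e/2; the summand 1 keeps c positive when u =
    0.\<close>
  define c where "c=(nsq u + 1)*2 / e"
  have "nsq u + 1 > 0" using nsq_nonneg[of u] by linarith
  hence c: "c > 0" using e by (simp add: c_def)
  obtain N where N: "!!k m. k \<ge> N ==> m \<ge> N ==> nsq (%t. (A ^^ (2 * k)) v t - (A ^^ (2 * m)) v t) < e / (2 * c)"
   using nsq_A_pow_Cauchy[OF v, of "e / (2 * c)"] e c by auto
  have lN: "l2 ((A ^^ (2 * N)) v)" by (intro V_l2 A_pow_in v)
  have b: "nsq (%t. (A ^^ (2 * N)) v t - proj v t) \<le> e / (2 * c)"
  proof (rule l2_limit(2))
   show "l2 (%t. (A ^^ (2 * N)) v t - (A ^^ (2*(k + N))) v t)" for k by (intro l2_diff V_l2 A_pow_in v)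
   show "nsq (%t. (A ^^ (2 * N)) v t - (A ^^ (2*(k + N))) v t) \<le> e / (2 * c)" for k
    using N[of N "k + N"] by simp
   show "(%k. (A ^^ (2 * N)) v t - (A ^^ (2*(k + N))) v t) \<longlonglongrightarrow> (A ^^ (2 * N)) v t - proj v t" for t
    using LIMSEQ_ignore_initial_segment[OF tendsto_proj[OF v, of t], of N] by (intro tendsto_intros)
  qed
  have "ip (%t. v t - proj v t) u=ip (%t. (A ^^ (2 * N)) v t - proj v t) u"
   using l lN ipk[of N] by (simp add: ip_diff_left)
  also have "norm ... \<le> c * nsq (%t. (A ^^ (2 * N)) v t - proj v t) + nsq u / c"
   by (rule norm_ip_le[OF l2_diff[OF lN l(3)] l(2) c])
  also have "... \<le> e / 2 + e / 2"
  proof (rule add_mono)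
   show "c * nsq (%t. (A ^^ (2 * N)) v t - proj v t) \<le> e / 2"
    using mult_left_mono[OF b, of c] c by simp
   show "nsq u / c \<le> e / 2"
    using e \<open>nsq u + 1 > 0\<close> by (simp add: c_def field_simps)
  qed
  finally show ?thesis by simp
 qed
 have "norm (ip (%t. v t - proj v t) u)\<le>0" by (rule field_le_epsilon) (simp add: *)
 thus ?thesis by simp
qed

text \<open>The difference of h and \<open>proj v\<close> lies in the kernel and is orthogonal to
  the kernel, hence to itself. Additivity of \<open>T\<close> is not among the axioms of the locale
  and enters as the single instance \<open>T_diff\<close>.\<close>

lemma proj_unique:
 assumes v: "v\<in>V" and h: "h\<in>V" "T h=(%_. 0)" and orth: "!!u. u\<in>V ==> T u=(%_. 0) ==> ip (%t. v t - h t) u=0"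
  and T_diff: "T (%t. h t - proj v t)=(%t. T h t - T (proj v) t)"
 shows "h=proj v"
proof -
 let ?d = "%t. h t - proj v t"
 have p: "proj v\<in>V" by (rule proj_in[OF v])
 have d: "?d\<in>V" using V_comb[OF h(1) p, of 1] by simp
 have Td: "T ?d=(%_. 0)" unfolding T_diff h(2) T_proj[OF v] by simp
 have l: "l2 v" "l2 h" "l2 (proj v)" "l2 ?d" by (intro V_l2 v h p d)+
 have "ip ?d ?d=ip (%t. (v t - proj v t) - (v t - h t)) ?d" by simp
 also have "...=ip (%t. v t - proj v t) ?d - ip (%t. v t - h t) ?d"
  by (intro ip_diff_left l2_diff l)
 also have "...=0" using proj_orth[OF v d Td] orth[OF d Td] by simp
 finally have "nsq ?d=0" unfolding ip_self by simp
 hence "?d=(%_. 0)" using nsq_zero_imp[OF l(4)] by simp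
 thus ?thesis by (metis eq_iff_diff_eq_0 ext)
qed

end

section \<open>Operators given by sparse kernels\<close>

definition kop :: "('a => 'b => complex) => ('b => complex) => 'a => complex"
 where "kop k c u=(\<Sum>t | k u t ~= 0. k u t * c t)"

definition adj :: "('a => 'b => complex) => 'b => 'a => complex"
 where "adj k=(%t u. cnj (k u t))"

definition sparse :: "('a => 'b => complex) => nat => real => bool"
 where "sparse k N M \<longleftrightarrow> (\<forall>u. finite {t. k u t ~= 0} & card {t. k u t ~= 0} \<le> N) &
  (\<forall>t. finite {u. k u t ~= 0} & card {u. k u t ~= 0} \<le> N) & (\<forall>u t. norm (k u t) \<le> M)"

lemma sparse_adj: "sparse k N M ==> sparse (adj k) N M"
 by (simp add: sparse_def adj_def)

lemma norm_sum_square_le: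
 fixes f :: "'a => complex"
 shows "(norm (\<Sum>i\<in>S. f i))\<^sup>2 \<le> real (card S)*(\<Sum>i\<in>S. (norm (f i))\<^sup>2)"
proof -
 have "(norm (\<Sum>i\<in>S. f i))\<^sup>2\<le>(\<Sum>i\<in>S. norm (f i)*1)\<^sup>2"
  by (intro power_mono) (simp_all add: norm_sum)
 also have "...\<le>(\<Sum>i\<in>S. (norm (f i))\<^sup>2)*(\<Sum>i\<in>S. 1\<^sup>2)" by (rule Cauchy_Schwarz_ineq_sum)
 finally show ?thesis by (simp add: mult.commute)
qed

text \<open>Schur test: Cauchy-Schwarz on each row costs a factor N, and each column index is
  counted by at most N rows.\<close>

lemma kop_bounded:
 assumes k: "sparse k N M" and c: "l2 c"
 shows "l2 (kop k c)" "nsq (kop k c)\<le>(real N * M)\<^sup>2 * nsq c"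
proof -
 have M: "M \<ge> 0" using k norm_ge_zero order_trans unfolding sparse_def by blast
 have "(\<Sum>u\<in>F. (norm (kop k c u))\<^sup>2)\<le>(real N * M)\<^sup>2 * nsq c" if F: "finite F" for F
 proof -
  define S where "S=(\<Union>u\<in>F. {t. k u t ~= 0})"
  have S: "finite S" using F k unfolding S_def sparse_def by auto
  have "(norm (kop k c u))\<^sup>2 \<le> real N * M\<^sup>2*(\<Sum>t\<in>S. if k u t ~= 0 then (norm (c t))\<^sup>2 else 0)" if u: "u\<in>F" for u
  proof -
   have "(norm (kop k c u))\<^sup>2 \<le> real (card {t. k u t ~= 0})*(\<Sum>t | k u t ~= 0. (norm (k u t * c t))\<^sup>2)"
    unfolding kop_def by (rule norm_sum_square_le)
   also have "... \<le> real N*(\<Sum>t | k u t ~= 0. M\<^sup>2*(norm (c t))\<^sup>2)"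
    using k unfolding sparse_def
    by (intro mult_mono sum_mono sum_nonneg) (auto simp: norm_mult power_mult_distrib intro!: mult_right_mono power_mono)
   also have "... = real N * M\<^sup>2*(\<Sum>t\<in>S. if k u t ~= 0 then (norm (c t))\<^sup>2 else 0)"
    using S u by (subst sum.inter_filter[symmetric]) (auto simp: S_def sum_distrib_left mult.assoc intro!: sum.cong)
   finally show ?thesis .
  qed
  hence "(\<Sum>u\<in>F. (norm (kop k c u))\<^sup>2) \<le>
   (\<Sum>u\<in>F. real N * M\<^sup>2*(\<Sum>t\<in>S. if k u t ~= 0 then (norm (c t))\<^sup>2 else 0))" by (rule sum_mono)
  also have "... = real N * M\<^sup>2*(\<Sum>t\<in>S. \<Sum>u\<in>F. if k u t ~= 0 then (norm (c t))\<^sup>2 else 0)"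
   by (subst sum.swap) (simp add: sum_distrib_left)
  also have "... \<le> real N * M\<^sup>2*(\<Sum>t\<in>S. real N*(norm (c t))\<^sup>2)"
  proof (intro mult_left_mono sum_mono)
   fix t
   have "(\<Sum>u\<in>F. if k u t ~= 0 then (norm (c t))\<^sup>2 else 0) = real (card {u\<in>F. k u t ~= 0})*(norm (c t))\<^sup>2"
    using F by (subst sum.inter_filter[symmetric]) auto
   also have "card {u\<in>F. k u t ~= 0} \<le> card {u. k u t ~= 0}"
    using k unfolding sparse_def by (intro card_mono) auto
   also have "card {u. k u t ~= 0} \<le> N" using k unfolding sparse_def by blast
   finally show "(\<Sum>u\<in>F. if k u t ~= 0 then (norm (c t))\<^sup>2 else 0) \<le> real N*(norm (c t))\<^sup>2"
    by (simp add: mult_right_mono)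
  qed simp
  also have "...=(real N * M)\<^sup>2*(\<Sum>t\<in>S. (norm (c t))\<^sup>2)"
   by (simp add: sum_distrib_left power_mult_distrib power2_eq_square mult_ac)
  also have "...\<le>(real N * M)\<^sup>2 * nsq c"
   by (intro mult_left_mono finite_sum_le_nsq c S) simp
  finally show ?thesis .
 qed
 from l2I[of "kop k c", OF this] show "l2 (kop k c)" "nsq (kop k c)\<le>(real N * M)\<^sup>2 * nsq c" by blast+
qed

text \<open>Exchange of summations. Absolute summability comes from bounding |c w| by the sum of the
  two squares, each of which is counted at most N times by sparseness.\<close>

lemma kop_adj:
 assumes k: "sparse k N M" and c: "l2 c" and w: "l2 w"
 shows "ip (kop k c) w=ip c (kop (adj k) w)"
proof -
 have M: "M \<ge> 0" using k norm_ge_zero order_trans unfolding sparse_def by blast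
 define f where "f u t=k u t * c t * cnj (w u)" for u t
 have "(%p. norm (case p of (u, t) => f u t)) summable_on UNIV \<times> UNIV"
 proof (rule nonneg_bdd_above_summable_on)
  show "bdd_above (sum (%p. norm (case p of (u, t) => f u t)) ` {F. F \<subseteq> UNIV \<times> UNIV & finite F})"
  proof (rule bdd_aboveI2)
   fix F :: "('a \<times> 'b) set" assume "F\<in>{F. F \<subseteq> UNIV \<times> UNIV & finite F}"
   hence F: "finite F" by simp
   define U S where "U=fst ` F" and "S = snd ` F"
   have US: "finite U" "finite S" "F \<subseteq> U \<times> S" using F unfolding U_def S_def by (auto simp: rev_image_eqI)
   let ?g = "%u t. if k u t ~= 0 then M*((norm (c t))\<^sup>2 + (norm (w u))\<^sup>2) else 0"
   have fg: "norm (f u t)\<le>?g u t" for u t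
   proof (cases "k u t=0")
    case False
    have "norm (f u t)=norm (k u t)*(norm (c t) * norm (w u))" by (simp add: f_def norm_mult)
    also have "... \<le> M*((norm (c t))\<^sup>2 + (norm (w u))\<^sup>2)"
     using k M mult_le_sum_squares unfolding sparse_def by (intro mult_mono) auto
    finally show ?thesis using False by simp
   qed (simp add: f_def)
   have "(\<Sum>p\<in>F. norm (case p of (u, t) => f u t))\<le>(\<Sum>p\<in>U \<times> S. norm (case p of (u, t) => f u t))"
    using US by (intro sum_mono2) auto
   also have "...\<le>(\<Sum>(u, t)\<in>U \<times> S. ?g u t)" using fg by (intro sum_mono) auto
   also have "...=(\<Sum>u\<in>U. \<Sum>t\<in>S. if k u t ~= 0 then M*(norm (c t))\<^sup>2 else 0) +
     (\<Sum>u\<in>U. \<Sum>t\<in>S. if k u t ~= 0 then M*(norm (w u))\<^sup>2 else 0)"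
    unfolding sum.cartesian_product[symmetric] sum.distrib[symmetric]
    by (intro sum.cong refl) (simp add: distrib_left)
   also have "(\<Sum>u\<in>U. \<Sum>t\<in>S. if k u t ~= 0 then M*(norm (w u))\<^sup>2 else 0) \<le> real N * M * nsq w"
   proof -
    have "(\<Sum>t\<in>S. if k u t ~= 0 then M*(norm (w u))\<^sup>2 else 0) \<le> real N * M*(norm (w u))\<^sup>2" for u
    proof -
     have "(\<Sum>t\<in>S. if k u t ~= 0 then M*(norm (w u))\<^sup>2 else 0) = real (card {t\<in>S. k u t ~= 0})*(M*(norm (w u))\<^sup>2)"
      using US by (subst sum.inter_filter[symmetric]) auto
     moreover have "card {t\<in>S. k u t ~= 0} \<le> card {t. k u t ~= 0}"
      using k unfolding sparse_def by (intro card_mono) auto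
     moreover have "card {t. k u t ~= 0} \<le> N" using k unfolding sparse_def by blast
     ultimately show ?thesis using M by (simp add: mult_right_mono mult.assoc)
    qed
    hence "(\<Sum>u\<in>U. \<Sum>t\<in>S. if k u t ~= 0 then M*(norm (w u))\<^sup>2 else 0)\<le>(\<Sum>u\<in>U. real N * M*(norm (w u))\<^sup>2)"
     by (rule sum_mono)
    also have "... \<le> real N * M * nsq w"
     unfolding sum_distrib_left[symmetric] using M by (intro mult_left_mono finite_sum_le_nsq w US) auto
    finally show ?thesis .
   qed
   also have "(\<Sum>u\<in>U. \<Sum>t\<in>S. if k u t ~= 0 then M*(norm (c t))\<^sup>2 else 0) \<le> real N * M * nsq c"
   proof (subst sum.swap)
    have "(\<Sum>u\<in>U. if k u t ~= 0 then M*(norm (c t))\<^sup>2 else 0) \<le> real N * M*(norm (c t))\<^sup>2" for t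
    proof -
     have "(\<Sum>u\<in>U. if k u t ~= 0 then M*(norm (c t))\<^sup>2 else 0) = real (card {u\<in>U. k u t ~= 0})*(M*(norm (c t))\<^sup>2)"
      using US by (subst sum.inter_filter[symmetric]) auto
     moreover have "card {u\<in>U. k u t ~= 0} \<le> card {u. k u t ~= 0}"
      using k unfolding sparse_def by (intro card_mono) auto
     moreover have "card {u. k u t ~= 0} \<le> N" using k unfolding sparse_def by blast
     ultimately show ?thesis using M by (simp add: mult_right_mono mult.assoc)
    qed
    hence "(\<Sum>t\<in>S. \<Sum>u\<in>U. if k u t ~= 0 then M*(norm (c t))\<^sup>2 else 0)\<le>(\<Sum>t\<in>S. real N * M*(norm (c t))\<^sup>2)"
     by (rule sum_mono)
    also have "... \<le> real N * M * nsq c"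
     unfolding sum_distrib_left[symmetric] using M by (intro mult_left_mono finite_sum_le_nsq c US) auto
    finally show "(\<Sum>t\<in>S. \<Sum>u\<in>U. if k u t ~= 0 then M*(norm (c t))\<^sup>2 else 0) \<le> real N * M * nsq c" .
   qed
   finally show "(\<Sum>p\<in>F. norm (case p of (u, t) => f u t)) \<le> real N * M * nsq c + real N * M * nsq w" by simp
  qed
 qed simp
 hence "(%(u, t). f u t) summable_on UNIV \<times> UNIV" by (rule abs_summable_summable)
 hence "(\<Sum>\<^sub>\<infinity>u. \<Sum>\<^sub>\<infinity>t. f u t)=(\<Sum>\<^sub>\<infinity>t. \<Sum>\<^sub>\<infinity>u. f u t)" by (rule infsum_swap_banach)
 moreover have "(\<Sum>\<^sub>\<infinity>t. f u t)=kop k c u * cnj (w u)" for u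
 proof -
  have "(\<Sum>\<^sub>\<infinity>t. f u t)=(\<Sum>\<^sub>\<infinity>t\<in>{t. k u t ~= 0}. f u t)" by (rule infsum_cong_neutral) (auto simp: f_def)
  also have "...=(\<Sum>t | k u t ~= 0. f u t)" using k by (simp add: sparse_def)
  finally show ?thesis by (simp add: f_def kop_def sum_distrib_right)
 qed
 moreover have "(\<Sum>\<^sub>\<infinity>u. f u t)=c t * cnj (kop (adj k) w t)" for t
 proof -
  have "(\<Sum>\<^sub>\<infinity>u. f u t)=(\<Sum>\<^sub>\<infinity>u\<in>{u. k u t ~= 0}. f u t)" by (rule infsum_cong_neutral) (auto simp: f_def)
  also have "...=(\<Sum>u | k u t ~= 0. f u t)" using k by (simp add: sparse_def)
  finally show ?thesis by (simp add: f_def kop_def adj_def sum_distrib_left mult_ac)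
 qed
 ultimately show ?thesis unfolding ip_def by simp
qed

lemma kop_tendsto: "(!!t. (%j. f j t) \<longlonglongrightarrow> g t) ==> (%j. kop k (f j) u) \<longlonglongrightarrow> kop k g u"
 unfolding kop_def by (intro tendsto_intros)

lemma kop_diff: "kop k (%t. f t - g t)=(%u. kop k f u - kop k g u)"
 by (intro ext) (simp add: kop_def right_diff_distrib sum_subtractf)

lemma kop_scale: "kop k (%t. a * f t)=(%u. a * kop k f u)"
 by (intro ext) (simp add: kop_def sum_distrib_left mult_ac)

text \<open>
 Extension by zero along an injective map \<open>J\<close> and restriction along it commute with kernel operators
 whose kernels match and do not connect the image of \<open>J\<close> with its complement.
\<close>

definition push :: "'a set => ('a => 'b) => ('a => complex) => 'b => complex"
 where "push U J c t=(if t\<in>J ` U then c (inv_into U J t) else 0)"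

definition pull :: "'a set => ('a => 'b) => ('b => complex) => 'a => complex"
 where "pull U J d t=(if t\<in>U then d (J t) else 0)"

definition matching :: "'a set => ('a => 'b) => ('a => 'a => complex) => ('b => 'b => complex) => bool"
 where "matching U J k' k \<longleftrightarrow> (\<forall>u\<in>U. \<forall>t\<in>U. k (J u) (J t)=k' u t) &
  (\<forall>u t. k u t ~= 0 --> (u\<in>J ` U \<longleftrightarrow> t\<in>J ` U)) & (\<forall>u t. k' u t ~= 0 --> u\<in>U & t\<in>U)"

lemma matching_adj: "matching U J k' k ==> matching U J (adj k') (adj k)"
 unfolding matching_def adj_def by auto

lemma matching_row:
 assumes "matching U J k' k" "inj_on J U" "u\<in>U"
 shows "bij_betw J {t. k' u t ~= 0} {t. k (J u) t ~= 0}"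
 unfolding bij_betw_def
proof
 have sub: "{t. k' u t ~= 0} \<subseteq> U" using assms unfolding matching_def by blast
 thus "inj_on J {t. k' u t ~= 0}" using assms(2) inj_on_subset by blast
 show "J ` {t. k' u t ~= 0}={t. k (J u) t ~= 0}"
 proof (intro equalityI subsetI)
  fix t assume "t\<in>J ` {t. k' u t ~= 0}"
  thus "t\<in>{t. k (J u) t ~= 0}" using assms(1,3) unfolding matching_def by auto
 next
  fix t assume t: "t\<in>{t. k (J u) t ~= 0}"
  hence "t\<in>J ` U" using assms(1,3) unfolding matching_def by blast
  then obtain s where s: "s\<in>U" "t=J s" by blast
  hence "k' u s ~= 0" using assms(1,3) t unfolding matching_def by auto
  thus "t\<in>J ` {t. k' u t ~= 0}" using s by blast
 qed
qed

lemma kop_push: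
 assumes m: "matching U J k' k" and inj: "inj_on J U"
 shows "kop k (push U J c)=push U J (kop k' c)"
proof
 fix u
 show "kop k (push U J c) u=push U J (kop k' c) u"
 proof (cases "u\<in>J ` U")
  case True
  then obtain s where s: "s\<in>U" "u=J s" by blast
  have "kop k (push U J c) u=(\<Sum>t | k' s t ~= 0. k (J s) (J t) * push U J c (J t))"
   unfolding kop_def s(2) by (rule sum.reindex_bij_betw[OF matching_row[OF m inj s(1)], symmetric])
  also have "...=(\<Sum>t | k' s t ~= 0. k' s t * c t)"
  proof (rule sum.cong[OF refl])
   fix t assume "t\<in>{t. k' s t ~= 0}"
   hence "t\<in>U" using m unfolding matching_def by blast
   thus "k (J s) (J t) * push U J c (J t)=k' s t * c t"
    using m s inj unfolding matching_def push_def by simp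
  qed
  also have "...=push U J (kop k' c) u" using s inj by (simp add: push_def kop_def)
  finally show ?thesis .
 next
  case False
  have "k u t * push U J c t=0" for t
  proof (cases "t\<in>J ` U")
   case True
   hence "k u t=0" using m False unfolding matching_def by blast
   thus ?thesis by simp
  qed (simp add: push_def)
  hence "kop k (push U J c) u=0" unfolding kop_def by simp
  thus ?thesis using False by (simp add: push_def)
 qed
qed

lemma kop_pull:
 assumes m: "matching U J k' k" and inj: "inj_on J U"
 shows "kop k' (pull U J d)=pull U J (kop k d)"
proof
 fix u
 show "kop k' (pull U J d) u=pull U J (kop k d) u"
 proof (cases "u\<in>U")
  case True
  have "kop k d (J u)=(\<Sum>t | k' u t ~= 0. k (J u) (J t) * d (J t))"
   unfolding kop_def by (rule sum.reindex_bij_betw[OF matching_row[OF m inj True], symmetric])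
  also have "...=(\<Sum>t | k' u t ~= 0. k' u t * pull U J d t)"
  proof (rule sum.cong[OF refl])
   fix t assume "t\<in>{t. k' u t ~= 0}"
   hence "t\<in>U" using m unfolding matching_def by blast
   thus "k (J u) (J t) * d (J t)=k' u t * pull U J d t"
    using m True unfolding matching_def pull_def by simp
  qed
  finally show ?thesis using True by (simp add: pull_def kop_def)
 next
  case False
  hence "{t. k' u t ~= 0}={}" using m unfolding matching_def by blast
  thus ?thesis using False by (simp add: pull_def kop_def)
 qed
qed

lemma nsq_push: "inj_on J U ==> l2 c ==> l2 (push U J c)"
proof -
 assume inj: "inj_on J U" and c: "l2 c"
 have "(%t. (norm (push U J c t))\<^sup>2) summable_on J ` U"
  unfolding summable_on_reindex[OF inj] o_def
  using c inj unfolding l2_def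
  by (subst summable_on_cong[where g = "%t. (norm (c t))\<^sup>2"])
   (auto simp: push_def intro: summable_on_subset_banach)
 thus "l2 (push U J c)" unfolding l2_def
  by (subst summable_on_cong_neutral[where T = "J ` U" and g = "%t. (norm (push U J c t))\<^sup>2"]) (auto simp: push_def)
qed

lemma l2_pull:
 assumes inj: "inj_on J U" and d: "l2 d"
 shows "l2 (pull U J d)"
proof -
 have "(%t. (norm (d t))\<^sup>2) summable_on J ` U"
  using d unfolding l2_def by (rule summable_on_subset_banach) simp
 hence "(%t. (norm (d (J t)))\<^sup>2) summable_on U" unfolding summable_on_reindex[OF inj] o_def .
 thus ?thesis unfolding l2_def
  by (subst summable_on_cong_neutral[where T = U and g = "%t. (norm (d (J t)))\<^sup>2"]) (auto simp: pull_def)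
qed

text \<open>Extension by zero and restriction are adjoint; through this, orthogonality to a harmonic
  chain of the large complex is tested in the small one.\<close>

lemma ip_push_pull:
 assumes inj: "inj_on J U" and c: "!!t. t \<notin> U ==> c t=0"
 shows "ip (push U J c) d=ip c (pull U J d)"
proof -
 have "ip (push U J c) d=(\<Sum>\<^sub>\<infinity>t\<in>J ` U. push U J c t * cnj (d t))"
  unfolding ip_def by (rule infsum_cong_neutral) (auto simp: push_def)
 also have "...=(\<Sum>\<^sub>\<infinity>t\<in>U. push U J c (J t) * cnj (d (J t)))"
  unfolding infsum_reindex[OF inj] o_def ..
 also have "...=(\<Sum>\<^sub>\<infinity>t. c t * cnj (pull U J d t))"
  by (rule infsum_cong_neutral) (auto simp: push_def pull_def inj c)
 finally show ?thesis by (simp add: ip_def)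
qed

section \<open>The Laplacian of a complex of bounded degree\<close>

lemma permute_list_inj:
 assumes "q permutes {..<n}" "length x=n" "length y=n" "permute_list q x=permute_list q y"
 shows "x=y"
proof -
 have "permute_list (inv_into UNIV q) (permute_list q x)=permute_list (inv_into UNIV q) (permute_list q y)" using assms(4) by simp
 moreover have "permute_list (inv_into UNIV q) (permute_list q z)=z" if "length z=n" for z
  using permute_list_compose[of "inv_into UNIV q" z q] permutes_inv[OF assms(1)] permutes_inv_o(1)[OF assms(1)] that by simp
 ultimately show ?thesis using assms(2,3) by metis
qed

lemma oriented_alt:
 "distinct t ==> oriented t u=(\<Sum>p | p permutes {..<length t}. if permute_list p t=u then of_int (sign p) else 0)"
 unfolding oriented_def by (simp add: sum.inter_filter[symmetric] finite_permutations conj_commute)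

lemma oriented_nonzeroD:
 assumes "oriented t u ~= 0"
 shows "distinct t" "distinct u" "length u=length t" "set u = set t" "\<exists>p. p permutes {..<length t} & u=permute_list p t"
proof -
 show d: "distinct t" using assms by (auto simp: oriented_def split: if_splits)
 show ex: "\<exists>p. p permutes {..<length t} & u=permute_list p t"
 proof (rule ccontr)
  assume "\<not> ?thesis"
  hence "oriented t u=0" using d by (auto simp: oriented_alt intro!: sum.neutral)
  thus False using assms by simp
 qed
 thus "distinct u" "length u=length t" "set u = set t" using d by auto
qed

lemma sign_permutes_compose:
 assumes "p permutes S" "q permutes S" "finite S"
 shows "sign (p \<circ> q) = sign p * sign q"
 using assms by (intro sign_compose) (auto simp: permutation_permutes)

text \<open>Composing the summation permutation with q on the right matches the two sums, and signs
  multiply.\<close>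

lemma oriented_permr:
 assumes q: "q permutes {..<length u}"
 shows "oriented t (permute_list q u) = of_int (sign q) * oriented t u"
proof (cases "distinct t & length t=length u")
 case False
 hence "oriented t (permute_list q u)=0" "oriented t u=0"
  using oriented_nonzeroD(1,3)[of t] by (metis length_permute_list)+
 thus ?thesis by simp
next
 case True
 hence d: "distinct t" and l: "length t=length u" by auto
 have q': "q permutes {..<length t}" using q l by simp
 have "oriented t (permute_list q u) =
  (\<Sum>p | p permutes {..<length t}. if permute_list (p \<circ> q) t=permute_list q u then of_int (sign (p \<circ> q)) else 0)"
  unfolding oriented_alt[OF d] by (rule sum_permutations_compose_right[OF q'])
 also have "...=(\<Sum>p | p permutes {..<length t}. of_int (sign q)*(if permute_list p t=u then of_int (sign p) else 0))"
 proof (rule sum.cong[OF refl])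
  fix p assume "p\<in>{p. p permutes {..<length t}}"
  hence p: "p permutes {..<length t}" by simp
  have "permute_list (p \<circ> q) t=permute_list q u \<longleftrightarrow> permute_list p t=u"
  proof -
   have "permute_list (p \<circ> q) t=permute_list q (permute_list p t)" by (rule permute_list_compose[OF q'])
   moreover have "length (permute_list p t)=length t" "length u=length t" using l by simp_all
   ultimately show ?thesis using permute_list_inj[OF q'] by metis
  qed
  thus "(if permute_list (p \<circ> q) t=permute_list q u then of_int (sign (p \<circ> q)) else 0) =
    of_int (sign q)*(if permute_list p t=u then of_int (sign p) else (0::complex))"
   using sign_permutes_compose[OF p q'] by simp
 qed
 finally show ?thesis unfolding oriented_alt[OF d] sum_distrib_left .
qed

lemma oriented_self:
 assumes "distinct t"
 shows "oriented t t=1"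
proof -
 have "permute_list p t=t \<longleftrightarrow> p=id" if p: "p permutes {..<length t}" for p
 proof
  assume e: "permute_list p t=t"
  have "p i=i" for i
  proof (cases "i < length t")
   case True
   hence "t ! p i=t ! i" using permute_list_nth[OF p True] e by simp
   moreover have "p i < length t" using permutes_in_image[OF p, of i] True by simp
   ultimately show ?thesis using assms True nth_eq_iff_index_eq by blast
  next
   case False
   thus ?thesis using p by (simp add: permutes_def)
  qed
  thus "p=id" by auto
 qed simp
 hence "oriented t t=(\<Sum>p | p permutes {..<length t}. if p=id then of_int (sign p) else 0)"
  unfolding oriented_alt[OF assms] by (intro sum.cong refl) auto
 also have "...=1" by (simp add: finite_permutations permutes_id)
 finally show ?thesis .
qed

lemma norm_oriented: "norm (oriented t u) \<le> fact (length t)"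
proof (cases "distinct t")
 case True
 have "norm (oriented t u)\<le>(\<Sum>p | p permutes {..<length t}. norm (if permute_list p t=u then of_int (sign p) else 0 :: complex))"
  unfolding oriented_alt[OF True] by (rule norm_sum)
 also have "...\<le>(\<Sum>p | p permutes {..<length t}. 1)" by (rule sum_mono) (auto simp: sign_def)
 also have "...=fact (length t)" by (simp add: card_permutations)
 finally show ?thesis .
qed (simp add: oriented_def)

lemma oriented_map:
 assumes "inj_on j (set t \<union> set u)"
 shows "oriented (map j t) (map j u) = oriented t u"
proof (cases "distinct t")
 case True
 have inj: "inj_on j (set t)" using assms by (rule inj_on_subset) simp
 have "permute_list p (map j t)=map j u \<longleftrightarrow> permute_list p t=u" if p: "p permutes {..<length t}" for p
 proof -
  have "inj_on j (set (permute_list p t) \<union> set u)" using assms p by simp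
  thus ?thesis using permute_list_map[OF p, of j] inj_on_map_eq_map by metis
 qed
 hence "(\<Sum>p | p permutes {..<length t}. if permute_list p (map j t)=map j u then of_int (sign p) else (0::complex)) =
  (\<Sum>p | p permutes {..<length t}. if permute_list p t=u then of_int (sign p) else 0)"
  by (intro sum.cong refl) auto
 moreover have "distinct (map j t)" using True inj by (simp add: distinct_map)
 ultimately show ?thesis using True by (simp add: oriented_alt)
qed (use assms in \<open>auto simp: oriented_def distinct_map intro: inj_on_subset\<close>)

lemma ord_simpD:
 assumes "t\<in>ordered_simplices n L"
 shows "length t=n + 1" "distinct t" "set t\<in>L" "set t\<subseteq>\<Union>L"
 using assms by (auto simp: ordered_simplices_def)

lemma permute_ordered_simplices:
 assumes "t\<in>ordered_simplices n L" "p permutes {..n}"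
 shows "permute_list p t\<in>ordered_simplices n L"
proof -
 have "p permutes {..<length t}" using assms by (simp add: ordered_simplices_def lessThan_Suc_atMost)
 thus ?thesis using assms by (simp add: ordered_simplices_def)
qed

lemma l2_chainsD:
 assumes "c\<in>l2_chains n L"
 shows "l2 c" "t \<notin> ordered_simplices n L ==> c t=0"
  "t\<in>ordered_simplices n L ==> p permutes {..n} ==> c (permute_list p t) = of_int (sign p) * c t"
 using assms by (auto simp: l2_chains_def l2_def)

lemma l2_chainsI:
 assumes "!!t. t \<notin> ordered_simplices n L ==> c t=0"
  "!!t p. t\<in>ordered_simplices n L ==> p permutes {..n} ==> c (permute_list p t) = of_int (sign p) * c t" "l2 c"
 shows "c\<in>l2_chains n L"
 using assms by (auto simp: l2_chains_def l2_def)

lemma l2_finite_support: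
 assumes "finite {t. c t ~= 0}"
 shows "l2 c"
proof -
 have "(%t. (norm (c t))\<^sup>2) summable_on {t. c t ~= 0}" using assms by simp
 thus ?thesis unfolding l2_def
  by (subst summable_on_cong_neutral[where T = "{t. c t ~= 0}" and g = "%t. (norm (c t))\<^sup>2"]) auto
qed

lemma oriented_support_finite: "finite {u. oriented t u ~= 0}"
proof (rule finite_subset)
 show "{u. oriented t u ~= 0}\<subseteq>(%p. permute_list p t) ` {p. p permutes {..<length t}}"
  using oriented_nonzeroD(5)[of t] by blast
qed (simp add: finite_permutations)

lemma oriented_in_l2_chains:
 assumes t: "t\<in>ordered_simplices n L"
 shows "oriented t\<in>l2_chains n L"
proof (rule l2_chainsI)
 fix u assume "u \<notin> ordered_simplices n L"
 moreover have "u\<in>ordered_simplices n L" if "oriented t u ~= 0"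
  using t oriented_nonzeroD(2-4)[OF that] by (simp add: ordered_simplices_def)
 ultimately show "oriented t u=0" by blast
next
 fix u p assume "u\<in>ordered_simplices n L" "p permutes {..n}"
 thus "oriented t (permute_list p u) = of_int (sign p) * oriented t u"
  by (intro oriented_permr) (simp add: ordered_simplices_def lessThan_Suc_atMost)
qed (rule l2_finite_support[OF oriented_support_finite])

text \<open>Each of the (n + 1)! orderings of t contributes c t, because the sign occurs twice.
  After the normalisation of \<open>chain_inner\<close>, pairing with an oriented simplex therefore
  reads off a coefficient.\<close>

lemma ip_oriented:
 assumes c: "c\<in>l2_chains n L" and t: "t\<in>ordered_simplices n L"
 shows "ip c (oriented t)=fact (n + 1) * c t"
proof -
 let ?P = "{p. p permutes {..n}}"
 have lt: "{..<length t}={..n}" and d: "distinct t" using t by (auto simp: ordered_simplices_def lessThan_Suc_atMost)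
 have val: "oriented t (permute_list p t) = of_int (sign p)" if "p\<in>?P" for p
  using oriented_permr[of p t t] that lt oriented_self[OF d] by simp
 have inj: "inj_on (%p. permute_list p t) ?P"
 proof (rule inj_onI)
  fix p q assume p: "p\<in>?P" and q: "q\<in>?P" and e: "permute_list p t=permute_list q t"
  have "p i=q i" for i
  proof (cases "i < length t")
   case True
   have "t ! p i=t ! q i" using e p q True permute_list_nth[of p t i] permute_list_nth[of q t i] lt by simp
   moreover have "p i < length t" "q i < length t" using permutes_in_image[of p "{..n}" i] permutes_in_image[of q "{..n}" i] p q True lt by auto
   ultimately show ?thesis using d nth_eq_iff_index_eq by blast
  next
   case False
   hence "i \<notin> {..n}" using lt by auto
   thus ?thesis using p q by (simp add: permutes_def)
  qed
  thus "p=q" by auto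
 qed
 have "ip c (oriented t)=(\<Sum>\<^sub>\<infinity>u\<in>(%p. permute_list p t) ` ?P. c u * cnj (oriented t u))"
  unfolding ip_def using oriented_nonzeroD(5)[of t] lt by (intro infsum_cong_neutral) auto
 also have "...=(\<Sum>p\<in>?P. c (permute_list p t) * cnj (oriented t (permute_list p t)))"
  by (simp add: finite_permutations sum.reindex[OF inj])
 also have "...=(\<Sum>p\<in>?P. c t)"
  using l2_chainsD(3)[OF c t] val by (intro sum.cong refl) (simp flip: of_int_mult)
 also have "...=fact (n + 1) * c t" by (simp add: card_permutations algebra_simps)
 finally show ?thesis .
qed

text \<open>
 The matrix of the boundary map, and its antisymmetrisation in the first argument. Both act in the same
 way on alternating chains, and the adjoint of the second produces alternating chains.
\<close>

definition bd_entry :: "nat => 'v list => 'v list => complex"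
 where "bd_entry n t u=(\<Sum>i\<le>n. (-1) ^ i * oriented (take i t @ drop (Suc i) t) u)"

definition alt_entry :: "nat => 'v list => 'v list => complex"
 where "alt_entry n t u=(\<Sum>p | p permutes {..n}. of_int (sign p) * bd_entry n (permute_list p t) u) / fact (n + 1)"

lemma bd_entry_nonzeroD:
 assumes "bd_entry n t u ~= 0" "length t=n + 1"
 shows "length u=n" "distinct u" "set u \<subseteq> set t"
proof -
 obtain i where i: "i \<le> n" "oriented (take i t @ drop (Suc i) t) u ~= 0"
  using assms(1) unfolding bd_entry_def by (metis (no_types, lifting) atMost_iff mult_zero_right sum.neutral)
 note o = oriented_nonzeroD[OF i(2)]
 show "length u=n" using o(3) i(1) assms(2) by simp
 show "distinct u" by (rule o(2))
 show "set u \<subseteq> set t" unfolding o(4) by (auto dest: in_set_takeD in_set_dropD)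
qed

lemma norm_bd_entry: "length t=n + 1 ==> norm (bd_entry n t u) \<le> fact (n + 1)"
proof -
 assume l: "length t=n + 1"
 have "norm (bd_entry n t u)\<le>(\<Sum>i\<le>n. norm ((-1) ^ i * oriented (take i t @ drop (Suc i) t) u))"
  unfolding bd_entry_def by (rule norm_sum)
 also have "...\<le>(\<Sum>i\<le>n. fact n)"
 proof (rule sum_mono)
  fix i assume "i\<in>{..n}"
  hence "length (take i t @ drop (Suc i) t)=n" using l by simp
  thus "norm ((-1) ^ i * oriented (take i t @ drop (Suc i) t) u) \<le> fact n"
   using norm_oriented[of "take i t @ drop (Suc i) t" u] by (simp only: norm_mult norm_power norm_minus_cancel norm_one power_one mult_1)
 qed
 also have "...=fact (n + 1)" by simp
 finally show ?thesis .
qed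

lemma bd_entry_permute_right:
 "q permutes {..<length u} ==> bd_entry n t (permute_list q u) = of_int (sign q) * bd_entry n t u"
 unfolding bd_entry_def sum_distrib_left by (rule sum.cong[OF refl]) (simp add: oriented_permr)

lemma bd_entry_map:
 assumes "inj_on j (set t \<union> set u)"
 shows "bd_entry n (map j t) (map j u)=bd_entry n t u"
 unfolding bd_entry_def
proof (rule sum.cong[OF refl])
 fix i
 have "set (take i t @ drop (Suc i) t) \<subseteq> set t" by (auto dest: in_set_takeD in_set_dropD)
 hence "inj_on j (set (take i t @ drop (Suc i) t) \<union> set u)" using assms by (blast intro: inj_on_subset)
 from oriented_map[OF this]
 show "(-1) ^ i * oriented (take i (map j t) @ drop (Suc i) (map j t)) (map j u)=(-1) ^ i * oriented (take i t @ drop (Suc i) t) u"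
  by (simp add: take_map drop_map)
qed

lemma alt_entry_nonzeroD:
 assumes "alt_entry n t u ~= 0" "length t=n + 1"
 shows "length u=n" "distinct u" "set u \<subseteq> set t"
proof -
 obtain p where p: "p permutes {..n}" "bd_entry n (permute_list p t) u ~= 0"
  using assms(1) unfolding alt_entry_def by (metis (no_types, lifting) divide_eq_0_iff mem_Collect_eq mult_zero_right sum.neutral)
 have "p permutes {..<length t}" using p(1) assms(2) by (simp add: lessThan_Suc_atMost)
 thus "length u=n" "distinct u" "set u \<subseteq> set t"
  using bd_entry_nonzeroD[OF p(2)] assms(2) by auto
qed

lemma norm_alt_entry:
 assumes "length t=n + 1"
 shows "norm (alt_entry n t u) \<le> fact (n + 1)"
proof -
 have "norm (\<Sum>p | p permutes {..n}. of_int (sign p) * bd_entry n (permute_list p t) u) \<le>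
  (\<Sum>p | p permutes {..n}. norm (of_int (sign p) * bd_entry n (permute_list p t) u))" by (rule norm_sum)
 also have "...\<le>(\<Sum>p | p permutes {..n}. fact (n + 1))"
  by (rule sum_mono) (use norm_bd_entry[of "permute_list _ t" n u] assms in \<open>auto simp: norm_mult sign_def\<close>)
 also have "...=fact (n + 1) * fact (n + 1)" by (simp add: card_permutations algebra_simps)
 finally show ?thesis unfolding alt_entry_def norm_divide norm_fact by (simp add: divide_le_eq del: fact_Suc)
qed

lemma alt_entry_permute_right:
 assumes "q permutes {..<length u}"
 shows "alt_entry n t (permute_list q u) = of_int (sign q) * alt_entry n t u"
 unfolding alt_entry_def bd_entry_permute_right[OF assms] by (simp add: sum_distrib_left mult_ac)

lemma alt_entry_permute_left:
 assumes q: "q permutes {..n}" and t: "length t=n + 1"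
 shows "alt_entry n (permute_list q t) u = of_int (sign q) * alt_entry n t u"
proof -
 have "(\<Sum>p | p permutes {..n}. of_int (sign p) * bd_entry n (permute_list p t) u) =
  (\<Sum>p | p permutes {..n}. of_int (sign (q \<circ> p)) * bd_entry n (permute_list (q \<circ> p) t) u)"
  by (rule setum_permutations_compose_left[OF q])
 also have "...=(\<Sum>p | p permutes {..n}. of_int (sign q)*(of_int (sign p) * bd_entry n (permute_list p (permute_list q t)) u))"
 proof (rule sum.cong[OF refl])
  fix p assume "p\<in>{p. p permutes {..n}}"
  hence p: "p permutes {..n}" by simp
  have "p permutes {..<length t}" using p t by (simp add: lessThan_Suc_atMost)
  thus "of_int (sign (q \<circ> p)) * bd_entry n (permute_list (q \<circ> p) t) u =
   of_int (sign q)*(of_int (sign p) * bd_entry n (permute_list p (permute_list q t)) u)"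
   using sign_permutes_compose[OF q p] by (simp add: permute_list_compose)
 qed
 finally have "alt_entry n t u = of_int (sign q) * alt_entry n (permute_list q t) u"
  unfolding alt_entry_def by (simp add: sum_distrib_left)
 hence "of_int (sign q) * alt_entry n t u = of_int (sign q)*(of_int (sign q) * alt_entry n (permute_list q t) u)"
  by (rule arg_cong)
 also have "... = of_int (sign q * sign q) * alt_entry n (permute_list q t) u" by (simp only: of_int_mult mult.assoc)
 finally show ?thesis by simp
qed

lemma alt_entry_map:
 assumes inj: "inj_on j (set t \<union> set u)" and t: "length t=n + 1"
 shows "alt_entry n (map j t) (map j u)=alt_entry n t u"
proof -
 have "bd_entry n (permute_list p (map j t)) (map j u)=bd_entry n (permute_list p t) u" if "p permutes {..n}" for p
 proof -
  have "p permutes {..<length t}" using that t by (simp add: lessThan_Suc_atMost)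
  thus ?thesis using inj by (simp add: permute_list_map bd_entry_map)
 qed
 thus ?thesis unfolding alt_entry_def by (intro arg_cong2[of _ _ _ _ "(/)"] sum.cong refl) auto
qed

text \<open>Rows are indexed by faces u and columns by n-simplices t. The division by (n + 1)!
  corrects for every simplex being present with all its orderings, and n = 0 gives the zero
  boundary.\<close>

definition bdk :: "nat => 'v set set => 'v list => 'v list => complex"
 where "bdk n L u t=(if n ~= 0 & t\<in>ordered_simplices n L then alt_entry n t u / fact (n + 1) else 0)"

definition bdd_complex :: "nat => 'v set set => bool"
 where "bdd_complex D L \<longleftrightarrow> simplicial_complex L &
  (\<forall>x. finite {y. y ~= x & {x, y}\<in>L} & card {y. y ~= x & {x, y}\<in>L} \<le> D)"

text \<open>Bounds the nonzero entries in a row and in a column of \<open>bdk\<close>. Simplices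
  containing a given face have all n + 1 vertices among one vertex and its at most D neighbours;
  faces of a given simplex are lists of length n in its n + 1 vertices. The base n + D + 1 covers
  both.\<close>

definition Nb :: "nat => nat => nat"
 where "Nb n D=(n + D + 1) ^ (n + 1)"

lemma simp_cx_subset: "simplicial_complex L ==> s\<in>L ==> t \<subseteq> s ==> t ~= {} ==> t\<in>L"
 unfolding simplicial_complex_def by blast

lemma bdk_nonzeroD:
 assumes "bdk n L u t ~= 0"
 shows "n ~= 0" "t\<in>ordered_simplices n L" "length u=n" "distinct u" "set u \<subseteq> set t"
proof -
 show "n ~= 0" and t: "t\<in>ordered_simplices n L" using assms by (auto simp: bdk_def split: if_splits)
 hence "alt_entry n t u ~= 0" using assms by (auto simp: bdk_def split: if_splits)
 from alt_entry_nonzeroD[OF this] ord_simpD(1)[OF t]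
 show "length u=n" "distinct u" "set u \<subseteq> set t" by auto
qed

lemma bdk_face:
 assumes "bdk n L u t ~= 0" "simplicial_complex L"
 shows "u\<in>ordered_simplices (n - 1) L"
proof -
 note b = bdk_nonzeroD[OF assms(1)]
 have "set u ~= {}" using b(1,3) by auto
 thus ?thesis using b simp_cx_subset[OF assms(2) ord_simpD(3)[OF b(2)] b(5)]
  by (simp add: ordered_simplices_def)
qed

lemma sparse_bdk:
 assumes L: "bdd_complex D L"
 shows "sparse (bdk n L) (Nb n D) 1"
 unfolding sparse_def
proof (intro conjI allI)
 fix u :: "'a list"
 \<comment> \<open>All vertices of a simplex with face u are equal or adjacent to the head of u. For
   u = [] the row is zero, and \<open>W\<close> is finite all the same because
   \<open>bdd_complex\<close> speaks about every point.\<close>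
 define W where "W=insert (hd u) {y. y ~= hd u & {hd u, y}\<in>L}"
 have W: "finite W" "card W \<le> D + 1"
  using L unfolding W_def bdd_complex_def by (auto intro: order_trans[OF card_insert_le_m1])
 have sub: "{t. bdk n L u t ~= 0}\<subseteq>{t. set t \<subseteq> W & length t=n + 1}"
 proof clarify
  fix t assume nz: "bdk n L u t ~= 0"
  note b = bdk_nonzeroD[OF nz]
  have hd: "hd u\<in>set t" using b(1,3,5) by (cases u) auto
  have "y\<in>W" if y: "y\<in>set t" for y
  proof (cases "y=hd u")
   case False
   have "{hd u, y}\<in>L"
    using y hd L by (intro simp_cx_subset[OF _ ord_simpD(3)[OF b(2)]]) (simp_all add: bdd_complex_def)
   thus ?thesis using False by (simp add: W_def)
  qed (simp add: W_def)
  thus "set t \<subseteq> W & length t=n + 1" using ord_simpD(1)[OF b(2)] by auto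
 qed
 have fin: "finite {t. set t \<subseteq> W & length t=n + 1}" using W(1) by (rule finite_lists_length_eq)
 show "finite {t. bdk n L u t ~= 0}" by (rule finite_subset[OF sub fin])
 have "card {t. bdk n L u t ~= 0} \<le> card {t. set t \<subseteq> W & length t=n + 1}" by (rule card_mono[OF fin sub])
 also have "...=card W ^ (n + 1)" using W(1) by (rule card_lists_length_eq)
 also have "... \<le> Nb n D" unfolding Nb_def using W(2) by (intro power_mono) auto
 finally show "card {t. bdk n L u t ~= 0} \<le> Nb n D" .
next
 fix t :: "'a list"
 show "finite {u. bdk n L u t ~= 0}" "card {u. bdk n L u t ~= 0} \<le> Nb n D"
 proof -
  have sub: "{u. bdk n L u t ~= 0}\<subseteq>{u. set u \<subseteq> set t & length u=n}"
   using bdk_nonzeroD(3,5)[of n L _ t] by auto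
  have fin: "finite {u. set u \<subseteq> set t & length u=n}" by (rule finite_lists_length_eq) simp
  show "finite {u. bdk n L u t ~= 0}" by (rule finite_subset[OF sub fin])
  show "card {u. bdk n L u t ~= 0} \<le> Nb n D"
  proof (cases "length t=n + 1")
   case True
   have "card {u. bdk n L u t ~= 0} \<le> card {u. set u \<subseteq> set t & length u=n}" by (rule card_mono[OF fin sub])
   also have "...=card (set t) ^ n" by (rule card_lists_length_eq) simp
   also have "...\<le>(n + D + 1) ^ n" using card_length[of t] True by (intro power_mono) auto
   also have "... \<le> Nb n D" unfolding Nb_def by (intro power_increasing) auto
   finally show ?thesis .
  next
   case False
   hence "{u. bdk n L u t ~= 0}={}" using bdk_nonzeroD(2) ord_simpD(1) by blast
   thus ?thesis by simp
  qed
 qed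
next
 fix u t :: "'a list"
 show "norm (bdk n L u t)\<le>1"
 proof (cases "n ~= 0 & t\<in>ordered_simplices n L")
  case True
  hence "norm (alt_entry n t u) \<le> fact (n + 1)" by (intro norm_alt_entry) (simp add: ordered_simplices_def)
  thus ?thesis using True unfolding bdk_def by (simp add: norm_divide divide_le_eq norm_fact del: fact_Suc)
 qed (auto simp: bdk_def)
qed

section \<open>Boundary, coboundary and Laplacian as kernel operators\<close>

lemma kop_bdk_in:
 assumes L: "bdd_complex D L" and c: "l2 c"
 shows "kop (bdk n L) c\<in>l2_chains (n - 1) L"
proof (rule l2_chainsI)
 fix u assume u: "u \<notin> ordered_simplices (n - 1) L"
 have "bdk n L u t=0" for t using bdk_face u L unfolding bdd_complex_def by blast
 thus "kop (bdk n L) c u=0" by (simp add: kop_def)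
next
 fix u p assume u: "u\<in>ordered_simplices (n - 1) L" and p: "p permutes {..n - 1}"
 have l: "p permutes {..<length u}" using p ord_simpD(1)[OF u] by (simp add: lessThan_Suc_atMost)
 have b: "bdk n L (permute_list p u) t = of_int (sign p) * bdk n L u t" for t
  using alt_entry_permute_right[OF l] by (simp add: bdk_def)
 have "of_int (sign p) ~= (0::complex)" by (simp add: sign_def)
 hence "{t. bdk n L (permute_list p u) t ~= 0}={t. bdk n L u t ~= 0}" by (simp add: b)
 thus "kop (bdk n L) c (permute_list p u) = of_int (sign p) * kop (bdk n L) c u"
  by (simp add: kop_def b sum_distrib_left mult_ac)
qed (rule kop_bounded(1)[OF sparse_bdk[OF L] c])

lemma kop_adj_bdk_in:
 assumes L: "bdd_complex D L" and c: "l2 c"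
 shows "kop (adj (bdk n L)) c\<in>l2_chains n L"
proof (rule l2_chainsI)
 fix t assume t: "t \<notin> ordered_simplices n L"
 have "adj (bdk n L) t u=0" for u using t by (simp add: bdk_def adj_def)
 thus "kop (adj (bdk n L)) c t=0" by (simp add: kop_def)
next
 fix t p assume t: "t\<in>ordered_simplices n L" and p: "p permutes {..n}"
 have b: "adj (bdk n L) (permute_list p t) u = of_int (sign p) * adj (bdk n L) t u" for u
  using alt_entry_permute_left[OF p ord_simpD(1)[OF t], of u] permute_ordered_simplices[OF t p] t
  by (simp add: bdk_def adj_def)
 have "of_int (sign p) ~= (0::complex)" by (simp add: sign_def)
 hence "{u. adj (bdk n L) (permute_list p t) u ~= 0}={u. adj (bdk n L) t u ~= 0}" by (simp add: b)
 thus "kop (adj (bdk n L)) c (permute_list p t) = of_int (sign p) * kop (adj (bdk n L)) c t"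
  by (simp add: kop_def b sum_distrib_left mult_ac)
qed (rule kop_bounded(1)[OF sparse_adj[OF sparse_bdk[OF L]] c])

text \<open>Replacing the coefficient of t by that of a reordering, with its sign, does not change
  the sum against an alternating chain; averaging over all reorderings replaces
  \<open>bd_entry\<close> by \<open>alt_entry\<close>.\<close>

lemma boundary_eq_kop:
 assumes L: "bdd_complex D L" and c: "c\<in>l2_chains n L"
 shows "boundary n L c=kop (bdk n L) c"
proof
 fix u
 show "boundary n L c u=kop (bdk n L) c u"
 proof (cases "n=0")
  case True
  thus ?thesis by (simp add: boundary_def kop_def bdk_def)
 next
  case n: False
  let ?O = "ordered_simplices n L"
  \<comment> \<open>Only simplices containing u contribute to the value at u, and these are finitely
    many by the degree bound; the infinite sum becomes finite.\<close>
  define S where "S={t\<in>?O. set u \<subseteq> set t & length u=n}"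
  have Sfin: "finite S"
  proof -
   define W where "W=insert (hd u) {y. y ~= hd u & {hd u, y}\<in>L}"
   have "S\<subseteq>{t. set t \<subseteq> W & length t=n + 1}"
   proof
    fix t assume t: "t\<in>S"
    hence tO: "t\<in>?O" and hd: "hd u\<in>set t" using n unfolding S_def by (cases u; auto)+
    have "y\<in>W" if y: "y\<in>set t" for y
    proof (cases "y=hd u")
     case False
     have "{hd u, y}\<in>L"
      using y hd L by (intro simp_cx_subset[OF _ ord_simpD(3)[OF tO]]) (simp_all add: bdd_complex_def)
     thus ?thesis using False by (simp add: W_def)
    qed (simp add: W_def)
    thus "t\<in>{t. set t \<subseteq> W & length t=n + 1}" using ord_simpD(1)[OF tO] by auto
   qed
   moreover have "finite W" using L by (simp add: W_def bdd_complex_def)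
   ultimately show ?thesis using finite_lists_length_eq finite_subset by blast
  qed
  have perm: "permute_list p t\<in>S \<longleftrightarrow> t\<in>S" if p: "p permutes {..n}" and t: "length t=n + 1" for p t
  proof -
   have "p permutes {..<length t}" using p t by (simp add: lessThan_Suc_atMost)
   thus ?thesis unfolding S_def by (simp add: ordered_simplices_def)
  qed
  have zero: "bd_entry n t u=0" if "t\<in>?O" "t \<notin> S" for t
   using bd_entry_nonzeroD[of n t u] ord_simpD(1)[OF that(1)] that unfolding S_def by blast
  have reidx: "(\<Sum>t\<in>S. c t*(of_int (sign p) * bd_entry n (permute_list p t) u))=(\<Sum>t\<in>S. c t * bd_entry n t u)"
   if p: "p permutes {..n}" for p
  proof -
   have bij: "bij_betw (permute_list p) S S"
   proof (rule bij_betwI[of _ _ _ "permute_list (inv_into UNIV p)"])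
    have pi: "inv_into UNIV p permutes {..n}" using permutes_inv[OF p] .
    have len: "length t=n + 1" if "t\<in>S" for t using that ord_simpD(1) unfolding S_def by blast
    show "permute_list p\<in>S \<rightarrow> S" "permute_list (inv_into UNIV p)\<in>S \<rightarrow> S"
     using perm[OF p] perm[OF pi] len by blast+
    fix t assume t: "t\<in>S"
    have l: "{..n}={..<length t}" using len[OF t] by (simp add: lessThan_Suc_atMost)
    show "permute_list (inv_into UNIV p) (permute_list p t)=t"
     using permute_list_compose[of "inv_into UNIV p" t p] pi l permutes_inv_o(1)[OF p] by simp
    show "permute_list p (permute_list (inv_into UNIV p) t)=t"
     using permute_list_compose[of p t "inv_into UNIV p"] p l permutes_inv_o(2)[OF p] by simp
   qed
   have "(\<Sum>t\<in>S. c t * bd_entry n t u)=(\<Sum>t\<in>S. c (permute_list p t) * bd_entry n (permute_list p t) u)"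
    by (rule sum.reindex_bij_betw[OF bij, symmetric])
   also have "...=(\<Sum>t\<in>S. c t*(of_int (sign p) * bd_entry n (permute_list p t) u))"
    by (intro sum.cong refl) (use l2_chainsD(3)[OF c _ p] in \<open>auto simp: S_def\<close>)
   finally show ?thesis by simp
  qed
  have "boundary n L c u=(\<Sum>\<^sub>\<infinity>t\<in>?O. c t * bd_entry n t u) / fact (n + 1)"
   unfolding boundary_def bd_entry_def using n by simp
  also have "(\<Sum>\<^sub>\<infinity>t\<in>?O. c t * bd_entry n t u)=(\<Sum>\<^sub>\<infinity>t\<in>S. c t * bd_entry n t u)"
   by (rule infsum_cong_neutral) (auto simp: zero, auto simp: S_def)
  also have "...=(\<Sum>t\<in>S. c t * bd_entry n t u)" using Sfin by simp
  also have "...=(\<Sum>t\<in>S. c t * alt_entry n t u)"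
  proof -
   have "fact (n + 1)*(\<Sum>t\<in>S. c t * alt_entry n t u) =
    (\<Sum>t\<in>S. \<Sum>p | p permutes {..n}. c t*(of_int (sign p) * bd_entry n (permute_list p t) u))"
    unfolding sum_distrib_left
   proof (rule sum.cong[OF refl])
    fix t
    have "fact (n + 1)*(c t * alt_entry n t u)=c t*(\<Sum>p | p permutes {..n}. of_int (sign p) * bd_entry n (permute_list p t) u)"
     unfolding alt_entry_def by (simp del: fact_Suc)
    thus "fact (n + 1)*(c t * alt_entry n t u)=(\<Sum>p | p permutes {..n}. c t*(of_int (sign p) * bd_entry n (permute_list p t) u))"
     by (simp only: sum_distrib_left)
   qed
   also have "...=(\<Sum>p | p permutes {..n}. \<Sum>t\<in>S. c t*(of_int (sign p) * bd_entry n (permute_list p t) u))"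
    by (rule sum.swap)
   also have "...=(\<Sum>p | p permutes {..n}. \<Sum>t\<in>S. c t * bd_entry n t u)"
    by (intro sum.cong refl reidx) simp
   also have "...=fact (n + 1)*(\<Sum>t\<in>S. c t * bd_entry n t u)" by (simp add: card_permutations algebra_simps)
   finally show ?thesis by (simp only: mult_cancel_left fact_nonzero simp_thms)
  qed
  also have "... / fact (n + 1)=(\<Sum>t\<in>S. bdk n L u t * c t)"
   using n by (simp add: sum_divide_distrib bdk_def S_def mult_ac)
  also have "...=(\<Sum>t | bdk n L u t ~= 0. bdk n L u t * c t)"
  proof (rule sum.mono_neutral_right[OF Sfin])
   show "{t. bdk n L u t ~= 0} \<subseteq> S"
   proof
    fix t assume "t\<in>{t. bdk n L u t ~= 0}"
    hence nz: "bdk n L u t ~= 0" by simp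
    show "t\<in>S" using bdk_nonzeroD(2,3,5)[OF nz] by (simp add: S_def)
   qed
  qed auto
  finally show ?thesis by (simp add: kop_def)
 qed
qed

lemma l2_chains_comb:
 assumes "c\<in>l2_chains n L" "d\<in>l2_chains n L"
 shows "(%t. c t - a * d t)\<in>l2_chains n L"
 by (rule l2_chainsI) (auto intro!: l2_diff l2_scale simp: l2_chainsD[OF assms(1)] l2_chainsD[OF assms(2)] algebra_simps)

lemma l2_chains_scale:
 assumes "c\<in>l2_chains n L"
 shows "(%t. a * c t)\<in>l2_chains n L"
 by (rule l2_chainsI) (auto intro!: l2_scale simp: l2_chainsD[OF assms(1)] algebra_simps)

text \<open>The factor n + 1 is the ratio of the normalisations (n + 1)! and n! of the inner
  products in degrees n and n - 1. Uniqueness of the adjoint is seen by testing two candidates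
  against their difference. In degree 0 both sides vanish.\<close>

lemma coboundary_eq_kop:
 assumes L: "bdd_complex D L" and w: "l2 w"
 shows "coboundary n L w=(%t. of_nat (n + 1) * kop (adj (bdk n L)) w t)"
proof -
 let ?v = "%t. of_nat (n + 1) * kop (adj (bdk n L)) w t"
 have v: "?v\<in>l2_chains n L" by (rule l2_chains_scale[OF kop_adj_bdk_in[OF L w]])
 have adj: "chain_inner (n - 1) (boundary n L u) w=chain_inner n u ?v" if u: "u\<in>l2_chains n L" for u
 proof (cases "n=0")
  case True
  thus ?thesis by (simp add: chain_inner_def boundary_def kop_def bdk_def adj_def)
 next
  case False
  hence f: "fact (n - 1 + 1)=(fact n :: complex)" "fact (n + 1) = of_nat (n + 1)*(fact n :: complex)" by simp_all
  have "of_nat (n + 1) ~= (0::complex)" by (simp only: of_nat_eq_0_iff)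
  have "chain_inner (n - 1) (boundary n L u) w=ip u (kop (adj (bdk n L)) w) / fact n"
   unfolding boundary_eq_kop[OF L u] chain_inner_def f ip_def[symmetric] kop_adj[OF sparse_bdk[OF L] l2_chainsD(1)[OF u] w] ..
  also have "... = of_nat (n + 1) * ip u (kop (adj (bdk n L)) w) / fact (n + 1)"
   unfolding f(2) using \<open>of_nat (n + 1) \<noteq> (0::complex)\<close> by (simp del: of_nat_add of_nat_Suc)
  also have "...=chain_inner n u ?v"
   unfolding chain_inner_def ip_def[symmetric] ip_scale_right by simp
  finally show ?thesis .
 qed
 show ?thesis
  unfolding coboundary_def hilbert_adjoint_def
 proof (rule the_equality)
  show "?v\<in>l2_chains n L & (\<forall>u\<in>l2_chains n L. chain_inner (n - 1) (boundary n L u) w=chain_inner n u ?v)"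
   using v adj by blast
  fix v' assume v': "v'\<in>l2_chains n L & (\<forall>u\<in>l2_chains n L. chain_inner (n - 1) (boundary n L u) w=chain_inner n u v')"
  let ?d = "%t. v' t - ?v t"
  have d: "?d\<in>l2_chains n L" using l2_chains_comb[OF conjunct1[OF v'] v, of 1] by simp
  have "chain_inner n ?d v'=chain_inner n ?d ?v" using conjunct2[OF v', rule_format, OF d] adj[OF d] by simp
  hence "ip ?d v' / fact (n + 1)=ip ?d ?v / fact (n + 1)" unfolding chain_inner_def ip_def .
  hence "ip ?d v'=ip ?d ?v" by (simp only: divide_cancel_right fact_nonzero simp_thms)
  hence "ip ?d ?d=0"
   using ip_diff_right[of v' ?v ?d] l2_chainsD(1)[OF d] l2_chainsD(1)[OF v] l2_chainsD(1)[OF conjunct1[OF v']] by simp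
  hence "nsq ?d=0" by (simp add: ip_self)
  hence "?d=(%_. 0)" using nsq_zero_imp[OF l2_chainsD(1)[OF d]] by simp
  thus "v'=?v" by (metis eq_iff_diff_eq_0 ext)
 qed
qed

text \<open>The Laplacian written with kernels, meaningful on arbitrary functions; the weights n + 2
  and n + 1 come from \<open>coboundary_eq_kop\<close> in degrees n + 1 and n.\<close>

definition lapk :: "nat => 'v set set => ('v list => complex) => 'v list => complex"
 where "lapk n L c=(%t. of_nat (n + 2) * kop (bdk (n + 1) L) (kop (adj (bdk (n + 1) L)) c) t +
  of_nat (n + 1) * kop (adj (bdk n L)) (kop (bdk n L) c) t)"

lemma laplacian_eq_lapk:
 assumes L: "bdd_complex D L" and c: "c\<in>l2_chains n L"
 shows "laplacian n L c=lapk n L c"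
proof -
 have l: "l2 c" by (rule l2_chainsD(1)[OF c])
 have "(%t. of_nat (n + 1 + 1) * kop (adj (bdk (n + 1) L)) c t)\<in>l2_chains (n + 1) L"
  by (rule l2_chains_scale[OF kop_adj_bdk_in[OF L l]])
 from boundary_eq_kop[OF L this]
 have "boundary (n + 1) L (coboundary (n + 1) L c)=(%t. of_nat (n + 2) * kop (bdk (n + 1) L) (kop (adj (bdk (n + 1) L)) c) t)"
  unfolding coboundary_eq_kop[OF L l] kop_scale by simp
 moreover have "coboundary n L (boundary n L c)=(%t. of_nat (n + 1) * kop (adj (bdk n L)) (kop (bdk n L) c) t)"
  unfolding boundary_eq_kop[OF L c] by (rule coboundary_eq_kop[OF L kop_bounded(1)[OF sparse_bdk[OF L] l]])
 ultimately show ?thesis unfolding laplacian_def lapk_def by simp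
qed

text \<open>Factor 2 from bounding the squared norm of a sum of two terms, \<open>Nb\<close> squared
  from the Schur test, and n + 2 as one of the two weights of each term, the other being absorbed by
  the quadratic form. It depends on n and D only, so one constant serves all fibres.\<close>

definition CC :: "nat => nat => real"
 where "CC n D=2 * real (n + 2)*(real (Nb (n + 1) D))\<^sup>2"

lemma adj_adj [simp]: "adj (adj k)=k" by (simp add: adj_def)

lemma lapk_diff: "lapk n L (%t. f t - g t)=(%t. lapk n L f t - lapk n L g t)"
 unfolding lapk_def kop_diff by (simp add: algebra_simps)

lemma lapk_scale: "lapk n L (%t. a * f t)=(%t. a * lapk n L f t)"
 unfolding lapk_def kop_scale by (simp add: algebra_simps)

text \<open>Both the symmetry of the Laplacian and the bound by its quadratic form are read off from
  this sum of two Gram terms.\<close>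

lemma lapk_form:
 assumes L: "bdd_complex D L" and v: "l2 v" and w: "l2 w"
 shows "ip (lapk n L v) w = of_nat (n + 2) * ip (kop (adj (bdk (n + 1) L)) v) (kop (adj (bdk (n + 1) L)) w) +
  of_nat (n + 1) * ip (kop (bdk n L) v) (kop (bdk n L) w)"
proof -
 note sp = sparse_bdk[OF L] sparse_adj[OF sparse_bdk[OF L]]
 note b = kop_bounded(1)[OF sp(1)] kop_bounded(1)[OF sp(2)]
 show ?thesis
  unfolding lapk_def
  by (subst ip_add_left) (simp_all add: l2_scale b v w ip_scale_left kop_adj[OF sp(1)] kop_adj[OF sp(2)] del: of_nat_add of_nat_Suc)
qed

lemma pos_op_lapk:
 assumes L: "bdd_complex D L"
 shows "pos_op (l2_chains n L) (lapk n L) (CC n D)"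
proof
 note sp = sparse_bdk[OF L] sparse_adj[OF sparse_bdk[OF L]]
 note b = kop_bounded(1)[OF sp(1)] kop_bounded(1)[OF sp(2)]
 show "l2 v" if "v\<in>l2_chains n L" for v by (rule l2_chainsD(1)[OF that])
 show "(%t. v t - a * w t)\<in>l2_chains n L" if "v\<in>l2_chains n L" "w\<in>l2_chains n L" for v w a
  using that by (rule l2_chains_comb)
 show "g\<in>l2_chains n L" if f: "!!k. f k\<in>l2_chains n L" and g: "!!t. (%k. f k t) \<longlonglongrightarrow> g t" "l2 g" for f g
 proof (rule l2_chainsI)
  fix t assume "t \<notin> ordered_simplices n L"
  hence "f k t=0" for k by (rule l2_chainsD(2)[OF f])
  thus "g t=0" using g(1)[of t] by (simp add: LIMSEQ_const_iff)
 next
  fix t p assume t: "t\<in>ordered_simplices n L" and p: "p permutes {..n}"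
  have "(%k. f k (permute_list p t))=(%k. of_int (sign p) * f k t)" using l2_chainsD(3)[OF f t p] by auto
  moreover have "(%k. of_int (sign p) * f k t) \<longlonglongrightarrow> of_int (sign p) * g t" by (intro tendsto_intros g)
  ultimately show "g (permute_list p t) = of_int (sign p) * g t" using g(1)[of "permute_list p t"] LIMSEQ_unique by metis
 qed (rule g(2))
 show "lapk n L v\<in>l2_chains n L" if v: "v\<in>l2_chains n L" for v
 proof -
  have l: "l2 v" by (rule l2_chainsD(1)[OF v])
  have "kop (bdk (n + 1) L) (kop (adj (bdk (n + 1) L)) v)\<in>l2_chains n L"
   using kop_bdk_in[OF L b(2)[OF l], of "n + 1"] by simp
  moreover have "kop (adj (bdk n L)) (kop (bdk n L) v)\<in>l2_chains n L"
   by (rule kop_adj_bdk_in[OF L b(1)[OF l]])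
  ultimately have "(%t. of_nat (n + 2) * kop (bdk (n + 1) L) (kop (adj (bdk (n + 1) L)) v) t -
   (- of_nat (n + 1)) * kop (adj (bdk n L)) (kop (bdk n L) v) t)\<in>l2_chains n L"
   by (intro l2_chains_comb l2_chains_scale)
  moreover have "a * x - (- b) * y=a * x + b * y" for a b x y :: complex by simp
  ultimately show ?thesis unfolding lapk_def by (simp only:)
 qed
 show "ip (lapk n L v) w=ip v (lapk n L w)" if "v\<in>l2_chains n L" "w\<in>l2_chains n L" for v w
 proof -
  have l: "l2 v" "l2 w" using that l2_chainsD(1) by auto
  have "ip v (lapk n L w)=cnj (ip (lapk n L w) v)" by (rule ip_cnj)
  also have "...=ip (lapk n L v) w"
   unfolding lapk_form[OF L l(2,1)] lapk_form[OF L l]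
   by (simp add: ip_cnj[symmetric] del: of_nat_add of_nat_Suc)
  finally show ?thesis ..
 qed
 show "nsq (lapk n L v) \<le> CC n D * Re (ip (lapk n L v) v)" if v: "v\<in>l2_chains n L" for v
 proof -
  have l: "l2 v" by (rule l2_chainsD(1)[OF v])
  define x y where "x=kop (adj (bdk (n + 1) L)) v" and "y=kop (bdk n L) v"
  define \<beta> where "\<beta>=(real (Nb (n + 1) D))\<^sup>2"
  have lx: "l2 x" "l2 y" using b l by (auto simp: x_def y_def)
  have "Nb n D \<le> Nb (n + 1) D" unfolding Nb_def by (intro order_trans[OF power_mono power_increasing]) auto
  hence \<beta>: "(real (Nb n D))\<^sup>2\<le>\<beta>" unfolding \<beta>_def by (intro power_mono) auto
  have bx: "nsq (kop (bdk (n + 1) L) x)\<le>\<beta> * nsq x"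
   using kop_bounded(2)[OF sp(1) lx(1), of "n + 1"] by (simp add: \<beta>_def)
  have "nsq (kop (adj (bdk n L)) y)\<le>(real (Nb n D))\<^sup>2 * nsq y"
   using kop_bounded(2)[OF sp(2) lx(2), of n] by simp
  also have "...\<le>\<beta> * nsq y" using \<beta> by (intro mult_right_mono) auto
  finally have "by": "nsq (kop (adj (bdk n L)) y)\<le>\<beta> * nsq y" .
  have "nsq (lapk n L v)\<le>2*((real (n + 2))\<^sup>2 * nsq (kop (bdk (n + 1) L) x)) + 2*((real (n + 1))\<^sup>2 * nsq (kop (adj (bdk n L)) y))"
   unfolding lapk_def x_def[symmetric] y_def[symmetric]
   using nsq_add_le(2)[OF l2_scale[OF b(1)[OF lx(1)]] l2_scale[OF b(2)[OF lx(2)]], of "of_nat (n + 2)" "n + 1" "of_nat (n + 1)" n]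
   unfolding nsq_scale norm_of_nat .
  also have "...\<le>2*((real (n + 2))\<^sup>2*(\<beta> * nsq x)) + 2*((real (n + 2) * real (n + 1))*(\<beta> * nsq y))"
   using bx "by" by (intro add_mono mult_left_mono mult_mono) (auto simp: power2_eq_square \<beta>_def intro!: mult_right_mono)
  also have "...=CC n D*(real (n + 2) * nsq x + real (n + 1) * nsq y)"
   unfolding CC_def \<beta>_def[symmetric] by (simp add: power2_eq_square algebra_simps)
  also have "real (n + 2) * nsq x + real (n + 1) * nsq y=Re (ip (lapk n L v) v)"
   unfolding lapk_form[OF L l l] x_def[symmetric] y_def[symmetric] ip_self
   by simp
  finally show ?thesis .
 qed
 show "(%k. lapk n L (f k) t) \<longlonglongrightarrow> lapk n L g t" if "!!t. (%k. f k t) \<longlonglongrightarrow> g t" for f g t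
  unfolding lapk_def by (intro tendsto_intros kop_tendsto that)
 have "Nb (n + 1) D > 0" by (simp add: Nb_def)
 thus "CC n D > 0" by (simp add: CC_def)
qed

section \<open>The projection onto harmonic chains and its naturality\<close>

definition hproj :: "nat => nat => 'v set set => ('v list => complex) => 'v list => complex"
 where "hproj D n L=pos_op.proj (lapk n L) (CC n D)"

lemma
 assumes L: "bdd_complex D L" and v: "v\<in>l2_chains n L"
 shows hproj_in: "hproj D n L v\<in>l2_chains n L"
  and lapk_hproj: "lapk n L (hproj D n L v)=(%_. 0)"
  and nsq_hproj: "nsq (hproj D n L v) \<le> nsq v"
  and hproj_orth: "u\<in>l2_chains n L ==> lapk n L u=(%_. 0) ==> ip (%t. v t - hproj D n L v t) u=0"
  and hproj_tendsto: "(%k. (pos_op.A (lapk n L) (CC n D) ^^ (2 * k)) v t) \<longlonglongrightarrow> hproj D n L v t"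
proof -
 interpret pos_op "l2_chains n L" "lapk n L" "CC n D" by (rule pos_op_lapk[OF L])
 show "hproj D n L v\<in>l2_chains n L" "lapk n L (hproj D n L v)=(%_. 0)" "nsq (hproj D n L v) \<le> nsq v"
  "u\<in>l2_chains n L ==> lapk n L u=(%_. 0) ==> ip (%t. v t - hproj D n L v t) u=0"
  "(%k. (A ^^ (2 * k)) v t) \<longlonglongrightarrow> hproj D n L v t"
  unfolding hproj_def using proj_in[OF v] T_proj[OF v] nsq_proj[OF v] proj_orth[OF v] tendsto_proj[OF v] by auto
qed

text \<open>Characterises the projection without reference to the iteration defining it; all
  naturality statements below are obtained by checking these two conditions.\<close>

lemma hproj_unique:
 assumes L: "bdd_complex D L" and v: "v\<in>l2_chains n L" and h: "h\<in>l2_chains n L" "lapk n L h=(%_. 0)"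
  and orth: "!!u. u\<in>l2_chains n L ==> lapk n L u=(%_. 0) ==> ip (%t. v t - h t) u=0"
 shows "hproj D n L v=h"
 unfolding hproj_def
proof (rule pos_op.proj_unique[OF pos_op_lapk[OF L] v h, symmetric])
 show "lapk n L (%t. h t - pos_op.proj (lapk n L) (CC n D) v t) =
  (%t. lapk n L h t - lapk n L (pos_op.proj (lapk n L) (CC n D) v) t)" by (rule lapk_diff)
qed (rule orth)

lemma hproj_scale:
 assumes L: "bdd_complex D L" and v: "v\<in>l2_chains n L"
 shows "hproj D n L (%t. a * v t)=(%t. a * hproj D n L v t)"
proof (rule hproj_unique[OF L l2_chains_scale[OF v] l2_chains_scale[OF hproj_in[OF L v]]])
 show "lapk n L (%t. a * hproj D n L v t)=(%_. 0)" unfolding lapk_scale lapk_hproj[OF L v] by simp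
 fix u assume "u\<in>l2_chains n L" "lapk n L u=(%_. 0)"
 from hproj_orth[OF L v this] ip_scale_left[of a "%t. v t - hproj D n L v t" u]
 show "ip (%t. a * v t - a * hproj D n L v t) u=0" by (simp add: right_diff_distrib)
qed

text \<open>An isomorphism onto a union of connected components, or onto the whole complex.\<close>

definition comp_emb :: "('v => 'w) => 'v set set => 'w set set => bool"
 where "comp_emb j L' L \<longleftrightarrow> inj_on j (\<Union>L') & (\<forall>s\<in>L'. j ` s\<in>L) &
  (\<forall>s\<in>L. s \<inter> j ` \<Union>L' ~= {} --> (\<exists>s'\<in>L'. s=j ` s'))"

text \<open>All lists of vertices rather than ordered simplices, so that one domain for
  \<open>map j\<close> serves chains and faces of every degree.\<close>

definition tuples :: "'v set set => 'v list set"
 where "tuples L={t. set t\<subseteq>\<Union>L}"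

lemma inj_on_map_tuples:
 assumes i: "inj_on j (\<Union>L)"
 shows "inj_on (map j) (tuples L)"
proof (rule inj_onI)
 fix x y assume x: "x\<in>tuples L" and y: "y\<in>tuples L" and e: "map j x=map j y"
 have "set x \<union> set y\<subseteq>\<Union>L" using x y by (simp add: tuples_def)
 hence "inj_on j (set x \<union> set y)" by (rule inj_on_subset[OF i])
 thus "x=y" by (rule map_inj_on[OF e])
qed

lemma map_image_tuples: "t\<in>map j ` tuples L \<longleftrightarrow> set t \<subseteq> j ` \<Union>L"
proof
 assume "set t \<subseteq> j ` \<Union>L"
 hence "\<forall>x\<in>set t. \<exists>y. y\<in>\<Union>L & x=j y" by blast
 then obtain f where f: "!!x. x\<in>set t ==> f x\<in>\<Union>L & x=j (f x)" by metis
 hence "map j (map f t)=t" by (auto intro!: map_idI simp: comp_def)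
 moreover have "map f t\<in>tuples L" using f by (auto simp: tuples_def)
 ultimately show "t\<in>map j ` tuples L" by (metis imageI)
next
 assume "t\<in>map j ` tuples L"
 thus "set t \<subseteq> j ` \<Union>L" unfolding tuples_def by (metis (no_types, lifting) image_iff image_mono list.set_map mem_Collect_eq)
qed

lemma map_ord_simp:
 assumes j: "comp_emb j L' L" and t: "t\<in>tuples L'"
 shows "map j t\<in>ordered_simplices n L \<longleftrightarrow> t\<in>ordered_simplices n L'"
proof -
 have inj: "inj_on j (\<Union>L')" using j by (simp add: comp_emb_def)
 have inj': "inj_on j (set t)" using inj t by (auto simp: tuples_def intro: inj_on_subset)
 have "j ` set t\<in>L \<longleftrightarrow> set t\<in>L'" if "length t=n + 1"
 proof
  assume L: "j ` set t\<in>L"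
  have "set t ~= {}" using that by auto
  moreover have "j ` set t \<subseteq> j ` \<Union>L'" using t unfolding tuples_def by (intro image_mono) simp
  ultimately have "j ` set t \<inter> j ` \<Union>L' ~= {}" by (simp add: Int_absorb2)
  then obtain s where s: "s\<in>L'" "j ` set t=j ` s" using j L unfolding comp_emb_def by blast
  hence "set t = s" using inj_on_image_eq_iff[OF inj, of "set t" s] t by (auto simp: tuples_def)
  thus "set t\<in>L'" using s by simp
 qed (use j in \<open>auto simp: comp_emb_def\<close>)
 thus ?thesis using inj' by (auto simp: ordered_simplices_def distinct_map)
qed

text \<open>A face u with nonzero entry is nonempty, so if u lies in the image then any simplex
  containing u meets the image and, by \<open>comp_emb\<close>, comes entirely from it. Thus no
  entry connects the image with its complement.\<close>

lemma matching_bdk: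
 assumes j: "comp_emb j L' L" and L': "simplicial_complex L'" and L: "simplicial_complex L"
 shows "matching (tuples L') (map j) (bdk n L') (bdk n L)"
 unfolding matching_def
proof (intro conjI ballI allI impI)
 have inj: "inj_on j (\<Union>L')" using j by (simp add: comp_emb_def)
 fix u t assume u: "u\<in>tuples L'" and t: "t\<in>tuples L'"
 have "inj_on j (set t \<union> set u)" using inj u t by (auto simp: tuples_def intro: inj_on_subset)
 thus "bdk n L (map j u) (map j t)=bdk n L' u t"
  using map_ord_simp[OF j t, of n] alt_entry_map[of j t u n] by (auto simp: bdk_def ordered_simplices_def)
next
 fix u t assume nz: "bdk n L u t ~= 0"
 note b = bdk_nonzeroD[OF nz]
 show "u\<in>map j ` tuples L' \<longleftrightarrow> t\<in>map j ` tuples L'"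
  unfolding map_image_tuples
 proof
  assume u: "set u \<subseteq> j ` \<Union>L'"
  have "set u ~= {}" using b(1,3) by auto
  then obtain x where x: "x\<in>set u" by (meson ex_in_conv)
  have "x\<in>set t \<inter> j ` \<Union>L'" using subsetD[OF b(5) x] subsetD[OF u x] by (rule IntI)
  hence "set t \<inter> j ` \<Union>L' ~= {}" by auto
  then obtain s where "s\<in>L'" "set t=j ` s" using j ord_simpD(3)[OF b(2)] unfolding comp_emb_def by blast
  thus "set t \<subseteq> j ` \<Union>L'" by blast
 qed (use b(5) in blast)
next
 fix u t assume nz: "bdk n L' u t ~= 0"
 note b = bdk_nonzeroD[OF nz]
 show "t\<in>tuples L'" "u\<in>tuples L'" using ord_simpD(4)[OF b(2)] b(5) by (auto simp: tuples_def)
qed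

abbreviation jpush :: "('v => 'w) => 'v set set => ('v list => complex) => 'w list => complex"
 where "jpush j L' \<equiv> push (tuples L') (map j)"

abbreviation jpull :: "('v => 'w) => 'v set set => ('w list => complex) => 'v list => complex"
 where "jpull j L' \<equiv> pull (tuples L') (map j)"

lemma push_map:
 assumes "comp_emb j L' L" "t\<in>tuples L'"
 shows "jpush j L' c (map j t)=c t"
 using assms inj_on_map_tuples[of j L'] by (simp add: push_def comp_emb_def)

lemma ordered_in_tuples: "t\<in>ordered_simplices n L ==> t\<in>tuples L"
 using ord_simpD(4)[of t n L] by (simp add: tuples_def)

lemma push_in_l2_chains:
 assumes j: "comp_emb j L' L" and c: "c\<in>l2_chains n L'"
 shows "jpush j L' c\<in>l2_chains n L"
proof (rule l2_chainsI)
 have inj: "inj_on (map j) (tuples L')" using j by (intro inj_on_map_tuples) (simp add: comp_emb_def)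
 show "l2 (jpush j L' c)" by (rule nsq_push[OF inj l2_chainsD(1)[OF c]])
 fix t assume t: "t \<notin> ordered_simplices n L"
 show "jpush j L' c t=0"
 proof (cases "t\<in>map j ` tuples L'")
  case True
  then obtain s where s: "s\<in>tuples L'" "t=map j s" by blast
  thus ?thesis using t map_ord_simp[OF j s(1)] l2_chainsD(2)[OF c] push_map[OF j s(1)] by simp
 qed (simp add: push_def)
next
 fix t p assume t: "t\<in>ordered_simplices n L" and p: "p permutes {..n}"
 have p': "p permutes {..<length t}" using p ord_simpD(1)[OF t] by (simp add: lessThan_Suc_atMost)
 show "jpush j L' c (permute_list p t) = of_int (sign p) * jpush j L' c t"
 proof (cases "t\<in>map j ` tuples L'")
  case True
  then obtain s where s: "s\<in>tuples L'" "t=map j s" by blast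
  have so: "s\<in>ordered_simplices n L'" using t s map_ord_simp[OF j s(1)] by simp
  have "permute_list p t=map j (permute_list p s)" using p' s by (simp add: permute_list_map)
  thus ?thesis
   using push_map[OF j ordered_in_tuples[OF permute_ordered_simplices[OF so p]], of c] push_map[OF j s(1), of c] s
    l2_chainsD(3)[OF c so p] by simp
 next
  case False
  hence "permute_list p t \<notin> map j ` tuples L'" using p' by (simp add: map_image_tuples)
  thus ?thesis using False by (simp add: push_def)
 qed
qed

lemma pull_in_l2_chains:
 assumes j: "comp_emb j L' L" and d: "d\<in>l2_chains n L"
 shows "jpull j L' d\<in>l2_chains n L'"
proof (rule l2_chainsI)
 have inj: "inj_on (map j) (tuples L')" using j by (intro inj_on_map_tuples) (simp add: comp_emb_def)
 show "l2 (jpull j L' d)" by (rule l2_pull[OF inj l2_chainsD(1)[OF d]])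
 fix t assume t: "t \<notin> ordered_simplices n L'"
 show "jpull j L' d t=0"
  using t map_ord_simp[OF j, of t n] l2_chainsD(2)[OF d] by (auto simp: pull_def)
next
 fix t p assume t: "t\<in>ordered_simplices n L'" and p: "p permutes {..n}"
 have p': "p permutes {..<length t}" using p ord_simpD(1)[OF t] by (simp add: lessThan_Suc_atMost)
 have tt: "t\<in>tuples L'" "permute_list p t\<in>tuples L'"
  using ordered_in_tuples[OF t] ordered_in_tuples[OF permute_ordered_simplices[OF t p]] by auto
 have "map j t\<in>ordered_simplices n L" using t map_ord_simp[OF j tt(1)] by simp
 from l2_chainsD(3)[OF d this p]
 show "jpull j L' d (permute_list p t) = of_int (sign p) * jpull j L' d t"
  using tt p' by (simp add: pull_def permute_list_map)
qed

lemma lapk_push_pull: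
 assumes j: "comp_emb j L' L" and L': "simplicial_complex L'" and L: "simplicial_complex L"
 shows "lapk n L (jpush j L' c)=jpush j L' (lapk n L' c)"
  and "lapk n L' (jpull j L' d)=jpull j L' (lapk n L d)"
proof -
 have inj: "inj_on (map j) (tuples L')" using j by (intro inj_on_map_tuples) (simp add: comp_emb_def)
 note m = matching_bdk[OF assms] matching_adj[OF matching_bdk[OF assms]]
 show "lapk n L (jpush j L' c)=jpush j L' (lapk n L' c)"
  unfolding lapk_def kop_push[OF m(1) inj] kop_push[OF m(2) inj] by (auto simp: push_def)
 show "lapk n L' (jpull j L' d)=jpull j L' (lapk n L d)"
  unfolding lapk_def kop_pull[OF m(1) inj] kop_pull[OF m(2) inj] by (auto simp: pull_def)
qed

text \<open>The extension by zero of a harmonic chain is harmonic. A harmonic chain of the large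
  complex restricts to a harmonic one of the small complex, so the orthogonality required by
  \<open>hproj_unique\<close> follows from the adjointness of extension and restriction.\<close>

lemma hproj_push:
 assumes j: "comp_emb j L' L" and L': "bdd_complex D L'" and L: "bdd_complex D L"
  and v: "v\<in>l2_chains n L'"
 shows "hproj D n L (jpush j L' v)=jpush j L' (hproj D n L' v)"
proof (rule hproj_unique[OF L push_in_l2_chains[OF j v] push_in_l2_chains[OF j hproj_in[OF L' v]]])
 have inj: "inj_on (map j) (tuples L')" using j by (intro inj_on_map_tuples) (simp add: comp_emb_def)
 have sc: "simplicial_complex L'" "simplicial_complex L" using L L' by (auto simp: bdd_complex_def)
 show "lapk n L (jpush j L' (hproj D n L' v))=(%_. 0)"
  unfolding lapk_push_pull(1)[OF j sc] lapk_hproj[OF L' v] by (auto simp: push_def)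
 fix u assume u: "u\<in>l2_chains n L" "lapk n L u=(%_. 0)"
 have h: "hproj D n L' v\<in>l2_chains n L'" by (rule hproj_in[OF L' v])
 have "(%t. jpush j L' v t - jpush j L' (hproj D n L' v) t)=jpush j L' (%t. v t - hproj D n L' v t)"
  by (auto simp: push_def)
 moreover have "ip (jpush j L' (%t. v t - hproj D n L' v t)) u=ip (%t. v t - hproj D n L' v t) (jpull j L' u)"
 proof (rule ip_push_pull[OF inj])
  fix t assume "t \<notin> tuples L'"
  hence "t \<notin> ordered_simplices n L'" using ordered_in_tuples by blast
  thus "v t - hproj D n L' v t=0" using l2_chainsD(2)[OF v] l2_chainsD(2)[OF h] by simp
 qed
 moreover have "...=0"
 proof (rule hproj_orth[OF L' v pull_in_l2_chains[OF j u(1)]])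
  show "lapk n L' (jpull j L' u)=(%_. 0)" unfolding lapk_push_pull(2)[OF j sc] u(2) by (auto simp: pull_def)
 qed
 ultimately show "ip (%t. jpush j L' v t - jpush j L' (hproj D n L' v) t) u=0" by simp
qed

lemma push_oriented:
 assumes j: "comp_emb j L' L" and t: "t\<in>ordered_simplices n L'"
 shows "jpush j L' (oriented t) = oriented (map j t)"
proof
 fix u
 have tt: "t\<in>tuples L'" by (rule ordered_in_tuples[OF t])
 show "jpush j L' (oriented t) u = oriented (map j t) u"
 proof (cases "u\<in>map j ` tuples L'")
  case True
  then obtain s where s: "s\<in>tuples L'" "u=map j s" by blast
  have "inj_on j (set t \<union> set s)" using j tt s by (auto simp: comp_emb_def tuples_def intro: inj_on_subset)
  thus ?thesis using push_map[OF j s(1)] s oriented_map by metis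
 next
  case False
  hence "\<not> set u \<subseteq> j ` \<Union>L'" by (simp add: map_image_tuples)
  moreover have "set (map j t) \<subseteq> j ` \<Union>L'" using tt by (auto simp: tuples_def)
  ultimately have "oriented (map j t) u=0" using oriented_nonzeroD(4)[of "map j t" u] by metis
  thus ?thesis using False by (simp add: push_def)
 qed
qed

text \<open>Block diagonality in usable form: coefficients of the projection at a simplex of the
  image are those of the small complex, and they vanish away from the image.\<close>

lemma hproj_oriented_map:
 assumes "comp_emb j L' L" "bdd_complex D L'" "bdd_complex D L" "t\<in>ordered_simplices n L'"
 shows "hproj D n L (oriented (map j t))=jpush j L' (hproj D n L' (oriented t))"
 using hproj_push[OF assms(1-3) oriented_in_l2_chains[OF assms(4)]] push_oriented[OF assms(1,4)] by simp

section \<open>The local topology on rooted complexes\<close>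

lemma group_actionI:
 assumes "group G" "!!g x. g\<in>carrier G ==> x\<in>E ==> \<phi> g x\<in>E" "!!x. x\<in>E ==> \<phi> \<one>\<^bsub>G\<^esub> x=x"
  "!!g h x. g\<in>carrier G ==> h\<in>carrier G ==> x\<in>E ==> \<phi> (g \<otimes>\<^bsub>G\<^esub> h) x=\<phi> g (\<phi> h x)"
  "!!g. g\<in>carrier G ==> \<phi> g\<in>extensional E"
 shows "group_action G E \<phi>"
proof -
 interpret group G by fact
 have bij: "\<phi> g\<in>Bij E" if g: "g\<in>carrier G" for g
 proof -
  have "bij_betw (\<phi> g) E E"
  proof (rule bij_betwI[of _ _ _ "\<phi> (inv\<^bsub>G\<^esub> g)"])
   show "\<phi> g\<in>E \<rightarrow> E" "\<phi> (inv\<^bsub>G\<^esub> g)\<in>E \<rightarrow> E" using assms(2) g by auto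
   show "\<phi> (inv\<^bsub>G\<^esub> g) (\<phi> g x)=x" "\<phi> g (\<phi> (inv\<^bsub>G\<^esub> g) x)=x" if "x\<in>E" for x
    using assms(4)[OF inv_closed[OF g] g that] assms(4)[OF g inv_closed[OF g] that] assms(3)[OF that] g by simp_all
  qed
  thus ?thesis using assms(5)[OF g] by (simp add: Bij_def)
 qed
 have "\<phi> (g \<otimes>\<^bsub>G\<^esub> h)=compose E (\<phi> g) (\<phi> h)" if gh: "g\<in>carrier G" "h\<in>carrier G" for g h
 proof
  fix x show "\<phi> (g \<otimes>\<^bsub>G\<^esub> h) x=compose E (\<phi> g) (\<phi> h) x"
   using assms(4)[OF gh, of x] assms(5)[OF m_closed[OF gh]] by (cases "x\<in>E") (auto simp: compose_def extensional_def)
 qed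
 hence "\<phi>\<in>hom G (BijGroup E)"
  using bij by (auto simp: hom_def BijGroup_def)
 thus ?thesis
  unfolding group_action_def group_hom_def group_hom_axioms_def using group_BijGroup is_group by blast
qed

lemma group_actionD:
 assumes "group_action G E \<phi>"
 shows "group G" "!!g x. g\<in>carrier G ==> x\<in>E ==> \<phi> g x\<in>E" "!!x. x\<in>E ==> \<phi> \<one>\<^bsub>G\<^esub> x=x"
  "!!g h x. g\<in>carrier G ==> h\<in>carrier G ==> x\<in>E ==> \<phi> (g \<otimes>\<^bsub>G\<^esub> h) x=\<phi> g (\<phi> h x)"
  "!!g. g\<in>carrier G ==> \<phi> g\<in>extensional E"
  "!!g x. g\<in>carrier G ==> x\<in>E ==> \<phi> (inv\<^bsub>G\<^esub> g) (\<phi> g x)=x"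
  "!!g x. g\<in>carrier G ==> x\<in>E ==> \<phi> g (\<phi> (inv\<^bsub>G\<^esub> g) x)=x"
proof -
 interpret group_action G E \<phi> by fact
 show g: "group G" using group_hom group_hom.axioms(1) by blast
 interpret G: group G by fact
 show c: "\<phi> g x\<in>E" if "g\<in>carrier G" "x\<in>E" for g x using element_image that by blast
 show o: "\<phi> \<one>\<^bsub>G\<^esub> x=x" if "x\<in>E" for x using id_eq_one that by (metis restrict_apply')
 show m: "\<phi> (g \<otimes>\<^bsub>G\<^esub> h) x=\<phi> g (\<phi> h x)" if "g\<in>carrier G" "h\<in>carrier G" "x\<in>E" for g h x
  using composition_rule that by blast
 show "\<phi> g\<in>extensional E" if "g\<in>carrier G" for g using bij_prop0[OF that] by (simp add: Bij_def)
 show "\<phi> (inv\<^bsub>G\<^esub> g) (\<phi> g x)=x" "\<phi> g (\<phi> (inv\<^bsub>G\<^esub> g) x)=x" if "g\<in>carrier G" "x\<in>E" for g x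
  using that m[of "inv\<^bsub>G\<^esub> g" g x] m[of g "inv\<^bsub>G\<^esub> g" x] o[of x] by auto
qed

lemma GcxD:
 assumes "G_complex G K"
 shows "simplicial_complex (faces K)" "group_action G (verts K) (act K)"
  "!!g s. g\<in>carrier G ==> s\<in>faces K ==> act K g ` s\<in>faces K"
 using assms by (auto simp: G_complex_def)

lemmas Gcx_act = group_actionD[OF GcxD(2)]

lemma simp_cxD:
 assumes "simplicial_complex S"
 shows "S ~= {}" "s\<in>S ==> finite s" "s\<in>S ==> s ~= {}" "s\<in>S ==> t \<subseteq> s ==> t ~= {} ==> t\<in>S"
  "x\<in>\<Union>S ==> {x}\<in>S"
proof -
 show "S ~= {}" "s\<in>S ==> finite s" "s\<in>S ==> s ~= {}" using assms unfolding simplicial_complex_def by simp_all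
 show "s\<in>S ==> t \<subseteq> s ==> t ~= {} ==> t\<in>S" by (rule simp_cx_subset[OF assms])
 assume "x\<in>\<Union>S"
 then obtain s where "s\<in>S" "x\<in>s" by blast
 thus "{x}\<in>S" using simp_cx_subset[OF assms, of s "{x}"] by simp
qed

lemma adjacentD: "adjacent K x y ==> x\<in>verts K" "adjacent K x y ==> y\<in>verts K"
 by (auto simp: adjacent_def verts_def)

lemma walk_in_verts: "(adjacent K ^^ k) x y ==> x\<in>verts K ==> y\<in>verts K"
 by (cases k) (auto dest: adjacentD)

text \<open>No equivariance is demanded: the maps x to \<lfloor>g, x\<rfloor> and the translations
  by group elements are used in this form.\<close>

definition gembed :: "('v => 'w) => ('g, 'v) gcomplex => ('g, 'w) gcomplex => bool"
 where "gembed f K L \<longleftrightarrow> comp_emb f (faces K) (faces L)"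

lemma gembed_adjacent:
 assumes f: "gembed f K L" and K: "simplicial_complex (faces K)" and x: "x\<in>verts K"
 shows "adjacent L (f x) w \<longleftrightarrow> (\<exists>y. w=f y & adjacent K x y)"
proof
 assume a: "adjacent L (f x) w"
 hence e: "{f x, w}\<in>faces L" "f x ~= w" by (auto simp: adjacent_def)
 moreover have "{f x, w} \<inter> f ` \<Union>(faces K) ~= {}" using x by (auto simp: verts_def)
 ultimately obtain s where s: "s\<in>faces K" "{f x, w}=f ` s"
  using f unfolding gembed_def comp_emb_def by blast
 have inj: "inj_on f (verts K)" using f by (simp add: gembed_def comp_emb_def verts_def)
 have sv: "s \<subseteq> verts K" using s(1) by (auto simp: verts_def)
 obtain y where y: "y\<in>s" "w=f y" using s(2) by blast
 obtain x' where "x'\<in>s" "f x=f x'" using s(2) by blast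
 hence "x\<in>s" using inj x sv inj_onD by (metis subsetD)
 hence "{x, y}\<in>faces K" using y s simp_cxD(4)[OF K s(1), of "{x, y}"] by auto
 thus "\<exists>y. w=f y & adjacent K x y" using y e(2) by (auto simp: adjacent_def)
next
 assume "\<exists>y. w=f y & adjacent K x y"
 then obtain y where y: "w=f y" "adjacent K x y" by blast
 have inj: "inj_on f (verts K)" using f by (simp add: gembed_def comp_emb_def verts_def)
 have "f ` {x, y}\<in>faces L" using f y(2) unfolding gembed_def comp_emb_def adjacent_def by blast
 moreover have "f x ~= f y" using inj_onD[OF inj _ x adjacentD(2)[OF y(2)]] y(2) by (auto simp: adjacent_def)
 ultimately show "adjacent L (f x) w" using y(1) by (simp add: adjacent_def)
qed

lemma gembed_walk:
 assumes f: "gembed f K L" and K: "simplicial_complex (faces K)" and x: "x\<in>verts K"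
 shows "(adjacent L ^^ k) (f x) w \<longleftrightarrow> (\<exists>y. w=f y & (adjacent K ^^ k) x y)"
proof (induction k arbitrary: w)
 case (Suc k)
 show ?case
 proof
  assume "(adjacent L ^^ Suc k) (f x) w"
  then obtain v where v: "(adjacent L ^^ k) (f x) v" "adjacent L v w" by auto
  then obtain y where y: "v=f y" "(adjacent K ^^ k) x y" using Suc by blast
  have "y\<in>verts K" by (rule walk_in_verts[OF y(2) x])
  then obtain z where "w=f z" "adjacent K y z" using v(2) y(1) gembed_adjacent[OF f K] by blast
  thus "\<exists>y. w=f y & (adjacent K ^^ Suc k) x y" using y(2) by auto
 next
  assume "\<exists>y. w=f y & (adjacent K ^^ Suc k) x y"
  then obtain z y where z: "w=f z" "(adjacent K ^^ k) x y" "adjacent K y z" by auto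
  have "y\<in>verts K" by (rule walk_in_verts[OF z(2) x])
  hence "adjacent L (f y) w" using z gembed_adjacent[OF f K] by blast
  moreover have "(adjacent L ^^ k) (f x) (f y)" using Suc z(2) by blast
  ultimately show "(adjacent L ^^ Suc k) (f x) w" by auto
 qed
qed auto

lemma gembed_reach:
 assumes f: "gembed f K L" and K: "simplicial_complex (faces K)" and x: "x\<in>verts K"
 shows "(adjacent L)\<^sup>*\<^sup>* (f x) w \<longleftrightarrow> (\<exists>y. w=f y & (adjacent K)\<^sup>*\<^sup>* x y)"
 unfolding rtranclp_power gembed_walk[OF assms] by blast

lemma reach_in_verts: "(adjacent K)\<^sup>*\<^sup>* x y ==> x\<in>verts K ==> y\<in>verts K"
 unfolding rtranclp_power using walk_in_verts by metis

definition giso :: "('g, 'b) monoid_scheme => ('v => 'w) => ('g, 'v) gcomplex => ('g, 'w) gcomplex => bool"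
 where "giso G f K L \<longleftrightarrow> bij_betw f (verts K) (verts L) & (%s. f ` s) ` faces K=faces L &
  (\<forall>g\<in>carrier G. \<forall>x\<in>verts K. f (act K g x)=act L g (f x))"

lemma marked_iso_iff: "marked_iso G (K, os) (L, os') \<longleftrightarrow> (\<exists>f. giso G f K L & map (%O'. f ` O') os = os')"
 by (auto simp: marked_iso_def giso_def)

lemma gisoD:
 assumes "giso G f K L"
 shows "inj_on f (verts K)" "f ` verts K=verts L" "s\<in>faces K ==> f ` s\<in>faces L"
  "t\<in>faces L ==> \<exists>s\<in>faces K. t=f ` s"
  "g\<in>carrier G ==> x\<in>verts K ==> f (act K g x)=act L g (f x)"
proof -
 show "inj_on f (verts K)" "f ` verts K=verts L" "s\<in>faces K ==> f ` s\<in>faces L"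
  "g\<in>carrier G ==> x\<in>verts K ==> f (act K g x)=act L g (f x)"
  using assms by (auto simp: giso_def bij_betw_def)
 assume "t\<in>faces L"
 hence "t\<in>(%s. f ` s) ` faces K" using assms by (simp add: giso_def)
 thus "\<exists>s\<in>faces K. t=f ` s" by (simp add: image_iff)
qed

lemma giso_gembed: "giso G f K L ==> gembed f K L"
 unfolding gembed_def comp_emb_def verts_def[symmetric] using gisoD[of G f K L] by blast

lemma giso_refl: "giso G id K K"
 by (auto simp: giso_def)

lemma giso_trans: "giso G f K L ==> giso G f' L M ==> giso G (f' \<circ> f) K M"
 unfolding giso_def
proof (elim conjE, intro conjI ballI)
 assume f: "bij_betw f (verts K) (verts L)" "(%s. f ` s) ` faces K=faces L"
   "\<forall>g\<in>carrier G. \<forall>x\<in>verts K. f (act K g x)=act L g (f x)"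
  and f': "bij_betw f' (verts L) (verts M)" "(%s. f' ` s) ` faces L=faces M"
   "\<forall>g\<in>carrier G. \<forall>x\<in>verts L. f' (act L g x)=act M g (f' x)"
 show "bij_betw (f' \<circ> f) (verts K) (verts M)" by (rule bij_betw_trans[OF f(1) f'(1)])
 show "(%s. (f' \<circ> f) ` s) ` faces K=faces M"
  unfolding f'(2)[symmetric] f(2)[symmetric] image_image image_comp[symmetric] ..
 fix g x assume "g\<in>carrier G" "x\<in>verts K"
 thus "(f' \<circ> f) (act K g x)=act M g ((f' \<circ> f) x)"
  using f(3) f'(3) bij_betwE[OF f(1)] by simp
qed

lemma giso_inv:
 assumes K: "G_complex G K" and f: "giso G f K L"
 shows "giso G (inv_into (verts K) f) L K"
 unfolding giso_def
proof (intro conjI ballI)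
 let ?f = "inv_into (verts K) f"
 note d = gisoD[OF f]
 show "bij_betw ?f (verts L) (verts K)" using f by (auto simp: giso_def intro: bij_betw_inv_into)
 have "?f ` (f ` s) = s" if "s\<in>faces K" for s
  using that d(1) by (intro inv_into_image_cancel) (auto simp: verts_def)
 hence "(%s. ?f ` s) ` ((%s. f ` s) ` faces K)=faces K" by (auto simp: image_image)
 thus "(%s. ?f ` s) ` faces L=faces K" using f by (simp add: giso_def)
 fix g y assume g: "g\<in>carrier G" and "y\<in>verts L"
 then obtain x where x: "x\<in>verts K" "y=f x" using d(2) by blast
 have "act K g x\<in>verts K" using Gcx_act(2)[OF K g x(1)] .
 hence "?f (f (act K g x))=act K g x" using d(1) by simp
 thus "?f (act L g y)=act K g (?f y)" using x d(1) d(5)[OF g x(1)] by simp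
qed

section \<open>Marked complexes and their isomorphism classes\<close>

definition wmarked :: "('g, 'b) monoid_scheme => ('g, 'v) marked => bool"
 where "wmarked G=(%(K, os). G_complex G K & (\<forall>O'\<in>set os. O' \<subseteq> verts K))"

lemma marked_iso_refl: "marked_iso G M M"
proof -
 obtain K os where M: "M=(K, os)" by fastforce
 have "map (%O'. id ` O') os = os" by simp
 thus ?thesis using giso_refl unfolding M marked_iso_iff by blast
qed

lemma marked_iso_trans: "marked_iso G M N ==> marked_iso G N P ==> marked_iso G M P"
proof -
 assume a: "marked_iso G M N" "marked_iso G N P"
 obtain K os L os' Q os'' where M: "M=(K, os)" "N=(L, os')" "P=(Q, os'')" by (metis surj_pair)
 from a obtain f f' where "giso G f K L" "map (%O'. f ` O') os = os'" "giso G f' L Q" "map (%O'. f' ` O') os' = os''"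
  unfolding M marked_iso_iff by blast
 moreover from this have "map (%O'. (f' \<circ> f) ` O') os = os''" by (auto simp: image_comp)
 ultimately show ?thesis unfolding M marked_iso_iff using giso_trans by blast
qed

text \<open>Only an action on \<open>K\<close> with roots among its vertices is used to invert the
  map. This is what \<open>wmarked\<close> records, and it holds for balls without a look at degrees
  or connectedness.\<close>

lemma marked_iso_sym: "wmarked G M ==> marked_iso G M N ==> marked_iso G N M"
proof -
 assume a: "wmarked G M" "marked_iso G M N"
 obtain K os L os' where M: "M=(K, os)" "N=(L, os')" by (metis surj_pair)
 from a obtain f where f: "giso G f K L" "map (%O'. f ` O') os = os'" unfolding M marked_iso_iff by blast
 have K: "G_complex G K" "\<forall>O'\<in>set os. O' \<subseteq> verts K" using a by (auto simp: M wmarked_def)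
 have "map (%O'. inv_into (verts K) f ` O') os'=map (%O'. O') os"
  unfolding f(2)[symmetric] map_map comp_def using K(2) gisoD(1)[OF f(1)]
  by (intro map_cong refl inv_into_image_cancel) auto
 thus ?thesis unfolding M marked_iso_iff using giso_inv[OF K(1) f(1)] by auto
qed

lemma markedD:
 assumes "marked_complex D G (K, os)"
 shows "G_complex G K" "degree_le D K" "O'\<in>set os ==> O'\<in>orbits G (verts K) (act K)"
  "O'\<in>set os ==> x\<in>verts K ==> \<exists>v\<in>O'. (adjacent K)\<^sup>*\<^sup>* v x"
 using assms by (auto simp: marked_complex_def)

lemma orbit_subset: "group_action G E \<phi> ==> x\<in>E ==> orbit G \<phi> x \<subseteq> E"
 using group_actionD(2) by (fastforce simp: orbit_def)

lemma root_subset: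
 assumes "marked_complex D G (K, os)" "O'\<in>set os"
 shows "O' \<subseteq> verts K"
proof -
 have "O'\<in>orbits G (verts K) (act K)" by (rule markedD(3)[OF assms])
 thus ?thesis
  unfolding orbits_def using orbit_subset[OF GcxD(2)[OF markedD(1)[OF assms(1)]]] by blast
qed

lemma marked_wmarked: "marked_complex D G M ==> wmarked G M"
proof -
 assume M: "marked_complex D G M"
 obtain K os where e: "M=(K, os)" by fastforce
 show ?thesis unfolding e wmarked_def prod.case
  using root_subset[OF M[unfolded e]] markedD(1)[OF M[unfolded e]] by blast
qed

lemma orbit_image:
 assumes f: "giso G f K L" and x: "x\<in>verts K"
 shows "f ` orbit G (act K) x = orbit G (act L) (f x)"
 unfolding orbit_def using gisoD(5)[OF f _ x] by (auto simp: image_def)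

definition nbrs :: "('g, 'v) gcomplex => 'v => 'v set"
 where "nbrs K x={y. adjacent K x y}"

lemma edges_nbrs: "bij_betw (%y. {x, y}) (nbrs K x) {e\<in>faces K. card e=2 & x\<in>e}"
proof (rule bij_betwI[of _ _ _ "%e. the_elem (e - {x})"])
 show "(%y. {x, y})\<in>nbrs K x \<rightarrow> {e\<in>faces K. card e=2 & x\<in>e}"
  by (auto simp: nbrs_def adjacent_def card_2_iff)
 have *: "\<exists>y. e={x, y} & x ~= y" if "card e=2" "x\<in>e" for e
  using that by (auto simp: card_2_iff doubleton_eq_iff)
 have t: "the_elem ({x, y} - {x})=y" if "x ~= y" for y
  using that by (simp add: insert_Diff_if)
 show "(%e. the_elem (e - {x}))\<in>{e\<in>faces K. card e=2 & x\<in>e} \<rightarrow> nbrs K x"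
 proof
  fix e assume e: "e\<in>{e\<in>faces K. card e=2 & x\<in>e}"
  then obtain y where "e={x, y}" "x ~= y" using * by blast
  thus "the_elem (e - {x})\<in>nbrs K x" using e t by (simp add: nbrs_def adjacent_def)
 qed
 show "the_elem ({x, y} - {x})=y" if "y\<in>nbrs K x" for y using that t by (simp add: nbrs_def adjacent_def)
 show "{x, the_elem (e - {x})}=e" if e: "e\<in>{e\<in>faces K. card e=2 & x\<in>e}" for e
 proof -
  obtain y where "e={x, y}" "x ~= y" using * e by blast
  thus ?thesis using t by simp
 qed
qed

lemma degree_le_nbrs: "degree_le D K \<longleftrightarrow> (\<forall>x\<in>verts K. finite (nbrs K x) & card (nbrs K x) \<le> D)"
proof -
 have "finite {e\<in>faces K. card e=2 & x\<in>e}=finite (nbrs K x)"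
  "card {e\<in>faces K. card e=2 & x\<in>e}=card (nbrs K x)" for x
  using bij_betw_finite[OF edges_nbrs[of x K]] bij_betw_same_card[OF edges_nbrs[of x K]] by simp_all
 thus ?thesis unfolding degree_le_def by simp
qed

lemma gembed_nbrs:
 assumes "gembed f K L" "simplicial_complex (faces K)" "x\<in>verts K"
 shows "nbrs L (f x)=f ` nbrs K x" "card (nbrs L (f x))=card (nbrs K x)"
proof -
 show 1: "nbrs L (f x)=f ` nbrs K x" unfolding nbrs_def gembed_adjacent[OF assms] by auto
 have "inj_on f (nbrs K x)"
  using assms(1) adjacentD(2)[of K x] by (auto simp: gembed_def comp_emb_def nbrs_def verts_def intro: inj_on_subset)
 thus "card (nbrs L (f x))=card (nbrs K x)" unfolding 1 by (rule card_image)
qed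

lemma degree_le_giso:
 assumes f: "giso G f K L" and K: "simplicial_complex (faces K)" "degree_le D K"
 shows "degree_le D L"
 unfolding degree_le_nbrs
proof
 fix y assume "y\<in>verts L"
 then obtain x where x: "x\<in>verts K" "y=f x" using gisoD(2)[OF f] by blast
 thus "finite (nbrs L y) & card (nbrs L y) \<le> D"
  using gembed_nbrs[OF giso_gembed[OF f] K(1) x(1)] K(2) by (auto simp: degree_le_nbrs)
qed

lemma marked_giso:
 assumes K: "marked_complex D G (K, os)" and L: "G_complex G L" and f: "giso G f K L"
 shows "marked_complex D G (L, map (%O'. f ` O') os)"
 unfolding marked_complex_def prod.case
proof (intro conjI ballI L)
 have sc: "simplicial_complex (faces K)" by (rule GcxD(1)[OF markedD(1)[OF K]])
 show "degree_le D L" by (rule degree_le_giso[OF f sc markedD(2)[OF K]])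
 fix O' assume "O'\<in>set (map (%O'. f ` O') os)"
 then obtain P where P: "P\<in>set os" "O'=f ` P" by auto
 obtain x where x: "x\<in>verts K" "P = orbit G (act K) x" using markedD(3)[OF K P(1)] by (auto simp: orbits_def)
 have "f x\<in>verts L" using gisoD(2)[OF f] x by blast
 thus "O'\<in>orbits G (verts L) (act L)" using orbit_image[OF f x(1)] P x(2) by (auto simp: orbits_def)
 fix y assume "y\<in>verts L"
 then obtain z where z: "z\<in>verts K" "y=f z" using gisoD(2)[OF f] by blast
 obtain v where v: "v\<in>P" "(adjacent K)\<^sup>*\<^sup>* v z" using markedD(4)[OF K P(1) z(1)] by blast
 have "v\<in>verts K" using root_subset[OF K P(1)] v by blast
 hence "(adjacent L)\<^sup>*\<^sup>* (f v) y" using gembed_reach[OF giso_gembed[OF f] sc] v z by blast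
 thus "\<exists>v\<in>O'. (adjacent L)\<^sup>*\<^sup>* v y" using P v by blast
qed

text \<open>Transport of structure along an injection of the vertices; with an enumeration it
  produces the representatives on natural numbers that classes are made of.\<close>

definition copy :: "('v => 'w) => ('g, 'v) gcomplex => ('g, 'w) gcomplex"
 where "copy e K=\<lparr>faces=(%s. e ` s) ` faces K,
  act=(%g. restrict (%y. e (act K g (inv_into (verts K) e y))) (e ` verts K))\<rparr>"

lemma copy:
 assumes K: "G_complex G K" and e: "inj_on e (verts K)"
 shows "giso G e K (copy e K)" "G_complex G (copy e K)"
proof -
 have v: "verts (copy e K)=e ` verts K" by (auto simp: verts_def copy_def)
 show iso: "giso G e K (copy e K)"
  unfolding giso_def v using e by (auto simp: bij_betw_def copy_def)
 note a = Gcx_act[OF K]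
 have sub: "s \<subseteq> verts K" if "s\<in>faces K" for s using that by (auto simp: verts_def)
 have act: "act (copy e K) g (e x)=e (act K g x)" if "x\<in>verts K" for g x
  using that e by (simp add: copy_def)
 have "simplicial_complex (faces (copy e K))"
  unfolding simplicial_complex_def
 proof (intro conjI ballI allI impI)
  show "faces (copy e K) ~= {}" using simp_cxD(1)[OF GcxD(1)[OF K]] by (simp add: copy_def)
  fix s assume "s\<in>faces (copy e K)"
  then obtain s' where s': "s'\<in>faces K" "s=e ` s'" by (auto simp: copy_def)
  show "finite s" "s ~= {}" using s' simp_cxD(2,3)[OF GcxD(1)[OF K]] by auto
  fix t assume t: "t \<subseteq> s & t ~= {}"
  then obtain t' where t': "t' \<subseteq> s'" "t=e ` t'" using s' by (metis subset_image_iff)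
  hence "t'\<in>faces K" using simp_cxD(4)[OF GcxD(1)[OF K] s'(1)] t by auto
  thus "t\<in>faces (copy e K)" using t' by (auto simp: copy_def)
 qed
 moreover have "group_action G (verts (copy e K)) (act (copy e K))"
  unfolding v
 proof (rule group_actionI[OF a(1)])
  fix g y assume g: "g\<in>carrier G" and "y\<in>e ` verts K"
  then obtain x where x: "x\<in>verts K" "y=e x" by blast
  show "act (copy e K) g y\<in>e ` verts K" using act[OF x(1)] x(2) a(2)[OF g x(1)] by simp
  fix h assume h: "h\<in>carrier G"
  show "act (copy e K) (h \<otimes>\<^bsub>G\<^esub> g) y=act (copy e K) h (act (copy e K) g y)"
   using act[OF x(1)] act[OF a(2)[OF g x(1)]] x(2) a(4)[OF h g x(1)] by simp
 next
  fix y assume "y\<in>e ` verts K"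
  thus "act (copy e K) \<one>\<^bsub>G\<^esub> y=y" using act a(3) by auto
 qed (auto simp: copy_def)
 moreover have "act (copy e K) g ` s\<in>faces (copy e K)" if g: "g\<in>carrier G" and s: "s\<in>faces (copy e K)" for g s
 proof -
  obtain s' where s': "s'\<in>faces K" "s=e ` s'" using s by (auto simp: copy_def)
  have "act (copy e K) g ` s=e ` (act K g ` s')" using act sub[OF s'(1)] by (auto simp: s'(2) image_image intro!: image_cong)
  thus ?thesis using GcxD(3)[OF K g s'(1)] by (auto simp: copy_def)
 qed
 ultimately show "G_complex G (copy e K)" by (simp add: G_complex_def)
qed

lemma nat_copy:
 assumes K: "marked_complex D G (K, os)" and "countable (verts K)"
 shows "\<exists>M :: ('g, nat) marked. marked_complex D G M & marked_iso G (K, os) M"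
proof -
 let ?e = "to_nat_on (verts K)"
 have e: "inj_on ?e (verts K)" using assms(2) by (rule inj_on_to_nat_on)
 note c = copy[OF markedD(1)[OF K] e]
 have "marked_complex D G (copy ?e K, map (%O'. ?e ` O') os)" by (rule marked_giso[OF K c(2,1)])
 thus ?thesis using c(1) marked_iso_iff by blast
qed

lemma mclass_self: "marked_complex D G (K, os) ==> (K, os)\<in>mclass D G K os"
 by (simp add: mclass_def marked_iso_refl)

lemma mclass_eq:
 assumes "wmarked G (K, os)" "marked_iso G (K, os) (L, os')"
 shows "mclass D G K os=mclass D G L os'"
 unfolding mclass_def using marked_iso_trans[OF assms(2)] marked_iso_trans[OF marked_iso_sym[OF assms]] by blast

lemma SC_D:
 assumes c: "c\<in>SC k D G" and M: "(K, os)\<in>c"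
 shows "marked_complex D G (K, os)" "c=mclass D G K os" "length os=k"
proof -
 obtain L :: "('a, nat) gcomplex" and os' where L: "marked_complex D G (L, os')" "length os'=k" "c=mclass D G L os'"
  using c unfolding SC_def by blast
 have iso: "marked_iso G (L, os') (K, os)" and m: "marked_complex D G (K, os)" using M L(3) by (auto simp: mclass_def)
 show "marked_complex D G (K, os)" by (rule m)
 show "c=mclass D G K os" unfolding L(3) by (rule mclass_eq[OF marked_wmarked[OF L(1)] iso])
 show "length os=k" using iso L(2) by (auto simp: marked_iso_iff)
qed

lemma SC_nonempty:
 assumes "c\<in>SC k D G"
 obtains K os where "(K, os)\<in>c"
 using assms mclass_self unfolding SC_def by blast

lemma mclass_in_SC:
 assumes K: "marked_complex D G (K, os)" "countable (verts K)"
 shows "mclass D G K os\<in>SC (length os) D G"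
proof -
 obtain M :: "('a, nat) marked" where M: "marked_complex D G M" "marked_iso G (K, os) M" using nat_copy[OF K] by blast
 obtain L os' where L: "M=(L, os')" by fastforce
 have "length os'=length os" using M(2) by (auto simp: L marked_iso_iff)
 moreover have "mclass D G K os=mclass D G L os'" using mclass_eq[OF marked_wmarked[OF K(1)]] M(2) by (simp add: L)
 ultimately show ?thesis using M(1) unfolding SC_def L by blast
qed

lemma mem_mclassD: "M\<in>mclass D G K os ==> marked_iso G (K, os) M & marked_complex D G M"
 by (simp add: mclass_def)

lemma rep_mem:
 assumes c: "c\<in>SC 1 D G" and r: "rep c=(K, O')"
 shows "(K, [O'])\<in>c"
proof -
 obtain L os where L: "(L, os)\<in>c" using SC_nonempty[OF c] .
 have "length os=1" by (rule SC_D(3)[OF c L])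
 then obtain P where "os=[P]" by (auto simp: length_Suc_conv)
 hence "case (L, P) of (K, O') => (K, [O'])\<in>c" using L by simp
 hence "case rep c of (K, O') => (K, [O'])\<in>c" unfolding rep_def by (rule someI)
 thus ?thesis by (simp add: r)
qed

section \<open>Full subcomplexes, balls and components\<close>

lemma verts_full:
 assumes "simplicial_complex (faces K)" "W \<subseteq> verts K"
 shows "verts (full_subcomplex K W)=W"
proof
 show "W \<subseteq> verts (full_subcomplex K W)"
 proof
  fix x assume "x\<in>W"
  hence "x\<in>\<Union>(faces K)" using assms(2) by (auto simp: verts_def)
  hence "{x}\<in>faces (full_subcomplex K W)"
   using simp_cxD(5)[OF assms(1)] \<open>x \<in> W\<close> by (simp add: full_subcomplex_def)
  thus "x\<in>verts (full_subcomplex K W)" by (auto simp: verts_def)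
 qed
qed (auto simp: full_subcomplex_def verts_def)

definition invariant :: "('g, 'b) monoid_scheme => ('g, 'v) gcomplex => 'v set => bool"
 where "invariant G K W \<longleftrightarrow> W \<subseteq> verts K & (\<forall>g\<in>carrier G. \<forall>x\<in>W. act K g x\<in>W)"

lemma G_complex_full_subcomplex:
 assumes K: "G_complex G K" and W: "invariant G K W" "W ~= {}"
 shows "G_complex G (full_subcomplex K W)"
proof -
 have Wv: "W \<subseteq> verts K" using W by (simp add: invariant_def)
 note v = verts_full[OF GcxD(1)[OF K] Wv]
 note a = Gcx_act[OF K]
 have "simplicial_complex (faces (full_subcomplex K W))"
  unfolding simplicial_complex_def
 proof (intro conjI ballI allI impI)
  show "faces (full_subcomplex K W) ~= {}" using v W(2) by (auto simp: verts_def)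
  fix s assume "s\<in>faces (full_subcomplex K W)"
  hence s: "s\<in>faces K" "s \<subseteq> W" by (simp_all add: full_subcomplex_def)
  note sc = GcxD(1)[OF K]
  show "finite s" "s ~= {}" by (rule simp_cxD(2)[OF sc s(1)], rule simp_cxD(3)[OF sc s(1)])
  fix t assume t: "t \<subseteq> s & t ~= {}"
  have "t\<in>faces K" by (rule simp_cxD(4)[OF sc s(1)]) (use t in auto)
  thus "t\<in>faces (full_subcomplex K W)" using s(2) t by (auto simp: full_subcomplex_def)
 qed
 moreover have "group_action G W (act (full_subcomplex K W))"
 proof (rule group_actionI[OF a(1)])
  show "act (full_subcomplex K W) (g \<otimes>\<^bsub>G\<^esub> h) x=act (full_subcomplex K W) g (act (full_subcomplex K W) h x)"
   if "g\<in>carrier G" "h\<in>carrier G" "x\<in>W" for g h x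
   using that W a(4)[OF that(1,2)] Wv by (auto simp: full_subcomplex_def invariant_def)
 qed (use W a(3) Wv in \<open>auto simp: full_subcomplex_def invariant_def\<close>)
 moreover have "act (full_subcomplex K W) g ` s\<in>faces (full_subcomplex K W)"
  if "g\<in>carrier G" "s\<in>faces (full_subcomplex K W)" for g s
 proof -
  have s: "s\<in>faces K" "s \<subseteq> W" using that by (auto simp: full_subcomplex_def)
  hence "act (full_subcomplex K W) g ` s=act K g ` s" by (auto simp: full_subcomplex_def intro!: image_cong)
  thus ?thesis using GcxD(3)[OF K that(1) s(1)] s W(1) that(1) by (auto simp: full_subcomplex_def invariant_def)
 qed
 ultimately show ?thesis unfolding G_complex_def v by blast
qed

lemma giso_full_subcomplex:
 assumes f: "giso G f K L" and K: "simplicial_complex (faces K)" and L: "simplicial_complex (faces L)" and W: "W \<subseteq> verts K"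
 shows "giso G f (full_subcomplex K W) (full_subcomplex L (f ` W))"
proof -
 note d = gisoD[OF f]
 have fW: "f ` W \<subseteq> verts L" using d(2) W by blast
 have sub: "s \<subseteq> verts K" if "s\<in>faces K" for s using that by (auto simp: verts_def)
 have "f ` s \<subseteq> f ` W \<longleftrightarrow> s \<subseteq> W" if "s\<in>faces K" for s
  using inj_on_image_subset_iff[OF d(1) sub[OF that] W] .
 hence "(%s. f ` s) ` {s\<in>faces K. s \<subseteq> W}={s\<in>faces L. s \<subseteq> f ` W}"
 proof (intro equalityI subsetI)
  fix t assume t: "t\<in>{s\<in>faces L. s \<subseteq> f ` W}"
  then obtain s where s: "s\<in>faces K" "t=f ` s" using d(4) by blast
  hence "s \<subseteq> W" using t \<open>!!s. s \<in> faces K ==> f ` s \<subseteq> f ` W \<longleftrightarrow> s \<subseteq> W\<close>[OF s(1)] by simp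
  thus "t\<in>(%s. f ` s) ` {s\<in>faces K. s \<subseteq> W}" using s by simp
 next
  fix t assume "t\<in>(%s. f ` s) ` {s\<in>faces K. s \<subseteq> W}"
  then obtain s where s: "s\<in>faces K" "s \<subseteq> W" "t=f ` s" by blast
  thus "t\<in>{s\<in>faces L. s \<subseteq> f ` W}" using d(3)[OF s(1)] image_mono[OF s(2)] by simp
 qed
 moreover have "bij_betw f W (f ` W)" using inj_on_subset[OF d(1) W] by (simp add: bij_betw_def)
 moreover have "f (act K g x)=act L g (f x)" if "g\<in>carrier G" "x\<in>W" for g x using d(5) that W by blast
 ultimately show ?thesis unfolding giso_def verts_full[OF K W] verts_full[OF L fW]
  by (auto simp: full_subcomplex_def)
qed

lemma full_full: "W' \<subseteq> W ==> full_subcomplex (full_subcomplex K W) W'=full_subcomplex K W'"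
 by (auto simp: full_subcomplex_def restrict_def fun_eq_iff)

definition ballset :: "('g, 'v) gcomplex => 'v set => real => 'v set"
 where "ballset K V r={x\<in>verts K. \<exists>v\<in>V. \<exists>k. real k \<le> r & (adjacent K ^^ k) v x}"

definition compset :: "('g, 'v) gcomplex => 'v set => 'v set"
 where "compset K V={x\<in>verts K. \<exists>v\<in>V. (adjacent K)\<^sup>*\<^sup>* v x}"

lemma cball_eq: "cball_complex K V r=full_subcomplex K (ballset K V r)"
 by (simp add: cball_complex_def ballset_def)

lemma comp_meeting_eq: "components_meeting K V=full_subcomplex K (compset K V)"
 by (simp add: components_meeting_def compset_def)

lemma ballset_subset: "ballset K V r \<subseteq> verts K" by (auto simp: ballset_def)

lemma subset_ballset: "V \<subseteq> verts K ==> 0 \<le> r ==> V \<subseteq> ballset K V r"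
 unfolding ballset_def by (auto intro!: bexI exI[of _ 0])

lemma subset_compset: "V \<subseteq> verts K ==> V \<subseteq> compset K V"
 by (auto simp: compset_def)

lemma giso_ballset:
 assumes f: "giso G f K L" and K: "simplicial_complex (faces K)" and V: "V \<subseteq> verts K"
 shows "f ` ballset K V r=ballset L (f ` V) r"
proof -
 note w = gembed_walk[OF giso_gembed[OF f] K]
 have "\<exists>x\<in>ballset K V r. y=f x" if mem: "y\<in>ballset L (f ` V) r" for y
 proof -
  obtain v k where v: "v\<in>V" "real k \<le> r" "(adjacent L ^^ k) (f v) y" using mem by (auto simp: ballset_def)
  then obtain x where x: "y=f x" "(adjacent K ^^ k) v x" using w V by blast
  have "x\<in>verts K" using walk_in_verts[OF x(2)] v V by blast
  thus ?thesis using x v by (auto simp: ballset_def)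
 qed
 moreover have "f x\<in>ballset L (f ` V) r" if mem: "x\<in>ballset K V r" for x
 proof -
  obtain v k where v: "x\<in>verts K" "v\<in>V" "real k \<le> r" "(adjacent K ^^ k) v x" using mem by (auto simp: ballset_def)
  hence "(adjacent L ^^ k) (f v) (f x)" using w V by blast
  thus ?thesis using v gisoD(2)[OF f] by (auto simp: ballset_def)
 qed
 ultimately show ?thesis by blast
qed

lemma giso_compset:
 assumes f: "giso G f K L" and K: "simplicial_complex (faces K)" and V: "V \<subseteq> verts K"
 shows "f ` compset K V=compset L (f ` V)"
proof -
 note w = gembed_reach[OF giso_gembed[OF f] K]
 have "\<exists>x\<in>compset K V. y=f x" if mem: "y\<in>compset L (f ` V)" for y
 proof -
  obtain v where v: "v\<in>V" "(adjacent L)\<^sup>*\<^sup>* (f v) y" using mem by (auto simp: compset_def)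
  then obtain x where x: "y=f x" "(adjacent K)\<^sup>*\<^sup>* v x" using w V by blast
  have "x\<in>verts K" using reach_in_verts[OF x(2)] v V by blast
  thus ?thesis using x v by (auto simp: compset_def)
 qed
 moreover have "f x\<in>compset L (f ` V)" if mem: "x\<in>compset K V" for x
 proof -
  obtain v where v: "x\<in>verts K" "v\<in>V" "(adjacent K)\<^sup>*\<^sup>* v x" using mem by (auto simp: compset_def)
  hence "(adjacent L)\<^sup>*\<^sup>* (f v) (f x)" using w V by blast
  thus ?thesis using v gisoD(2)[OF f] by (auto simp: compset_def)
 qed
 ultimately show ?thesis by blast
qed

text \<open>A translation is undone by the inverse element; as an embedding onto the whole complex
  it inherits all results on walks and harmonic projections.\<close>

lemma act_giso:
 assumes K: "G_complex G K" and g: "g\<in>carrier G"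
 shows "gembed (act K g) K K"
 unfolding gembed_def comp_emb_def verts_def[symmetric]
proof (intro conjI ballI impI)
 note a = Gcx_act[OF K]
 interpret group G by (rule a(1))
 show "inj_on (act K g) (verts K)" using a(6)[OF g] by (metis inj_onI)
 show "act K g ` s\<in>faces K" if "s\<in>faces K" for s using GcxD(3)[OF K g that] .
 show "\<exists>s'\<in>faces K. s=act K g ` s'" if s: "s\<in>faces K" for s
 proof (rule bexI[of _ "act K (inv\<^bsub>G\<^esub> g) ` s"])
  have "s \<subseteq> verts K" using s by (auto simp: verts_def)
  hence "act K g ` (act K (inv\<^bsub>G\<^esub> g) ` s)=(%x. x) ` s"
   unfolding image_image using a(7)[OF g] by (intro image_cong) auto
  thus "s=act K g ` (act K (inv\<^bsub>G\<^esub> g) ` s)" by simp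
 qed (rule GcxD(3)[OF K inv_closed[OF g] s])
qed

lemma invariant_ballset:
 assumes K: "G_complex G K" and V: "invariant G K V"
 shows "invariant G K (ballset K V r)"
 unfolding invariant_def
proof (intro conjI ballI ballset_subset)
 fix g x assume g: "g\<in>carrier G" and "x\<in>ballset K V r"
 then obtain v k where v: "x\<in>verts K" "v\<in>V" "real k \<le> r" "(adjacent K ^^ k) v x" by (auto simp: ballset_def)
 have vv: "v\<in>verts K" "act K g v\<in>V" using V v(2) g by (auto simp: invariant_def)
 have "(adjacent K ^^ k) (act K g v) (act K g x)"
  using gembed_walk[OF act_giso[OF K g] GcxD(1)[OF K] vv(1)] v(4) by blast
 thus "act K g x\<in>ballset K V r" using v vv Gcx_act(2)[OF K g v(1)] by (auto simp: ballset_def)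
qed

lemma invariant_compset:
 assumes K: "G_complex G K" and V: "invariant G K V"
 shows "invariant G K (compset K V)"
 unfolding invariant_def
proof (intro conjI ballI)
 show "compset K V \<subseteq> verts K" by (auto simp: compset_def)
 fix g x assume g: "g\<in>carrier G" and "x\<in>compset K V"
 then obtain v where v: "x\<in>verts K" "v\<in>V" "(adjacent K)\<^sup>*\<^sup>* v x" by (auto simp: compset_def)
 have vv: "v\<in>verts K" "act K g v\<in>V" using V v(2) g by (auto simp: invariant_def)
 have "(adjacent K)\<^sup>*\<^sup>* (act K g v) (act K g x)"
  using gembed_reach[OF act_giso[OF K g] GcxD(1)[OF K] vv(1)] v(3) by blast
 thus "act K g x\<in>compset K V" using v vv Gcx_act(2)[OF K g v(1)] by (auto simp: compset_def)
qed

lemma orbit_mem_act: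
 assumes "group_action G E \<phi>" "x\<in>E" "g\<in>carrier G" "y\<in>orbit G \<phi> x"
 shows "\<phi> g y\<in>orbit G \<phi> x"
proof -
 note a = group_actionD[OF assms(1)]
 interpret group G by (rule a(1))
 obtain h where h: "h\<in>carrier G" "y=\<phi> h x" using assms(4) by (auto simp: orbit_def)
 hence "\<phi> g y=\<phi> (g \<otimes>\<^bsub>G\<^esub> h) x" using a(4)[OF assms(3) h(1) assms(2)] by simp
 thus ?thesis using h assms(3) by (auto simp: orbit_def)
qed

lemma invariant_orbit: "G_complex G K ==> x\<in>verts K ==> invariant G K (orbit G (act K) x)"
 unfolding invariant_def
proof (intro conjI ballI)
 assume K: "G_complex G K" and x: "x\<in>verts K"
 show "orbit G (act K) x \<subseteq> verts K" by (rule orbit_subset[OF GcxD(2)[OF K] x])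
 fix g y assume "g\<in>carrier G" "y\<in>orbit G (act K) x"
 thus "act K g y\<in>orbit G (act K) x" by (rule orbit_mem_act[OF GcxD(2)[OF K] x])
qed

lemma invariant_Union: "(!!V. V\<in>\<V> ==> invariant G K V) ==> invariant G K (\<Union>\<V>)"
 unfolding invariant_def by blast

lemma root_invariant:
 assumes K: "marked_complex D G (K, os)" and "O'\<in>set os"
 shows "invariant G K O'" "O' ~= {}"
proof -
 obtain x where x: "x\<in>verts K" "O' = orbit G (act K) x" using markedD(3)[OF assms] by (auto simp: orbits_def)
 show "invariant G K O'" unfolding x(2) by (rule invariant_orbit[OF markedD(1)[OF K] x(1)])
 have "\<one>\<^bsub>G\<^esub>\<in>carrier G" using Gcx_act(1)[OF markedD(1)[OF K]] by (simp add: group_def monoid.one_closed)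
 thus "O' ~= {}" unfolding x(2) orbit_def by blast
qed

lemma walk_full_subcomplex: "(adjacent (full_subcomplex K W) ^^ k) v x ==> (adjacent K ^^ k) v x"
proof (induction k arbitrary: x)
 case (Suc k)
 then obtain y where y: "(adjacent (full_subcomplex K W) ^^ k) v y" "adjacent (full_subcomplex K W) y x" by auto
 have "adjacent K y x" using y(2) by (simp add: adjacent_def full_subcomplex_def)
 thus ?case using Suc.IH[OF y(1)] by auto
qed simp

text \<open>Every vertex on a walk of length at most r from \<open>V\<close> lies in the ball and so
  in \<open>W\<close>; the walk survives in the subcomplex.\<close>

lemma ballset_full_subcomplex:
 assumes K: "simplicial_complex (faces K)" and W: "W \<subseteq> verts K" and sub: "ballset K V r \<subseteq> W"
 shows "ballset (full_subcomplex K W) V r=ballset K V r"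
proof
 have "(adjacent (full_subcomplex K W) ^^ k) v x"
  if "(adjacent K ^^ k) v x" "v\<in>V" "v\<in>verts K" "real k \<le> r" for k v x
  using that
 proof (induction k arbitrary: x)
  case (Suc k)
  then obtain y where y: "(adjacent K ^^ k) v y" "adjacent K y x" by auto
  have IH: "(adjacent (full_subcomplex K W) ^^ k) v y" using Suc y by simp
  have kr: "real k \<le> r" using Suc.prems by simp
  have "y\<in>ballset K V r"
   unfolding ballset_def using adjacentD(1)[OF y(2)] Suc.prems(2) y(1) kr by blast
  moreover have "x\<in>ballset K V r"
   unfolding ballset_def using adjacentD(2)[OF y(2)] Suc.prems(1,2,4) by blast
  ultimately have "y\<in>W" "x\<in>W" using sub by blast+
  hence "adjacent (full_subcomplex K W) y x" using y(2) by (auto simp: adjacent_def full_subcomplex_def)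
  thus ?case using IH by auto
 qed simp
 moreover have "v\<in>verts K" if w: "(adjacent K ^^ k) v x" and x: "x\<in>verts K" for k v x
 proof (cases k)
  case (Suc m)
  have "\<exists>y. adjacent K v y & (adjacent K ^^ m) y x" by (rule relpowp_Suc_D2[OF w[unfolded Suc]])
  then obtain y where "adjacent K v y" by (elim exE conjE)
  thus ?thesis by (rule adjacentD(1))
 qed (use w x in simp)
 ultimately show "ballset K V r \<subseteq> ballset (full_subcomplex K W) V r"
  using sub unfolding ballset_def verts_full[OF K W] by blast
 show "ballset (full_subcomplex K W) V r \<subseteq> ballset K V r"
 proof
  fix x assume "x\<in>ballset (full_subcomplex K W) V r"
  then obtain v k where x: "x\<in>W" "v\<in>V" "real k \<le> r" "(adjacent (full_subcomplex K W) ^^ k) v x"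
   unfolding ballset_def verts_full[OF K W] by (elim CollectE conjE bexE exE)
  have "(adjacent K ^^ k) v x" by (rule walk_full_subcomplex[OF x(4)])
  thus "x\<in>ballset K V r" unfolding ballset_def using x(1-3) W by auto
 qed
qed

lemma cball_full_subcomplex:
 assumes "simplicial_complex (faces K)" "W \<subseteq> verts K" "ballset K V r \<subseteq> W"
 shows "cball_complex (full_subcomplex K W) V r=cball_complex K V r"
 unfolding cball_eq ballset_full_subcomplex[OF assms] by (rule full_full[OF assms(3)])

section \<open>Agreement of balls, open sets and Borel sets\<close>

definition brel :: "('g, 'b) monoid_scheme => real => ('g, 'v) marked => ('g, 'w) marked => bool"
 where "brel G r=(%(K, os) (L, os').
  marked_iso G (cball_complex K (\<Union>(set os)) r, os) (cball_complex L (\<Union>(set os')) r, os'))"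

lemma giso_cball:
 assumes f: "giso G f K L" and K: "simplicial_complex (faces K)" and L: "simplicial_complex (faces L)" and V: "V \<subseteq> verts K"
 shows "giso G f (cball_complex K V r) (cball_complex L (f ` V) r)"
 unfolding cball_eq giso_ballset[OF f K V, symmetric]
 by (rule giso_full_subcomplex[OF f K L ballset_subset])

lemma roots_subset: "marked_complex D G (K, os) ==> \<Union>(set os) \<subseteq> verts K"
 using root_subset by blast

lemma marked_sc: "marked_complex D G (K, os) ==> simplicial_complex (faces K)"
 using markedD(1) GcxD(1) by blast

lemma brel_of_iso:
 assumes K: "marked_complex D G (K, os)" and L: "marked_complex D G (L, os')" and iso: "marked_iso G (K, os) (L, os')"
 shows "brel G r (K, os) (L, os')"
proof -
 obtain f where f: "giso G f K L" "map (%O'. f ` O') os = os'" using iso marked_iso_iff by blast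
 have "f ` \<Union>(set os)=\<Union>(set os')" unfolding f(2)[symmetric] by (simp add: image_Union)
 thus ?thesis
  unfolding brel_def prod.case marked_iso_iff using giso_cball[OF f(1) marked_sc[OF K] marked_sc[OF L] roots_subset[OF K]] f(2) by metis
qed

lemma brel_trans: "brel G r M N ==> brel G r N P ==> brel G r M P"
 unfolding brel_def using marked_iso_trans by (cases M; cases N; cases P) auto

lemma wmarked_cball:
 assumes K: "marked_complex D G (K, os)" and "os ~= []" "0 \<le> r"
 shows "wmarked G (cball_complex K (\<Union>(set os)) r, os)"
proof -
 let ?B = "ballset K (\<Union>(set os)) r"
 have inv: "invariant G K (\<Union>(set os))" by (rule invariant_Union) (rule root_invariant(1)[OF K])
 have sub: "\<Union>(set os)\<subseteq>?B" by (rule subset_ballset[OF roots_subset[OF K] assms(3)])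
 obtain O' where "O'\<in>set os" using assms(2) by (meson last_in_set)
 hence ne: "?B ~= {}" using sub root_invariant(2)[OF K] by blast
 have "G_complex G (cball_complex K (\<Union>(set os)) r)" unfolding cball_eq
  by (rule G_complex_full_subcomplex[OF markedD(1)[OF K] invariant_ballset[OF markedD(1)[OF K] inv] ne])
 moreover have "verts (cball_complex K (\<Union>(set os)) r)=?B"
  unfolding cball_eq by (rule verts_full[OF marked_sc[OF K] ballset_subset])
 ultimately show ?thesis using sub by (auto simp: wmarked_def)
qed

lemma brel_sym:
 assumes K: "marked_complex D G (K, os)" "os ~= []" "0 \<le> r" and "brel G r (K, os) N"
 shows "brel G r N (K, os)"
 using marked_iso_sym[OF wmarked_cball[OF K]] assms(4) unfolding brel_def by (cases N) auto

text \<open>An isomorphism of r-balls restricts to smaller balls, because a smaller ball computed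
  inside the r-ball is the one computed in the whole complex.\<close>

lemma brel_mono:
 assumes K: "marked_complex D G (K, os)" and L: "marked_complex D G (L, os')"
  and b: "brel G r (K, os) (L, os')" and r: "0 \<le> r'" "r' \<le> r" and ne: "os ~= []"
 shows "brel G r' (K, os) (L, os')"
proof -
 let ?V = "\<Union>(set os)" and ?V' = "\<Union>(set os')"
 obtain f where f: "giso G f (cball_complex K ?V r) (cball_complex L ?V' r)" "map (%O'. f ` O') os = os'"
  using b unfolding brel_def prod.case marked_iso_iff by blast
 have V: "f ` ?V=?V'" unfolding f(2)[symmetric] by (simp add: image_Union)
 have ne': "os' ~= []" using f(2) ne by auto
 have r0: "0 \<le> r" using r by simp
 have sK: "simplicial_complex (faces (cball_complex K ?V r))" "simplicial_complex (faces (cball_complex L ?V' r))"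
  using wmarked_cball[OF K ne r0] wmarked_cball[OF L ne' r0] GcxD(1) by (auto simp: wmarked_def)
 have "?V \<subseteq> verts (cball_complex K ?V r)" using wmarked_cball[OF K ne r0] by (auto simp: wmarked_def)
 from giso_cball[OF f(1) sK this, of r']
 have "giso G f (cball_complex (cball_complex K ?V r) ?V r') (cball_complex (cball_complex L ?V' r) ?V' r')" by (simp add: V)
 moreover have "ballset K ?V r' \<subseteq> ballset K ?V r" "ballset L ?V' r' \<subseteq> ballset L ?V' r"
  using r unfolding ballset_def by (auto intro: order_trans)
 ultimately have "giso G f (cball_complex K ?V r') (cball_complex L ?V' r')"
  unfolding cball_eq[of K ?V r] cball_eq[of L ?V' r]
  by (simp add: cball_full_subcomplex[OF marked_sc[OF K] ballset_subset] cball_full_subcomplex[OF marked_sc[OF L] ballset_subset])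
 thus ?thesis unfolding brel_def prod.case marked_iso_iff using f(2) by blast
qed

text \<open>Integer radii suffice for the topology, and by \<open>crel_iff\<close> the relation can
  be tested on any pair of representatives.\<close>

definition crel :: "('g, 'b) monoid_scheme => nat => 'g iso_class => 'g iso_class => bool"
 where "crel G n c c' \<longleftrightarrow> (\<exists>M\<in>c. \<exists>M'\<in>c'. brel G (real n) M M')"

lemma crel_iff:
 assumes K: "marked_complex D G (K, os)" "countable (verts K)" and L: "marked_complex D G (L, os')" "countable (verts L)"
  and ne: "os ~= []"
 shows "crel G n (mclass D G K os) (mclass D G L os') \<longleftrightarrow> brel G (real n) (K, os) (L, os')"
proof
 assume "crel G n (mclass D G K os) (mclass D G L os')"
 then obtain M M' where M: "M\<in>mclass D G K os" "M'\<in>mclass D G L os'" "brel G (real n) M M'" unfolding crel_def by blast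
 obtain K1 os1 L1 os1' where e: "M=(K1, os1)" "M'=(L1, os1')" by fastforce
 have m: "marked_iso G (K, os) M" "marked_complex D G M" "marked_iso G (L, os') M'" "marked_complex D G M'"
  using M(1,2) by (auto dest: mem_mclassD)
 have "brel G (real n) (K, os) M" using brel_of_iso[OF K(1)] m unfolding e by blast
 moreover have "brel G (real n) M' (L, os')"
  using brel_of_iso[OF _ L(1)] m(4) marked_iso_sym[OF marked_wmarked[OF L(1)] m(3)] unfolding e by blast
 ultimately show "brel G (real n) (K, os) (L, os')" by (rule brel_trans[OF brel_trans[OF _ M(3)]])
next
 assume b: "brel G (real n) (K, os) (L, os')"
 obtain M :: "('a, nat) marked" where M: "marked_complex D G M" "marked_iso G (K, os) M" using nat_copy[OF K] by blast
 obtain M' :: "('a, nat) marked" where M': "marked_complex D G M'" "marked_iso G (L, os') M'" using nat_copy[OF L] by blast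
 obtain K1 os1 L1 os1' where e: "M=(K1, os1)" "M'=(L1, os1')" by fastforce
 have "brel G (real n) M (K, os)"
  using brel_of_iso[OF _ K(1)] M(1) marked_iso_sym[OF marked_wmarked[OF K(1)] M(2)] unfolding e by blast
 moreover have "brel G (real n) (L, os') M'" using brel_of_iso[OF L(1)] M' unfolding e by blast
 ultimately have "brel G (real n) M M'" by (rule brel_trans[OF brel_trans[OF _ b]])
 moreover have "M\<in>mclass D G K os" "M'\<in>mclass D G L os'" using M M' by (auto simp: mclass_def)
 ultimately show "crel G n (mclass D G K os) (mclass D G L os')" unfolding crel_def by blast
qed

text \<open>A distance below 2^-n means agreement at some radius at least n, which
  \<open>brel_mono\<close> brings down to n; conversely agreement at a large integer radius bounds
  the distance.\<close>

lemma openin_SC_iff: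
 assumes k: "k > 0"
 shows "openin (SC_topology k D G) U \<longleftrightarrow> U \<subseteq> SC k D G &
  (\<forall>c\<in>U. \<exists>n. \<forall>c'\<in>SC k D G. crel G n c c' --> c'\<in>U)"
proof (cases "U \<subseteq> SC k D G")
 case U: True
 have "(\<exists>e>0. \<forall>c'\<in>SC k D G. SC_dist G c c' < e --> c'\<in>U) \<longleftrightarrow> (\<exists>n. \<forall>c'\<in>SC k D G. crel G n c c' --> c'\<in>U)"
  if c: "c\<in>U" for c
 proof
  assume "\<exists>e>0. \<forall>c'\<in>SC k D G. SC_dist G c c' < e --> c'\<in>U"
  then obtain e where e: "e > 0" "!!c'. c'\<in>SC k D G ==> SC_dist G c c' < e ==> c'\<in>U" by blast
  \<comment> \<open>The successor is taken because \<open>SC_dist\<close> ranges over positive radii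
    only.\<close>
  have "\<exists>n. ennreal (2 powr - real (Suc n)) < e"
  proof -
   have "(%n. ennreal ((1/2) ^ Suc n)) \<longlonglongrightarrow> ennreal 0"
    by (intro tendsto_ennrealI LIMSEQ_Suc LIMSEQ_realpow_zero) auto
   from order_tendstoD(2)[OF this, of e] obtain n where "ennreal ((1/2) ^ Suc n) < e"
    using e(1) unfolding eventually_sequentially by auto
   moreover have "(1/2) ^ Suc n=(2::real) powr - real (Suc n)"
    by (simp only: powr_minus powr_realpow[of 2] zero_less_numeral) (simp add: power_one_over inverse_eq_divide)
   ultimately show ?thesis by metis
  qed
  then obtain n where n: "ennreal (2 powr - real (Suc n)) < e" by blast
  show "\<exists>n. \<forall>c'\<in>SC k D G. crel G n c c' --> c'\<in>U"
  proof (intro exI[of _ "Suc n"] ballI impI)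
   fix c' assume c': "c'\<in>SC k D G" and "crel G (Suc n) c c'"
   then obtain M M' where M: "M\<in>c" "M'\<in>c'" "brel G (real (Suc n)) M M'" unfolding crel_def by blast
   have "SC_dist G c c' \<le> ennreal (2 powr - real (Suc n))"
    unfolding SC_dist_def
   proof (rule Inf_lower, rule CollectI, intro exI conjI)
    show "0 < real (Suc n)" by simp
    show "\<exists>(K, os)\<in>c. \<exists>(L, os')\<in>c'. marked_iso G (cball_complex K (\<Union>(set os)) (real (Suc n)), os)
      (cball_complex L (\<Union>(set os')) (real (Suc n)), os')"
     using M unfolding brel_def by (cases M; cases M') blast
   qed simp
   thus "c'\<in>U" using e(2)[OF c'] n by (meson le_less_trans)
  qed
 next
  assume "\<exists>n. \<forall>c'\<in>SC k D G. crel G n c c' --> c'\<in>U"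
  then obtain n where n: "!!c'. c'\<in>SC k D G ==> crel G n c c' ==> c'\<in>U" by blast
  show "\<exists>e>0. \<forall>c'\<in>SC k D G. SC_dist G c c' < e --> c'\<in>U"
  proof (intro exI[of _ "ennreal (2 powr - real n)"] conjI ballI impI)
   show "0 < ennreal (2 powr - real n)" by simp
   fix c' assume c': "c'\<in>SC k D G" and "SC_dist G c c' < ennreal (2 powr - real n)"
   then obtain r where r: "r > 0" "ennreal (2 powr - r) < ennreal (2 powr - real n)"
    "\<exists>(K, os)\<in>c. \<exists>(L, os')\<in>c'. marked_iso G (cball_complex K (\<Union>(set os)) r, os) (cball_complex L (\<Union>(set os')) r, os')"
    unfolding SC_dist_def Inf_less_iff by blast
   then obtain K os L os' where M: "(K, os)\<in>c" "(L, os')\<in>c'" "brel G r (K, os) (L, os')"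
    unfolding brel_def by blast
   have "real n \<le> r" using r(2) by (simp add: ennreal_less_iff)
   moreover have cS: "c\<in>SC k D G" using U c by blast
   moreover have "os ~= []" using SC_D(3)[OF cS M(1)] k by auto
   ultimately have "brel G (real n) (K, os) (L, os')"
    using brel_mono[OF SC_D(1)[OF cS M(1)] SC_D(1)[OF c' M(2)] M(3)] by simp
   thus "c'\<in>U" using n[OF c'] M unfolding crel_def by blast
  qed
 qed
 thus ?thesis unfolding openin_SC_topology using U by blast
qed (simp add: openin_SC_topology)

lemma continuous_map_SC:
 assumes k: "k > 0" "k' > 0" and F: "!!c. c\<in>SC k D G ==> F c\<in>SC k' D' G'"
  and loc: "!!c n. c\<in>SC k D G ==> \<exists>m. \<forall>c'\<in>SC k D G. crel G m c c' --> crel G' n (F c) (F c')"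
 shows "continuous_map (SC_topology k D G) (SC_topology k' D' G') F"
 unfolding continuous_map_def topspace_SC_topology
proof (intro conjI allI impI)
 show "F\<in>SC k D G \<rightarrow> SC k' D' G'" using F by blast
 fix U assume "openin (SC_topology k' D' G') U"
 hence U: "U \<subseteq> SC k' D' G'" "!!c. c\<in>U ==> \<exists>n. \<forall>c'\<in>SC k' D' G'. crel G' n c c' --> c'\<in>U"
  unfolding openin_SC_iff[OF k(2)] by blast+
 show "openin (SC_topology k D G) {x\<in>SC k D G. F x\<in>U}"
  unfolding openin_SC_iff[OF k(1)]
 proof (intro conjI ballI)
  fix c assume c: "c\<in>{x\<in>SC k D G. F x\<in>U}"
  then obtain n where n: "!!c'. c'\<in>SC k' D' G' ==> crel G' n (F c) c' ==> c'\<in>U" using U(2) by blast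
  obtain m where "\<forall>c'\<in>SC k D G. crel G m c c' --> crel G' n (F c) (F c')" using loc c by blast
  thus "\<exists>n. \<forall>c'\<in>SC k D G. crel G n c c' --> c'\<in>{x\<in>SC k D G. F x\<in>U}" using n F by blast
 qed auto
qed

lemma opens_Pow: "{U. openin (SC_topology k D G) U} \<subseteq> Pow (SC k D G)"
proof
 fix U assume "U\<in>{U. openin (SC_topology k D G) U}"
 hence "U \<subseteq> topspace (SC_topology k D G)" by (intro openin_subset) simp
 thus "U\<in>Pow (SC k D G)" by (simp add: topspace_SC_topology)
qed

lemma space_SC_borel [simp]: "space (SC_borel k D G)=SC k D G"
 unfolding SC_borel_def by (rule space_measure_of[OF opens_Pow])

lemma sets_SC_borel: "sets (SC_borel k D G) = sigma_sets (SC k D G) {U. openin (SC_topology k D G) U}"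
 unfolding SC_borel_def by (rule sets_measure_of[OF opens_Pow])

lemma open_in_sets: "openin (SC_topology k D G) U ==> U\<in>sets (SC_borel k D G)"
 unfolding sets_SC_borel by blast

lemma measurable_SC_continuous:
 assumes F: "continuous_map (SC_topology k D G) (SC_topology k' D' G') F"
 shows "F\<in>SC_borel k D G \<rightarrow>\<^sub>M SC_borel k' D' G'"
 unfolding SC_borel_def[of k' D' G']
proof (rule measurable_measure_of)
 show "{U. openin (SC_topology k' D' G') U} \<subseteq> Pow (SC k' D' G')" by (rule opens_Pow)
 show "F\<in>space (SC_borel k D G) \<rightarrow> SC k' D' G'" using F by (auto simp: continuous_map_def topspace_SC_topology)
 fix U assume "U\<in>{U. openin (SC_topology k' D' G') U}"
 hence "openin (SC_topology k D G) {x\<in>SC k D G. F x\<in>U}" using F by (auto simp: continuous_map_def topspace_SC_topology)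
 moreover have "F -` U \<inter> space (SC_borel k D G)={x\<in>SC k D G. F x\<in>U}" by auto
 ultimately show "F -` U \<inter> space (SC_borel k D G)\<in>sets (SC_borel k D G)" using open_in_sets by metis
qed

lemma borel_measurable_SC_continuous:
 assumes f: "continuous_map (SC_topology k D G) euclideanreal f"
 shows "f\<in>borel_measurable (SC_borel k D G)"
proof (rule borel_measurableI)
 fix S :: "real set" assume "open S"
 hence "openin (SC_topology k D G) {x\<in>SC k D G. f x\<in>S}"
  using f by (auto simp: continuous_map_def topspace_SC_topology)
 moreover have "f -` S \<inter> space (SC_borel k D G)={x\<in>SC k D G. f x\<in>S}" by auto
 ultimately show "f -` S \<inter> space (SC_borel k D G)\<in>sets (SC_borel k D G)" using open_in_sets by metis
qed

section \<open>Induced complexes\<close>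

locale fin_pair = fin_group G for G (structure) +
 fixes H
 assumes sub: "subgroup H G"
begin

abbreviation HG where "HG \<equiv> G\<lparr>carrier := H\<rparr>"

lemma HG_group: "group HG"
 using sub is_group by (rule subgroup.subgroup_is_group)

lemma H_sub: "h\<in>H ==> h\<in>carrier G"
 using sub subgroup.mem_carrier by metis

lemma H_closed: "h\<in>H ==> k\<in>H ==> h \<otimes> k\<in>H" "\<one>\<in>H" "h\<in>H ==> inv h\<in>H"
 using sub by (auto simp: subgroup.m_closed subgroup.one_closed subgroup.m_inv_closed)

lemma HG_inv: "h\<in>H ==> inv\<^bsub>HG\<^esub> h=inv h"
 using m_inv_consistent[OF sub] by simp

text \<open>Applied to all vertices, to a root and to a ball alike, so that the induced versions of
  all three are handled by the same lemmas.\<close>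

definition iset :: "('a => 'v => 'v) => 'v set => ('a \<times> 'v) set set"
 where "iset a V={ind_point G H a g x | g x. g\<in>carrier G & x\<in>V}"

abbreviation pt where "pt K \<equiv> ind_point G H (act K)"
abbreviation ind where "ind \<equiv> ind_complex G H"

lemma HK_act:
 assumes K: "G_complex HG K"
 shows "h\<in>H ==> x\<in>verts K ==> act K h x\<in>verts K" "x\<in>verts K ==> act K \<one> x=x"
  "h\<in>H ==> k\<in>H ==> x\<in>verts K ==> act K (h \<otimes> k) x=act K h (act K k x)"
  "h\<in>H ==> s\<in>faces K ==> act K h ` s\<in>faces K"
  "h\<in>H ==> x\<in>verts K ==> act K h (act K (inv h) x)=x"
  "h\<in>H ==> x\<in>verts K ==> act K (inv h) (act K h x)=x"
proof -
 note a = Gcx_act[OF K]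
 show "h\<in>H ==> x\<in>verts K ==> act K h x\<in>verts K" using a(2)[of h x] by simp
 show one: "x\<in>verts K ==> act K \<one> x=x" using a(3)[of x] by simp
 show m: "h\<in>H ==> k\<in>H ==> x\<in>verts K ==> act K (h \<otimes> k) x=act K h (act K k x)" for h k using a(4)[of h k x] by simp
 show "h\<in>H ==> s\<in>faces K ==> act K h ` s\<in>faces K" using GcxD(3)[OF K, of h s] by simp
 show "h\<in>H ==> x\<in>verts K ==> act K h (act K (inv h) x)=x"
  using m[of h "inv h"] H_closed(3)[of h] H_sub[of h] one by simp
 show "h\<in>H ==> x\<in>verts K ==> act K (inv h) (act K h x)=x"
  using m[of "inv h" h] H_closed(3)[of h] H_sub[of h] one by simp
qed

text \<open>The defining relation \<lfloor>gh, y\<rfloor> = \<lfloor>g, hy\<rfloor>; the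
  substitution of hk for k matches the two sets of pairs.\<close>

lemma pt_shift:
 assumes K: "G_complex HG K" and g: "g\<in>carrier G" and h: "h\<in>H" and y: "y\<in>verts K"
 shows "pt K (g \<otimes> h) y=pt K g (act K h y)"
proof
 note a = HK_act[OF K]
 have hG: "h\<in>carrier G" by (rule H_sub[OF h])
 show "pt K (g \<otimes> h) y \<subseteq> pt K g (act K h y)"
 proof
  fix p assume "p\<in>pt K (g \<otimes> h) y"
  then obtain k where k: "k\<in>H" "p=(g \<otimes> h \<otimes> k, act K (inv k) y)" by (auto simp: ind_point_def)
  have kG: "k\<in>carrier G" by (rule H_sub[OF k(1)])
  have "act K (inv (h \<otimes> k)) (act K h y)=act K (inv k \<otimes> inv h) (act K h y)"
   using hG kG by (simp add: inv_mult_group)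
  also have "...=act K (inv k) (act K (inv h) (act K h y))"
   using h k y a H_closed by simp
  also have "...=act K (inv k) y" using a(6)[OF h y] by simp
  finally have "p=(g \<otimes> (h \<otimes> k), act K (inv (h \<otimes> k)) (act K h y))"
   using k(2) g hG kG by (simp add: m_assoc)
  thus "p\<in>pt K g (act K h y)" using H_closed(1)[OF h k(1)] by (auto simp: ind_point_def)
 qed
 show "pt K g (act K h y) \<subseteq> pt K (g \<otimes> h) y"
 proof
  fix p assume "p\<in>pt K g (act K h y)"
  then obtain k where k: "k\<in>H" "p=(g \<otimes> k, act K (inv k) (act K h y))" by (auto simp: ind_point_def)
  have kG: "k\<in>carrier G" by (rule H_sub[OF k(1)])
  let ?m = "inv h \<otimes> k"
  have m: "?m\<in>H" using h k H_closed by simp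
  have "inv ?m=inv k \<otimes> h" using hG kG by (simp add: inv_mult_group)
  hence "act K (inv ?m) y=act K (inv k) (act K h y)" using h k y a H_closed by simp
  moreover have "g \<otimes> h \<otimes> ?m=g \<otimes> k"
  proof -
   have "h \<otimes> (inv h \<otimes> k)=k" using hG kG by (simp add: m_assoc[symmetric])
   thus ?thesis using g hG kG by (simp add: m_assoc)
  qed
  ultimately show "p\<in>pt K (g \<otimes> h) y" using m k(2) by (auto simp: ind_point_def intro!: exI[of _ ?m])
 qed
qed

text \<open>The pair (g', y') belongs to its own class, by taking the identity of \<open>H\<close>;
  membership in the other class produces h.\<close>

lemma pt_eqD:
 assumes K: "G_complex HG K" and y: "y\<in>verts K" "y'\<in>verts K" and g: "g\<in>carrier G" "g'\<in>carrier G" and eq: "pt K g y=pt K g' y'"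
 shows "\<exists>h\<in>H. g'=g \<otimes> h & y'=act K (inv h) y"
proof -
 have "(g' \<otimes> \<one>, act K (inv \<one>) y')\<in>pt K g' y'" unfolding ind_point_def using H_closed(2) by blast
 hence "(g', y')\<in>pt K g y" using HK_act(2)[OF K y(2)] g eq by simp
 thus ?thesis by (auto simp: ind_point_def)
qed

lemma pt_inj:
 assumes "G_complex HG K" "y\<in>verts K" "y'\<in>verts K" "g\<in>carrier G" "pt K g y=pt K g y'"
 shows "y=y'"
proof -
 obtain h where h: "h\<in>H" "g=g \<otimes> h" "y'=act K (inv h) y" using pt_eqD[OF assms(1-4,4,5)] by blast
 have "h=\<one>" using h(2) assms(4) H_sub[OF h(1)] by (metis l_cancel_one')
 thus ?thesis using h(3) HK_act(2)[OF assms(1,2)] by simp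
qed

lemma verts_ind: "verts (ind K)=iset (act K) (verts K)"
proof -
 have "\<Union> {pt K g ` s | g s. g\<in>carrier G & s\<in>faces K}={pt K g x | g x. g\<in>carrier G & x\<in>\<Union>(faces K)}" by blast
 thus ?thesis by (simp add: verts_def ind_complex_def iset_def)
qed

lemma pt_in_verts: "g\<in>carrier G ==> x\<in>verts K ==> pt K g x\<in>verts (ind K)"
 unfolding verts_ind iset_def by blast

lemma faces_ind: "faces (ind K)={pt K g ` s | g s. g\<in>carrier G & s\<in>faces K}"
 by (simp add: ind_complex_def)

lemma act_ind: "g\<in>carrier G ==> g'\<in>carrier G ==> x\<in>verts K ==> act (ind K) g (pt K g' x)=pt K (g \<otimes> g') x"
 by (rule ind_complex_act[OF is_group]) (auto intro: H_sub)

text \<open>The source of the block decomposition. If a simplex g's meets the translate by g, then g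
  = g'h for some h in \<open>H\<close>, and the whole simplex equals g applied to the simplex h^-1 s
  of \<open>K\<close>. So each translate is a copy of \<open>K\<close> and a union of
  components.\<close>

lemma gembed_pt:
 assumes K: "G_complex HG K" and g: "g\<in>carrier G"
 shows "gembed (pt K g) K (ind K)"
 unfolding gembed_def comp_emb_def verts_def[symmetric]
proof (intro conjI ballI impI)
 show "inj_on (pt K g) (verts K)" by (rule inj_onI) (rule pt_inj[OF K _ _ g])
 show "pt K g ` s\<in>faces (ind K)" if "s\<in>faces K" for s using that g by (auto simp: faces_ind)
 fix t assume "t\<in>faces (ind K)" and meet: "t \<inter> pt K g ` verts K ~= {}"
 then obtain g' s where s: "g'\<in>carrier G" "s\<in>faces K" "t=pt K g' ` s" by (auto simp: faces_ind)
 have sv: "s \<subseteq> verts K" using s(2) by (auto simp: verts_def)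
 obtain y x where yx: "y\<in>s" "x\<in>verts K" "pt K g' y=pt K g x" using meet s(3) by blast
 obtain h where h: "h\<in>H" "g=g' \<otimes> h" using pt_eqD[OF K _ yx(2) s(1) g yx(3)] yx(1) sv by blast
 have "pt K g' z=pt K g (act K (inv h) z)" if z: "z\<in>s" for z
 proof -
  have zv: "z\<in>verts K" using z sv by blast
  have "pt K g (act K (inv h) z)=pt K g' (act K h (act K (inv h) z))"
   unfolding h(2) by (rule pt_shift[OF K s(1) h(1)]) (rule HK_act(1)[OF K H_closed(3)[OF h(1)] zv])
  thus ?thesis using HK_act(5)[OF K h(1) zv] by simp
 qed
 hence "t=pt K g ` (act K (inv h) ` s)" unfolding s(3) image_image by (intro image_cong) auto
 thus "\<exists>s'\<in>faces K. t=pt K g ` s'" using HK_act(4)[OF K H_closed(3)[OF h(1)] s(2)] by blast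
qed

lemma G_complex_ind:
 assumes K: "G_complex HG K"
 shows "G_complex G (ind K)"
proof -
 note sc = GcxD(1)[OF K]
 have act_ext: "act (ind K) g\<in>extensional (verts (ind K))" for g
  unfolding verts_ind iset_def by (simp add: ind_complex_def)
 have "simplicial_complex (faces (ind K))"
  unfolding simplicial_complex_def
 proof (intro conjI ballI allI impI)
  show "faces (ind K) ~= {}" using simp_cxD(1)[OF sc] one_closed by (auto simp: faces_ind)
  fix t assume "t\<in>faces (ind K)"
  then obtain g s where s: "g\<in>carrier G" "s\<in>faces K" "t=pt K g ` s" by (auto simp: faces_ind)
  show "finite t" "t ~= {}" using s(3) simp_cxD(2)[OF sc s(2)] simp_cxD(3)[OF sc s(2)] by auto
  fix r assume r: "r \<subseteq> t & r ~= {}"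
  then obtain q where q: "q \<subseteq> s" "r=pt K g ` q" using s(3) by (metis subset_image_iff)
  have "q\<in>faces K" by (rule simp_cxD(4)[OF sc s(2) q(1)]) (use r q in auto)
  thus "r\<in>faces (ind K)" using s(1) q(2) by (auto simp: faces_ind)
 qed
 moreover have "group_action G (verts (ind K)) (act (ind K))"
 proof (rule group_actionI[OF is_group])
  fix g p assume g: "g\<in>carrier G" and "p\<in>verts (ind K)"
  then obtain k x where p: "k\<in>carrier G" "x\<in>verts K" "p=pt K k x" by (auto simp: verts_ind iset_def)
  show "act (ind K) g p\<in>verts (ind K)" using g p by (simp add: act_ind pt_in_verts)
  fix h assume h: "h\<in>carrier G"
  show "act (ind K) (h \<otimes> g) p=act (ind K) h (act (ind K) g p)" using g h p by (simp add: act_ind m_assoc)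
 next
  fix p assume "p\<in>verts (ind K)"
  then obtain k x where p: "k\<in>carrier G" "x\<in>verts K" "p=pt K k x" by (auto simp: verts_ind iset_def)
  show "act (ind K) \<one> p=p" using p by (simp add: act_ind)
 qed (rule act_ext)
 moreover have "act (ind K) g ` t\<in>faces (ind K)" if g: "g\<in>carrier G" and t: "t\<in>faces (ind K)" for g t
 proof -
  obtain k s where s: "k\<in>carrier G" "s\<in>faces K" "t=pt K k ` s" using t by (auto simp: faces_ind)
  have "act (ind K) g ` t=pt K (g \<otimes> k) ` s"
   unfolding s(3) image_image
  proof (rule image_cong[OF refl])
   fix x assume "x\<in>s"
   hence "x\<in>verts K" using s(2) unfolding verts_def by (rule UnionI[rotated])
   thus "act (ind K) g (pt K k x)=pt K (g \<otimes> k) x" by (rule act_ind[OF g s(1)])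
  qed
  thus ?thesis using g s by (auto simp: faces_ind)
 qed
 ultimately show ?thesis by (simp add: G_complex_def)
qed

lemma degree_le_ind:
 assumes K: "G_complex HG K" and "degree_le D K"
 shows "degree_le D (ind K)"
 unfolding degree_le_nbrs
proof
 fix p assume "p\<in>verts (ind K)"
 then obtain g x where p: "g\<in>carrier G" "x\<in>verts K" "p=pt K g x" by (auto simp: verts_ind iset_def)
 show "finite (nbrs (ind K) p) & card (nbrs (ind K) p) \<le> D"
  using gembed_nbrs[OF gembed_pt[OF K p(1)] GcxD(1)[OF K] p(2)] assms(2) p by (simp add: degree_le_nbrs)
qed

text \<open>The right-hand side may be based at any translate g of x; this freedom makes all
  translates contribute alike to sums over the vertices of the induced complex.\<close>

lemma iset_orbit:
 assumes K: "G_complex HG K" and x: "x\<in>verts K" and g: "g\<in>carrier G"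
 shows "iset (act K) (orbit HG (act K) x) = orbit G (act (ind K)) (pt K g x)"
proof
 show "iset (act K) (orbit HG (act K) x) \<subseteq> orbit G (act (ind K)) (pt K g x)"
 proof
  fix p assume "p\<in>iset (act K) (orbit HG (act K) x)"
  then obtain k h where p: "k\<in>carrier G" "h\<in>H" "p=pt K k (act K h x)" by (auto simp: iset_def orbit_def)
  have hG: "h\<in>carrier G" by (rule H_sub[OF p(2)])
  have "p=pt K (k \<otimes> h) x" unfolding p(3) by (rule pt_shift[OF K p(1,2) x, symmetric])
  also have "...=act (ind K) (k \<otimes> h \<otimes> inv g) (pt K g x)" using p(1) hG g x by (simp add: act_ind m_assoc)
  finally show "p\<in>orbit G (act (ind K)) (pt K g x)" using p(1) hG g by (auto simp: orbit_def)
 qed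
 show "orbit G (act (ind K)) (pt K g x) \<subseteq> iset (act K) (orbit HG (act K) x)"
 proof
  fix p assume "p\<in>orbit G (act (ind K)) (pt K g x)"
  then obtain k where k: "k\<in>carrier G" "p=act (ind K) k (pt K g x)" by (auto simp: orbit_def)
  hence "p=pt K (k \<otimes> g) (act K \<one> x)" using g x HK_act(2)[OF K x] by (simp add: act_ind)
  moreover have "act K \<one> x\<in>orbit HG (act K) x" using H_closed(2) by (auto simp: orbit_def)
  ultimately show "p\<in>iset (act K) (orbit HG (act K) x)" using k g unfolding iset_def by blast
 qed
qed

lemma marked_ind:
 assumes K: "marked_complex D HG (K, os)"
 shows "marked_complex D G (ind K, map (iset (act K)) os)"
 unfolding marked_complex_def prod.case
proof (intro conjI ballI)
 note KG = markedD(1)[OF K]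
 show "G_complex G (ind K)" by (rule G_complex_ind[OF KG])
 show "degree_le D (ind K)" by (rule degree_le_ind[OF KG markedD(2)[OF K]])
 fix Q assume "Q\<in>set (map (iset (act K)) os)"
 then obtain P where P: "P\<in>set os" "Q=iset (act K) P" by auto
 obtain x where x: "x\<in>verts K" "P = orbit HG (act K) x" using markedD(3)[OF K P(1)] by (auto simp: orbits_def)
 show "Q\<in>orbits G (verts (ind K)) (act (ind K))"
  unfolding P(2) x(2) iset_orbit[OF KG x(1) one_closed] orbits_def using pt_in_verts[OF one_closed x(1)] by blast
 fix p assume "p\<in>verts (ind K)"
 then obtain g y where p: "g\<in>carrier G" "y\<in>verts K" "p=pt K g y" by (auto simp: verts_ind iset_def)
 obtain v where v: "v\<in>P" "(adjacent K)\<^sup>*\<^sup>* v y" using markedD(4)[OF K P(1) p(2)] by blast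
 have vv: "v\<in>verts K" using root_subset[OF K P(1)] v(1) by blast
 have "(adjacent (ind K))\<^sup>*\<^sup>* (pt K g v) p"
  using gembed_reach[OF gembed_pt[OF KG p(1)] GcxD(1)[OF KG] vv] v(2) p(3) by blast
 moreover have "pt K g v\<in>Q" using P(2) v(1) p(1) unfolding iset_def by blast
 ultimately show "\<exists>v\<in>Q. (adjacent (ind K))\<^sup>*\<^sup>* v p" by blast
qed

lemma countable_ind: "countable (verts K) ==> countable (verts (ind K))"
proof -
 assume c: "countable (verts K)"
 have "verts (ind K)=(%(g, x). pt K g x) ` (carrier G \<times> verts K)"
  unfolding verts_ind iset_def by auto
 thus ?thesis using c by (simp add: countable_finite)
qed

section \<open>Functoriality of induction and its compatibility with balls and components\<close>

definition imap :: "('v => 'w) => ('a \<times> 'v) set => ('a \<times> 'w) set"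
 where "imap f c=(%(g, y). (g, f y)) ` c"

lemma imap_pt:
 assumes f: "giso HG f K L" and x: "x\<in>verts K"
 shows "imap f (pt K g x)=pt L g (f x)"
proof -
 have "f (act K (inv h) x)=act L (inv h) (f x)" if "h\<in>H" for h
  using gisoD(5)[OF f _ x, of "inv h"] H_closed(3)[OF that] by simp
 hence "(%h. (g \<otimes> h, f (act K (inv h) x))) ` H=(%h. (g \<otimes> h, act L (inv h) (f x))) ` H"
  by (intro image_cong) auto
 thus ?thesis unfolding imap_def ind_point_def Setcompr_eq_image image_image by simp
qed

lemma imap_iset:
 assumes f: "giso HG f K L" and V: "V \<subseteq> verts K"
 shows "imap f ` iset (act K) V=iset (act L) (f ` V)"
proof -
 have "imap f ` iset (act K) V={imap f (pt K g x) | g x. g\<in>carrier G & x\<in>V}" unfolding iset_def by blast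
 also have "...={pt L g (f x) | g x. g\<in>carrier G & x\<in>V}"
  using imap_pt[OF f] V by (intro Collect_cong) (metis subsetD)
 also have "...=iset (act L) (f ` V)" unfolding iset_def by blast
 finally show ?thesis .
qed

lemma giso_ind:
 assumes K: "G_complex HG K" and L: "G_complex HG L" and f: "giso HG f K L"
 shows "giso G (imap f) (ind K) (ind L)"
 unfolding giso_def
proof (intro conjI ballI)
 show "bij_betw (imap f) (verts (ind K)) (verts (ind L))"
  unfolding bij_betw_def
 proof
  show "imap f ` verts (ind K)=verts (ind L)"
   unfolding verts_ind imap_iset[OF f order_refl] gisoD(2)[OF f] ..
  show "inj_on (imap f) (verts (ind K))"
  proof (rule inj_onI)
   fix p q assume "p\<in>verts (ind K)" "q\<in>verts (ind K)" and e: "imap f p=imap f q"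
   then obtain g x k y where p: "g\<in>carrier G" "x\<in>verts K" "p=pt K g x" and q: "k\<in>carrier G" "y\<in>verts K" "q=pt K k y"
    by (auto simp: verts_ind iset_def)
   have fx: "f x\<in>verts L" "f y\<in>verts L" using gisoD(2)[OF f] p(2) q(2) by blast+
   have "pt L g (f x)=pt L k (f y)" using e by (simp add: p(3) q(3) imap_pt[OF f p(2)] imap_pt[OF f q(2)])
   then obtain h where h: "h\<in>H" "k=g \<otimes> h" "f y=act L (inv h) (f x)" using pt_eqD[OF L fx p(1) q(1)] by blast
   have hi: "inv h\<in>H" by (rule H_closed(3)[OF h(1)])
   have av: "act K (inv h) x\<in>verts K" by (rule HK_act(1)[OF K hi p(2)])
   have "f y=f (act K (inv h) x)" using h(3) gisoD(5)[OF f _ p(2), of "inv h"] hi by simp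
   hence "y=act K (inv h) x" using gisoD(1)[OF f] q(2) av inj_onD by metis
   hence "q=pt K g (act K h (act K (inv h) x))" using pt_shift[OF K p(1) h(1) av] q(3) h(2) by simp
   thus "p=q" using HK_act(5)[OF K h(1) p(2)] p(3) by simp
  qed
 qed
 have img: "imap f ` (pt K g ` s)=pt L g ` (f ` s)" if "s\<in>faces K" for g s
  unfolding image_image using imap_pt[OF f] that by (intro image_cong) (auto simp: verts_def)
 have "(%s. imap f ` s) ` faces (ind K)={imap f ` (pt K g ` s) | g s. g\<in>carrier G & s\<in>faces K}"
  unfolding faces_ind by blast
 also have "...={pt L g ` (f ` s) | g s. g\<in>carrier G & s\<in>faces K}"
  by (intro Collect_cong) (metis img)

 also have "...={pt L g ` t | g t. g\<in>carrier G & t\<in>(%s. f ` s) ` faces K}" by blast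
 also have "(%s. f ` s) ` faces K=faces L" using f by (simp add: giso_def)
 finally show "(%s. imap f ` s) ` faces (ind K)=faces (ind L)" by (simp only: faces_ind)
 fix g p assume g: "g\<in>carrier G" and "p\<in>verts (ind K)"
 then obtain k x where p: "k\<in>carrier G" "x\<in>verts K" "p=pt K k x" by (auto simp: verts_ind iset_def)
 have "f x\<in>verts L" using gisoD(2)[OF f] p(2) by blast
 thus "imap f (act (ind K) g p)=act (ind L) g (imap f p)"
  using g p by (simp add: act_ind imap_pt[OF f])
qed

lemma iset_mono: "V \<subseteq> W ==> iset a V \<subseteq> iset a W"
 unfolding iset_def by blast

lemma pt_in_iset_iff:
 assumes K: "G_complex HG K" and V: "invariant HG K V" and g: "g\<in>carrier G" and x: "x\<in>verts K"
 shows "pt K g x\<in>iset (act K) V \<longleftrightarrow> x\<in>V"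
proof
 assume "pt K g x\<in>iset (act K) V"
 then obtain k y where k: "k\<in>carrier G" "y\<in>V" "pt K k y=pt K g x" unfolding iset_def by (auto simp: eq_commute)
 have "y\<in>verts K" using V k(2) by (auto simp: invariant_def)
 then obtain h where "h\<in>H" "x=act K (inv h) y" using pt_eqD[OF K _ x k(1) g k(3)] by blast
 thus "x\<in>V" using V k(2) H_closed(3) by (auto simp: invariant_def)
qed (use g in \<open>auto simp: iset_def\<close>)

lemma pt_full_subcomplex: "y\<in>W ==> pt (full_subcomplex K W) g y=pt K g y"
 unfolding ind_point_def by (simp add: full_subcomplex_def)

lemma iset_full_subcomplex: "V \<subseteq> W ==> iset (act (full_subcomplex K W)) V=iset (act K) V"
 unfolding iset_def using pt_full_subcomplex[of _ W K] by (intro Collect_cong) (metis subsetD)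

text \<open>An equality of records and not merely an isomorphism: points are literally the same sets
  of pairs, since on \<open>W\<close> the restricted action agrees with the original one. Invariance
  of \<open>W\<close> matches the faces.\<close>

lemma ind_full_subcomplex:
 assumes K: "G_complex HG K" and W: "invariant HG K W"
 shows "ind (full_subcomplex K W)=full_subcomplex (ind K) (iset (act K) W)"
proof -
 have Wv: "W \<subseteq> verts K" using W by (simp add: invariant_def)
 have sub: "pt K g ` s \<subseteq> iset (act K) W \<longleftrightarrow> s \<subseteq> W" if "g\<in>carrier G" "s\<in>faces K" for g s
 proof -
  have "s \<subseteq> verts K" using that(2) by (auto simp: verts_def)
  thus ?thesis using pt_in_iset_iff[OF K W that(1)] by blast
 qed
 have img: "pt (full_subcomplex K W) g ` s=pt K g ` s" if "s \<subseteq> W" for g s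
  using that pt_full_subcomplex[of _ W K g] by (intro image_cong) auto
 have "faces (ind (full_subcomplex K W))={pt K g ` s | g s. g\<in>carrier G & s\<in>faces K & s \<subseteq> W}"
  unfolding faces_ind using img by (auto simp: full_subcomplex_def) blast+
 also have "...=faces (full_subcomplex (ind K) (iset (act K) W))"
  using sub by (auto simp: full_subcomplex_def faces_ind) blast+
 finally have faces: "faces (ind (full_subcomplex K W))=faces (full_subcomplex (ind K) (iset (act K) W))" .
 have vW: "verts (full_subcomplex K W)=W" by (rule verts_full[OF GcxD(1)[OF K] Wv])
 have "act (ind (full_subcomplex K W))=(%g. restrict ((`) (%(g', y). (g \<otimes> g', y))) (iset (act (full_subcomplex K W)) (verts (full_subcomplex K W))))"
  unfolding ind_complex_def iset_def by simp
 also have "iset (act (full_subcomplex K W)) (verts (full_subcomplex K W))=iset (act K) W"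
  unfolding vW by (rule iset_full_subcomplex[OF order_refl])
 also have "(%g. restrict ((`) (%(g', y). (g \<otimes> g', y))) (iset (act K) W)) =
  (%g. restrict (restrict ((`) (%(g', y). (g \<otimes> g', y))) (iset (act K) (verts K))) (iset (act K) W))"
  using iset_mono[OF Wv, of "act K"] by (auto simp: restrict_def fun_eq_iff)
 also have "...=act (full_subcomplex (ind K) (iset (act K) W))"
  unfolding full_subcomplex_def ind_complex_def iset_def by simp
 finally show ?thesis using faces by (intro gcomplex.equality) auto
qed

text \<open>A walk starting at \<lfloor>g, v\<rfloor> stays in the copy of \<open>K\<close> indexed
  by g, where it is a walk of \<open>K\<close> of the same length.\<close>

lemma iset_ballset:
 assumes K: "G_complex HG K" and V: "invariant HG K V"
 shows "ballset (ind K) (iset (act K) V) r=iset (act K) (ballset K V r)"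
proof
 note w = gembed_walk[OF gembed_pt[OF K] GcxD(1)[OF K]]
 have Vv: "V \<subseteq> verts K" using V by (simp add: invariant_def)
 show "ballset (ind K) (iset (act K) V) r \<subseteq> iset (act K) (ballset K V r)"
 proof
  fix p assume "p\<in>ballset (ind K) (iset (act K) V) r"
  then obtain g v k where p: "g\<in>carrier G" "v\<in>V" "real k \<le> r" "(adjacent (ind K) ^^ k) (pt K g v) p"
   by (auto simp: ballset_def iset_def)
  have v: "v\<in>verts K" using Vv p(2) by blast
  obtain y where y: "p=pt K g y" "(adjacent K ^^ k) v y" using w[OF p(1) v] p(4) by blast
  have "y\<in>ballset K V r" using walk_in_verts[OF y(2) v] y(2) p(2,3) by (auto simp: ballset_def)
  thus "p\<in>iset (act K) (ballset K V r)" using y(1) p(1) unfolding iset_def by blast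
 qed
 show "iset (act K) (ballset K V r) \<subseteq> ballset (ind K) (iset (act K) V) r"
 proof
  fix p assume "p\<in>iset (act K) (ballset K V r)"
  then obtain g y where p: "g\<in>carrier G" "y\<in>ballset K V r" "p=pt K g y" by (auto simp: iset_def)
  then obtain v k where v: "y\<in>verts K" "v\<in>V" "real k \<le> r" "(adjacent K ^^ k) v y" by (auto simp: ballset_def)
  have vv: "v\<in>verts K" using Vv v(2) by blast
  have "(adjacent (ind K) ^^ k) (pt K g v) p" using w[OF p(1) vv] v(4) p(3) by blast
  moreover have "pt K g v\<in>iset (act K) V" using p(1) v(2) unfolding iset_def by blast
  moreover have "p\<in>verts (ind K)" using p v(1) by (simp add: pt_in_verts)
  ultimately show "p\<in>ballset (ind K) (iset (act K) V) r" using v(3) unfolding ballset_def by blast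
 qed
qed

lemma iset_compset:
 assumes K: "G_complex HG K" and V: "invariant HG K V"
 shows "compset (ind K) (iset (act K) V)=iset (act K) (compset K V)"
proof
 note w = gembed_reach[OF gembed_pt[OF K] GcxD(1)[OF K]]
 have Vv: "V \<subseteq> verts K" using V by (simp add: invariant_def)
 show "compset (ind K) (iset (act K) V) \<subseteq> iset (act K) (compset K V)"
 proof
  fix p assume "p\<in>compset (ind K) (iset (act K) V)"
  then obtain g v where p: "g\<in>carrier G" "v\<in>V" "(adjacent (ind K))\<^sup>*\<^sup>* (pt K g v) p"
   by (auto simp: compset_def iset_def)
  have v: "v\<in>verts K" using Vv p(2) by blast
  obtain y where y: "p=pt K g y" "(adjacent K)\<^sup>*\<^sup>* v y" using w[OF p(1) v] p(3) by blast
  have "y\<in>compset K V" using reach_in_verts[OF y(2) v] y(2) p(2) by (auto simp: compset_def)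
  thus "p\<in>iset (act K) (compset K V)" using y(1) p(1) unfolding iset_def by blast
 qed
 show "iset (act K) (compset K V) \<subseteq> compset (ind K) (iset (act K) V)"
 proof
  fix p assume "p\<in>iset (act K) (compset K V)"
  then obtain g y where p: "g\<in>carrier G" "y\<in>compset K V" "p=pt K g y" by (auto simp: iset_def)
  then obtain v where v: "y\<in>verts K" "v\<in>V" "(adjacent K)\<^sup>*\<^sup>* v y" by (auto simp: compset_def)
  have vv: "v\<in>verts K" using Vv v(2) by blast
  have "(adjacent (ind K))\<^sup>*\<^sup>* (pt K g v) p" using w[OF p(1) vv] v(3) p(3) by blast
  moreover have "pt K g v\<in>iset (act K) V" using p(1) v(2) unfolding iset_def by blast
  moreover have "p\<in>verts (ind K)" using p v(1) by (simp add: pt_in_verts)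
  ultimately show "p\<in>compset (ind K) (iset (act K) V)" unfolding compset_def by blast
 qed
qed

lemma iset_Union: "\<Union>(set (map (iset a) os))=iset a (\<Union>(set os))"
 unfolding iset_def by auto

lemma cball_ind:
 assumes K: "marked_complex D HG (K, os)"
 shows "cball_complex (ind K) (\<Union>(set (map (iset (act K)) os))) r=ind (cball_complex K (\<Union>(set os)) r)"
proof -
 note KG = markedD(1)[OF K]
 have inv: "invariant HG K (\<Union>(set os))" by (rule invariant_Union) (rule root_invariant(1)[OF K])
 show ?thesis
  unfolding cball_eq iset_Union iset_ballset[OF KG inv]
  by (rule ind_full_subcomplex[OF KG invariant_ballset[OF KG inv], symmetric])
qed

text \<open>Balls of the induced complex are induced balls of the same radius, so agreement carries
  over without loss of radius.\<close>

lemma brel_ind: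
 assumes K: "marked_complex D HG (K, os)" and L: "marked_complex D HG (L, os')" and ne: "os ~= []" and r: "0 \<le> r"
  and b: "brel HG r (K, os) (L, os')"
 shows "brel G r (ind K, map (iset (act K)) os) (ind L, map (iset (act L)) os')"
proof -
 let ?BK = "cball_complex K (\<Union>(set os)) r" and ?BL = "cball_complex L (\<Union>(set os')) r"
 obtain f where f: "giso HG f ?BK ?BL" "map (%O'. f ` O') os = os'"
  using b unfolding brel_def prod.case marked_iso_iff by blast
 have ne': "os' ~= []" using ne f(2) by auto
 note wK = wmarked_cball[OF K ne r] and wL = wmarked_cball[OF L ne' r]
 have G: "G_complex HG ?BK" "G_complex HG ?BL" using wK wL by (auto simp: wmarked_def)
 have iK: "iset (act ?BK) P=iset (act K) P" if P: "P\<in>set os" for P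
  unfolding cball_eq
  by (rule iset_full_subcomplex) (use subset_ballset[OF roots_subset[OF K] r] P in blast)
 have iL: "iset (act ?BL) P=iset (act L) P" if P: "P\<in>set os'" for P
  unfolding cball_eq
  by (rule iset_full_subcomplex) (use subset_ballset[OF roots_subset[OF L] r] P in blast)
 have "imap f ` iset (act K) P=iset (act L) (f ` P)" if P: "P\<in>set os" for P
 proof -
  have "P \<subseteq> verts ?BK" using wK P by (auto simp: wmarked_def)
  from imap_iset[OF f(1) this] show ?thesis using iK[OF P] iL[of "f ` P"] P f(2) by auto
 qed
 hence "map (%O'. imap f ` O') (map (iset (act K)) os)=map (iset (act L)) os'"
  unfolding f(2)[symmetric] by simp
 thus ?thesis
  unfolding brel_def prod.case cball_ind[OF K] cball_ind[OF L] marked_iso_iff using giso_ind[OF G f(1)] by blast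
qed

lemma marked_iso_ind:
 assumes K: "marked_complex D HG (K, os)" and L: "marked_complex D HG (L, os')" and iso: "marked_iso HG (K, os) (L, os')"
 shows "marked_iso G (ind K, map (iset (act K)) os) (ind L, map (iset (act L)) os')"
proof -
 obtain f where f: "giso HG f K L" "map (%O'. f ` O') os = os'" using iso marked_iso_iff by blast
 have "imap f ` iset (act K) P=iset (act L) (f ` P)" if "P\<in>set os" for P
  by (rule imap_iset[OF f(1) root_subset[OF K that]])
 hence "map (%O'. imap f ` O') (map (iset (act K)) os)=map (iset (act L)) os'"
  unfolding f(2)[symmetric] by simp
 thus ?thesis unfolding marked_iso_iff
  using giso_ind[OF markedD(1)[OF K] markedD(1)[OF L] f(1)] by blast
qed

text \<open>\<open>ind_map\<close> treats a single root. The mass transport identity needs the same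
  construction for two roots, hence this version for lists.\<close>

definition indc :: "nat => 'a iso_class => 'a iso_class"
 where "indc D c=(case (SOME M. M\<in>c) of (K, os) => mclass D G (ind K) (map (iset (act K)) os))"

lemma indc_eq:
 assumes c: "c\<in>SC k D HG" and M: "(K, os)\<in>c"
 shows "indc D c=mclass D G (ind K) (map (iset (act K)) os)"
proof -
 obtain L os' where L: "(SOME M. M\<in>c)=(L, os')" by fastforce
 have Lc: "(L, os')\<in>c" using someI[of "%M. M\<in>c", OF M] by (simp only: L)
 have iso: "marked_iso HG (L, os') (K, os)" using SC_D(2)[OF c Lc] M by (auto dest: mem_mclassD)
 note mL = SC_D(1)[OF c Lc] and mK = SC_D(1)[OF c M]
 have "mclass D G (ind L) (map (iset (act L)) os')=mclass D G (ind K) (map (iset (act K)) os)"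
  by (rule mclass_eq[OF marked_wmarked[OF marked_ind[OF mL]] marked_iso_ind[OF mL mK iso]])
 thus ?thesis by (simp add: indc_def L)
qed

lemma indc_mclass:
 assumes K: "marked_complex D HG (K, os)" "countable (verts K)"
 shows "indc D (mclass D HG K os)=mclass D G (ind K) (map (iset (act K)) os)"
proof -
 obtain M :: "('a, nat) marked" where M: "marked_complex D HG M" "marked_iso HG (K, os) M" using nat_copy[OF K] by blast
 obtain L os' where L: "M=(L, os')" by fastforce
 have "(L, os')\<in>mclass D HG K os" using M by (simp add: L mclass_def)
 from indc_eq[OF mclass_in_SC[OF K] this]
 have "indc D (mclass D HG K os)=mclass D G (ind L) (map (iset (act L)) os')" .
 also have "...=mclass D G (ind K) (map (iset (act K)) os)"
  by (rule mclass_eq[symmetric, OF marked_wmarked[OF marked_ind[OF K(1)]] marked_iso_ind[OF K(1) M(1)[unfolded L] M(2)[unfolded L]]])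
 finally show ?thesis .
qed

lemma indc_SC:
 assumes c: "c\<in>SC k D HG"
 shows "indc D c\<in>SC k D G"
proof -
 obtain K os where M: "(K, os)\<in>c" using SC_nonempty[OF c] .
 have "mclass D G (ind K) (map (iset (act K)) os)\<in>SC (length (map (iset (act K)) os)) D G"
  by (rule mclass_in_SC[OF marked_ind[OF SC_D(1)[OF c M]] countable_ind]) simp
 thus ?thesis using indc_eq[OF c M] SC_D(3)[OF c M] by simp
qed

lemma crel_indc:
 assumes c: "c\<in>SC k D HG" and c': "c'\<in>SC k D HG" and k: "k > 0" and rel: "crel HG n c c'"
 shows "crel G n (indc D c) (indc D c')"
proof -
 obtain M M' where M: "M\<in>c" "M'\<in>c'" "brel HG (real n) M M'" using rel unfolding crel_def by blast
 obtain K os L os' where e: "M=(K, os)" "M'=(L, os')" by fastforce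
 note mK = SC_D[OF c M(1)[unfolded e]] and mL = SC_D[OF c' M(2)[unfolded e]]
 have ne: "os ~= []" using mK(3) k by auto
 have "brel G (real n) (ind K, map (iset (act K)) os) (ind L, map (iset (act L)) os')"
  by (rule brel_ind[OF mK(1) mL(1) ne _ M(3)[unfolded e]]) simp
 moreover have "map (iset (act K)) os ~= []" using ne by simp
 ultimately show ?thesis
  unfolding indc_eq[OF c M(1)[unfolded e]] indc_eq[OF c' M(2)[unfolded e]]
  using crel_iff[OF marked_ind[OF mK(1)] countable_ind marked_ind[OF mL(1)] countable_ind] by simp
qed

lemma continuous_indc:
 assumes k: "k > 0"
 shows "continuous_map (SC_topology k D HG) (SC_topology k D G) (indc D)"
proof (rule continuous_map_SC[OF k k indc_SC], assumption)
 show "\<exists>m. \<forall>c'\<in>SC k D HG. crel HG m c c' --> crel G n (indc D c) (indc D c')" if c: "c\<in>SC k D HG" for c n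
  by (intro exI[of _ n] ballI impI) (rule crel_indc[OF c _ k])
qed

lemma ind_map_eq:
 assumes c: "c\<in>SC 1 D HG"
 shows "ind_map D G H c=indc D c"
proof -
 obtain K O' where r: "rep c=(K, O')" by fastforce
 have "(K, [O'])\<in>c" by (rule rep_mem[OF c r])
 from indc_eq[OF c this] show ?thesis by (simp add: ind_map_def r iset_def)
qed

text \<open>\<open>\<tau>\<close> picks one element from each left coset and so is constant on
  cosets and the identity on its range. Vertices of the induced complex are then pairs of a
  representative and a vertex of \<open>K\<close>, and one \<open>T\<close> serves every
  \<open>K\<close>.\<close>

lemma transversal:
 obtains T where "T \<subseteq> carrier G" "finite T" "T ~= {}" "!!K. G_complex HG K ==> bij_betw (%(t, y). pt K t y) (T \<times> verts K) (verts (ind K))"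
proof -
 define \<tau> where "\<tau> g=(SOME k. k\<in>g <# H)" for g
 have mem: "\<tau> g\<in>g <# H" if "g\<in>carrier G" for g
  unfolding \<tau>_def by (rule someI[of _ g]) (use that H_closed(2) in \<open>force simp: l_coset_def\<close>)
 have coset: "g <# H=k <# H" if "g\<in>carrier G" "k\<in>g <# H" for g k
  using l_repr_independence[OF that(2,1) sub] .
 define T where "T=\<tau> ` carrier G"
 have TG: "T \<subseteq> carrier G" unfolding T_def using mem H_sub by (fastforce simp: l_coset_def)
 have idem: "\<tau> t=t" if mem_T: "t\<in>T" for t
 proof -
  have "\<exists>g\<in>carrier G. t=\<tau> g" using mem_T unfolding T_def image_iff .
  then obtain g where g: "g\<in>carrier G" "t=\<tau> g" by (elim bexE)
  have "g <# H=t <# H" using coset[OF g(1) mem[OF g(1)]] g(2) by simp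
  thus ?thesis using g(2) by (simp add: \<tau>_def)
 qed
 have bij: "bij_betw (%(t, y). pt K t y) (T \<times> verts K) (verts (ind K))" if K: "G_complex HG K" for K :: "('a, 'v) gcomplex"
  unfolding bij_betw_def
 proof
  show "inj_on (%(t, y). pt K t y) (T \<times> verts K)"
  proof (rule inj_onI, clarify)
   fix t y t' y' assume t: "t\<in>T" "t'\<in>T" and y: "y\<in>verts K" "y'\<in>verts K" and e: "pt K t y=pt K t' y'"
   have tG: "t\<in>carrier G" "t'\<in>carrier G" using t TG by blast+
   obtain h where "h\<in>H" "t'=t \<otimes> h" using pt_eqD[OF K y tG e] by blast
   hence "t'\<in>t <# H" by (auto simp: l_coset_def)
   hence "\<tau> t=\<tau> t'" unfolding \<tau>_def using coset[OF tG(1)] by simp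
   hence "t=t'" using idem t by simp
   thus "t=t' & y=y'" using pt_inj[OF K y tG(1)] e by simp
  qed
  show "(%(t, y). pt K t y) ` (T \<times> verts K)=verts (ind K)"
  proof
   show "(%(t, y). pt K t y) ` (T \<times> verts K) \<subseteq> verts (ind K)"
   proof
    fix p assume "p\<in>(%(t, y). pt K t y) ` (T \<times> verts K)"
    then obtain t y where p: "t\<in>T" "y\<in>verts K" "p=pt K t y" by auto
    show "p\<in>verts (ind K)" unfolding p(3) by (rule pt_in_verts[OF subsetD[OF TG p(1)] p(2)])
   qed
   show "verts (ind K)\<subseteq>(%(t, y). pt K t y) ` (T \<times> verts K)"
   proof
    fix p assume "p\<in>verts (ind K)"
    then obtain g x where p: "g\<in>carrier G" "x\<in>verts K" "p=pt K g x" by (auto simp: verts_ind iset_def)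
    obtain h where h: "h\<in>H" "\<tau> g=g \<otimes> h" using mem[OF p(1)] by (auto simp: l_coset_def)
    have hi: "inv h\<in>H" "act K (inv h) x\<in>verts K" using H_closed(3)[OF h(1)] HK_act(1)[OF K _ p(2)] by auto
    have "p=pt K (\<tau> g) (act K (inv h) x)"
     using pt_shift[OF K p(1) h(1) hi(2)] HK_act(5)[OF K h(1) p(2)] p(3) h(2) by simp
    moreover have "\<tau> g\<in>T" using p(1) by (simp add: T_def)
    ultimately show "p\<in>(%(t, y). pt K t y) ` (T \<times> verts K)" using hi(2) by force
   qed
  qed
 qed
 show thesis
 proof (rule that[OF TG])
  show "finite T" "T ~= {}" using one_closed by (auto simp: T_def)
 qed (rule bij)
qed

end

section \<open>Unimodularity\<close>

lemma reach_sym: "(adjacent K)\<^sup>*\<^sup>* x y ==> (adjacent K)\<^sup>*\<^sup>* y x"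
proof (induction rule: rtranclp_induct)
 case (step y z)
 have "adjacent K z y" using step(2) by (auto simp: adjacent_def insert_commute)
 thus ?case using step(3) by (rule converse_rtranclp_into_rtranclp)
qed simp

text \<open>The Boolean selects the order of the two roots, so the two sides of the mass transport
  identity are instances of the same expressions.\<close>

definition two :: "bool => 'a => 'a => 'a list"
 where "two b P Q=(if b then [P, Q] else [Q, P])"

lemma two_simps [simp]: "set (two b P Q)={P, Q}" "map f (two b P Q)=two b (f P) (f Q)" "length (two b P Q)=2"
  "two b P Q ~= []"
 by (auto simp: two_def)

text \<open>To reach y from the orbit of x, join x to some root u and y to some root w. A group
  element moving u to w moves x to a vertex connected with w and hence with y.\<close>

lemma marked_orbit:
 assumes K: "marked_complex D G (K, [P])" and x: "x\<in>verts K"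
 shows "marked_complex D G (K, two b P (orbit G (act K) x))"
proof -
 note KG = markedD(1)[OF K]
 have Pr: "P\<in>set [P]" by simp
 obtain p where p: "p\<in>verts K" "P = orbit G (act K) p" using markedD(3)[OF K Pr] by (auto simp: orbits_def)
 have "\<exists>v\<in>orbit G (act K) x. (adjacent K)\<^sup>*\<^sup>* v y" if y: "y\<in>verts K" for y
 proof -
  obtain u where u: "u\<in>P" "(adjacent K)\<^sup>*\<^sup>* u x" using markedD(4)[OF K Pr x] by blast
  obtain w where w: "w\<in>P" "(adjacent K)\<^sup>*\<^sup>* w y" using markedD(4)[OF K Pr y] by blast
  have uv: "u\<in>verts K" using root_subset[OF K Pr] u(1) by blast
  interpret group G by (rule Gcx_act(1)[OF KG])
  obtain g h where g: "g\<in>carrier G" "u=act K g p" and h: "h\<in>carrier G" "w=act K h p"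
   using u(1) w(1) unfolding p(2) orbit_def by blast
  let ?k = "h \<otimes>\<^bsub>G\<^esub> inv\<^bsub>G\<^esub> g"
  have k: "?k\<in>carrier G" using g h by simp
  have "act K ?k u=act K h (act K (inv\<^bsub>G\<^esub> g) u)" using Gcx_act(4)[OF KG h(1) inv_closed[OF g(1)] uv] .
  also have "act K (inv\<^bsub>G\<^esub> g) u=p" unfolding g(2) by (rule Gcx_act(6)[OF KG g(1) p(1)])
  finally have ku: "act K ?k u=w" using h(2) by simp
  have "(adjacent K)\<^sup>*\<^sup>* (act K ?k u) (act K ?k x)"
   using gembed_reach[OF act_giso[OF KG k] GcxD(1)[OF KG] uv] u(2) by blast
  hence "(adjacent K)\<^sup>*\<^sup>* (act K ?k x) w" unfolding ku by (rule reach_sym)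
  hence "(adjacent K)\<^sup>*\<^sup>* (act K ?k x) y" using w(2) by (rule rtranclp_trans)
  moreover have "act K ?k x\<in>orbit G (act K) x" using k unfolding orbit_def by blast
  ultimately show ?thesis by blast
 qed
 moreover have "orbit G (act K) x\<in>orbits G (verts K) (act K)" using x by (auto simp: orbits_def)
 ultimately show ?thesis
  using K unfolding marked_complex_def by simp
qed

definition ocls :: "('g, 'b) monoid_scheme => nat => bool => ('g, 'v) gcomplex => 'v set => 'v => 'g iso_class"
 where "ocls G D b K P x=mclass D G K (two b P (orbit G (act K) x))"

definition orbit_sum :: "('g, 'b) monoid_scheme => nat => bool => ('g iso_class => ennreal) => 'g iso_class => ennreal"
 where "orbit_sum G D b f c=(case rep c of (K, P) => \<integral>\<^sup>+x. f (ocls G D b K P x) \<partial>count_space (verts K))"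

lemma ocls_giso:
 assumes K: "marked_complex D G (K, [P])" and f: "giso G f K L" "f ` P=Q" and x: "x\<in>verts K"
 shows "ocls G D b L Q (f x) = ocls G D b K P x"
proof -
 have "marked_iso G (K, two b P (orbit G (act K) x)) (L, two b Q (orbit G (act L) (f x)))"
  unfolding marked_iso_iff using f orbit_image[OF f(1) x] by auto
 thus ?thesis unfolding ocls_def by (rule mclass_eq[OF marked_wmarked[OF marked_orbit[OF K x]], symmetric])
qed

lemma ocls_SC:
 assumes K: "marked_complex D G (K, [P])" "countable (verts K)" and x: "x\<in>verts K"
 shows "ocls G D b K P x\<in>SC 2 D G"
 using mclass_in_SC[OF marked_orbit[OF K(1) x] K(2), of b] by (simp add: ocls_def)

text \<open>An isomorphism permutes the summands, so the sum may be evaluated on any marked complex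
  of the class and not only on the chosen \<open>rep\<close>.\<close>

lemma orbit_sum_eq:
 assumes K: "marked_complex D G (K, [P])" and c: "c\<in>SC 1 D G" "c=mclass D G K [P]"
 shows "orbit_sum G D b f c=(\<integral>\<^sup>+x. f (ocls G D b K P x) \<partial>count_space (verts K))"
proof -
 obtain L Q where r: "rep c=(L, Q)" by fastforce
 have "(L, [Q])\<in>mclass D G K [P]" using rep_mem[OF c(1) r] c(2) by simp
 hence "marked_iso G (K, [P]) (L, [Q])" using mem_mclassD by blast
 then obtain f' where f: "giso G f' K L" "f' ` P=Q" unfolding marked_iso_iff by auto
 have b: "bij_betw f' (verts K) (verts L)" using f(1) by (simp add: giso_def)
 have "(\<integral>\<^sup>+x. f (ocls G D b L Q x) \<partial>count_space (verts L))=(\<integral>\<^sup>+x. f (ocls G D b L Q (f' x)) \<partial>count_space (verts K))"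
  by (rule nn_integral_bij_count_space[OF b, symmetric])
 also have "...=(\<integral>\<^sup>+x. f (ocls G D b K P x) \<partial>count_space (verts K))"
  by (rule nn_integral_cong) (simp add: ocls_giso[OF K f])
 finally show ?thesis by (simp add: orbit_sum_def r)
qed

section \<open>Measurability of sums over vertices\<close>

lemma finite_ballset:
 assumes G: "finite (carrier G)" and K: "marked_complex D G (K, [P])"
 shows "finite (ballset K P r)"
proof -
 have P: "P\<in>set [P]" by simp
 obtain p where p: "p\<in>verts K" "P = orbit G (act K) p" using markedD(3)[OF K P] by (auto simp: orbits_def)
 have "orbit G (act K) p=(%g. act K g p) ` carrier G" by (auto simp: orbit_def)
 hence fP: "finite P" using G p(2) by simp
 have walk: "finite {x. (adjacent K ^^ k) v x}" if v: "v\<in>verts K" for v k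
 proof (induction k)
  case (Suc k)
  have "{x. (adjacent K ^^ Suc k) v x}\<subseteq>(\<Union>y\<in>{y. (adjacent K ^^ k) v y}. nbrs K y)"
   by (auto simp: nbrs_def)
  moreover have "finite (nbrs K y)" if y: "(adjacent K ^^ k) v y" for y
   using markedD(2)[OF K] walk_in_verts[OF y v] by (simp add: degree_le_nbrs)
  ultimately show ?case using finite_subset finite_UN_I Suc by (metis (no_types, lifting) mem_Collect_eq)
 qed simp
 have "ballset K P r\<subseteq>(\<Union>v\<in>P. \<Union>k\<in>{..nat \<lfloor>r\<rfloor>}. {x. (adjacent K ^^ k) v x})"
 proof
  fix x assume "x\<in>ballset K P r"
  then obtain v k where x: "v\<in>P" "real k \<le> r" "(adjacent K ^^ k) v x" by (auto simp: ballset_def)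
  have "k\<in>{..nat \<lfloor>r\<rfloor>}" using le_nat_floor[OF x(2)] by simp
  thus "x\<in>(\<Union>v\<in>P. \<Union>k\<in>{..nat \<lfloor>r\<rfloor>}. {x. (adjacent K ^^ k) v x})" using x(1,3) by blast
 qed
 moreover have "finite (\<Union>v\<in>P. \<Union>k\<in>{..nat \<lfloor>r\<rfloor>}. {x. (adjacent K ^^ k) v x})"
  using fP walk root_subset[OF K P] by (intro finite_UN_I) auto
 ultimately show ?thesis by (rule finite_subset)
qed

lemma Union_ballset:
 assumes K: "marked_complex D G (K, [P])"
 shows "(\<Union>n::nat. ballset K P (real n))=verts K"
proof
 show "verts K\<subseteq>(\<Union>n::nat. ballset K P (real n))"
 proof
  fix x assume x: "x\<in>verts K"
  obtain v k where "v\<in>P" "(adjacent K ^^ k) v x" using markedD(4)[OF K _ x] unfolding rtranclp_power by fastforce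
  hence "x\<in>ballset K P (real k)" using x unfolding ballset_def by blast
  thus "x\<in>(\<Union>n::nat. ballset K P (real n))" by blast
 qed
qed (auto simp: ballset_def)

lemma ballset_mono: "r \<le> r' ==> ballset K V r \<subseteq> ballset K V r'"
 unfolding ballset_def by (blast intro: order_trans)

lemma ballset_triangle:
 assumes K: "simplicial_complex (faces K)" and W: "W \<subseteq> ballset K V n" and r: "n + r \<le> m"
 shows "ballset K W r \<subseteq> ballset K V m"
proof
 fix y assume "y\<in>ballset K W r"
 then obtain w k where y: "y\<in>verts K" "w\<in>W" "real k \<le> r" "(adjacent K ^^ k) w y" by (auto simp: ballset_def)
 obtain v l where v: "v\<in>V" "real l \<le> n" "(adjacent K ^^ l) v w" using W y(2) by (auto simp: ballset_def)
 have "(adjacent K ^^ (l + k)) v y" using v(3) y(4) by (auto simp: relpowp_add)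
 moreover have "real (l + k) \<le> m" using v(2) y(3) r by simp
 ultimately show "y\<in>ballset K V m" using y(1) v(1) unfolding ballset_def by blast
qed

text \<open>The second root lies within distance n of the first, so an r-ball around both roots fits
  into the ball of radius n + r around the first, where the isomorphism is defined.\<close>

lemma brel_orbit:
 assumes K: "marked_complex D G (K, [P])" and L: "marked_complex D G (L, [Q])"
  and f: "giso G f (cball_complex K P m) (cball_complex L Q m)" "f ` P=Q"
  and x: "x\<in>ballset K P n" and r: "0 \<le> n" "0 \<le> r" "n + r \<le> m"
 shows "brel G r (K, two b P (orbit G (act K) x)) (L, two b Q (orbit G (act L) (f x)))" "f x\<in>ballset L Q n"
proof -
 note KG = markedD(1)[OF K] and LG = markedD(1)[OF L]
 have Pr: "P\<in>set [P]" and Qr: "Q\<in>set [Q]" by simp_all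
 let ?K = "cball_complex K P m" and ?L = "cball_complex L Q m"
 have r0: "0 \<le> m" using r by simp
 note P = root_subset[OF K Pr] and Q = root_subset[OF L Qr]
 have wK: "wmarked G (?K, [P])" and wL: "wmarked G (?L, [Q])"
  using wmarked_cball[OF K _ r0] wmarked_cball[OF L _ r0] by simp_all
 have GK: "G_complex G ?K" and GL: "G_complex G ?L" and PK: "P \<subseteq> verts ?K" using wK wL by (auto simp: wmarked_def)
 note sK = GcxD(1)[OF KG] and sL = GcxD(1)[OF LG]
 have vK: "verts ?K=ballset K P m" and vL: "verts ?L=ballset L Q m"
  unfolding cball_eq by (rule verts_full[OF sK ballset_subset], rule verts_full[OF sL ballset_subset])
 have nm: "ballset K P n \<subseteq> ballset K P m" "ballset L Q n \<subseteq> ballset L Q m"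
  using r by (intro ballset_mono; simp)+
 have ball: "f ` ballset K P n=ballset L Q n"
 proof -
  have "f ` ballset ?K P n=ballset ?L (f ` P) n" by (rule giso_ballset[OF f(1) GcxD(1)[OF GK] PK])
  thus ?thesis
   unfolding f(2) cball_eq ballset_full_subcomplex[OF sK ballset_subset nm(1)] ballset_full_subcomplex[OF sL ballset_subset nm(2)] .
 qed
 thus fx: "f x\<in>ballset L Q n" using x by blast
 have xm: "x\<in>verts ?K" using x nm(1) vK by blast
 have fxm: "f x\<in>verts ?L" using fx nm(2) vL by blast
 have oK: "orbit G (act ?K) x = orbit G (act K) x" and oL: "orbit G (act ?L) (f x) = orbit G (act L) (f x)"
  using subsetD[OF nm(1) x] subsetD[OF nm(2) fx] unfolding cball_eq by (simp_all add: orbit_def full_subcomplex_def)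
 have oi: "f ` orbit G (act K) x = orbit G (act L) (f x)" using orbit_image[OF f(1) xm] by (simp only: oK oL)
 have inv: "invariant G K (ballset K P n)" "invariant G L (ballset L Q n)"
  by (rule invariant_ballset[OF KG root_invariant(1)[OF K Pr]], rule invariant_ballset[OF LG root_invariant(1)[OF L Qr]])
 have oKb: "orbit G (act K) x \<subseteq> ballset K P n" and oLb: "orbit G (act L) (f x) \<subseteq> ballset L Q n"
  using inv x fx unfolding invariant_def orbit_def by blast+
 let ?V = "P \<union> orbit G (act K) x" and ?W = "Q \<union> orbit G (act L) (f x)"
 have V: "?V \<subseteq> ballset K P n" and W: "?W \<subseteq> ballset L Q n"
  using subset_ballset[OF P r(1)] subset_ballset[OF Q r(1)] oKb oLb by blast+
 have bV: "ballset K ?V r \<subseteq> ballset K P m" and bW: "ballset L ?W r \<subseteq> ballset L Q m"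
  by (rule ballset_triangle[OF sK V r(3)], rule ballset_triangle[OF sL W r(3)])
 have "giso G f (cball_complex ?K ?V r) (cball_complex ?L (f ` ?V) r)"
  by (rule giso_cball[OF f(1) GcxD(1)[OF GK] GcxD(1)[OF GL]]) (use V nm(1) vK in blast)
 moreover have "f ` ?V=?W" using f(2) oi by (simp add: image_Un)
 moreover have "cball_complex ?K ?V r=cball_complex K ?V r" "cball_complex ?L ?W r=cball_complex L ?W r"
  unfolding cball_eq[of K P m] cball_eq[of L Q m]
  by (rule cball_full_subcomplex[OF sK ballset_subset bV], rule cball_full_subcomplex[OF sL ballset_subset bW])
 ultimately have "giso G f (cball_complex K ?V r) (cball_complex L ?W r)" by simp
 thus "brel G r (K, two b P (orbit G (act K) x)) (L, two b Q (orbit G (act L) (f x)))"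
  unfolding brel_def prod.case marked_iso_iff using f(2) oi by auto
qed

definition hits :: "('g, 'b) monoid_scheme => nat => bool => nat => 'g iso_class set => 'g iso_class => nat"
 where "hits G D b n A c=(case rep c of (K, P) => card {x\<in>ballset K P (real n). ocls G D b K P x\<in>A})"

lemma SC1_rep:
 assumes c: "c\<in>SC 1 D G" and r: "rep c=(K, P)"
 shows "marked_complex D G (K, [P])" "c=mclass D G K [P]" "countable (verts K)"
 using SC_D[OF c rep_mem[OF c r]] by auto

text \<open>Lower semicontinuity of \<open>hits\<close> for open \<open>A\<close>: each of the
  finitely many vertices counted at c is still counted, via the isomorphism of balls, at every class
  that agrees with c to a large enough radius.\<close>

lemma open_hits:
 assumes G: "finite (carrier G)" and A: "openin (SC_topology 2 D G) A"
 shows "openin (SC_topology 1 D G) {c\<in>SC 1 D G. a < hits G D b n A c}"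
proof -
 have "\<exists>m. \<forall>c'\<in>SC 1 D G. crel G m c c' --> hits G D b n A c \<le> hits G D b n A c'" if c: "c\<in>SC 1 D G" for c
 proof -
  obtain K P where r: "rep c=(K, P)" by fastforce
  note K = SC1_rep[OF c r]
  define S where "S={x\<in>ballset K P (real n). ocls G D b K P x\<in>A}"
  have fS: "finite S" using finite_ballset[OF G K(1), of "real n"] unfolding S_def by simp
  have "\<exists>q. \<forall>c'\<in>SC 2 D G. crel G q (ocls G D b K P x) c' --> c'\<in>A" if x: "x\<in>S" for x
   using A x unfolding openin_SC_iff[OF zero_less_numeral] S_def by blast
  \<comment> \<open>\<open>q x\<close> is a radius up to which agreement keeps the class rooted at x
    inside \<open>A\<close>. The maximum N of these, plus n for the position of x, is the radius
    used.\<close>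
  then obtain q where q: "!!x c'. x\<in>S ==> c'\<in>SC 2 D G ==> crel G (q x) (ocls G D b K P x) c' ==> c'\<in>A" by metis
  obtain N where N: "!!x. x\<in>S ==> q x \<le> N" using finite_nat_set_iff_bounded_le[of "q ` S"] fS by auto
  show ?thesis
  proof (intro exI[of _ "n + N"] ballI impI)
   fix c' assume c': "c'\<in>SC 1 D G" and rel: "crel G (n + N) c c'"
   obtain L Q where r': "rep c'=(L, Q)" by fastforce
   note L = SC1_rep[OF c' r']
   have "crel G (n + N) (mclass D G K [P]) (mclass D G L [Q])" using rel by (simp only: K(2)[symmetric] L(2)[symmetric])
   hence "brel G (real (n + N)) (K, [P]) (L, [Q])" using crel_iff[OF K(1,3) L(1,3)] by simp
   then obtain f where f: "giso G f (cball_complex K P (real (n + N))) (cball_complex L Q (real (n + N)))" "f ` P=Q"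
    unfolding brel_def prod.case marked_iso_iff by auto
   have "f x\<in>{y\<in>ballset L Q (real n). ocls G D b L Q y\<in>A}" if x: "x\<in>S" for x
   proof -
    have xb: "x\<in>ballset K P (real n)" using x by (simp add: S_def)
    have "real n + real (q x) \<le> real (n + N)" using N[OF x] by simp
    note br = brel_orbit(1)[OF K(1) L(1) f xb _ _ this, of b] brel_orbit(2)[OF K(1) L(1) f xb _ _ this]
    have xv: "x\<in>verts K" by (rule subsetD[OF ballset_subset xb])
    have fv: "f x\<in>verts L" by (rule subsetD[OF ballset_subset br(2)]) simp_all
    have "crel G (q x) (ocls G D b K P x) (ocls G D b L Q (f x))"
     unfolding ocls_def using crel_iff[OF marked_orbit[OF K(1) xv] K(3) marked_orbit[OF L(1) fv] L(3)] br(1) by simp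
    hence "ocls G D b L Q (f x)\<in>A" by (rule q[OF x ocls_SC[OF L(1,3) fv]])
    thus ?thesis using br(2) by simp
   qed
   moreover have "inj_on f S"
   proof (rule inj_on_subset[OF gisoD(1)[OF f(1)]])
    have "S \<subseteq> ballset K P (real (n + N))" unfolding S_def using ballset_mono[of "real n" "real (n + N)" K P] by auto
    thus "S \<subseteq> verts (cball_complex K P (real (n + N)))"
     unfolding cball_eq verts_full[OF GcxD(1)[OF markedD(1)[OF K(1)]] ballset_subset] .
   qed
   ultimately have "card S \<le> card {y\<in>ballset L Q (real n). ocls G D b L Q y\<in>A}"
    using finite_ballset[OF G L(1), of "real n"] by (intro card_inj_on_le[of f]) auto
   thus "hits G D b n A c \<le> hits G D b n A c'" by (simp add: hits_def r r' S_def)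
  qed
 qed
 thus ?thesis
  unfolding openin_SC_iff[of 1, OF less_numeral_extra(1)] by (blast intro: less_le_trans)
qed

context fin_group
begin

lemma measurable_hits:
 assumes "openin (SC_topology 2 D G) A"
 shows "(%c. real (hits G D b n A c))\<in>borel_measurable (SC_borel 1 D G)"
 unfolding borel_measurable_iff_greater
proof
 fix a :: real
 have "{w\<in>space (SC_borel 1 D G). a < real (hits G D b n A w)} =
   (if a < 0 then space (SC_borel 1 D G) else {c\<in>SC 1 D G. nat \<lfloor>a\<rfloor> < hits G D b n A c})"
  by (auto simp: nat_less_iff floor_less_iff)
 thus "{w\<in>space (SC_borel 1 D G). a < real (hits G D b n A w)}\<in>sets (SC_borel 1 D G)"
  using open_in_sets[OF open_hits[OF fin assms]] sets.top[of "SC_borel 1 D G"] by (auto simp del: One_nat_def)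
qed

text \<open>The sum over a ball is its cardinality times an integral against the image of the
  uniform measure on the ball. These images form a probability kernel, whose measurability has to be
  checked only on the intersection-stable family of open sets, where \<open>hits\<close> computes
  it; general measurable f then come for free.\<close>

lemma measurable_ball_sum:
 fixes f :: "'a iso_class => ennreal"
 assumes f: "f\<in>borel_measurable (SC_borel 2 D G)"
 shows "(%c. case rep c of (K, P) => \<Sum>x\<in>ballset K P (real n). f (ocls G D b K P x))\<in>borel_measurable (SC_borel 1 D G)"
proof -
 define B where "B c=(case rep c of (K, P) => ballset K P (real n))" for c :: "'a iso_class"
 define cl where "cl c=(case rep c of (K, P) => ocls G D b K P)" for c
 define N where "N c=distr (uniform_count_measure (B c)) (SC_borel 2 D G) (cl c)" for c
 have S2: "openin (SC_topology 2 D G) (SC 2 D G)" using openin_topspace[of "SC_topology 2 D G"] by (simp add: topspace_SC_topology)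
 have B: "finite (B c)" "B c ~= {}" "x\<in>B c ==> cl c x\<in>SC 2 D G" if c: "c\<in>SC 1 D G" for c x
 proof -
  obtain K P where r: "rep c=(K, P)" by fastforce
  note K = SC1_rep[OF c r]
  have P: "P\<in>set [P]" by simp
  show "finite (B c)" using finite_ballset[OF fin K(1)] by (simp add: B_def r)
  show "B c ~= {}" using subset_ballset[OF root_subset[OF K(1) P], of "real n"] root_invariant(2)[OF K(1) P]
   by (auto simp: B_def r)
  show "x\<in>B c ==> cl c x\<in>SC 2 D G" using ocls_SC[OF K(1,3)] ballset_subset[of K P "real n"] by (auto simp: B_def cl_def r)
 qed
 have om: "cl c\<in>uniform_count_measure (B c) \<rightarrow>\<^sub>M SC_borel 2 D G" if c: "c\<in>SC 1 D G" for c
  using B(3)[OF c] by (auto simp: measurable_def space_uniform_count_measure sets_uniform_count_measure)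
 have cardB: "hits G D b n (SC 2 D G) c=card (B c)" if c: "c\<in>SC 1 D G" for c
 proof -
  obtain K P where r: "rep c=(K, P)" by fastforce
  have "{x\<in>B c. cl c x\<in>SC 2 D G}=B c" using B(3)[OF c] by blast
  thus ?thesis by (simp add: hits_def r B_def cl_def)
 qed
 have em: "emeasure (N c) A=ennreal (real (hits G D b n A c) / real (hits G D b n (SC 2 D G) c))"
  if c: "c\<in>SC 1 D G" and A: "A\<in>sets (SC_borel 2 D G)" for c A
 proof -
  obtain K P where r: "rep c=(K, P)" by fastforce
  have "emeasure (N c) A=emeasure (uniform_count_measure (B c)) (cl c -` A \<inter> B c)"
   unfolding N_def using emeasure_distr[OF om[OF c] A] by (simp add: space_uniform_count_measure)
  also have "...=ennreal (real (card (cl c -` A \<inter> B c)) / real (card (B c)))"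
   by (rule emeasure_uniform_count_measure[OF B(1)[OF c]]) simp
  also have "cl c -` A \<inter> B c={x\<in>B c. cl c x\<in>A}" by auto
  finally show ?thesis unfolding cardB[OF c] by (simp add: hits_def r B_def cl_def)
 qed
 have "N\<in>SC_borel 1 D G \<rightarrow>\<^sub>M subprob_algebra (SC_borel 2 D G)"
 proof (rule measurable_subprob_algebra_generated[OF sets_SC_borel _ opens_Pow])
  show "Int_stable {U. openin (SC_topology 2 D G) U}" by (auto simp: Int_stable_def)
  fix c assume "c\<in>space (SC_borel 1 D G)"
  hence c: "c\<in>SC 1 D G" by simp
  have "prob_space (uniform_count_measure (B c))" by (rule prob_space_uniform_count_measure[OF B(1,2)[OF c]])
  hence "prob_space (N c)" unfolding N_def by (rule prob_space.prob_space_distr[OF _ om[OF c]])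
  thus "subprob_space (N c)" by (rule prob_space_imp_subprob_space)
  show "sets (N c) = sets (SC_borel 2 D G)" by (simp add: N_def)
 next
  have *: "(%c. emeasure (N c) A)\<in>borel_measurable (SC_borel 1 D G)" if A: "openin (SC_topology 2 D G) A" for A
  proof -
   have "(%c. ennreal (real (hits G D b n A c) / real (hits G D b n (SC 2 D G) c)))\<in>borel_measurable (SC_borel 1 D G)"
    by (intro measurable_compose[OF _ measurable_ennreal] borel_measurable_divide measurable_hits A S2)
   thus ?thesis by (rule measurable_cong[THEN iffD2, rotated]) (simp add: em open_in_sets[OF A])
  qed
  show "(%c. emeasure (N c) A)\<in>borel_measurable (SC_borel 1 D G)" if "A\<in>{U. openin (SC_topology 2 D G) U}" for A
   using * that by simp
  show "(%c. emeasure (N c) (SC 2 D G))\<in>borel_measurable (SC_borel 1 D G)" by (rule *[OF S2])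
 qed
 hence "(%c. \<integral>\<^sup>+x. f x \<partial>N c)\<in>borel_measurable (SC_borel 1 D G)"
  by (rule measurable_compose[OF _ nn_integral_measurable_subprob_algebra[OF f]])
 hence m: "(%c. ennreal (real (hits G D b n (SC 2 D G) c))*(\<integral>\<^sup>+x. f x \<partial>N c))\<in>borel_measurable (SC_borel 1 D G)"
  by (intro borel_measurable_times_ennreal measurable_compose[OF _ measurable_ennreal] measurable_hits S2)
 show ?thesis
 proof (rule measurable_cong[THEN iffD1, OF _ m])
  fix c assume "c\<in>space (SC_borel 1 D G)"
  hence c: "c\<in>SC 1 D G" by simp
  obtain K P where r: "rep c=(K, P)" by fastforce
  have n0: "card (B c) > 0" using B(1,2)[OF c] by (simp add: card_gt_0_iff)
  have "(\<integral>\<^sup>+x. f x \<partial>N c)=(\<integral>\<^sup>+x. f (cl c x) \<partial>uniform_count_measure (B c))"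
   unfolding N_def by (rule nn_integral_distr[OF om[OF c]]) (use f in simp)
  also have "...=(\<Sum>x\<in>B c. f (cl c x) * ennreal (1 / real (card (B c))))"
   unfolding uniform_count_measure_def
   by (subst nn_integral_point_measure_finite[OF B(1)[OF c]]) (simp_all add: mult.commute)
  also have "...=(\<Sum>x\<in>B c. f (cl c x)) * ennreal (1 / real (card (B c)))" by (rule sum_distrib_right[symmetric])
  finally have "ennreal (real (card (B c)))*(\<integral>\<^sup>+x. f x \<partial>N c)=(ennreal (real (card (B c))) * ennreal (1 / real (card (B c))))*(\<Sum>x\<in>B c. f (cl c x))"
   by (simp only: ac_simps)
  also have "ennreal (real (card (B c))) * ennreal (1 / real (card (B c)))=1"
   using n0 by (simp add: ennreal_mult[symmetric])
  finally show "ennreal (real (hits G D b n (SC 2 D G) c))*(\<integral>\<^sup>+x. f x \<partial>N c) =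
    (case rep c of (K, P) => \<Sum>x\<in>ballset K P (real n). f (ocls G D b K P x))"
   unfolding cardB[OF c] by (simp add: B_def cl_def r)
 qed
qed

text \<open>The balls around the root exhaust the vertices, so monotone convergence presents the sum
  as a supremum of sums over balls.\<close>

lemma measurable_orbit_sum:
 assumes f: "f\<in>borel_measurable (SC_borel 2 D G)"
 shows "orbit_sum G D b f\<in>borel_measurable (SC_borel 1 D G)"
proof -
 let ?S = "%n c. case rep c of (K, P) => \<Sum>x\<in>ballset K P (real n). f (ocls G D b K P x)"
 have m: "(%c. SUP n. ?S n c)\<in>borel_measurable (SC_borel 1 D G)"
  by (rule borel_measurable_SUP, simp) (rule measurable_ball_sum[OF f])
 show ?thesis
 proof (rule measurable_cong[THEN iffD1, OF _ m])
  fix c assume "c\<in>space (SC_borel 1 D G)"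
  hence c: "c\<in>SC 1 D G" by simp
  obtain K P where r: "rep c=(K, P)" by fastforce
  note K = SC1_rep[OF c r]
  let ?g = "%n x. f (ocls G D b K P x) * indicator (ballset K P (real n)) x"
  have inc: "ballset K P (real n) \<subseteq> ballset K P (real n')" if "n \<le> n'" for n n'
   using that by (intro ballset_mono) simp
  have "(\<Sum>x\<in>ballset K P (real n). f (ocls G D b K P x))=(\<integral>\<^sup>+x. ?g n x \<partial>count_space (verts K))" for n
  proof -
   have "(\<integral>\<^sup>+x. ?g n x \<partial>count_space (verts K))=(\<Sum>x\<in>ballset K P (real n). ?g n x)"
    by (rule nn_integral_count_space'[OF finite_ballset[OF fin K(1)]]) (use ballset_subset[of K P "real n"] in auto)
   thus ?thesis by simp
  qed
  hence "(SUP n. ?S n c)=(SUP n. \<integral>\<^sup>+x. ?g n x \<partial>count_space (verts K))" by (simp add: r)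
  also have "...=(\<integral>\<^sup>+x. (SUP n. ?g n x) \<partial>count_space (verts K))"
   by (rule nn_integral_monotone_convergence_SUP[symmetric])
    (use inc in \<open>auto simp: incseq_def le_fun_def intro!: mult_left_mono split: split_indicator\<close>)
  also have "...=(\<integral>\<^sup>+x. f (ocls G D b K P x) \<partial>count_space (verts K))"
  proof (rule nn_integral_cong)
   fix x assume "x\<in>space (count_space (verts K))"
   then obtain n where n: "x\<in>ballset K P (real n)" using Union_ballset[OF K(1)] by auto
   show "(SUP n. ?g n x)=f (ocls G D b K P x)"
   proof (rule antisym)
    show "(SUP n. ?g n x) \<le> f (ocls G D b K P x)" by (rule SUP_least) (simp split: split_indicator)
    show "f (ocls G D b K P x)\<le>(SUP n. ?g n x)" by (rule SUP_upper2[of n]) (use n in auto)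
   qed
  qed
  finally show "(SUP n. ?S n c) = orbit_sum G D b f c" by (simp add: orbit_sum_def r)
 qed
qed

end

section \<open>The mass transport identity for the induced measure\<close>

context fin_pair
begin

lemma HG_fin: "fin_group HG"
proof -
 have "finite H" using sub fin by (meson subgroup.subset finite_subset)
 thus ?thesis using HG_group by (simp add: fin_group_def fin_group_axioms_def)
qed

text \<open>The class of the induced complex with second root at \<lfloor>t, y\<rfloor> does not
  depend on t, so each coset contributes one copy of the sum over \<open>K\<close>.\<close>

lemma orbit_sum_ind:
 assumes T: "finite T" "T \<subseteq> carrier G" "!!K :: ('a, nat) gcomplex. G_complex HG K ==> bij_betw (%(t, y). pt K t y) (T \<times> verts K) (verts (ind K))"
  and c: "c\<in>SC 1 D HG"
 shows "orbit_sum G D b f (indc D c) = of_nat (card T) * orbit_sum HG D b (%c. f (indc D c)) c"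
proof -
 obtain K P where r: "rep c=(K, P)" by fastforce
 note K = SC1_rep[OF c r]
 note KG = markedD(1)[OF K(1)]
 have ic: "indc D c=mclass D G (ind K) [iset (act K) P]" using indc_eq[OF c rep_mem[OF c r]] by simp
 have m: "marked_complex D G (ind K, [iset (act K) P])" using marked_ind[OF K(1)] by simp
 have cl: "ocls G D b (ind K) (iset (act K) P) (pt K t y)=indc D (ocls HG D b K P y)" if t: "t\<in>T" and y: "y\<in>verts K" for t y
 proof -
  have tG: "t\<in>carrier G" using t T(2) by blast
  show ?thesis
   unfolding ocls_def indc_mclass[OF marked_orbit[OF K(1) y] K(3)] iset_orbit[OF KG y tG, symmetric] by simp
 qed
 have "orbit_sum G D b f (indc D c)=(\<integral>\<^sup>+p. f (ocls G D b (ind K) (iset (act K) P) p) \<partial>count_space (verts (ind K)))"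
  by (rule orbit_sum_eq[OF m indc_SC[OF c] ic])
 also have "...=(\<integral>\<^sup>+q. f (ocls G D b (ind K) (iset (act K) P) (case q of (t, y) => pt K t y)) \<partial>count_space (T \<times> verts K))"
  by (rule nn_integral_bij_count_space[OF T(3)[OF KG], symmetric])
 also have "...=(\<integral>\<^sup>+q. f (indc D (ocls HG D b K P (snd q))) \<partial>count_space (T \<times> verts K))"
  by (rule nn_integral_cong) (auto simp: cl)
 also have "...=(\<integral>\<^sup>+t. \<integral>\<^sup>+y. f (indc D (ocls HG D b K P y)) \<partial>count_space (verts K) \<partial>count_space T)"
  using sigma_finite_measure.nn_integral_fst[OF sigma_finite_measure_count_space_countable[OF K(3)],
    of "%q. f (indc D (ocls HG D b K P (snd q)))" "count_space T"] countable_finite[OF T(1)] K(3)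
  by (simp add: pair_measure_countable)
 also have "... = of_nat (card T) * orbit_sum HG D b (%c. f (indc D c)) c"
  using T(1) by (simp add: orbit_sum_def r emeasure_count_space mult.commute)
 finally show ?thesis .
qed

lemma unimodular_iff:
 "unimodular D G' \<mu> \<longleftrightarrow> (\<forall>f :: 'a iso_class => real. f\<in>borel_measurable (SC_borel 2 D G') & (\<forall>c\<in>SC 2 D G'. 0 \<le> f c) -->
  (\<integral>\<^sup>+c. orbit_sum G' D True (%c. ennreal (f c)) c \<partial>\<mu>)=(\<integral>\<^sup>+c. orbit_sum G' D False (%c. ennreal (f c)) c \<partial>\<mu>))"
 by (simp add: unimodular_def orbit_sum_def ocls_def two_def)

lemma measurable_ind_map:
 assumes "space \<mu>=SC 1 D HG" "sets \<mu> = sets (SC_borel 1 D HG)"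
 shows "ind_map D G H\<in>\<mu> \<rightarrow>\<^sub>M SC_borel 1 D G"
proof -
 have "indc D\<in>SC_borel 1 D HG \<rightarrow>\<^sub>M SC_borel 1 D G" by (rule measurable_SC_continuous[OF continuous_indc]) simp
 hence "indc D\<in>\<mu> \<rightarrow>\<^sub>M SC_borel 1 D G" by (simp add: measurable_cong_sets[OF assms(2) refl])
 thus ?thesis by (rule measurable_cong[THEN iffD2, rotated]) (simp add: assms(1) ind_map_eq)
qed

text \<open>For a test function f on classes with two roots, the identity over \<open>H\<close> is
  applied to f composed with \<open>indc D\<close>; both sides acquire the same factor, the index of
  \<open>H\<close>.\<close>

lemma random_rooted_complex_ind:
 assumes \<mu>: "random_rooted_complex D HG \<mu>"
 shows "random_rooted_complex D G (ind_measure D G H \<mu>)"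
proof -
 interpret HH: fin_group HG by (rule HG_fin)
 have \<mu>': "prob_space \<mu>" "space \<mu>=SC 1 D HG" "sets \<mu> = sets (SC_borel 1 D HG)" "unimodular D HG \<mu>"
  using \<mu> by (auto simp: random_rooted_complex_def)
 note mi = measurable_ind_map[OF \<mu>'(2,3)]
 obtain T where T: "finite T" "T \<subseteq> carrier G"
  "!!K :: ('a, nat) gcomplex. G_complex HG K ==> bij_betw (%(t, y). pt K t y) (T \<times> verts K) (verts (ind K))"
  using transversal by metis
 have "unimodular D G (ind_measure D G H \<mu>)"
  unfolding unimodular_iff
 proof (intro allI impI)
  fix f :: "'a iso_class => real"
  assume f: "f\<in>borel_measurable (SC_borel 2 D G) & (\<forall>c\<in>SC 2 D G. 0 \<le> f c)"
  have fe: "(%c. ennreal (f c))\<in>borel_measurable (SC_borel 2 D G)"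
   by (rule measurable_compose[OF _ measurable_ennreal]) (use f in simp)
  have fi: "(%c. f (indc D c))\<in>borel_measurable (SC_borel 2 D HG)"
   by (rule measurable_compose[OF measurable_SC_continuous[OF continuous_indc]]) (use f in simp_all)
  have e: "(\<integral>\<^sup>+c. orbit_sum G D b (%c. ennreal (f c)) c \<partial>ind_measure D G H \<mu>) =
   of_nat (card T)*(\<integral>\<^sup>+c. orbit_sum HG D b (%c. ennreal (f (indc D c))) c \<partial>\<mu>)" for b
  proof -
   have "(\<integral>\<^sup>+c. orbit_sum G D b (%c. ennreal (f c)) c \<partial>ind_measure D G H \<mu>) =
    (\<integral>\<^sup>+c. orbit_sum G D b (%c. ennreal (f c)) (ind_map D G H c) \<partial>\<mu>)"
    unfolding ind_measure_def
    by (rule nn_integral_distr[OF mi]) (use measurable_orbit_sum[OF fe] in simp)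
   also have "...=(\<integral>\<^sup>+c. of_nat (card T) * orbit_sum HG D b (%c. ennreal (f (indc D c))) c \<partial>\<mu>)"
    by (rule nn_integral_cong) (simp add: \<mu>'(2) ind_map_eq orbit_sum_ind[OF T])
   also have "... = of_nat (card T)*(\<integral>\<^sup>+c. orbit_sum HG D b (%c. ennreal (f (indc D c))) c \<partial>\<mu>)"
    by (rule nn_integral_cmult) (use HH.measurable_orbit_sum[OF measurable_compose[OF fi measurable_ennreal]] in
     \<open>simp add: measurable_cong_sets[OF \<mu>'(3) refl]\<close>)
   finally show ?thesis .
  qed
  have "\<forall>c\<in>SC 2 D HG. 0 \<le> f (indc D c)" using f indc_SC by blast
  hence "(\<integral>\<^sup>+c. orbit_sum HG D True (%c. ennreal (f (indc D c))) c \<partial>\<mu>)=(\<integral>\<^sup>+c. orbit_sum HG D False (%c. ennreal (f (indc D c))) c \<partial>\<mu>)"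
   using \<mu>'(4) fi unfolding unimodular_iff by blast
  thus "(\<integral>\<^sup>+c. orbit_sum G D True (%c. ennreal (f c)) c \<partial>ind_measure D G H \<mu>) =
   (\<integral>\<^sup>+c. orbit_sum G D False (%c. ennreal (f c)) c \<partial>ind_measure D G H \<mu>)" unfolding e by simp
 qed
 moreover have "prob_space (ind_measure D G H \<mu>)"
  unfolding ind_measure_def by (rule prob_space.prob_space_distr[OF \<mu>'(1) mi])
 ultimately show ?thesis by (simp add: random_rooted_complex_def ind_measure_def)
qed

end

section \<open>Soficity\<close>

definition pcls :: "('g, 'b) monoid_scheme => nat => ('g, 'v) gcomplex => 'v => 'g iso_class"
 where "pcls G D K x=mclass D G (components_meeting K (orbit G (act K) x)) [orbit G (act K) x]"

lemma gembed_full_subcomplex: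
 assumes K: "simplicial_complex (faces K)" and W: "W \<subseteq> verts K" and cl: "!!x y. x\<in>W ==> adjacent K x y ==> y\<in>W"
 shows "gembed (%x. x) (full_subcomplex K W) K"
 unfolding gembed_def comp_emb_def verts_def[symmetric] verts_full[OF K W]
proof (intro conjI ballI impI)
 show "(%x. x) ` s\<in>faces K" if "s\<in>faces (full_subcomplex K W)" for s using that by (simp add: full_subcomplex_def)
 fix s assume s: "s\<in>faces K" and "s \<inter> (%x. x) ` W ~= {}"
 then obtain x where x: "x\<in>s" "x\<in>W" by auto
 have "y\<in>W" if y: "y\<in>s" for y
 proof (cases "y=x")
  case False
  have "{x, y}\<in>faces K" using simp_cxD(4)[OF K s, of "{x, y}"] x(1) y by simp
  thus ?thesis using cl[OF x(2)] False by (simp add: adjacent_def)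
 qed (use x in simp)
 hence "s\<in>faces (full_subcomplex K W)" using s by (auto simp: full_subcomplex_def)
 thus "\<exists>s'\<in>faces (full_subcomplex K W). s=(%x. x) ` s'" by auto
qed simp

lemma mem_orbit:
 assumes "G_complex G K" "x\<in>verts K"
 shows "x\<in>orbit G (act K) x"
proof -
 interpret group G by (rule Gcx_act(1)[OF assms(1)])
 have "x=act K \<one>\<^bsub>G\<^esub> x" using Gcx_act(3)[OF assms] by simp
 thus ?thesis unfolding orbit_def using one_closed by blast
qed

text \<open>The vertex set is closed under adjacency, so the subcomplex is a union of components and
  inherits degrees and connecting walks.\<close>

lemma marked_components:
 assumes K: "G_complex G K" "degree_le D K" and x: "x\<in>verts K"
 shows "marked_complex D G (components_meeting K (orbit G (act K) x), [orbit G (act K) x])"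
  "verts (components_meeting K (orbit G (act K) x)) \<subseteq> verts K"
proof -
 let ?O = "orbit G (act K) x"
 let ?W = "compset K ?O"
 let ?F = "full_subcomplex K ?W"
 note sc = GcxD(1)[OF K(1)]
 have inv: "invariant G K ?O" by (rule invariant_orbit[OF K(1) x])
 have O: "?O \<subseteq> verts K" using inv by (simp add: invariant_def)
 have W: "?W \<subseteq> verts K" by (auto simp: compset_def)
 have vF: "verts ?F=?W" by (rule verts_full[OF sc W])
 have xW: "x\<in>?W" using subset_compset[OF O] mem_orbit[OF K(1) x] by blast
 have emb: "gembed (%x. x) ?F K"
 proof (rule gembed_full_subcomplex[OF sc W])
  fix u y assume "u\<in>?W" and a: "adjacent K u y"
  then obtain v where "v\<in>?O" "(adjacent K)\<^sup>*\<^sup>* v u" by (auto simp: compset_def)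
  hence "(adjacent K)\<^sup>*\<^sup>* v y" using a by (meson rtranclp.rtrancl_into_rtrancl)
  thus "y\<in>?W" using adjacentD(2)[OF a] \<open>v \<in> ?O\<close> unfolding compset_def by blast
 qed
 have GF: "G_complex G ?F" by (rule G_complex_full_subcomplex[OF K(1) invariant_compset[OF K(1) inv]]) (use xW in blast)
 have oF: "orbit G (act ?F) x=?O" using xW by (simp add: orbit_def full_subcomplex_def)
 have "degree_le D ?F"
  unfolding degree_le_nbrs
 proof
  fix y assume y: "y\<in>verts ?F"
  hence "y\<in>verts K" using vF W by blast
  thus "finite (nbrs ?F y) & card (nbrs ?F y) \<le> D"
   using gembed_nbrs(1)[OF emb GcxD(1)[OF GF] y] K(2) unfolding degree_le_nbrs image_ident by metis
 qed
 moreover have "\<exists>v\<in>?O. (adjacent ?F)\<^sup>*\<^sup>* v y" if y: "y\<in>verts ?F" for y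
 proof -
  obtain v where v: "v\<in>?O" "(adjacent K)\<^sup>*\<^sup>* v y" using y unfolding vF by (auto simp: compset_def)
  have "v\<in>verts ?F" unfolding vF using subset_compset[OF O] v(1) by blast
  from gembed_reach[OF emb GcxD(1)[OF GF] this, of y] show ?thesis using v by auto
 qed
 moreover have "?O\<in>orbits G (verts ?F) (act ?F)" unfolding orbits_def vF using xW oF by blast
 ultimately show "marked_complex D G (components_meeting K ?O, [?O])"
  unfolding comp_meeting_eq marked_complex_def using GF by simp
 show "verts (components_meeting K ?O) \<subseteq> verts K" unfolding comp_meeting_eq vF by (rule W)
qed

lemma pcls_SC:
 assumes "G_complex G K" "degree_le D K" "x\<in>verts K" "countable (verts K)"
 shows "pcls G D K x\<in>SC 1 D G"
 using mclass_in_SC[OF marked_components(1)[OF assms(1-3)] countable_subset[OF marked_components(2)[OF assms(1-3)] assms(4)]]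
 by (simp add: pcls_def)

lemma pcls_giso:
 assumes K: "G_complex G K" "degree_le D K" and L: "G_complex G L" and f: "giso G f K L" and x: "x\<in>verts K"
 shows "pcls G D L (f x)=pcls G D K x"
proof -
 let ?O = "orbit G (act K) x"
 have O: "?O \<subseteq> verts K" by (rule orbit_subset[OF GcxD(2)[OF K(1)] x])
 have W: "compset K ?O \<subseteq> verts K" by (auto simp: compset_def)
 have "giso G f (components_meeting K ?O) (components_meeting L (f ` ?O))"
  unfolding comp_meeting_eq giso_compset[OF f GcxD(1)[OF K(1)] O, symmetric]
  by (rule giso_full_subcomplex[OF f GcxD(1)[OF K(1)] GcxD(1)[OF L] W])
 hence "marked_iso G (components_meeting K ?O, [?O]) (components_meeting L (orbit G (act L) (f x)), [orbit G (act L) (f x)])"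
  unfolding marked_iso_iff orbit_image[OF f x] using orbit_image[OF f x] by auto
 thus ?thesis unfolding pcls_def by (rule mclass_eq[OF marked_wmarked[OF marked_components(1)[OF K x]], symmetric])
qed

text \<open>As a push-forward of the uniform measure on the vertices, the empirical measure turns
  integrals into averages over vertices.\<close>

lemma empirical_measure_eq:
 assumes K: "G_complex G K" "degree_le D K" "finite (verts K)"
 shows "empirical_measure D G K=distr (uniform_count_measure (verts K)) (SC_borel 1 D G) (pcls G D K)"
  "pcls G D K\<in>uniform_count_measure (verts K) \<rightarrow>\<^sub>M SC_borel 1 D G"
proof -
 let ?S = "SC_borel 1 D G" and ?V = "verts K"
 let ?M = "distr (uniform_count_measure ?V) ?S (pcls G D K)"
 show m: "pcls G D K\<in>uniform_count_measure ?V \<rightarrow>\<^sub>M ?S"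
  using pcls_SC[OF K(1,2) _ countable_finite[OF K(3)]]
  by (auto simp: measurable_def space_uniform_count_measure sets_uniform_count_measure)
 obtain s where "s\<in>faces K" "s ~= {}" using simp_cxD(1,3)[OF GcxD(1)[OF K(1)]] by blast
 hence "?V ~= {}" by (auto simp: verts_def)
 hence n0: "card ?V > 0" using K(3) by (simp add: card_gt_0_iff)
 have "empirical_measure D G K=measure_of (space ?S) (sets ?S) (emeasure ?M)"
  unfolding empirical_measure_def space_SC_borel
 proof (rule measure_of_eq)
  show "sets ?S \<subseteq> Pow (SC 1 D G)" using sets.space_closed[of ?S] by simp
  fix A assume "A\<in>sigma_sets (SC 1 D G) (sets ?S)"
  hence A: "A\<in>sets ?S" using sets.sigma_sets_eq[of ?S] by simp
  have "(\<Sum>x\<in>?V. emeasure (return ?S (let O' = orbit G (act K) x in mclass D G (components_meeting K O') [O'])) A) =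
   (\<Sum>x\<in>?V. if pcls G D K x\<in>A then 1 else 0)"
   using A by (intro sum.cong) (auto simp: pcls_def Let_def)
  also have "... = of_nat (card {x\<in>?V. pcls G D K x\<in>A})"
   using K(3) by (subst sum.inter_filter[symmetric]) simp_all
  finally have "(\<Sum>x\<in>?V. emeasure (return ?S (let O' = orbit G (act K) x in mclass D G (components_meeting K O') [O'])) A)
    / of_nat (card ?V)=ennreal (real (card {x\<in>?V. pcls G D K x\<in>A}) / real (card ?V))"
   using n0 by (simp add: ennreal_of_nat_eq_real_of_nat divide_ennreal)
  also have "{x\<in>?V. pcls G D K x\<in>A}=pcls G D K -` A \<inter> ?V" by auto
  also have "ennreal (real (card (pcls G D K -` A \<inter> ?V)) / real (card ?V))=emeasure (uniform_count_measure ?V) (pcls G D K -` A \<inter> ?V)"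
   by (rule emeasure_uniform_count_measure[OF K(3), symmetric]) simp
  also have "...=emeasure ?M A" using emeasure_distr[OF m A] by (simp add: space_uniform_count_measure)
  finally show "(\<Sum>x\<in>?V. emeasure (return ?S (let O' = orbit G (act K) x in mclass D G (components_meeting K O') [O'])) A)
    / of_nat (card ?V)=emeasure ?M A" .
 qed
 thus "empirical_measure D G K=?M" using measure_of_of_measure[of ?M] by simp
qed

lemma integral_empirical:
 fixes f :: "'g iso_class => real"
 assumes K: "G_complex G K" "degree_le D K" "finite (verts K)" and f: "f\<in>borel_measurable (SC_borel 1 D G)"
 shows "(\<integral>c. f c \<partial>empirical_measure D G K)=(\<Sum>x\<in>verts K. f (pcls G D K x)) / real (card (verts K))"
 unfolding empirical_measure_eq(1)[OF K] integral_distr[OF empirical_measure_eq(2)[OF K] f]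
 by (rule integral_uniform_count_measure[OF K(3)])

context fin_pair
begin

lemma pcls_ind:
 assumes K: "G_complex HG K" "degree_le D K" "countable (verts K)" and x: "x\<in>verts K" and g: "g\<in>carrier G"
 shows "pcls G D (ind K) (pt K g x)=indc D (pcls HG D K x)"
proof -
 let ?O = "orbit HG (act K) x"
 note m = marked_components[OF K(1,2) x]
 have inv: "invariant HG K ?O" by (rule invariant_orbit[OF K(1) x])
 have O: "?O \<subseteq> compset K ?O" by (rule subset_compset) (use inv in \<open>simp add: invariant_def\<close>)
 have "components_meeting (ind K) (iset (act K) ?O)=ind (components_meeting K ?O)"
  unfolding comp_meeting_eq iset_compset[OF K(1) inv] by (rule ind_full_subcomplex[OF K(1) invariant_compset[OF K(1) inv], symmetric])
 moreover have "iset (act (components_meeting K ?O)) ?O=iset (act K) ?O"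
  unfolding comp_meeting_eq by (rule iset_full_subcomplex[OF O])
 ultimately show ?thesis
  unfolding pcls_def iset_orbit[OF K(1) x g, symmetric] indc_mclass[OF m(1) countable_subset[OF m(2) K(3)]] by simp
qed

text \<open>Passing from K to the induced complex multiplies both the sum over vertices and their
  number by the index of \<open>H\<close>, so the average is unchanged. The copy on natural numbers
  is there because \<open>sofic\<close> asks for complexes of this type.\<close>

lemma integral_empirical_ind:
 fixes f :: "'a iso_class => real" and K :: "('a, nat) gcomplex"
 assumes K: "G_complex HG K" "degree_le D K" "finite (verts K)" and f: "f\<in>borel_measurable (SC_borel 1 D G)"
 shows "(\<integral>c. f c \<partial>empirical_measure D G (copy (to_nat_on (verts (ind K))) (ind K)))=(\<integral>c. f (indc D c) \<partial>empirical_measure D HG K)"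
  "finite (verts (ind K))"
proof -
 obtain T where T: "T \<subseteq> carrier G" "finite T" "T ~= {}"
  "!!K :: ('a, nat) gcomplex. G_complex HG K ==> bij_betw (%(t, y). pt K t y) (T \<times> verts K) (verts (ind K))"
  using transversal by metis
 note bij = T(4)[OF K(1)]
 show fI: "finite (verts (ind K))" using bij_betw_finite[OF bij] T(2) K(3) by simp
 let ?e = "to_nat_on (verts (ind K))"
 have e: "inj_on ?e (verts (ind K))" by (rule inj_on_to_nat_on[OF countable_finite[OF fI]])
 note GI = G_complex_ind[OF K(1)] and dI = degree_le_ind[OF K(1,2)]
 note c = copy[OF GI e]
 have be: "bij_betw ?e (verts (ind K)) (verts (copy ?e (ind K)))" using c(1) by (simp add: giso_def)
 have dc: "degree_le D (copy ?e (ind K))" by (rule degree_le_giso[OF c(1) GcxD(1)[OF GI] dI])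
 have fc: "finite (verts (copy ?e (ind K)))" using bij_betw_finite[OF be] fI by simp
 have fi: "(%c. f (indc D c))\<in>borel_measurable (SC_borel 1 D HG)"
  by (rule measurable_compose[OF measurable_SC_continuous[OF continuous_indc] f]) simp
 have "(\<Sum>x\<in>verts (copy ?e (ind K)). f (pcls G D (copy ?e (ind K)) x))=(\<Sum>x\<in>verts (ind K). f (pcls G D (copy ?e (ind K)) (?e x)))"
  by (rule sum.reindex_bij_betw[OF be, symmetric])
 also have "...=(\<Sum>x\<in>verts (ind K). f (pcls G D (ind K) x))"
  by (rule sum.cong[OF refl]) (simp add: pcls_giso[OF GI dI c(2,1)])
 also have "...=(\<Sum>q\<in>T \<times> verts K. f (pcls G D (ind K) (case q of (t, y) => pt K t y)))"
  by (rule sum.reindex_bij_betw[OF bij, symmetric])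
 also have "...=(\<Sum>q\<in>T \<times> verts K. f (indc D (pcls HG D K (snd q))))"
  by (rule sum.cong[OF refl]) (use T(1) in \<open>auto simp: pcls_ind[OF K(1,2) countable_finite[OF K(3)]]\<close>)
 also have "...=(\<Sum>t\<in>T. \<Sum>y\<in>verts K. f (indc D (pcls HG D K y)))"
  by (subst sum.cartesian_product) (simp add: case_prod_unfold)
 also have "... = real (card T)*(\<Sum>y\<in>verts K. f (indc D (pcls HG D K y)))" by simp
 finally have s: "(\<Sum>x\<in>verts (copy ?e (ind K)). f (pcls G D (copy ?e (ind K)) x)) = real (card T)*(\<Sum>y\<in>verts K. f (indc D (pcls HG D K y)))" .
 have "card (verts (copy ?e (ind K)))=card T * card (verts K)"
  using bij_betw_same_card[OF be] bij_betw_same_card[OF bij] by (simp add: card_cartesian_product)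
 moreover have "card T > 0" using T(2,3) by (simp add: card_gt_0_iff)
 ultimately show "(\<integral>c. f c \<partial>empirical_measure D G (copy ?e (ind K)))=(\<integral>c. f (indc D c) \<partial>empirical_measure D HG K)"
  unfolding integral_empirical[OF c(2) dc fc f] integral_empirical[OF K fi] s by simp
qed

lemma sofic_ind:
 assumes "sofic D HG \<mu>"
 shows "sofic D G (ind_measure D G H \<mu>)"
proof -
 have \<mu>: "random_rooted_complex D HG \<mu>" using assms by (simp add: sofic_def)
 have \<mu>': "space \<mu>=SC 1 D HG" "sets \<mu> = sets (SC_borel 1 D HG)" using \<mu> by (auto simp: random_rooted_complex_def)
 obtain K :: "nat => ('a, nat) gcomplex" where K: "!!j. G_complex HG (K j)" "!!j. finite (verts (K j))" "!!j. degree_le D (K j)"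
  and lim: "weak_limit (SC_topology 1 D HG) (%j. empirical_measure D HG (K j)) \<mu>"
  using assms unfolding sofic_def by blast
 define L where "L j=copy (to_nat_on (verts (ind (K j)))) (ind (K j))" for j
 have L: "G_complex G (L j)" "finite (verts (L j))" "degree_le D (L j)" for j
 proof -
  have fI: "finite (verts (ind (K j)))" by (rule integral_empirical_ind(2)[OF K(1,3,2)]) (rule borel_measurable_const)
  have e: "inj_on (to_nat_on (verts (ind (K j)))) (verts (ind (K j)))" by (rule inj_on_to_nat_on[OF countable_finite[OF fI]])
  note GI = G_complex_ind[OF K(1)]
  note c = copy[OF GI e]
  show "G_complex G (L j)" unfolding L_def by (rule c(2))
  show "degree_le D (L j)" unfolding L_def by (rule degree_le_giso[OF c(1) GcxD(1)[OF GI] degree_le_ind[OF K(1,3)]])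
  show "finite (verts (L j))" unfolding L_def using gisoD(2)[OF c(1)] fI by (metis finite_imageI)
 qed
 have "weak_limit (SC_topology 1 D G) (%j. empirical_measure D G (L j)) (ind_measure D G H \<mu>)"
  unfolding weak_limit_def
 proof (intro allI impI)
  fix f :: "'a iso_class => real"
  assume f: "continuous_map (SC_topology 1 D G) euclideanreal f & bounded (f ` topspace (SC_topology 1 D G))"
  have fm: "f\<in>borel_measurable (SC_borel 1 D G)" by (rule borel_measurable_SC_continuous) (use f in blast)
  have ci: "continuous_map (SC_topology 1 D HG) (SC_topology 1 D G) (indc D)" by (rule continuous_indc) simp
  have "continuous_map (SC_topology 1 D HG) euclideanreal (f \<circ> indc D)" by (rule continuous_map_compose[OF ci]) (use f in blast)
  moreover have "bounded ((f \<circ> indc D) ` topspace (SC_topology 1 D HG))"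
  proof (rule bounded_subset)
   show "bounded (f ` topspace (SC_topology 1 D G))" using f by blast
   show "(f \<circ> indc D) ` topspace (SC_topology 1 D HG) \<subseteq> f ` topspace (SC_topology 1 D G)"
    using indc_SC by (auto simp: topspace_SC_topology)
  qed
  ultimately have "(%j. \<integral>c. (f \<circ> indc D) c \<partial>empirical_measure D HG (K j)) \<longlonglongrightarrow> (\<integral>c. (f \<circ> indc D) c \<partial>\<mu>)"
   using lim unfolding weak_limit_def by blast
  moreover have "(\<integral>c. (f \<circ> indc D) c \<partial>empirical_measure D HG (K j))=(\<integral>c. f c \<partial>empirical_measure D G (L j))" for j
   unfolding L_def integral_empirical_ind(1)[OF K(1,3,2) fm] by simp
  moreover have "(\<integral>c. (f \<circ> indc D) c \<partial>\<mu>)=(\<integral>c. f c \<partial>ind_measure D G H \<mu>)"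
   unfolding ind_measure_def integral_distr[OF measurable_ind_map[OF \<mu>'] fm]
   by (rule Bochner_Integration.integral_cong[OF refl]) (simp add: \<mu>'(1) ind_map_eq)
  ultimately show "(%j. \<integral>c. f c \<partial>empirical_measure D G (L j)) \<longlonglongrightarrow> (\<integral>c. f c \<partial>ind_measure D G H \<mu>)" by simp
 qed
 thus ?thesis unfolding sofic_def using L random_rooted_complex_ind[OF \<mu>] by blast
qed

end

section \<open>Local multiplicities\<close>

lemma bdd_complex_faces:
 assumes K: "G_complex G K" "degree_le D K"
 shows "bdd_complex D (faces K)"
proof -
 have "nbrs K x={y. y ~= x & {x, y}\<in>faces K}" for x by (auto simp: nbrs_def adjacent_def)
 moreover have "nbrs K x={}" if "x \<notin> verts K" for x using adjacentD(1) that by (force simp: nbrs_def)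
 ultimately show ?thesis
  using K(2) GcxD(1)[OF K(1)] unfolding bdd_complex_def degree_le_nbrs by (metis card.empty finite.emptyI le0)
qed

lemma l2_chains_sum:
 assumes "finite I" "!!i. i\<in>I ==> f i\<in>l2_chains n L"
 shows "(%t. \<Sum>i\<in>I. a i * f i t)\<in>l2_chains n L"
 using assms
proof (induction I)
 case empty
 show ?case by (rule l2_chainsI) simp_all
next
 case (insert i I)
 have "(%t. (\<Sum>i\<in>I. a i * f i t) - (- a i) * f i t)\<in>l2_chains n L"
  by (rule l2_chains_comb) (use insert in auto)
 thus ?case using insert(1,2) by (simp add: add.commute)
qed

lemma ip_sum_left:
 assumes "finite I" "!!i. i\<in>I ==> l2 (f i)" "l2 h"
 shows "l2 (%t. \<Sum>i\<in>I. a i * f i t)" "ip (%t. \<Sum>i\<in>I. a i * f i t) h=(\<Sum>i\<in>I. a i * ip (f i) h)"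
proof -
 have "l2 (%t. \<Sum>i\<in>I. a i * f i t) & ip (%t. \<Sum>i\<in>I. a i * f i t) h=(\<Sum>i\<in>I. a i * ip (f i) h)"
  using assms(1,2)
 proof (induction I)
  case (insert i I)
  have l: "l2 (%t. a i * f i t)" "l2 (%t. \<Sum>i\<in>I. a i * f i t)" using insert by (auto intro: l2_scale)
  show ?case using nsq_add_le(1)[OF l] ip_add_left[OF l assms(3)] insert by (simp add: ip_scale_left)
 qed simp
 thus "l2 (%t. \<Sum>i\<in>I. a i * f i t)" "ip (%t. \<Sum>i\<in>I. a i * f i t) h=(\<Sum>i\<in>I. a i * ip (f i) h)" by blast+
qed

lemma lapk_sum:
 assumes "finite I"
 shows "lapk n L (%t. \<Sum>i\<in>I. a i * f i t)=(%t. \<Sum>i\<in>I. a i * lapk n L (f i) t)"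
 using assms
proof (induction I)
 case empty
 show ?case using lapk_scale[of n L 0 "%_. 0"] by simp
next
 case (insert i I)
 have "lapk n L (%t. (\<Sum>i\<in>I. a i * f i t) - (- a i) * f i t)=(%t. (\<Sum>i\<in>I. a i * lapk n L (f i) t) - (- a i) * lapk n L (f i) t)"
  unfolding lapk_diff lapk_scale insert.IH ..
 thus ?case using insert(1,2) by (simp add: add.commute)
qed

lemma distinct_permute:
 assumes "distinct t" "distinct t'" "set t = set t'"
 shows "\<exists>p. p permutes {..<length t} & t'=permute_list p t"
proof -
 have "mset t'=mset t" using assms set_eq_iff_mset_eq_distinct by blast
 thus ?thesis using mset_eq_permutation[of t' t] by metis
qed

text \<open>Both sides vanish unless u is an ordering of t. Writing u as a permutation of the
  permuted list lets the signs be read off from the rule for the right argument.\<close>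

lemma oriented_permute_left:
 assumes t: "distinct t" and p: "p permutes {..<length t}"
 shows "oriented (permute_list p t)=(%u. of_int (sign p) * oriented t u)"
proof
 fix u
 let ?t = "permute_list p t"
 have t': "distinct ?t" "set ?t = set t" "length ?t=length t" using t p by simp_all
 show "oriented ?t u = of_int (sign p) * oriented t u"
 proof (cases "distinct u & set u = set t")
  case True
  then obtain q where q: "q permutes {..<length t}" "u=permute_list q ?t" using distinct_permute[OF t'(1)] t' by metis
  have "oriented ?t u = of_int (sign q)" unfolding q(2) using oriented_permr[of q ?t ?t] q(1) oriented_self[OF t'(1)] by simp
  moreover have "oriented t u = of_int (sign q) * of_int (sign p)"
   unfolding q(2) using oriented_permr[of q ?t t] oriented_permr[OF p, of t] q(1) oriented_self[OF t] by simp
  moreover have "(of_int (sign p) * of_int (sign p) :: complex)=1" by (simp flip: of_int_mult)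
  ultimately show ?thesis by simp
 next
  case False
  thus ?thesis using oriented_nonzeroD(2,4)[of t u] oriented_nonzeroD(2,4)[of ?t u] t'(2) by fastforce
 qed
qed

lemma SOME_list: "finite s ==> distinct (SOME t. distinct t & set t = s) & set (SOME t. distinct t & set t = s) = s"
 by (rule someI_ex) (use finite_distinct_list in blast)

lemma SOME_ordered:
 assumes "simplicial_complex L" "s\<in>L" "card s=n + 1"
 shows "(SOME t. distinct t & set t = s)\<in>ordered_simplices n L" "set (SOME t. distinct t & set t = s) = s"
 using SOME_list[OF simp_cxD(2)[OF assms(1,2)]] assms by (auto simp: ordered_simplices_def dest: distinct_card)

text \<open>The diagonal coefficient at t of the average of \<psi> over the group composed with the
  harmonic projection. The weight \<psi> is an arbitrary function because the character of \<rho> on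
  \<open>H\<close> need not be irreducible.\<close>

definition dens :: "('g, 'b) monoid_scheme => nat => nat => ('g => complex) => ('g, 'v) gcomplex => 'v list => complex"
 where "dens G D n \<psi> K t=(\<Sum>g\<in>carrier G. cnj (\<psi> g) *
  hproj D n (faces K) (oriented t) (map (act K (inv\<^bsub>G\<^esub> g)) t)) / of_nat (card (carrier G))"

text \<open>The contribution of one vertex to the dimension of an isotypic component, up to \<open>(n + 1) / \<psi>(1)\<close>.\<close>

definition vdens :: "('g, 'b) monoid_scheme => nat => nat => ('g => complex) => ('g, 'v) gcomplex => 'v => complex"
 where "vdens G D n \<psi> K x=(\<Sum>s\<in>{s\<in>faces K. card s=n + 1 & x\<in>s}. dens G D n \<psi> K (SOME t. distinct t & set t = s))"

lemma gembed_ordered: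
 assumes f: "gembed f K L" and t: "t\<in>ordered_simplices n (faces K)"
 shows "map f t\<in>ordered_simplices n (faces L)"
 using map_ord_simp[OF f[unfolded gembed_def] ordered_in_tuples[OF t]] t by blast

lemma hproj_gembed:
 assumes f: "gembed f K L" and K: "bdd_complex D (faces K)" "bdd_complex D (faces L)" and t: "t\<in>ordered_simplices n (faces K)"
  and u: "set u \<subseteq> verts K"
 shows "hproj D n (faces L) (oriented (map f t)) (map f u)=hproj D n (faces K) (oriented t) u"
 unfolding hproj_oriented_map[OF f[unfolded gembed_def] K t]
 by (rule push_map[OF f[unfolded gembed_def]]) (use u in \<open>simp add: tuples_def verts_def\<close>)

text \<open>Reordering t changes both the oriented simplex and the point of evaluation by the same
  sign, and the signs cancel. Thus the choice of an ordering in \<open>vdens\<close> does not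
  matter.\<close>

lemma dens_permute:
 assumes K: "G_complex G K" "degree_le D K" and t: "t\<in>ordered_simplices n (faces K)" "t'\<in>ordered_simplices n (faces K)" "set t = set t'"
 shows "dens G D n \<psi> K t=dens G D n \<psi> K t'"
proof -
 note b = bdd_complex_faces[OF K]
 note o = ord_simpD[OF t(1)]
 interpret group G by (rule Gcx_act(1)[OF K(1)])
 obtain p where p: "p permutes {..<length t}" "t'=permute_list p t"
  using distinct_permute[OF o(2) ord_simpD(2)[OF t(2)] t(3)] by blast
 have pn: "p permutes {..n}" using p(1) o(1) by (simp add: lessThan_Suc_atMost)
 have "hproj D n (faces K) (oriented t') (map (act K (inv\<^bsub>G\<^esub> g)) t')=hproj D n (faces K) (oriented t) (map (act K (inv\<^bsub>G\<^esub> g)) t)"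
  if g: "g\<in>carrier G" for g
 proof -
  let ?a = "act K (inv\<^bsub>G\<^esub> g)" and ?h = "hproj D n (faces K) (oriented t)"
  have m: "map ?a t\<in>ordered_simplices n (faces K)" by (rule gembed_ordered[OF act_giso[OF K(1) inv_closed[OF g]] t(1)])
  have "hproj D n (faces K) (oriented t') (map ?a t') = of_int (sign p)*?h (permute_list p (map ?a t))"
   unfolding p(2) oriented_permute_left[OF o(2) p(1)] hproj_scale[OF b oriented_in_l2_chains[OF t(1)]] permute_list_map[OF p(1)] ..
  also have "...=(of_int (sign p) * of_int (sign p))*?h (map ?a t)"
   unfolding l2_chainsD(3)[OF hproj_in[OF b oriented_in_l2_chains[OF t(1)]] m pn] by (simp only: mult.assoc)
  also have "(of_int (sign p) * of_int (sign p) :: complex)=1" by (simp flip: of_int_mult)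
  finally show ?thesis by simp
 qed
 hence "(\<Sum>g\<in>carrier G. cnj (\<psi> g) * hproj D n (faces K) (oriented t') (map (act K (inv\<^bsub>G\<^esub> g)) t')) =
  (\<Sum>g\<in>carrier G. cnj (\<psi> g) * hproj D n (faces K) (oriented t) (map (act K (inv\<^bsub>G\<^esub> g)) t))"
  by (intro sum.cong[OF refl]) simp
 thus ?thesis unfolding dens_def by simp
qed

text \<open>The embedding maps the n-simplices at x bijectively onto those at f x. The factor r
  covers both the invariance statements, with r = 1, and the passage from \<open>H\<close> to
  \<open>G\<close>.\<close>

lemma vdens_transfer:
 assumes f: "gembed f K L" and K: "simplicial_complex (faces K)" and L: "G_complex G L" "degree_le D L" and x: "x\<in>verts K"
  and d: "!!t. t\<in>ordered_simplices n (faces K) ==> dens G D n \<psi> L (map f t) = r * dens G' D n \<psi>' K t"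
 shows "vdens G D n \<psi> L (f x) = r * vdens G' D n \<psi>' K x"
proof -
 have e: "inj_on f (verts K)" "!!s. s\<in>faces K ==> f ` s\<in>faces L" "!!s. s\<in>faces L ==> s \<inter> f ` verts K ~= {} ==> \<exists>s'\<in>faces K. s=f ` s'"
  using f unfolding gembed_def comp_emb_def verts_def by blast+
 have sv: "s \<subseteq> verts K" if "s\<in>faces K" for s using that by (auto simp: verts_def)
 have cs: "card (f ` s)=card s" if "s\<in>faces K" for s by (rule card_image[OF inj_on_subset[OF e(1) sv[OF that]]])
 let ?S = "{s\<in>faces K. card s=n + 1 & x\<in>s}" and ?T = "{s\<in>faces L. card s=n + 1 & f x\<in>s}"
 have bij: "bij_betw (%s. f ` s) ?S ?T"
  unfolding bij_betw_def
 proof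
  show "inj_on (%s. f ` s) ?S" using inj_on_image_eq_iff[OF e(1)] sv by (intro inj_onI) auto
  show "(%s. f ` s) ` ?S=?T"
  proof
   show "(%s. f ` s) ` ?S\<subseteq>?T" using e(2) cs by auto
   show "?T\<subseteq>(%s. f ` s) ` ?S"
   proof
    fix s assume s: "s\<in>?T"
    then obtain s' where s': "s'\<in>faces K" "s=f ` s'" using e(3)[of s] x by blast
    hence "x\<in>s'" using s e(1) sv[OF s'(1)] x by (auto dest: inj_onD)
    hence "s'\<in>?S" using s s' cs[OF s'(1)] by simp
    thus "s\<in>(%s. f ` s) ` ?S" using s'(2) by blast
   qed
  qed
 qed
 have "vdens G D n \<psi> L (f x)=(\<Sum>s\<in>?S. dens G D n \<psi> L (SOME t. distinct t & set t=f ` s))"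
  unfolding vdens_def by (rule sum.reindex_bij_betw[OF bij, symmetric])
 also have "...=(\<Sum>s\<in>?S. r * dens G' D n \<psi>' K (SOME t. distinct t & set t = s))"
 proof (rule sum.cong[OF refl])
  fix s assume s: "s\<in>?S"
  have s': "s\<in>faces K" "card s=n + 1" using s by auto
  note so = SOME_ordered[OF K s'] and so' = SOME_ordered[OF GcxD(1)[OF L(1)] e(2)[OF s'(1)] trans[OF cs[OF s'(1)] s'(2)]]
  have "set (map f (SOME t. distinct t & set t = s))=f ` s" unfolding set_map so(2) ..
  from dens_permute[OF L so'(1) gembed_ordered[OF f so(1)]] this so'(2)
  have "dens G D n \<psi> L (SOME t. distinct t & set t=f ` s)=dens G D n \<psi> L (map f (SOME t. distinct t & set t = s))" by simp
  thus "dens G D n \<psi> L (SOME t. distinct t & set t=f ` s) = r * dens G' D n \<psi>' K (SOME t. distinct t & set t = s)"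
   using d[OF so(1)] by simp
 qed
 finally show ?thesis by (simp add: vdens_def sum_distrib_left)
qed

text \<open>For g outside \<open>H\<close>, translating by the inverse of g moves the simplex off
  the image, where the projected chain vanishes. The remaining sum over \<open>H\<close> is that of
  \<open>K\<close>, and the quotient of orders is the quotient of the two averaging factors.\<close>

lemma (in fin_pair) vdens_embed:
 assumes f: "gembed f K L" and K: "G_complex HG K" "degree_le D K" and L: "G_complex G L" "degree_le D L" and x: "x\<in>verts K"
  and eq: "!!h y. h\<in>H ==> y\<in>verts K ==> f (act K h y)=act L h (f y)"
  and disj: "!!g y. g\<in>carrier G ==> g \<notin> H ==> y\<in>verts K ==> act L g (f y) \<notin> f ` verts K"
 shows "vdens G D n \<psi> L (f x) = of_nat (card H) / of_nat (card (carrier G)) * vdens HG D n \<psi> K x"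
proof (rule vdens_transfer[OF f GcxD(1)[OF K(1)] L x])
 fix t assume t: "t\<in>ordered_simplices n (faces K)"
 have tv: "set t \<subseteq> verts K" using ord_simpD(4)[OF t] by (simp add: verts_def)
 have tne: "t ~= []" using ord_simpD(1)[OF t] by auto
 note b = bdd_complex_faces[OF K] bdd_complex_faces[OF L]
 let ?L = "%g. hproj D n (faces L) (oriented (map f t)) (map (act L (inv g)) (map f t))"
 let ?K = "%g. hproj D n (faces K) (oriented t) (map (act K (inv\<^bsub>HG\<^esub> g)) t)"
 have 1: "?L g=?K g" if g: "g\<in>H" for g
 proof -
  have i: "inv g\<in>H" by (rule H_closed(3)[OF g])
  have m: "map (act L (inv g)) (map f t)=map f (map (act K (inv g)) t)"
   using eq[OF i] tv by (auto simp: subset_iff)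
  have "set (map (act K (inv g)) t) \<subseteq> verts K" using HK_act(1)[OF K(1) i] tv by auto
  thus ?thesis unfolding m HG_inv[OF g] by (rule hproj_gembed[OF f b t])
 qed
 have 2: "?L g=0" if g: "g\<in>carrier G - H" for g
 proof -
  have i: "inv g\<in>carrier G" "inv g \<notin> H" using g H_closed(3)[of "inv g"] by auto
  obtain y where y: "y\<in>set t" using tne by fastforce
  have "act L (inv g) (f y) \<notin> f ` verts K" using disj[OF i] y tv by blast
  hence "\<not> set (map (act L (inv g)) (map f t)) \<subseteq> f ` \<Union>(faces K)" using y by (auto simp: verts_def)
  hence "map (act L (inv g)) (map f t) \<notin> map f ` tuples (faces K)" unfolding map_image_tuples .
  thus ?thesis unfolding hproj_oriented_map[OF f[unfolded gembed_def] b t] by (simp add: push_def)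
 qed
 have HG: "H \<subseteq> carrier G" using H_sub by blast
 have "(\<Sum>g\<in>carrier G. cnj (\<psi> g)*?L g)=(\<Sum>g\<in>H. cnj (\<psi> g)*?L g)"
  by (rule sum.mono_neutral_right[OF fin HG]) (use 2 in simp)
 also have "...=(\<Sum>g\<in>H. cnj (\<psi> g)*?K g)" by (rule sum.cong[OF refl]) (simp only: 1)
 finally have e: "(\<Sum>g\<in>carrier G. cnj (\<psi> g)*?L g)=(\<Sum>g\<in>H. cnj (\<psi> g)*?K g)" .
 have "card H ~= 0" using finite_subset[OF HG fin] H_closed(2) by auto
 thus "dens G D n \<psi> L (map f t) = of_nat (card H) / of_nat (card (carrier G)) * dens HG D n \<psi> K t"
  unfolding dens_def e by simp
qed

context fin_group
begin

text \<open>The case of the whole group as its own subgroup in \<open>vdens_embed\<close>: no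
  element lies outside, and the factor is 1.\<close>

lemma vdens_giso:
 assumes f: "giso G f K L" and K: "G_complex G K" "degree_le D K" and L: "G_complex G L" "degree_le D L" and x: "x\<in>verts K"
 shows "vdens G D n \<psi> L (f x)=vdens G D n \<psi> K x"
proof -
 interpret T: fin_pair G "carrier G" by (intro fin_pair.intro fin_group_axioms fin_pair_axioms.intro subgroup_self)
 have G: "G\<lparr>carrier := carrier G\<rparr>=G" by simp
 have "card (carrier G) ~= 0" using fin one_closed by auto
 thus ?thesis using T.vdens_embed[unfolded G, OF giso_gembed[OF f] K L x] gisoD(5)[OF f] by simp
qed

lemma character_conj:
 assumes \<rho>: "is_rep G \<rho>" and g: "g\<in>carrier G" "k\<in>carrier G"
 shows "character \<rho> (k \<otimes> g \<otimes> inv k)=character \<rho> g"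
proof -
 have c: "\<rho> x\<in>carrier_mat (rep_dim G \<rho>) (rep_dim G \<rho>)" if "x\<in>carrier G" for x using \<rho> that by (simp add: is_rep_def)
 have m: "\<rho> (x \<otimes> y)=\<rho> x*\<rho> y" if "x\<in>carrier G" "y\<in>carrier G" for x y using \<rho> that by (simp add: is_rep_def)
 have "character \<rho> (k \<otimes> g \<otimes> inv k)=tr (\<rho> (k \<otimes> g)*\<rho> (inv k))" using g by (simp add: character_eq_tr m)
 also have "...=tr (\<rho> (inv k)*\<rho> (k \<otimes> g))" using g by (intro tr_comm[OF c c]) auto
 also have "...=tr (\<rho> (inv k \<otimes> (k \<otimes> g)))" using g by (simp add: m)
 also have "inv k \<otimes> (k \<otimes> g)=g" using g by (simp add: m_assoc[symmetric])
 finally show ?thesis by (simp add: character_eq_tr)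
qed

text \<open>Translation by k conjugates the summation variable, which a character does not notice.
  Hence all vertices of a root orbit carry the same density.\<close>

lemma vdens_translate:
 assumes \<rho>: "is_rep G \<rho>" and K: "G_complex G K" "degree_le D K" and x: "x\<in>verts K" and k: "k\<in>carrier G"
 shows "vdens G D n (character \<rho>) K (act K k x)=vdens G D n (character \<rho>) K x"
proof -
 note b = bdd_complex_faces[OF K]
 note a = Gcx_act[OF K(1)]
 have "vdens G D n (character \<rho>) K (act K k x)=1 * vdens G D n (character \<rho>) K x"
 proof (rule vdens_transfer[OF act_giso[OF K(1) k] GcxD(1)[OF K(1)] K x])
  fix t assume t: "t\<in>ordered_simplices n (faces K)"
  have tv: "set t \<subseteq> verts K" using ord_simpD(4)[OF t] by (simp add: verts_def)
  let ?h = "hproj D n (faces K)"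
  let ?c = "%g. k \<otimes> g \<otimes> inv k"
  have bij: "bij_betw ?c (carrier G) (carrier G)"
   using bij_betw_trans[OF bij_mult_left[OF k] bij_mult_right[OF inv_closed[OF k]]] by (simp add: comp_def)
  have "(\<Sum>g\<in>carrier G. cnj (character \<rho> g)*?h (oriented (map (act K k) t)) (map (act K (inv g)) (map (act K k) t))) =
   (\<Sum>g\<in>carrier G. cnj (character \<rho> (?c g))*?h (oriented (map (act K k) t)) (map (act K (inv (?c g))) (map (act K k) t)))"
   by (rule sum.reindex_bij_betw[OF bij, symmetric])
  also have "...=(\<Sum>g\<in>carrier G. cnj (character \<rho> g)*?h (oriented t) (map (act K (inv g)) t))"
  proof (rule sum.cong[OF refl])
   fix g assume g: "g\<in>carrier G"
   have "act K (inv (?c g)) (act K k y)=act K k (act K (inv g) y)" if "y\<in>verts K" for y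
   proof -
    have e: "inv (?c g) \<otimes> k=k \<otimes> inv g" using g k by (simp add: inv_mult_group m_assoc)
    have "act K (inv (?c g)) (act K k y)=act K (inv (?c g) \<otimes> k) y" by (rule a(4)[symmetric]) (use g k that in auto)
    also have "...=act K k (act K (inv g) y)" unfolding e by (rule a(4)) (use g k that in auto)
    finally show ?thesis .
   qed
   hence m: "map (act K (inv (?c g))) (map (act K k) t)=map (act K k) (map (act K (inv g)) t)" using tv by (auto simp: subset_iff)
   have u: "set (map (act K (inv g)) t) \<subseteq> verts K" using a(2)[OF inv_closed[OF g]] tv by auto
   show "cnj (character \<rho> (?c g))*?h (oriented (map (act K k) t)) (map (act K (inv (?c g))) (map (act K k) t)) =
     cnj (character \<rho> g)*?h (oriented t) (map (act K (inv g)) t)"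
    unfolding m character_conj[OF \<rho> g k] hproj_gembed[OF act_giso[OF K(1) k] b b t u] ..
  qed
  finally show "dens G D n (character \<rho>) K (map (act K k) t)=1 * dens G D n (character \<rho>) K t" unfolding dens_def by simp
 qed
 thus ?thesis by simp
qed

text \<open>Identifies the group action with extension along an automorphism, so that commutation
  with the Laplacian and adjointness come from the general results on embeddings.\<close>

lemma chain_act_eq_push:
 assumes K: "G_complex G K" and g: "g\<in>carrier G" and f: "f\<in>l2_chains n (faces K)"
 shows "chain_act G K g f=jpush (act K g) (faces K) f"
proof
 fix t
 note a = Gcx_act[OF K]
 have emb: "comp_emb (act K g) (faces K) (faces K)" using act_giso[OF K g] by (simp add: gembed_def)
 show "chain_act G K g f t=jpush (act K g) (faces K) f t"
 proof (cases "set t\<in>faces K")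
  case True
  let ?u = "map (act K (inv g)) t"
  have tv: "set t \<subseteq> verts K" using True by (auto simp: verts_def)
  have u: "?u\<in>tuples (faces K)" using a(2)[OF inv_closed[OF g]] tv by (auto simp: tuples_def verts_def[symmetric])
  have "map (act K g) ?u=t" using a(7)[OF g] tv by (auto intro!: map_idI simp: subset_iff)
  thus ?thesis using push_map[OF emb u, of f] True by (simp add: chain_act_def)
 next
  case False
  have "jpush (act K g) (faces K) f t=0"
  proof (cases "t\<in>map (act K g) ` tuples (faces K)")
   case True
   then obtain u where u: "u\<in>tuples (faces K)" "t=map (act K g) u" by blast
   have "set u \<notin> faces K" using False GcxD(3)[OF K g] u(2) by auto
   hence "f u=0" using l2_chainsD(2)[OF f] by (auto simp: ordered_simplices_def)
   thus ?thesis unfolding u(2) push_map[OF emb u(1)] .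
  qed (simp add: push_def)
  thus ?thesis using False by (simp add: chain_act_def)
 qed
qed

lemma chain_act_in:
 assumes K: "G_complex G K" and g: "g\<in>carrier G" and f: "f\<in>l2_chains n (faces K)"
 shows "chain_act G K g f\<in>l2_chains n (faces K)"
 unfolding chain_act_eq_push[OF assms] by (rule push_in_l2_chains[OF act_giso[OF K g, unfolded gembed_def] f])

lemma chain_act_mult:
 assumes K: "G_complex G K" and g: "g\<in>carrier G" "h\<in>carrier G"
 shows "chain_act G K g (chain_act G K h f)=chain_act G K (g \<otimes> h) f"
proof
 fix t
 note a = Gcx_act[OF K]
 show "chain_act G K g (chain_act G K h f) t=chain_act G K (g \<otimes> h) f t"
 proof (cases "set t\<in>faces K")
  case True
  have tv: "set t \<subseteq> verts K" using True by (auto simp: verts_def)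
  have "act K (inv (g \<otimes> h)) y=act K (inv h) (act K (inv g) y)" if "y\<in>verts K" for y
   unfolding inv_mult_group[OF g] by (rule a(4)) (use g that in auto)
  hence m: "map (act K (inv (g \<otimes> h))) t=map (act K (inv h)) (map (act K (inv g)) t)" using tv by (auto simp: subset_iff)
  show ?thesis using True GcxD(3)[OF K inv_closed[OF g(1)] True] by (simp add: chain_act_def m del: map_map)
 qed (simp add: chain_act_def)
qed

lemma chain_act_adj:
 assumes K: "G_complex G K" and g: "g\<in>carrier G" and f: "f\<in>l2_chains n (faces K)" "f'\<in>l2_chains n (faces K)"
 shows "ip (chain_act G K g f) f'=ip f (chain_act G K (inv g) f')"
proof -
 note emb = act_giso[OF K g, unfolded gembed_def]
 have inj: "inj_on (map (act K g)) (tuples (faces K))" using emb by (intro inj_on_map_tuples) (simp add: comp_emb_def)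
 have z: "f t=0" if "t \<notin> tuples (faces K)" for t using l2_chainsD(2)[OF f(1)] ordered_in_tuples that by blast
 have "jpull (act K g) (faces K) f'=chain_act G K (inv g) f'"
 proof
  fix t
  show "jpull (act K g) (faces K) f' t=chain_act G K (inv g) f' t"
  proof (cases "set t\<in>faces K")
   case True
   hence "t\<in>tuples (faces K)" by (auto simp: tuples_def)
   thus ?thesis using True g by (simp add: chain_act_def pull_def)
  next
   case False
   have "f' (map (act K g) t)=0" if t: "t\<in>tuples (faces K)"
   proof (rule l2_chainsD(2)[OF f(2)])
    have "t \<notin> ordered_simplices n (faces K)" using False by (simp add: ordered_simplices_def)
    thus "map (act K g) t \<notin> ordered_simplices n (faces K)" unfolding map_ord_simp[OF emb t] .
   qed
   thus ?thesis using False by (simp add: chain_act_def pull_def)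
  qed
 qed
 moreover have "ip (jpush (act K g) (faces K) f) f'=ip f (jpull (act K g) (faces K) f')"
  by (rule ip_push_pull[OF inj]) (rule z)
 ultimately show ?thesis unfolding chain_act_eq_push[OF K g f(1)] by simp
qed

end

section \<open>The isotypic projector on the chains of a single complex\<close>

definition isoP :: "('g, 'b) monoid_scheme => ('g => complex mat) => ('g, 'v) gcomplex => ('v list => complex) => 'v list => complex"
 where "isoP G \<rho> K f=(%t. \<Sum>g\<in>carrier G.
  character \<rho> \<one>\<^bsub>G\<^esub> / of_nat (card (carrier G)) * cnj (character \<rho> g) * chain_act G K g f t)"

lemma isotypic_projector_eq: "isotypic_projector G \<Psi> \<rho> \<sigma>=(%c. isoP G \<rho> (NG_complex (\<Psi> c)) (\<sigma> c))"
 by (simp add: isotypic_projector_def isoP_def sum_distrib_left mult.assoc)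

context fin_group
begin

context
 fixes \<rho> :: "'a => complex mat" and D :: nat and K :: "('a, 'v) gcomplex"
 assumes \<rho>: "irreducible_rep G \<rho>" and K: "G_complex G K" "degree_le D K"
begin

lemmas rho = irr_is_rep[OF \<rho>]

definition "cf g=character \<rho> \<one> / of_nat (card (carrier G)) * cnj (character \<rho> g)"

lemma rep_dim_pos: "rep_dim G \<rho> > 0"
 using \<rho> by (simp add: irreducible_rep_def)

lemma cf_inv: "g\<in>carrier G ==> cf (inv g)=cnj (cf g)"
 using cnj_character[OF rho, of "inv g"] by (simp add: cf_def character_one[OF rho])

text \<open>The coefficients form an idempotent of the group algebra: after inverting the summation
  variable, \<open>character_convolution\<close> contributes |G|/d, which reduces the square of
  d/|G| to d/|G|, where d is the dimension of \<rho>.\<close>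

lemma cf_convolution:
 assumes k: "k\<in>carrier G"
 shows "(\<Sum>g\<in>carrier G. cf g * cf (inv g \<otimes> k))=cf k"
proof -
 let ?d = "of_nat (rep_dim G \<rho>) :: complex" and ?N = "of_nat (card (carrier G)) :: complex"
 have N: "?N ~= 0" using fin one_closed by auto
 have "(\<Sum>g\<in>carrier G. character \<rho> g * character \<rho> (inv g \<otimes> k)) =
   (\<Sum>g\<in>carrier G. character \<rho> (inv g) * character \<rho> (inv (inv g) \<otimes> k))"
  by (rule sum.reindex_bij_betw[OF bij_inv, symmetric])
 also have "...=(\<Sum>g\<in>carrier G. character \<rho> (inv g) * character \<rho> (g \<otimes> k))" by (rule sum.cong[OF refl]) simp
 also have "...=?N / ?d * character \<rho> k" by (rule character_convolution[OF \<rho> k])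
 finally have e: "(\<Sum>g\<in>carrier G. character \<rho> g * character \<rho> (inv g \<otimes> k))=?N / ?d * character \<rho> k" .
 have "(\<Sum>g\<in>carrier G. cf g * cf (inv g \<otimes> k))=(?d / ?N)\<^sup>2 * cnj (\<Sum>g\<in>carrier G. character \<rho> g * character \<rho> (inv g \<otimes> k))"
  unfolding cf_def character_one[OF rho] cnj_sum sum_distrib_left
  by (rule sum.cong[OF refl]) (simp add: power2_eq_square algebra_simps)
 also have "...=cf k"
  unfolding e cf_def character_one[OF rho] using N rep_dim_pos by (simp add: power2_eq_square field_simps)
 finally show ?thesis .
qed

lemma isoP_cf: "isoP G \<rho> K f=(%t. \<Sum>g\<in>carrier G. cf g * chain_act G K g f t)"
 by (simp add: isoP_def cf_def)

lemma isoP_in: "f\<in>l2_chains n (faces K) ==> isoP G \<rho> K f\<in>l2_chains n (faces K)"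
 unfolding isoP_cf by (intro l2_chains_sum fin chain_act_in K)

text \<open>The group acts unitarily, and inverting g conjugates the coefficient
  \<open>cf g\<close>; so the average is self-adjoint.\<close>

lemma ip_isoP:
 assumes f: "f\<in>l2_chains n (faces K)" "f'\<in>l2_chains n (faces K)"
 shows "ip (isoP G \<rho> K f) f'=ip f (isoP G \<rho> K f')"
proof -
 have l: "!!g. g\<in>carrier G ==> l2 (chain_act G K g f)" "!!g. g\<in>carrier G ==> l2 (chain_act G K g f')" "l2 f" "l2 f'"
  using l2_chainsD(1) chain_act_in[OF K(1)] f by blast+
 have "ip f (isoP G \<rho> K f')=cnj (ip (isoP G \<rho> K f') f)" by (rule ip_cnj)
 also have "...=(\<Sum>g\<in>carrier G. cnj (cf g) * cnj (ip (chain_act G K g f') f))"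
  unfolding isoP_cf using ip_sum_left(2)[OF fin l(2,3), of "%g. g" "%g. cf g"] by simp
 also have "...=(\<Sum>g\<in>carrier G. cf (inv g) * ip f (chain_act G K g f'))"
  by (rule sum.cong[OF refl]) (simp add: cf_inv ip_cnj[of f])
 also have "...=(\<Sum>g\<in>carrier G. cf (inv (inv g)) * ip f (chain_act G K (inv g) f'))"
  by (rule sum.reindex_bij_betw[OF bij_inv, symmetric])
 also have "...=(\<Sum>g\<in>carrier G. cf g * ip (chain_act G K g f) f')"
  by (rule sum.cong[OF refl]) (simp add: chain_act_adj[OF K(1) _ f])
 also have "...=ip (isoP G \<rho> K f) f'"
  unfolding isoP_cf using ip_sum_left(2)[OF fin l(1,4), of "%g. g" "%g. cf g"] by simp
 finally show ?thesis ..
qed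

lemma isoP_idem: "isoP G \<rho> K (isoP G \<rho> K f)=isoP G \<rho> K f"
proof
 fix t
 have lin: "chain_act G K g (isoP G \<rho> K f) t=(\<Sum>h\<in>carrier G. cf h * chain_act G K (g \<otimes> h) f t)" if g: "g\<in>carrier G" for g
 proof -
  have "chain_act G K g (isoP G \<rho> K f) t=(\<Sum>h\<in>carrier G. cf h * chain_act G K g (chain_act G K h f) t)"
   by (simp add: isoP_cf chain_act_def[of G K g])
  thus ?thesis using chain_act_mult[OF K(1) g] by simp
 qed
 have "isoP G \<rho> K (isoP G \<rho> K f) t=(\<Sum>g\<in>carrier G. cf g*(\<Sum>h\<in>carrier G. cf h * chain_act G K (g \<otimes> h) f t))"
  unfolding isoP_cf[of "isoP G \<rho> K f"] by (rule sum.cong[OF refl]) (simp add: lin)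
 also have "...=(\<Sum>g\<in>carrier G. cf g*(\<Sum>k\<in>carrier G. cf (inv g \<otimes> k) * chain_act G K (g \<otimes> (inv g \<otimes> k)) f t))"
 proof (rule sum.cong[OF refl])
  fix g assume "g\<in>carrier G"
  from sum.reindex_bij_betw[OF bij_mult_left[OF inv_closed[OF this]], of "%h. cf h * chain_act G K (g \<otimes> h) f t"]
  show "cf g*(\<Sum>h\<in>carrier G. cf h * chain_act G K (g \<otimes> h) f t) =
   cf g*(\<Sum>k\<in>carrier G. cf (inv g \<otimes> k) * chain_act G K (g \<otimes> (inv g \<otimes> k)) f t)" by simp
 qed
 also have "...=(\<Sum>g\<in>carrier G. \<Sum>k\<in>carrier G. cf g * cf (inv g \<otimes> k) * chain_act G K k f t)"
  unfolding sum_distrib_left by (intro sum.cong[OF refl]) (simp add: m_assoc[symmetric] mult.assoc)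
 also have "...=(\<Sum>k\<in>carrier G. \<Sum>g\<in>carrier G. cf g * cf (inv g \<otimes> k) * chain_act G K k f t)" by (rule sum.swap)
 also have "...=isoP G \<rho> K f t"
  unfolding isoP_cf sum_distrib_right[symmetric] by (rule sum.cong[OF refl]) (simp add: cf_convolution)
 finally show "isoP G \<rho> K (isoP G \<rho> K f) t=isoP G \<rho> K f t" .
qed

text \<open>Each translation commutes with the Laplacian by naturality, hence so does their weighted
  sum.\<close>

lemma lapk_isoP:
 assumes f: "f\<in>l2_chains n (faces K)" and z: "lapk n (faces K) f=(%_. 0)"
 shows "lapk n (faces K) (isoP G \<rho> K f)=(%_. 0)"
proof -
 have "lapk n (faces K) (chain_act G K g f)=(%_. 0)" if g: "g\<in>carrier G" for g
  unfolding chain_act_eq_push[OF K(1) g f]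
   lapk_push_pull(1)[OF act_giso[OF K(1) g, unfolded gembed_def] GcxD(1)[OF K(1)] GcxD(1)[OF K(1)]] z
  by (simp add: push_def fun_eq_iff)
 thus ?thesis unfolding isoP_cf lapk_sum[OF fin] by simp
qed

text \<open>A self-adjoint idempotent splits f orthogonally, so the squared norm of its value at f
  is at most that of f.\<close>

lemma nsq_isoP:
 assumes f: "f\<in>l2_chains n (faces K)"
 shows "nsq (isoP G \<rho> K f) \<le> nsq f"
proof -
 note l = l2_chainsD(1)[OF f] l2_chainsD(1)[OF isoP_in[OF f]]
 have "ip f (isoP G \<rho> K f)=ip f (isoP G \<rho> K (isoP G \<rho> K f))" by (simp only: isoP_idem)
 also have "...=ip (isoP G \<rho> K f) (isoP G \<rho> K f)" by (rule ip_isoP[OF f isoP_in[OF f], symmetric])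
 finally have "Re (ip f (isoP G \<rho> K f))=nsq (isoP G \<rho> K f)" by (simp add: ip_self)
 hence "nsq (%t. f t - isoP G \<rho> K f t)=nsq f - nsq (isoP G \<rho> K f)" using nsq_diff[OF l] by simp
 thus ?thesis using nsq_nonneg[of "%t. f t - isoP G \<rho> K f t"] by linarith
qed

text \<open>The isotypic projection commutes with the one onto harmonic chains, so their product is a projection.\<close>

lemma isoP_orth:
 assumes v: "v\<in>l2_chains n (faces K)" and s: "s\<in>l2_chains n (faces K)" "lapk n (faces K) s=(%_. 0)"
 shows "ip (%t. v t - isoP G \<rho> K (hproj D n (faces K) v) t) (isoP G \<rho> K s)=0"
proof -
 note b = bdd_complex_faces[OF K]
 let ?h = "hproj D n (faces K) v" and ?s = "isoP G \<rho> K s"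
 note h = hproj_in[OF b v]
 note l = l2_chainsD(1)[OF v] l2_chainsD(1)[OF h] l2_chainsD(1)[OF isoP_in[OF h]] l2_chainsD(1)[OF isoP_in[OF s(1)]]
 have "ip (isoP G \<rho> K ?h) ?s=ip ?h ?s" unfolding ip_isoP[OF h isoP_in[OF s(1)]] isoP_idem ..
 hence "ip (%t. v t - isoP G \<rho> K ?h t) ?s=ip (%t. v t - ?h t) ?s"
  using ip_diff_left[OF l(1,3,4)] ip_diff_left[OF l(1,2,4)] by simp
 also have "...=0" by (rule hproj_orth[OF b v isoP_in[OF s(1)] lapk_isoP[OF s]])
 finally show ?thesis .
qed

lemma isoP_dens:
 assumes t: "t\<in>ordered_simplices n (faces K)"
 shows "isoP G \<rho> K (hproj D n (faces K) (oriented t)) t=character \<rho> \<one> * dens G D n (character \<rho>) K t"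
 using ord_simpD(3)[OF t] by (simp add: isoP_def dens_def chain_act_def sum_distrib_left sum_divide_distrib mult.assoc)

text \<open>Both maps are contractions, and an oriented n-simplex has squared norm (n + 1)! in the
  unnormalised product. This bound, uniform over complexes, dominates the integrands later.\<close>

lemma norm_isoP_hproj:
 assumes t: "t\<in>ordered_simplices n (faces K)"
 shows "norm (isoP G \<rho> K (hproj D n (faces K) (oriented t)) u) \<le> sqrt (fact (n + 1))"
proof -
 note b = bdd_complex_faces[OF K]
 note o = oriented_in_l2_chains[OF t]
 note h = hproj_in[OF b o]
 have "ip (oriented t) (oriented t)=fact (n + 1)" using ip_oriented[OF o t] oriented_self[OF ord_simpD(2)[OF t]] by simp
 hence "complex_of_real (nsq (oriented t))=complex_of_real (fact (n + 1))" unfolding ip_self by (simp del: fact_Suc)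
 hence n: "nsq (oriented t)=fact (n + 1)" unfolding of_real_eq_iff .
 have "(norm (isoP G \<rho> K (hproj D n (faces K) (oriented t)) u))\<^sup>2 \<le> nsq (isoP G \<rho> K (hproj D n (faces K) (oriented t)))"
  by (rule norm_le_nsq[OF l2_chainsD(1)[OF isoP_in[OF h]]])
 also have "... \<le> nsq (hproj D n (faces K) (oriented t))" by (rule nsq_isoP[OF h])
 also have "... \<le> fact (n + 1)" using nsq_hproj[OF b o] n by simp
 finally show ?thesis by (intro real_le_rsqrt)
qed

end

end

section \<open>The direct integral\<close>

text \<open>Replaces the net of finite subsets behind an unconditional sum by a sequence, as
  required by measurability of limits and by dominated convergence.\<close>

lemma filterlim_initial_segments:
 assumes "countable J"
 shows "finite {t\<in>J. to_nat_on J t < N}" "filterlim (%N. {t\<in>J. to_nat_on J t < N}) (finite_subsets_at_top J) sequentially"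
proof -
 let ?F = "%N. {t\<in>J. to_nat_on J t < N}"
 have inj: "inj_on (to_nat_on J) J" by (rule inj_on_to_nat_on[OF assms])
 show fin: "finite (?F N)" for N
  by (rule finite_imageD[of "to_nat_on J"]) (auto intro: finite_subset[of _ "{..<N}"] inj_on_subset[OF inj])
 show "filterlim ?F (finite_subsets_at_top J) sequentially"
  unfolding filterlim_finite_subsets_at_top
 proof (intro allI impI)
  fix X assume X: "finite X & X \<subseteq> J"
  obtain N where N: "!!t. t\<in>X ==> to_nat_on J t < N" using finite_nat_set_iff_bounded[of "to_nat_on J ` X"] X by auto
  have "finite (?F m) & X\<subseteq>?F m & ?F m \<subseteq> J" if "m \<ge> N" for m
   using fin[of m] X N that by (auto intro: less_le_trans)
  thus "\<forall>\<^sub>F m in sequentially. finite (?F m) & X\<subseteq>?F m & ?F m \<subseteq> J" unfolding eventually_sequentially by blast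
 qed
qed

lemma measurable_has_sum:
 fixes f :: "'t => 'c => complex"
 assumes J: "countable J" and f: "!!t. t\<in>J ==> f t\<in>borel_measurable M"
  and S: "!!c. c\<in>space M ==> ((%t. f t c) has_sum S c) J"
 shows "S\<in>borel_measurable M"
proof (rule borel_measurable_LIMSEQ_metric)
 let ?F = "%N. {t\<in>J. to_nat_on J t < N}"
 show "(%c. \<Sum>t\<in>?F N. f t c)\<in>borel_measurable M" for N using f by (intro borel_measurable_sum) auto
 show "(%N. \<Sum>t\<in>?F N. f t c) \<longlonglongrightarrow> S c" if "c\<in>space M" for c
  using filterlim_compose[OF S[OF that, unfolded has_sum_def] filterlim_initial_segments(2)[OF J]] .
qed

lemma measurable_cnj: "f\<in>borel_measurable M ==> (%x. cnj (f x))\<in>borel_measurable M"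
 by (rule measurable_compose[OF _ borel_measurable_continuous_onI]) (auto intro: continuous_on_cnj continuous_on_id)

lemma chain_inner_ip: "chain_inner n f g=ip f g / fact (n + 1)"
 by (simp add: chain_inner_def ip_def)

lemma measurable_kop:
 fixes k :: "'c => 'u => 't => complex"
 assumes J: "countable J" and k: "!!u t. (%c. k c u t)\<in>borel_measurable M" and v: "!!t. (%c. v c t)\<in>borel_measurable M"
  and sp: "!!c. c\<in>space M ==> sparse (k c) N B" and supp: "!!c u t. c\<in>space M ==> k c u t ~= 0 ==> t\<in>J"
 shows "(%c. kop (k c) (v c) u)\<in>borel_measurable M"
proof (rule measurable_has_sum[OF J])
 show "(%c. k c u t * v c t)\<in>borel_measurable M" for t by (intro borel_measurable_times k v)
 fix c assume c: "c\<in>space M"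
 have "finite {t. k c u t ~= 0}" using sp[OF c] by (simp add: sparse_def)
 hence "((%t. k c u t * v c t) has_sum kop (k c) (v c) u) {t. k c u t ~= 0}" unfolding kop_def by (rule has_sum_finite)
 thus "((%t. k c u t * v c t) has_sum kop (k c) (v c) u) J"
  by (rule has_sum_cong_neutral[THEN iffD1, rotated -1]) (use supp[OF c] in auto)
qed

locale realised = fin_group G for G :: "('a, 'b) monoid_scheme" (structure) +
 fixes D :: nat and R :: "'a gset set" and \<Psi> :: "'a iso_class => 'a nvert set set"
 assumes R: "orbit_reps G R" and real: "realisation D G R \<Psi>"
begin

lemma gsetD:
 assumes "X\<in>R"
 shows "group_action G (fst X) (snd X)" "fst X ~= {}" "!!x y. x\<in>fst X ==> y\<in>fst X ==> \<exists>g\<in>carrier G. snd X g x=y"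
proof -
 have t: "transitive_action G (fst X) (snd X) & fst X ~= {}"
  using R assms unfolding orbit_reps_def transitive_gset_def by (auto simp: case_prod_unfold)
 show "group_action G (fst X) (snd X)" by (rule transitive_action.axioms(1)[OF conjunct1[OF t]])
 show "fst X ~= {}" by (rule conjunct2[OF t])
 show "!!x y. x\<in>fst X ==> y\<in>fst X ==> \<exists>g\<in>carrier G. snd X g x=y" by (rule transitive_action.unique_orbit[OF conjunct1[OF t]])
qed

lemma finite_gset: "X\<in>R ==> finite (fst X)"
proof -
 assume X: "X\<in>R"
 obtain x where x: "x\<in>fst X" using gsetD(2)[OF X] by blast
 have "fst X\<subseteq>(%g. snd X g x) ` carrier G" using gsetD(3)[OF X x] by fastforce
 thus ?thesis using fin finite_surj by blast
qed

text \<open>A transitive \<open>G\<close>-set is determined by the stabiliser of a point, so there are finitely many.\<close>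

lemma finite_R: "finite R"
proof -
 define pt where "pt X=(SOME x. x\<in>fst X)" for X :: "'a gset"
 define st where "st X={g\<in>carrier G. snd X g (pt X)=pt X}" for X :: "'a gset"
 have pt: "pt X\<in>fst X" if "X\<in>R" for X unfolding pt_def using gsetD(2)[OF that] some_in_eq by blast
 have eq_iff: "snd X g (pt X) = snd X h (pt X) \<longleftrightarrow> inv h \<otimes> g\<in>st X" if X: "X\<in>R" and g: "g\<in>carrier G" "h\<in>carrier G" for X g h
 proof -
  note a = group_actionD[OF gsetD(1)[OF X]] and p = pt[OF X]
  have m: "snd X (inv h \<otimes> g) (pt X) = snd X (inv h) (snd X g (pt X))" by (rule a(4)) (use g p in auto)
  show ?thesis
  proof
   assume "snd X g (pt X) = snd X h (pt X)"
   thus "inv h \<otimes> g\<in>st X" unfolding st_def using m a(6)[OF g(2) p] g by simp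
  next
   assume "inv h \<otimes> g\<in>st X"
   hence "snd X h (snd X (inv h) (snd X g (pt X))) = snd X h (pt X)" using m by (simp add: st_def)
   thus "snd X g (pt X) = snd X h (pt X)" using a(7)[OF g(2) a(2)[OF g(1) p]] by simp
  qed
 qed
 have "inj_on st R"
 proof (rule inj_onI)
  fix X Y assume X: "X\<in>R" and Y: "Y\<in>R" and e: "st X = st Y"
  have ee: "snd X g (pt X) = snd X h (pt X) \<longleftrightarrow> snd Y g (pt Y) = snd Y h (pt Y)" if "g\<in>carrier G" "h\<in>carrier G" for g h
   unfolding eq_iff[OF X that] eq_iff[OF Y that] e ..
  define \<gamma> where "\<gamma> x=(SOME g. g\<in>carrier G & snd X g (pt X)=x)" for x
  have \<gamma>: "\<gamma> x\<in>carrier G & snd X (\<gamma> x) (pt X)=x" if "x\<in>fst X" for x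
   unfolding \<gamma>_def by (rule someI_ex) (use gsetD(3)[OF X pt[OF X] that] in blast)
  \<comment> \<open>The map sends the translate of the base point of \<open>X\<close> by g to that
    of \<open>Y\<close>; equality of the two stabilisers, in the form \<open>ee\<close>, makes it
    independent of the choice of g and injective.\<close>
  define f where "f x = snd Y (\<gamma> x) (pt Y)" for x
  have f: "f (snd X g (pt X)) = snd Y g (pt Y)" if g: "g\<in>carrier G" for g
   unfolding f_def using ee[of "\<gamma> (snd X g (pt X))" g] \<gamma>[OF group_actionD(2)[OF gsetD(1)[OF X] g pt[OF X]]] g by blast
  have orb: "\<exists>g\<in>carrier G. x = snd X g (pt X)" if "x\<in>fst X" for x using \<gamma>[OF that] by metis
  have "bij_betw f (fst X) (fst Y)"
   unfolding bij_betw_def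
  proof
   show "inj_on f (fst X)"
   proof (rule inj_onI)
    fix x y assume "x\<in>fst X" "y\<in>fst X" and q: "f x=f y"
    then obtain g h where g: "g\<in>carrier G" "x = snd X g (pt X)" and h: "h\<in>carrier G" "y = snd X h (pt X)" using orb by metis
    show "x=y" using q f[OF g(1)] f[OF h(1)] ee[OF g(1) h(1)] unfolding g(2) h(2) by simp
   qed
   show "f ` fst X=fst Y"
   proof
    show "f ` fst X \<subseteq> fst Y" using group_actionD(2)[OF gsetD(1)[OF Y] _ pt[OF Y]] \<gamma> by (auto simp: f_def)
    show "fst Y \<subseteq> f ` fst X"
    proof
     fix y assume "y\<in>fst Y"
     then obtain g where g: "g\<in>carrier G" "snd Y g (pt Y)=y" using gsetD(3)[OF Y pt[OF Y]] by blast
     show "y\<in>f ` fst X" using f[OF g(1)] g(2) group_actionD(2)[OF gsetD(1)[OF X] g(1) pt[OF X]] by (metis imageI)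
    qed
   qed
  qed
  moreover have "f (snd X g x) = snd Y g (f x)" if g: "g\<in>carrier G" and x: "x\<in>fst X" for g x
  proof -
   obtain h where h: "h\<in>carrier G" "x = snd X h (pt X)" using orb[OF x] by blast
   have "snd X g x = snd X (g \<otimes> h) (pt X)" unfolding h(2) by (rule group_actionD(4)[OF gsetD(1)[OF X] g h(1) pt[OF X], symmetric])
   hence "f (snd X g x) = snd Y (g \<otimes> h) (pt Y)" using f g h(1) by simp
   also have "... = snd Y g (snd Y h (pt Y))" by (rule group_actionD(4)[OF gsetD(1)[OF Y] g h(1) pt[OF Y]])
   finally show ?thesis using f[OF h(1)] h(2) by simp
  qed
  ultimately have "gset_iso G X Y" unfolding gset_iso_def case_prod_unfold by blast
  moreover have "gset_iso G Y Y" unfolding gset_iso_def case_prod_unfold by (intro exI[of _ id]) simp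
  moreover have "transitive_gset G Y" using R Y by (simp add: orbit_reps_def)
  ultimately show "X=Y" using R X Y unfolding orbit_reps_def by blast
 qed
 moreover have "finite (st ` R)" by (rule finite_subset[of _ "Pow (carrier G)"]) (auto simp: st_def)
 ultimately show ?thesis by (simp add: finite_image_iff)
qed

lemma countable_NG: "countable (NG R)"
proof -
 have "NG R \<subseteq> UNIV \<times> (SIGMA X:R. fst X)" by (auto simp: NG_def)
 moreover have "countable (UNIV \<times> (SIGMA X:R. fst X) :: 'a nvert set)"
  using finite_R finite_gset by (intro countable_SIGMA) (auto intro: countable_finite)
 ultimately show ?thesis by (rule countable_subset)
qed

lemma NG_action:
 assumes "x\<in>NG R"
 shows "g\<in>carrier G ==> NG_act g x\<in>NG R" "NG_act \<one> x=x"
  "g\<in>carrier G ==> h\<in>carrier G ==> NG_act (g \<otimes> h) x=NG_act g (NG_act h x)"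
proof -
 obtain k X a where x: "x=(k, X, a)" "X\<in>R" "a\<in>fst X" using assms by (auto simp: NG_def)
 note A = group_actionD[OF gsetD(1)[OF x(2)]]
 show "g\<in>carrier G ==> NG_act g x\<in>NG R" using A(2)[of g a] x by (simp add: NG_act_def NG_def)
 show "NG_act \<one> x=x" using A(3) x by (simp add: NG_act_def)
 show "g\<in>carrier G ==> h\<in>carrier G ==> NG_act (g \<otimes> h) x=NG_act g (NG_act h x)" using A(4)[of g h a] x by (simp add: NG_act_def)
qed

lemma faces_NG [simp]: "faces (NG_complex L)=L" "verts (NG_complex L)=\<Union>L"
 by (simp_all add: NG_complex_def verts_def)

lemma Psi_D:
 assumes c: "c\<in>SC 1 D G"
 shows "\<Psi> c \<subseteq> Delta D R" "\<Union>(\<Psi> c) \<subseteq> NG R" "G_complex G (NG_complex (\<Psi> c))" "degree_le D (NG_complex (\<Psi> c))"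
  "\<exists>X\<in>R. base_orbit X\<subseteq>\<Union>(\<Psi> c) & (\<forall>K O'. rep c=(K, O') --> (\<exists>f. giso G f (NG_complex (\<Psi> c)) K & f ` base_orbit X=O'))"
  "\<exists>!X. X\<in>R & base_orbit X\<subseteq>\<Union>(\<Psi> c)"
proof -
 have S: "\<Psi> c\<in>Sub_Delta D G R" using real c by (simp add: realisation_def)
 thus sub: "\<Psi> c \<subseteq> Delta D R" and u: "\<exists>!X. X\<in>R & base_orbit X\<subseteq>\<Union>(\<Psi> c)" by (auto simp: Sub_Delta_def)
 show NGs: "\<Union>(\<Psi> c) \<subseteq> NG R" using sub by (auto simp: Delta_def)
 have inv: "NG_act g ` s\<in>\<Psi> c" if "g\<in>carrier G" "s\<in>\<Psi> c" for g s using S that by (simp add: Sub_Delta_def)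
 have act: "act (NG_complex (\<Psi> c)) g x=NG_act g x" if "x\<in>\<Union>(\<Psi> c)" for g x using that by (simp add: NG_complex_def)
 have cl: "NG_act g x\<in>\<Union>(\<Psi> c)" if "g\<in>carrier G" "x\<in>\<Union>(\<Psi> c)" for g x using inv[OF that(1)] that(2) by blast
 show GN: "G_complex G (NG_complex (\<Psi> c))"
  unfolding G_complex_def faces_NG
 proof (intro conjI ballI)
  show "simplicial_complex (\<Psi> c)" using S by (simp add: Sub_Delta_def)
  show "group_action G (\<Union>(\<Psi> c)) (act (NG_complex (\<Psi> c)))"
  proof (rule group_actionI[OF is_group])
   show "act (NG_complex (\<Psi> c)) g\<in>extensional (\<Union>(\<Psi> c))" for g by (simp add: NG_complex_def)
  qed (use act cl NG_action subsetD[OF NGs] in \<open>simp_all add: m_closed\<close>)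
  fix g s assume g: "g\<in>carrier G" and s: "s\<in>\<Psi> c"
  have "act (NG_complex (\<Psi> c)) g ` s=NG_act g ` s"
  proof (rule image_cong[OF refl])
   fix x assume "x\<in>s"
   hence "x\<in>\<Union>(\<Psi> c)" using s by (rule UnionI[rotated])
   thus "act (NG_complex (\<Psi> c)) g x=NG_act g x" by (rule act)
  qed
  thus "act (NG_complex (\<Psi> c)) g ` s\<in>\<Psi> c" using inv[OF g s] by simp
 qed
 obtain K O' where r: "rep c=(K, O')" by fastforce
 obtain X where X: "X\<in>R" "base_orbit X\<subseteq>\<Union>(\<Psi> c)" "marked_iso G (NG_complex (\<Psi> c), [base_orbit X]) (K, [O'])"
  using real c rep_mem[OF c r] unfolding realisation_def by blast
 obtain f where f: "giso G f (NG_complex (\<Psi> c)) K" "f ` base_orbit X=O'" using X(3) unfolding marked_iso_iff by auto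
 note K = markedD[OF SC1_rep(1)[OF c r]]
 show "degree_le D (NG_complex (\<Psi> c))" by (rule degree_le_giso[OF giso_inv[OF GN f(1)] GcxD(1)[OF K(1)] K(2)])
 show "\<exists>X\<in>R. base_orbit X\<subseteq>\<Union>(\<Psi> c) & (\<forall>K O'. rep c=(K, O') --> (\<exists>f. giso G f (NG_complex (\<Psi> c)) K & f ` base_orbit X=O'))"
  using X f r by auto
qed

text \<open>Evaluation of the indicator at s is a coordinate projection of the product topology, so
  by continuity of \<Psi> the set is open for s in \<open>Delta D R\<close>, and it is empty
  otherwise.\<close>

lemma measurable_Psi:
 assumes sp: "space \<nu>=SC 1 D G" "sets \<nu> = sets (SC_borel 1 D G)"
 shows "{c\<in>space \<nu>. s\<in>\<Psi> c}\<in>sets \<nu>"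
proof (cases "s\<in>Delta D R")
 case True
 let ?P = "product_topology (%_. discrete_topology UNIV) (Delta D R) :: ('a nvert set => bool) topology"
 have "continuous_map (SC_topology 1 D G) (Sub_topology D G R) (%c. indicator_on (Delta D R) (\<Psi> c))"
  using real by (simp add: realisation_def)
 hence "continuous_map (SC_topology 1 D G) ?P (%c. indicator_on (Delta D R) (\<Psi> c))"
  unfolding Sub_topology_def by (simp add: continuous_map_in_subtopology)
 from continuous_map_compose[OF this continuous_map_product_projection[OF True]]
 have "continuous_map (SC_topology 1 D G) (discrete_topology UNIV) (%c. s\<in>\<Psi> c)"
  by (rule continuous_map_eq) (simp add: indicator_on_def True)
 hence "openin (SC_topology 1 D G) {c\<in>topspace (SC_topology 1 D G). (s\<in>\<Psi> c)\<in>{True}}"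
  by (rule openin_continuous_map_preimage) simp
 thus ?thesis using open_in_sets[of 1 D G] by (simp add: sp topspace_SC_topology)
next
 case False
 hence "{c\<in>space \<nu>. s\<in>\<Psi> c}={}" using Psi_D(1) sp(1) by auto
 thus ?thesis by (simp only: sets.empty_sets)
qed

end

section \<open>Measurable fields of chains over a random rooted complex\<close>

locale random_realised = realised G D R \<Psi> for G :: "('a, 'b) monoid_scheme" (structure) and D R \<Psi> +
 fixes \<nu> :: "'a iso_class measure" and n :: nat and \<rho> :: "'a => complex mat"
 assumes prob: "prob_space \<nu>" and sp: "space \<nu>=SC 1 D G" and sets: "sets \<nu> = sets (SC_borel 1 D G)"
  and rho: "irreducible_rep G \<rho>"
begin

abbreviation "NK c \<equiv> NG_complex (\<Psi> c)"
abbreviation "DI \<equiv> direct_integral D R \<Psi> \<nu> n"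
abbreviation "PP \<sigma> \<equiv> (%c. isoP G \<rho> (NK c) (\<sigma> c))"

definition fld :: "'a field => bool"
 where "fld \<sigma> \<longleftrightarrow> (\<forall>c\<in>space \<nu>. \<sigma> c\<in>l2_chains n (\<Psi> c)) & (\<forall>t. (%c. \<sigma> c t)\<in>borel_measurable \<nu>)"

lemma cS: "c\<in>space \<nu> ==> c\<in>SC 1 D G" by (simp add: sp)

lemmas PsiD = Psi_D[OF cS]

lemma fldD: "fld \<sigma> ==> c\<in>space \<nu> ==> \<sigma> c\<in>l2_chains n (\<Psi> c)" "fld \<sigma> ==> (%c. \<sigma> c t)\<in>borel_measurable \<nu>"
 by (auto simp: fld_def)

lemma fld_l2: "fld \<sigma> ==> c\<in>space \<nu> ==> l2 (\<sigma> c)" using l2_chainsD(1) fldD(1) by blast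

lemma bounded: "c\<in>space \<nu> ==> bdd_complex D (\<Psi> c)"
 using bdd_complex_faces[OF PsiD(3,4)] by simp

lemma measurable_if_Psi:
 "f\<in>borel_measurable \<nu> ==> (%c. if s\<in>\<Psi> c then f c else (0 :: complex))\<in>borel_measurable \<nu>"
 by (rule measurable_If) (use measurable_Psi[OF sp sets] in auto)

lemma countable_lists_NG: "countable (lists (NG R))"
 by (rule countable_lists[OF countable_NG])

lemma ordered_lists: "c\<in>space \<nu> ==> t\<in>ordered_simplices m (\<Psi> c) ==> t\<in>lists (NG R)"
 using ord_simpD(4)[of t m "\<Psi> c"] PsiD(2)[of c] by (auto simp: in_lists_conv_set)

lemma chain_inner_xi:
 assumes c: "c\<in>space \<nu>" and f: "f\<in>l2_chains n (\<Psi> c)" and t: "t\<in>ordered_simplices n (Delta D R)"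
 shows "chain_inner n f (xi \<Psi> t c)=f t"
proof (cases "set t\<in>\<Psi> c")
 case True
 hence "t\<in>ordered_simplices n (\<Psi> c)" using t by (simp add: ordered_simplices_def)
 thus ?thesis using True by (simp add: xi_def chain_inner_ip ip_oriented[OF f] del: fact_Suc)
next
 case False
 hence "f t=0" using l2_chainsD(2)[OF f] by (simp add: ordered_simplices_def)
 thus ?thesis using False by (simp add: xi_def chain_inner_def)
qed

lemma Re_chain_inner: "Re (chain_inner n f f)=nsq f / fact (n + 1)"
proof -
 have "chain_inner n f f=complex_of_real (nsq f / fact (n + 1))" by (simp add: chain_inner_ip ip_self del: fact_Suc)
 thus ?thesis by (simp only: Re_complex_of_real)
qed

text \<open>Pairing with \<xi> reads off one coordinate, and coordinates outside
  \<open>Delta D R\<close> are zero, so measurability against the fundamental sequence is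
  measurability of all coordinates.\<close>

lemma DI_iff: "\<sigma>\<in>DI \<longleftrightarrow> fld \<sigma> & (\<integral>\<^sup>+c. ennreal (nsq (\<sigma> c) / fact (n + 1)) \<partial>\<nu>) < \<infinity>"
proof -
 have "(\<forall>s\<in>ordered_simplices n (Delta D R). (%c. chain_inner n (\<sigma> c) (xi \<Psi> s c))\<in>borel_measurable \<nu>) \<longleftrightarrow>
  (\<forall>t. (%c. \<sigma> c t)\<in>borel_measurable \<nu>)" if \<sigma>: "\<forall>c\<in>space \<nu>. \<sigma> c\<in>l2_chains n (\<Psi> c)"
 proof -
  have "(%c. chain_inner n (\<sigma> c) (xi \<Psi> t c))\<in>borel_measurable \<nu> \<longleftrightarrow> (%c. \<sigma> c t)\<in>borel_measurable \<nu>"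
   if "t\<in>ordered_simplices n (Delta D R)" for t
   by (rule measurable_cong) (use chain_inner_xi that \<sigma> in blast)
  moreover have "(%c. \<sigma> c t)\<in>borel_measurable \<nu>" if t: "t \<notin> ordered_simplices n (Delta D R)" for t
  proof -
   have "\<sigma> c t=0" if c: "c\<in>space \<nu>" for c
    using l2_chainsD(2)[OF bspec[OF \<sigma> c], of t] t PsiD(1)[OF c] by (auto simp: ordered_simplices_def)
   thus ?thesis by (rule measurable_cong[THEN iffD2]) (assumption, rule borel_measurable_const)
  qed
  ultimately show ?thesis by blast
 qed
 thus ?thesis unfolding direct_integral_def fld_def Re_chain_inner by blast
qed

lemma measurable_ip:
 assumes \<sigma>: "fld \<sigma>" "fld \<tau>"
 shows "(%c. ip (\<sigma> c) (\<tau> c))\<in>borel_measurable \<nu>"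
proof (rule measurable_has_sum[OF countable_lists_NG])
 show "(%c. \<sigma> c t * cnj (\<tau> c t))\<in>borel_measurable \<nu>" for t by (intro borel_measurable_times measurable_cnj fldD \<sigma>)
 fix c assume c: "c\<in>space \<nu>"
 have "((%t. \<sigma> c t * cnj (\<tau> c t)) has_sum ip (\<sigma> c) (\<tau> c)) UNIV"
  unfolding ip_def by (rule has_sum_infsum[OF l2_prod(2)]) (use fld_l2 \<sigma> c in blast)+
 moreover have "\<sigma> c t=0" if "t \<notin> lists (NG R)" for t using l2_chainsD(2)[OF fldD(1)[OF \<sigma>(1) c]] ordered_lists[OF c] that by blast
 ultimately show "((%t. \<sigma> c t * cnj (\<tau> c t)) has_sum ip (\<sigma> c) (\<tau> c)) (lists (NG R))"
  by (rule_tac has_sum_cong_neutral[THEN iffD1, rotated -1]) auto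
qed

lemma integrable_nsq:
 assumes "\<sigma>\<in>DI"
 shows "integrable \<nu> (%c. nsq (\<sigma> c) / fact (n + 1))"
proof (rule integrableI_nonneg)
 have "nsq (\<sigma> c)=Re (ip (\<sigma> c) (\<sigma> c))" for c by (simp add: ip_self)
 thus "(%c. nsq (\<sigma> c) / fact (n + 1))\<in>borel_measurable \<nu>"
  using measurable_ip[of \<sigma> \<sigma>] assms DI_iff by (auto intro!: borel_measurable_divide borel_measurable_Re)
qed (use assms DI_iff in auto)

lemma integrable_inner:
 assumes "\<sigma>\<in>DI" "\<tau>\<in>DI"
 shows "integrable \<nu> (%c. chain_inner n (\<sigma> c) (\<tau> c))"
proof (rule Bochner_Integration.integrable_bound[OF Bochner_Integration.integrable_add[OF integrable_nsq[OF assms(1)] integrable_nsq[OF assms(2)]]])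
 have f: "fld \<sigma>" "fld \<tau>" using assms DI_iff by auto
 show "(%c. chain_inner n (\<sigma> c) (\<tau> c))\<in>borel_measurable \<nu>"
  unfolding chain_inner_ip by (intro borel_measurable_divide measurable_ip f) simp
 have le: "norm (ip (\<sigma> c) (\<tau> c) / fact (n + 1)) \<le> nsq (\<sigma> c) / fact (n + 1) + nsq (\<tau> c) / fact (n + 1)" if c: "c\<in>space \<nu>" for c
  using norm_ip_le[OF fld_l2[OF f(1) c] fld_l2[OF f(2) c], of 1]
  unfolding norm_divide norm_fact add_divide_distrib[symmetric] by (intro divide_right_mono) simp_all
 show "AE c in \<nu>. norm (chain_inner n (\<sigma> c) (\<tau> c)) \<le> norm (nsq (\<sigma> c) / fact (n + 1) + nsq (\<tau> c) / fact (n + 1))"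
 proof (rule AE_I2)
  fix c assume "c\<in>space \<nu>"
  from order_trans[OF le[OF this] abs_ge_self]
  show "norm (chain_inner n (\<sigma> c) (\<tau> c)) \<le> norm (nsq (\<sigma> c) / fact (n + 1) + nsq (\<tau> c) / fact (n + 1))"
   unfolding chain_inner_ip real_norm_def .
 qed
qed

lemma field_inner_diff:
 assumes "\<sigma>\<in>DI" "\<sigma>'\<in>DI" "\<tau>\<in>DI"
 shows "field_inner \<nu> n (\<sigma> - \<sigma>') \<tau>=field_inner \<nu> n \<sigma> \<tau> - field_inner \<nu> n \<sigma>' \<tau>"
proof -
 have f: "fld \<sigma>" "fld \<sigma>'" "fld \<tau>" using assms DI_iff by auto
 have "field_inner \<nu> n (\<sigma> - \<sigma>') \<tau>=(\<integral>c. chain_inner n (\<sigma> c) (\<tau> c) - chain_inner n (\<sigma>' c) (\<tau> c) \<partial>\<nu>)"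
  unfolding field_inner_def
 proof (rule Bochner_Integration.integral_cong[OF refl])
  fix c assume c: "c\<in>space \<nu>"
  have "(\<sigma> - \<sigma>') c=(%t. \<sigma> c t - \<sigma>' c t)" by (simp add: fun_eq_iff)
  thus "chain_inner n ((\<sigma> - \<sigma>') c) (\<tau> c)=chain_inner n (\<sigma> c) (\<tau> c) - chain_inner n (\<sigma>' c) (\<tau> c)"
   using ip_diff_left[OF fld_l2[OF f(1) c] fld_l2[OF f(2) c] fld_l2[OF f(3) c]]
   by (simp add: chain_inner_ip diff_divide_distrib del: fact_Suc)
 qed
 thus ?thesis unfolding field_inner_def by (simp add: integrable_inner assms)
qed

lemma field_inner_cnj: "field_inner \<nu> n \<tau> \<sigma>=cnj (field_inner \<nu> n \<sigma> \<tau>)"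
proof -
 have "chain_inner n (\<tau> c) (\<sigma> c)=cnj (chain_inner n (\<sigma> c) (\<tau> c))" for c
  using ip_cnj[of "\<tau> c" "\<sigma> c"] by (simp add: chain_inner_ip del: fact_Suc)
 thus ?thesis by (simp add: field_inner_def)
qed

text \<open>In the realisation the group acts by one fixed map on all fibres. A coordinate of a
  translated field is therefore another coordinate of the same field, cut off to those c for which
  the simplex is present.\<close>

lemma fld_PP:
 assumes \<sigma>: "fld \<sigma>"
 shows "fld (PP \<sigma>)"
 unfolding fld_def
proof (intro conjI ballI allI)
 show "isoP G \<rho> (NK c) (\<sigma> c)\<in>l2_chains n (\<Psi> c)" if c: "c\<in>space \<nu>" for c
  using isoP_in[OF rho PsiD(3,4)[OF c], of "\<sigma> c" n] fldD(1)[OF \<sigma> c] by simp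
 fix t
 have ca: "chain_act G (NK c) g (\<sigma> c) t=(if set t\<in>\<Psi> c then \<sigma> c (map (NG_act (inv g)) t) else 0)" for c g
 proof -
  have "map (act (NK c) (inv g)) t=map (NG_act (inv g)) t" if "set t\<in>\<Psi> c"
   using that by (auto simp: NG_complex_def)
  thus ?thesis by (cases "set t\<in>\<Psi> c") (simp_all add: chain_act_def del: map_eq_conv)
 qed
 show "(%c. isoP G \<rho> (NK c) (\<sigma> c) t)\<in>borel_measurable \<nu>"
  unfolding isoP_def ca
  by (intro borel_measurable_sum borel_measurable_times borel_measurable_const measurable_if_Psi fldD(2)[OF \<sigma>])
qed

lemma DI_PP: "\<sigma>\<in>DI ==> PP \<sigma>\<in>DI"
proof -
 assume \<sigma>: "\<sigma>\<in>DI"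
 hence f: "fld \<sigma>" using DI_iff by blast
 have "(\<integral>\<^sup>+c. ennreal (nsq (isoP G \<rho> (NK c) (\<sigma> c)) / fact (n + 1)) \<partial>\<nu>)\<le>(\<integral>\<^sup>+c. ennreal (nsq (\<sigma> c) / fact (n + 1)) \<partial>\<nu>)"
 proof (rule nn_integral_mono)
  fix c assume c: "c\<in>space \<nu>"
  have "nsq (isoP G \<rho> (NK c) (\<sigma> c)) \<le> nsq (\<sigma> c)" by (rule nsq_isoP[OF rho PsiD(3,4)[OF c], of _ n]) (use fldD(1)[OF f c] in simp)
  thus "ennreal (nsq (isoP G \<rho> (NK c) (\<sigma> c)) / fact (n + 1)) \<le> ennreal (nsq (\<sigma> c) / fact (n + 1))"
   by (intro ennreal_leI divide_right_mono) simp_all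
 qed
 thus ?thesis using \<sigma> fld_PP[OF f] unfolding DI_iff by (meson le_less_trans)
qed

lemma DI_bounded:
 assumes f: "fld \<sigma>" and b: "!!c. c\<in>space \<nu> ==> nsq (\<sigma> c) \<le> B"
 shows "\<sigma>\<in>DI"
proof -
 have "(\<integral>\<^sup>+c. ennreal (nsq (\<sigma> c) / fact (n + 1)) \<partial>\<nu>)\<le>(\<integral>\<^sup>+c. ennreal (B / fact (n + 1)) \<partial>\<nu>)"
  by (intro nn_integral_mono ennreal_leI divide_right_mono b) simp_all
 also have "... < \<infinity>" using prob_space.emeasure_space_1[OF prob] by (simp del: fact_Suc)
 finally show ?thesis using f DI_iff by blast
qed

text \<open>The kernel entries depend on c only through the presence of a simplex, and the step size
  is the same for all c. So each iterate is measurable, and the projection is their pointwise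
  limit.\<close>

lemma fld_hproj:
 assumes v: "fld v"
 shows "fld (%c. hproj D n (\<Psi> c) (v c))"
 unfolding fld_def
proof (intro conjI ballI allI)
 show "hproj D n (\<Psi> c) (v c)\<in>l2_chains n (\<Psi> c)" if c: "c\<in>space \<nu>" for c by (rule hproj_in[OF bounded[OF c] fldD(1)[OF v c]])
 have mb: "(%c. bdk m (\<Psi> c) u t)\<in>borel_measurable \<nu>" for m u t
 proof -
  have "bdk m (\<Psi> c) u t=(if set t\<in>\<Psi> c then if m ~= 0 & length t=m + 1 & distinct t then alt_entry m t u / fact (m + 1) else 0 else 0)" for c
   by (simp add: bdk_def ordered_simplices_def)
  thus ?thesis by (simp only:) (intro measurable_if_Psi borel_measurable_const)
 qed
 have k1: "(%c. kop (bdk m (\<Psi> c)) (w c) u)\<in>borel_measurable \<nu>" if w: "!!t. (%c. w c t)\<in>borel_measurable \<nu>" for m w u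
  by (rule measurable_kop[OF countable_lists_NG mb w sparse_bdk[OF bounded]]) (use ordered_lists bdk_nonzeroD(2) in blast)+
 have k2: "(%c. kop (adj (bdk m (\<Psi> c))) (w c) u)\<in>borel_measurable \<nu>" if w: "!!t. (%c. w c t)\<in>borel_measurable \<nu>" for m w u
 proof (rule measurable_kop[OF countable_lists_NG _ w sparse_adj[OF sparse_bdk[OF bounded]]])
  show "(%c. adj (bdk m (\<Psi> c)) u t)\<in>borel_measurable \<nu>" for u t unfolding adj_def by (rule measurable_cnj[OF mb])
  fix c u t assume c: "c\<in>space \<nu>" and "adj (bdk m (\<Psi> c)) u t ~= 0"
  hence nz: "bdk m (\<Psi> c) t u ~= 0" by (simp add: adj_def)
  show "t\<in>lists (NG R)"
   using ordered_lists[OF c bdk_nonzeroD(2)[OF nz]] bdk_nonzeroD(5)[OF nz] by (auto simp: in_lists_conv_set)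
 qed
 define A where "A c=pos_op.A (lapk n (\<Psi> c)) (CC n D)" for c
 have it: "(%c. (A c ^^ k) (v c) t)\<in>borel_measurable \<nu>" for k t
 proof (induction k arbitrary: t)
  case 0
  show ?case using fldD(2)[OF v] by simp
 next
  case (Suc k)
  have lm: "(%c. lapk n (\<Psi> c) ((A c ^^ k) (v c)) t)\<in>borel_measurable \<nu>"
   unfolding lapk_def by (intro borel_measurable_add borel_measurable_times borel_measurable_const k1 k2 Suc)
  have "(A c ^^ Suc k) (v c) t=(A c ^^ k) (v c) t - complex_of_real (1 / CC n D) * lapk n (\<Psi> c) ((A c ^^ k) (v c)) t"
   if c: "c\<in>space \<nu>" for c
  proof -
   note p = pos_op_lapk[OF bounded[OF c], of n]
   show ?thesis unfolding A_def[of c] funpow.simps comp_apply pos_op.A_def[OF p] pos_op.a_def[OF p] ..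
  qed
  thus ?case
   by (rule measurable_cong[THEN iffD2]) (assumption, intro borel_measurable_diff borel_measurable_times borel_measurable_const Suc lm)
 qed
 show "(%c. hproj D n (\<Psi> c) (v c) t)\<in>borel_measurable \<nu>" for t
  by (rule borel_measurable_LIMSEQ_metric[OF it, of "%k. 2 * k"])
   (use hproj_tendsto[OF bounded fldD(1)[OF v]] in \<open>simp add: A_def\<close>)
qed

lemma xi_chain:
 assumes t: "t\<in>ordered_simplices n (Delta D R)"
 shows "xi \<Psi> t c\<in>l2_chains n (\<Psi> c)"
proof (cases "set t\<in>\<Psi> c")
 case True
 hence "t\<in>ordered_simplices n (\<Psi> c)" using t by (simp add: ordered_simplices_def)
 thus ?thesis using True oriented_in_l2_chains by (simp add: xi_def)
next
 case False
 thus ?thesis by (auto simp: xi_def intro: l2_chainsI)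
qed

definition "pdens t c=(if set t\<in>\<Psi> c then character \<rho> \<one> * dens G D n (character \<rho>) (NK c) t else 0)"

text \<open>The choice of the projection in \<open>orthogonal_projection\<close> is not pinned down pointwise, but its
 inner product with \<open>\<xi>\<close> does not depend on it.\<close>

lemma projection_inner:
 assumes t: "t\<in>ordered_simplices n (Delta D R)"
 shows "field_inner \<nu> n (orthogonal_projection (isotypic_projector G \<Psi> \<rho> ` l2_harmonic D R \<Psi> \<nu> n) (field_inner \<nu> n) (xi \<Psi> t)) (xi \<Psi> t) =
   (\<integral>c. cnj (pdens t c) \<partial>\<nu>)"
  and "(%c. pdens t c)\<in>borel_measurable \<nu>" "c\<in>space \<nu> ==> norm (pdens t c) \<le> sqrt (fact (n + 1))"
proof -
 let ?W = "isotypic_projector G \<Psi> \<rho> ` l2_harmonic D R \<Psi> \<nu> n" and ?\<xi> = "xi \<Psi> t"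
 define h where "h c=hproj D n (\<Psi> c) (?\<xi> c)" for c
 have fx: "fld ?\<xi>"
  unfolding fld_def
 proof (intro conjI ballI allI xi_chain[OF t])
  have "xi \<Psi> t c u=(if set t\<in>\<Psi> c then oriented t u else 0)" for c u by (simp add: xi_def)
  thus "(%c. xi \<Psi> t c u)\<in>borel_measurable \<nu>" for u by (simp only:) (intro measurable_if_Psi borel_measurable_const)
 qed
 have nx: "nsq (?\<xi> c) \<le> nsq (oriented t)" for c
  using nsq_nonneg[of "oriented t"] by (auto simp: xi_def nsq_def[of "%_. 0"])
 have xD: "?\<xi>\<in>DI" by (rule DI_bounded[OF fx nx])
 have hD: "h\<in>DI" unfolding h_def
  by (rule DI_bounded[OF fld_hproj[OF fx]]) (use nx nsq_hproj[OF bounded fldD(1)[OF fx]] order_trans in blast)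
 have hf: "fld h" using hD DI_iff by blast
 have hh: "h\<in>l2_harmonic D R \<Psi> \<nu> n"
  unfolding l2_harmonic_def
 proof (intro CollectI conjI hD AE_I2)
  fix c assume c: "c\<in>space \<nu>"
  show "laplacian n (\<Psi> c) (h c)=(%_. 0)"
   unfolding laplacian_eq_lapk[OF bounded[OF c] fldD(1)[OF hf c]]
   unfolding h_def by (rule lapk_hproj[OF bounded[OF c] fldD(1)[OF fx c]])
 qed
 let ?w = "PP h"
 have wD: "?w\<in>DI" by (rule DI_PP[OF hD])
 have wW: "?w\<in>?W" using hh unfolding isotypic_projector_eq by blast
 have WD: "u\<in>DI" if "u\<in>?W" for u using that DI_PP unfolding isotypic_projector_eq l2_harmonic_def by blast
 have orth: "field_inner \<nu> n (?\<xi> - ?w) u=0" if u: "u\<in>?W" for u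
 proof -
  obtain \<sigma> where s: "\<sigma>\<in>l2_harmonic D R \<Psi> \<nu> n" "u=PP \<sigma>" using u unfolding isotypic_projector_eq by blast
  have sf: "fld \<sigma>" and ae: "AE c in \<nu>. laplacian n (\<Psi> c) (\<sigma> c)=(%_. 0)" using s(1) DI_iff unfolding l2_harmonic_def by auto
  have "AE c in \<nu>. chain_inner n ((?\<xi> - ?w) c) (u c)=0"
   using ae
  proof (rule AE_mp, intro AE_I2 impI)
   fix c assume c: "c\<in>space \<nu>" and l: "laplacian n (\<Psi> c) (\<sigma> c)=(%_. 0)"
   have "lapk n (\<Psi> c) (\<sigma> c)=(%_. 0)" using l laplacian_eq_lapk[OF bounded[OF c] fldD(1)[OF sf c]] by simp
   hence "ip (%t. ?\<xi> c t - ?w c t) (PP \<sigma> c)=0"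
    using isoP_orth[OF rho PsiD(3,4)[OF c], of "?\<xi> c" n "\<sigma> c"] fldD(1)[OF fx c] fldD(1)[OF sf c] by (simp add: h_def)
   moreover have "(?\<xi> - ?w) c=(%t. ?\<xi> c t - ?w c t)" by (simp add: fun_eq_iff)
   ultimately show "chain_inner n ((?\<xi> - ?w) c) (u c)=0" by (simp add: chain_inner_ip s(2) del: fact_Suc)
  qed
  thus ?thesis unfolding field_inner_def by (rule integral_eq_zero_AE)
 qed
 define v where "v = orthogonal_projection ?W (field_inner \<nu> n) ?\<xi>"
 have "v\<in>?W & (\<forall>u\<in>?W. field_inner \<nu> n (?\<xi> - v) u=0)"
  unfolding v_def orthogonal_projection_def by (rule someI[of _ ?w]) (use wW orth in blast)
 hence v: "v\<in>?W" "field_inner \<nu> n (?\<xi> - v) ?w=0" using wW by blast+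
 \<comment> \<open>Both v and the explicit field w satisfy the orthogonality relation, so <v,\<xi>>
   = cnj <\<xi>,v> = cnj <w,v> = <v,w> = <\<xi>,w>. This is the conjugate of <w,\<xi>>, and the
   conjugation is carried along to the final formula.\<close>
 have e1: "field_inner \<nu> n ?\<xi> ?w=field_inner \<nu> n v ?w" using v(2) field_inner_diff[OF xD WD[OF v(1)] wD] by simp
 have e2: "field_inner \<nu> n ?\<xi> v=field_inner \<nu> n ?w v" using orth[OF v(1)] field_inner_diff[OF xD wD WD[OF v(1)]] by simp
 have "field_inner \<nu> n v ?\<xi>=cnj (field_inner \<nu> n ?\<xi> v)" by (rule field_inner_cnj)
 also have "...=field_inner \<nu> n v ?w" unfolding e2 by (rule field_inner_cnj[symmetric])
 also have "...=cnj (field_inner \<nu> n ?w ?\<xi>)" unfolding e1[symmetric] by (rule field_inner_cnj)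
 also have "...=(\<integral>c. cnj (chain_inner n (?w c) (?\<xi> c)) \<partial>\<nu>)" unfolding field_inner_def by simp
 also have "...=(\<integral>c. cnj (?w c t) \<partial>\<nu>)"
  by (rule Bochner_Integration.integral_cong[OF refl]) (use chain_inner_xi[OF _ fldD(1)[OF fld_PP[OF hf]] t] in simp)
 finally have e: "field_inner \<nu> n v ?\<xi>=(\<integral>c. cnj (?w c t) \<partial>\<nu>)" .
 have wt: "?w c t=pdens t c & norm (pdens t c) \<le> sqrt (fact (n + 1))" if c: "c\<in>space \<nu>" for c
 proof (cases "set t\<in>\<Psi> c")
  case True
  hence o: "t\<in>ordered_simplices n (faces (NK c))" using t by (simp add: ordered_simplices_def)
  thus ?thesis
   using isoP_dens[OF rho PsiD(3,4)[OF c] o] norm_isoP_hproj[OF rho PsiD(3,4)[OF c] o, of t] True by (simp add: pdens_def h_def xi_def)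
 next
  case False
  hence "?w c t=0" using l2_chainsD(2)[OF fldD(1)[OF fld_PP[OF hf] c]] by (simp add: ordered_simplices_def)
  thus ?thesis using False by (simp add: pdens_def)
 qed
 show "field_inner \<nu> n (orthogonal_projection ?W (field_inner \<nu> n) ?\<xi>) ?\<xi>=(\<integral>c. cnj (pdens t c) \<partial>\<nu>)"
  unfolding v_def[symmetric] e by (rule Bochner_Integration.integral_cong[OF refl]) (use wt in simp)
 have "pdens t\<in>borel_measurable \<nu> \<longleftrightarrow> (%c. ?w c t)\<in>borel_measurable \<nu>" by (rule measurable_cong) (use wt in simp)
 thus "(%c. pdens t c)\<in>borel_measurable \<nu>" using fldD(2)[OF fld_PP[OF hf]] by simp
 show "c\<in>space \<nu> ==> norm (pdens t c) \<le> sqrt (fact (n + 1))" using wt by blast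
qed

end

text \<open>At each point only finitely many terms are nonzero, but which ones depends on the point.
  The uniform bound on sums of norms makes the integrals absolutely summable and dominates the
  partial sums along an enumeration of S.\<close>

lemma infsum_integral:
 fixes f :: "'s => 'c => complex"
 assumes M: "prob_space M" and S: "countable S" and f: "!!s. s\<in>S ==> f s\<in>borel_measurable M"
  and fin: "!!c. c\<in>space M ==> finite {s\<in>S. f s c ~= 0}"
  and bound: "!!c F. c\<in>space M ==> finite F ==> F \<subseteq> S ==> (\<Sum>s\<in>F. norm (f s c)) \<le> B"
 shows "(\<Sum>\<^sub>\<infinity>s\<in>S. \<integral>c. f s c \<partial>M)=(\<integral>c. (\<Sum>s | s\<in>S & f s c ~= 0. f s c) \<partial>M)"
  "integrable M (%c. \<Sum>s | s\<in>S & f s c ~= 0. f s c)"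
proof -
 interpret prob_space M by (rule M)
 let ?F = "%N. {t\<in>S. to_nat_on S t < N}"
 let ?g = "%c. \<Sum>s | s\<in>S & f s c ~= 0. f s c"
 note finF = filterlim_initial_segments(1)[OF S] and lim = filterlim_initial_segments(2)[OF S]
 have hs: "((%s. f s c) has_sum ?g c) S" if c: "c\<in>space M" for c
  by (rule has_sum_cong_neutral[THEN iffD1, rotated -1, OF has_sum_finite[OF fin[OF c]]]) auto
 have gm: "?g\<in>borel_measurable M" by (rule measurable_has_sum[OF S f hs])
 have le: "norm (\<Sum>s\<in>F. f s c) \<le> B" if "c\<in>space M" "finite F" "F \<subseteq> S" for c F
  using bound[OF that] norm_sum[of "%s. f s c" F] by (rule order_trans[rotated])
 have sm: "(%c. \<Sum>s\<in>F. f s c)\<in>borel_measurable M" if "F \<subseteq> S" for F using f that by (intro borel_measurable_sum) auto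
 have int: "integrable M (f s)" if s: "s\<in>S" for s
  by (rule integrable_const_bound[of _ B]) (use le[of _ "{s}"] s f in auto)
 show "integrable M ?g"
  by (rule integrable_const_bound[OF AE_I2 gm]) (rule le, use fin in auto)
 have dom: "(%N. \<integral>c. (\<Sum>s\<in>?F N. f s c) \<partial>M) \<longlonglongrightarrow> (\<integral>c. ?g c \<partial>M)"
 proof (rule integral_dominated_convergence[of _ _ _ "%_. B"])
  show "AE c in M. (%N. \<Sum>s\<in>?F N. f s c) \<longlonglongrightarrow> ?g c"
   by (rule AE_I2) (use filterlim_compose[OF hs[unfolded has_sum_def] lim] in blast)
  show "AE c in M. norm (\<Sum>s\<in>?F N. f s c) \<le> B" for N by (rule AE_I2) (rule le[OF _ finF], auto)
 qed (use gm sm in \<open>auto simp: integrable_const\<close>)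
 have "(%s. \<integral>c. f s c \<partial>M) summable_on S"
 proof (rule abs_summable_summable, rule nonneg_bdd_above_summable_on)
  show "bdd_above (sum (%s. norm (\<integral>c. f s c \<partial>M)) ` {F. F \<subseteq> S & finite F})"
  proof (rule bdd_aboveI2)
   fix F assume "F\<in>{F. F \<subseteq> S & finite F}"
   hence F: "F \<subseteq> S" "finite F" by auto
   have "(\<Sum>s\<in>F. norm (\<integral>c. f s c \<partial>M))\<le>(\<Sum>s\<in>F. \<integral>c. norm (f s c) \<partial>M)" by (rule sum_mono) (rule integral_norm_bound)
   also have "...=(\<integral>c. (\<Sum>s\<in>F. norm (f s c)) \<partial>M)"
    by (rule Bochner_Integration.integral_sum[symmetric]) (use int F in auto)
   also have "...\<le>(\<integral>c. B \<partial>M)"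
    by (rule integral_mono) (use int F bound in \<open>auto intro!: Bochner_Integration.integrable_sum\<close>)
   finally show "(\<Sum>s\<in>F. norm (\<integral>c. f s c \<partial>M)) \<le> B" by (simp add: prob_space)
  qed
 qed simp
 hence "((%s. \<integral>c. f s c \<partial>M) has_sum (\<Sum>\<^sub>\<infinity>s\<in>S. \<integral>c. f s c \<partial>M)) S" by (rule has_sum_infsum)
 from filterlim_compose[OF this[unfolded has_sum_def] lim]
 have "(%N. \<Sum>s\<in>?F N. \<integral>c. f s c \<partial>M) \<longlonglongrightarrow> (\<Sum>\<^sub>\<infinity>s\<in>S. \<integral>c. f s c \<partial>M)" .
 moreover have "(\<Sum>s\<in>?F N. \<integral>c. f s c \<partial>M)=(\<integral>c. (\<Sum>s\<in>?F N. f s c) \<partial>M)" for N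
  by (rule Bochner_Integration.integral_sum[symmetric]) (use int in auto)
 ultimately show "(\<Sum>\<^sub>\<infinity>s\<in>S. \<integral>c. f s c \<partial>M)=(\<integral>c. ?g c \<partial>M)" using dom LIMSEQ_unique by simp
qed

section \<open>The multiplicity as an integral over rooted complexes\<close>

definition rdens :: "('g, 'b) monoid_scheme => nat => nat => ('g => complex) => 'g iso_class => complex"
 where "rdens G D n \<psi> c=(case rep c of (K, P) => vdens G D n \<psi> K (SOME x. x\<in>P))"

text \<open>Isomorphism invariance moves the vertex into the chosen representative, and translation
  invariance moves it to the chosen point of the root orbit.\<close>

lemma (in fin_group) rdens_eq:
 assumes \<rho>: "is_rep G \<rho>" and c: "c\<in>SC 1 D G" and r: "rep c=(K, P)" and L: "G_complex G L" "degree_le D L"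
  and f: "giso G f L K" and x: "x\<in>verts L" "f x\<in>P"
 shows "vdens G D n (character \<rho>) L x = rdens G D n (character \<rho>) c"
proof -
 note K = SC1_rep(1)[OF c r]
 note KG = markedD[OF K]
 have P: "P\<in>set [P]" by simp
 obtain p where p: "p\<in>verts K" "P = orbit G (act K) p" using KG(3)[OF P] by (auto simp: orbits_def)
 have all: "vdens G D n (character \<rho>) K y=vdens G D n (character \<rho>) K p" if y: "y\<in>P" for y
  using y vdens_translate[OF \<rho> KG(1,2) p(1)] unfolding p(2) orbit_def by blast
 have "(SOME x. x\<in>P)\<in>P" using x(2) by (rule someI)
 thus ?thesis
  using vdens_giso[OF f L KG(1,2) x(1)] all[OF x(2)] all by (simp add: rdens_def r)
qed

context random_realised
begin

text \<open>The trace is evaluated fibrewise: by \<open>infsum_integral\<close> the sum over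
  simplices goes under the integral. In each fibre one X survives and its points contribute equally,
  which cancels |X|; the remaining factor is the dimension of \<rho>, divided out in
  \<open>l2_multiplicity\<close>.\<close>

lemma l2_multiplicity_eq:
 "l2_multiplicity D G R \<Psi> n \<rho> \<nu>=(\<integral>c. cnj (rdens G D n (character \<rho>) c) \<partial>\<nu>) / of_nat (n + 1)"
  "integrable \<nu> (rdens G D n (character \<rho>))"
proof -
 note irr = irr_is_rep[OF rho]
 have \<chi>0: "character \<rho> \<one> ~= 0" using rho by (simp add: character_one[OF irr] irreducible_rep_def)
 let ?S = "%x. {s\<in>Delta D R. card s=n + 1 & x\<in>s}"
 let ?t = "%s. SOME t. distinct t & set t = s"
 let ?W = "isotypic_projector G \<Psi> \<rho> ` l2_harmonic D R \<Psi> \<nu> n"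
 let ?v = "%x c. character \<rho> \<one> * vdens G D n (character \<rho>) (NK c) x"
 have o: "?t s\<in>ordered_simplices n (Delta D R)" "set (?t s) = s" if "s\<in>?S x" for s x
  using SOME_list[of s] that by (auto simp: ordered_simplices_def Delta_def dest: distinct_card)
 \<comment> \<open>A simplex containing x is a subset of x together with its at most D neighbours,
   whence 2^(D+1).\<close>
 have nb: "finite (\<Psi> c \<inter> ?S x) & card (\<Psi> c \<inter> ?S x)\<le>2 ^ Suc D" if c: "c\<in>space \<nu>" for c x
 proof -
  let ?N = "insert x {y. y ~= x & {x, y}\<in>\<Psi> c}"
  have b: "finite {y. y ~= x & {x, y}\<in>\<Psi> c}" "card {y. y ~= x & {x, y}\<in>\<Psi> c} \<le> D" "simplicial_complex (\<Psi> c)"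
   using bounded[OF c] unfolding bdd_complex_def by blast+
  have "\<Psi> c \<inter> ?S x \<subseteq> Pow ?N"
  proof
   fix s assume s: "s\<in>\<Psi> c \<inter> ?S x"
   have "{x, y}\<in>\<Psi> c" if "y\<in>s" for y by (rule simp_cx_subset[OF b(3), of s]) (use s that in auto)
   thus "s\<in>Pow ?N" by auto
  qed
  moreover have "card (Pow ?N)\<le>2 ^ Suc D" using b(1,2) by (simp add: card_Pow)
  ultimately show ?thesis using b(1) by (meson card_mono finite.insertI finite_Pow_iff finite_subset le_trans)
 qed
 have countS: "countable (?S x)" for x
  by (rule countable_subset[OF _ countable_Collect_finite_subset[OF countable_NG]]) (auto simp: Delta_def)
 let ?f = "%s c. cnj (pdens (?t s) c)"
 have zero: "?f s c=0" if "s\<in>?S x" "s \<notin> \<Psi> c" for s x c using o(2)[OF that(1)] that(2) by (simp add: pdens_def)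
 have fm: "?f s\<in>borel_measurable \<nu>" if "s\<in>?S x" for s x by (rule measurable_cnj[OF projection_inner(2)[OF o(1)[OF that]]])
 have ff: "finite {s\<in>?S x. ?f s c ~= 0}" if c: "c\<in>space \<nu>" for x c
  by (rule finite_subset[OF _ conjunct1[OF nb[OF c, of x]]]) (use zero in blast)
 have bd: "(\<Sum>s\<in>F. norm (?f s c))\<le>2 ^ Suc D * sqrt (fact (n + 1))" if c: "c\<in>space \<nu>" and F: "finite F" "F\<subseteq>?S x" for F x c
 proof -
  have "(\<Sum>s\<in>F. norm (?f s c))=(\<Sum>s\<in>F \<inter> \<Psi> c. norm (?f s c))"
  proof (rule sum.mono_neutral_right[OF F(1)], blast, rule ballI)
   fix s assume s: "s\<in>F - F \<inter> \<Psi> c"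
   have "?f s c=0" by (rule zero[of s x]) (use s F(2) in blast)+
   thus "norm (?f s c)=0" by (simp only: norm_zero)
  qed
  also have "... \<le> of_nat (card (F \<inter> \<Psi> c)) * sqrt (fact (n + 1))"
  proof (rule sum_bounded_above)
   fix s assume "s\<in>F \<inter> \<Psi> c"
   hence s: "s\<in>?S x" using F(2) by blast
   show "norm (?f s c) \<le> sqrt (fact (n + 1))" unfolding complex_mod_cnj by (rule projection_inner(3)[OF o(1)[OF s] c])
  qed
  also have "...\<le>2 ^ Suc D * sqrt (fact (n + 1))"
  proof (rule mult_right_mono)
   have "card (F \<inter> \<Psi> c) \<le> card (\<Psi> c \<inter> ?S x)" by (rule card_mono[OF conjunct1[OF nb[OF c]]]) (use F(2) in blast)
   hence "real (card (F \<inter> \<Psi> c)) \<le> real (2 ^ Suc D)" using conjunct2[OF nb[OF c, of x]] by (intro of_nat_mono) linarith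
   thus "real (card (F \<inter> \<Psi> c))\<le>2 ^ Suc D" by simp
  qed simp
  finally show ?thesis .
 qed
 have sv: "(\<Sum>s | s\<in>?S x & ?f s c ~= 0. ?f s c)=cnj (?v x c)" if c: "c\<in>space \<nu>" for x c
 proof -
  have "(\<Sum>s | s\<in>?S x & ?f s c ~= 0. ?f s c)=(\<Sum>s\<in>\<Psi> c \<inter> ?S x. ?f s c)"
   by (rule sum.mono_neutral_left[OF conjunct1[OF nb[OF c]]]) (use zero in blast)+
  also have "\<Psi> c \<inter> ?S x={s\<in>\<Psi> c. card s=n + 1 & x\<in>s}" using PsiD(1)[OF c] by auto
  also have "(\<Sum>s\<in>{s\<in>\<Psi> c. card s=n + 1 & x\<in>s}. ?f s c)=cnj (?v x c)"
   unfolding vdens_def sum_distrib_left cnj_sum faces_NG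
  proof (rule sum.cong[OF refl])
   fix s assume s: "s\<in>{s\<in>\<Psi> c. card s=n + 1 & x\<in>s}"
   hence "s\<in>?S x" using PsiD(1)[OF c] by blast
   from o(2)[OF this] s show "?f s c=cnj (character \<rho> \<one> * dens G D n (character \<rho>) (NK c) (?t s))" by (simp add: pdens_def)
  qed
  finally show ?thesis .
 qed
 have II: "(\<Sum>\<^sub>\<infinity>s\<in>?S x. \<integral>c. ?f s c \<partial>\<nu>)=(\<integral>c. (\<Sum>s | s\<in>?S x & ?f s c ~= 0. ?f s c) \<partial>\<nu>)"
  "integrable \<nu> (%c. \<Sum>s | s\<in>?S x & ?f s c ~= 0. ?f s c)" for x
  by (rule infsum_integral[OF prob countS]; (rule fm ff bd; assumption))+
 have vi: "integrable \<nu> (%c. cnj (?v x c))" for x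
 proof -
  have "integrable \<nu> (%c. \<Sum>s | s\<in>?S x & ?f s c ~= 0. ?f s c) \<longleftrightarrow> integrable \<nu> (%c. cnj (?v x c))"
   by (rule Bochner_Integration.integrable_cong[OF refl]) (rule sv)
  thus ?thesis using II(2)[of x] by (rule iffD1)
 qed
 have tr: "(\<Sum>\<^sub>\<infinity>s\<in>?S (0, X, x). let \<xi>=xi \<Psi> (?t s) in
   field_inner \<nu> n (orthogonal_projection ?W (field_inner \<nu> n) \<xi>) \<xi> / (of_nat (card (fst X)) * of_nat (n + 1))) =
   (\<integral>c. cnj (?v (0, X, x) c) / (of_nat (card (fst X)) * of_nat (n + 1)) \<partial>\<nu>)" for X x
 proof -
  have "(\<Sum>\<^sub>\<infinity>s\<in>?S (0, X, x). let \<xi>=xi \<Psi> (?t s) in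
   field_inner \<nu> n (orthogonal_projection ?W (field_inner \<nu> n) \<xi>) \<xi> / (of_nat (card (fst X)) * of_nat (n + 1))) =
   (\<Sum>\<^sub>\<infinity>s\<in>?S (0, X, x). (\<integral>c. ?f s c \<partial>\<nu>)*(1 / (of_nat (card (fst X)) * of_nat (n + 1))))"
   unfolding Let_def by (rule infsum_cong) (simp only: projection_inner(1)[OF o(1)] times_divide_eq_right mult_1_right)
  also have "...=(\<Sum>\<^sub>\<infinity>s\<in>?S (0, X, x). \<integral>c. ?f s c \<partial>\<nu>)*(1 / (of_nat (card (fst X)) * of_nat (n + 1)))"
   by (rule infsum_cmult_left')
  also have "(\<Sum>\<^sub>\<infinity>s\<in>?S (0, X, x). \<integral>c. ?f s c \<partial>\<nu>)=(\<integral>c. cnj (?v (0, X, x) c) \<partial>\<nu>)"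
   unfolding II(1) by (rule Bochner_Integration.integral_cong[OF refl]) (rule sv)
  finally show ?thesis by simp
 qed
 have pw: "(\<Sum>X\<in>R. \<Sum>x\<in>fst X. cnj (?v (0, X, x) c) / (of_nat (card (fst X)) * of_nat (n + 1))) =
   cnj (character \<rho> \<one> * rdens G D n (character \<rho>) c) / of_nat (n + 1)" if c: "c\<in>space \<nu>" for c
 proof -
  have c1: "c\<in>SC 1 D G" using c by (simp add: sp)
  obtain K P where r: "rep c=(K, P)" by fastforce
  obtain X f where X: "X\<in>R" "base_orbit X\<subseteq>\<Union>(\<Psi> c)" "giso G f (NK c) K" "f ` base_orbit X=P"
   using PsiD(5)[OF c] r by blast
  note N = PsiD(3,4)[OF c]
  \<comment> \<open>If a point (0, Y, y) were a vertex, invariance and transitivity would put the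
    whole base orbit of \<open>Y\<close> into the complex, which contains only that of
    \<open>X\<close>. So no simplex contains the point and the sum is empty.\<close>
  have zv: "?v (0, Y, y) c=0" if Y: "Y\<in>R" "Y ~= X" "y\<in>fst Y" for Y y
  proof -
   have "(0, Y, y) \<notin> \<Union>(\<Psi> c)"
   proof
    assume m: "(0, Y, y)\<in>\<Union>(\<Psi> c)"
    have "base_orbit Y\<subseteq>\<Union>(\<Psi> c)"
    proof
     fix p assume "p\<in>base_orbit Y"
     then obtain z where z: "z\<in>fst Y" "p=(0, Y, z)" by (auto simp: base_orbit_def)
     obtain g where g: "g\<in>carrier G" "snd Y g y=z" using gsetD(3)[OF Y(1,3) z(1)] by blast
     have "act (NK c) g (0, Y, y)\<in>verts (NK c)" using Gcx_act(2)[OF N(1) g(1)] m by simp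
     moreover have "act (NK c) g (0, Y, y)=p" using m z g(2) by (simp add: NG_complex_def NG_act_def)
     ultimately show "p\<in>\<Union>(\<Psi> c)" by simp
    qed
    thus False using PsiD(6)[OF c] X(1,2) Y(1,2) by blast
   qed
   hence e: "{s\<in>faces (NK c). card s=n + 1 & (0, Y, y)\<in>s}={}" by auto
   show ?thesis unfolding vdens_def e by simp
  qed
  have xv: "?v (0, X, x) c=character \<rho> \<one> * rdens G D n (character \<rho>) c" if x: "x\<in>fst X" for x
  proof -
   have b: "(0, X, x)\<in>base_orbit X" using x by (simp add: base_orbit_def)
   have "(0, X, x)\<in>verts (NK c)" "f (0, X, x)\<in>P" using b X(2,4) by auto
   thus ?thesis using rdens_eq[OF irr c1 r N X(3)] by simp
  qed
  have "(\<Sum>X\<in>R. \<Sum>x\<in>fst X. cnj (?v (0, X, x) c) / (of_nat (card (fst X)) * of_nat (n + 1))) =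
   (\<Sum>Y\<in>{X}. \<Sum>x\<in>fst Y. cnj (?v (0, Y, x) c) / (of_nat (card (fst Y)) * of_nat (n + 1)))"
  proof (rule sum.mono_neutral_right[OF finite_R])
   show "{X} \<subseteq> R" using X(1) by simp
   show "\<forall>Y\<in>R - {X}. (\<Sum>y\<in>fst Y. cnj (?v (0, Y, y) c) / (of_nat (card (fst Y)) * of_nat (n + 1)))=0"
   proof (rule ballI, rule sum.neutral, rule ballI)
    fix Y y assume "Y\<in>R - {X}" "y\<in>fst Y"
    hence "?v (0, Y, y) c=0" by (intro zv) auto
    thus "cnj (?v (0, Y, y) c) / (of_nat (card (fst Y)) * of_nat (n + 1))=0" by (simp only: complex_cnj_zero div_0)
   qed
  qed
  also have "...=(\<Sum>x\<in>fst X. cnj (?v (0, X, x) c) / (of_nat (card (fst X)) * of_nat (n + 1)))" by simp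
  also have "...=(\<Sum>x\<in>fst X. cnj (character \<rho> \<one> * rdens G D n (character \<rho>) c) / (of_nat (card (fst X)) * of_nat (n + 1)))"
   by (rule sum.cong[OF refl]) (simp only: xv)
  also have "...=cnj (character \<rho> \<one> * rdens G D n (character \<rho>) c) / of_nat (n + 1)"
   using finite_gset[OF X(1)] gsetD(2)[OF X(1)] by (simp add: card_gt_0_iff del: complex_cnj_mult of_nat_Suc of_nat_add)
  finally show ?thesis .
 qed
 have int: "integrable \<nu> (%c. cnj (?v (0, X, x) c) / (of_nat (card (fst X)) * of_nat (n + 1)))" for X x
  by (rule integrable_divide_zero) (rule vi)
 have "integrable \<nu> (%c. \<Sum>X\<in>R. \<Sum>x\<in>fst X. cnj (?v (0, X, x) c) / (of_nat (card (fst X)) * of_nat (n + 1)))"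
  by (intro Bochner_Integration.integrable_sum int)
 hence "integrable \<nu> (%c. cnj (character \<rho> \<one> * rdens G D n (character \<rho>) c) / of_nat (n + 1))"
  by (rule Bochner_Integration.integrable_cong[OF refl, THEN iffD1, rotated]) (rule pw)
 hence "integrable \<nu> (%c. cnj (cnj (character \<rho> \<one> * rdens G D n (character \<rho>) c) / of_nat (n + 1))*(of_nat (n + 1) / character \<rho> \<one>))"
  by (intro integrable_mult_left) (rule integrable_cnj)
 thus "integrable \<nu> (rdens G D n (character \<rho>))" using \<chi>0 by (simp del: of_nat_Suc of_nat_add)
 have "vN_trace D R \<Psi> \<nu> n (orthogonal_projection ?W (field_inner \<nu> n)) =
   (\<Sum>X\<in>R. \<Sum>x\<in>fst X. \<integral>c. cnj (?v (0, X, x) c) / (of_nat (card (fst X)) * of_nat (n + 1)) \<partial>\<nu>)"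
  unfolding vN_trace_def tr ..
 also have "...=(\<Sum>X\<in>R. \<integral>c. (\<Sum>x\<in>fst X. cnj (?v (0, X, x) c) / (of_nat (card (fst X)) * of_nat (n + 1))) \<partial>\<nu>)"
  by (rule sum.cong[OF refl], rule Bochner_Integration.integral_sum[symmetric], rule int)
 also have "...=(\<integral>c. (\<Sum>X\<in>R. \<Sum>x\<in>fst X. cnj (?v (0, X, x) c) / (of_nat (card (fst X)) * of_nat (n + 1))) \<partial>\<nu>)"
  by (rule Bochner_Integration.integral_sum[symmetric], rule Bochner_Integration.integrable_sum, rule int)
 also have "...=(\<integral>c. cnj (character \<rho> \<one> * rdens G D n (character \<rho>) c) / of_nat (n + 1) \<partial>\<nu>)"
  by (rule Bochner_Integration.integral_cong[OF refl]) (rule pw)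
 also have "...=(\<integral>c. (character \<rho> \<one> / of_nat (n + 1)) * cnj (rdens G D n (character \<rho>) c) \<partial>\<nu>)"
  by (rule Bochner_Integration.integral_cong[OF refl]) (simp add: character_one[OF irr])
 also have "...=(character \<rho> \<one> / of_nat (n + 1))*(\<integral>c. cnj (rdens G D n (character \<rho>) c) \<partial>\<nu>)"
  by (rule integral_mult_right_zero)
 finally show "l2_multiplicity D G R \<Psi> n \<rho> \<nu>=(\<integral>c. cnj (rdens G D n (character \<rho>) c) \<partial>\<nu>) / of_nat (n + 1)"
  unfolding l2_multiplicity_def vN_dim_def using \<chi>0 by (simp del: of_nat_Suc of_nat_add)
qed

end

section \<open>Induction and multiplicities\<close>

text \<open>The densities are conjugate-linear in \<psi>; since the coefficients are natural
  numbers, conjugation leaves them unchanged.\<close>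

lemma rdens_sum:
 assumes "!!g. g\<in>carrier G ==> \<psi> g=(\<Sum>i\<in>I. of_nat (a i)*\<phi> i g)"
 shows "rdens G D n \<psi> c=(\<Sum>i\<in>I. of_nat (a i) * rdens G D n (\<phi> i) c)"
proof -
 obtain K P where r: "rep c=(K, P)" by fastforce
 have d: "dens G D n \<psi> K t=(\<Sum>i\<in>I. of_nat (a i) * dens G D n (\<phi> i) K t)" for t
 proof -
  let ?h = "%g. hproj D n (faces K) (oriented t) (map (act K (inv\<^bsub>G\<^esub> g)) t)"
  have "(\<Sum>g\<in>carrier G. cnj (\<psi> g)*?h g)=(\<Sum>g\<in>carrier G. \<Sum>i\<in>I. of_nat (a i)*(cnj (\<phi> i g)*?h g))"
   by (rule sum.cong[OF refl]) (simp add: assms sum_distrib_right mult.assoc)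
  also have "...=(\<Sum>i\<in>I. of_nat (a i)*(\<Sum>g\<in>carrier G. cnj (\<phi> i g)*?h g))"
   unfolding sum_distrib_left by (rule sum.swap)
  finally show ?thesis unfolding dens_def by (simp only: sum_divide_distrib[where A = I] times_divide_eq_right)
 qed
 have "rdens G D n \<psi> c=(\<Sum>s\<in>{s\<in>faces K. card s=n + 1 & (SOME x. x\<in>P)\<in>s}. \<Sum>i\<in>I. of_nat (a i) * dens G D n (\<phi> i) K (SOME t. distinct t & set t = s))"
  by (simp add: rdens_def r vdens_def d)
 also have "...=(\<Sum>i\<in>I. of_nat (a i) * rdens G D n (\<phi> i) c)"
  unfolding rdens_def r vdens_def prod.case sum_distrib_left by (rule sum.swap)
 finally show ?thesis .
qed

lemma rdens_cong:
 assumes "!!g. g\<in>carrier G ==> \<psi> g=\<phi> g"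
 shows "rdens G D n \<psi> = rdens G D n \<phi>"
 using rdens_sum[where G = G and \<psi> = \<psi> and I = "{()}" and a = "%_. 1" and \<phi> = "%_. \<phi>"] assms by (simp add: fun_eq_iff)

text \<open>A member \<theta> of a class is given only as equivalent to an irreducible
  representation. Both the isotypic projector and the density depend on it through its character
  alone, so the computation is done with the irreducible one.\<close>

lemma (in fin_group) l2_multiplicity_Irr:
 assumes "orbit_reps G R" "realisation D G R \<Psi>" "prob_space \<nu>" "space \<nu>=SC 1 D G" "sets \<nu> = sets (SC_borel 1 D G)"
  and C: "C\<in>Irr G" "\<theta>\<in>C"
 shows "l2_multiplicity D G R \<Psi> n \<theta> \<nu>=(\<integral>c. cnj (rdens G D n (character \<theta>) c) \<partial>\<nu>) / of_nat (n + 1)"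
  "integrable \<nu> (rdens G D n (character \<theta>))"
proof -
 obtain \<rho> where \<rho>: "irreducible_rep G \<rho>" "C={\<sigma>. is_rep G \<sigma> & rep_equiv G \<rho> \<sigma>}" using IrrE[OF C(1)] by metis
 have e: "character \<theta> g=character \<rho> g" if "g\<in>carrier G" for g
  by (rule rep_equiv_character[OF irr_is_rep[OF \<rho>(1)] _ _ that, symmetric]) (use C(2) \<rho>(2) in blast)+
 interpret random_realised G D R \<Psi> \<nu> n \<rho>
  by (intro random_realised.intro realised.intro fin_group_axioms realised_axioms.intro random_realised_axioms.intro assms \<rho>(1))
 have "isotypic_projector G \<Psi> \<theta>=isotypic_projector G \<Psi> \<rho>"
  unfolding isotypic_projector_def by (intro ext arg_cong2[where f = "(*)"] sum.cong[OF refl]) (simp_all add: e)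
 hence "l2_multiplicity D G R \<Psi> n \<theta> \<nu>=l2_multiplicity D G R \<Psi> n \<rho> \<nu>" by (simp add: l2_multiplicity_def e)
 thus "l2_multiplicity D G R \<Psi> n \<theta> \<nu>=(\<integral>c. cnj (rdens G D n (character \<theta>) c) \<partial>\<nu>) / of_nat (n + 1)"
  "integrable \<nu> (rdens G D n (character \<theta>))"
  using l2_multiplicity_eq rdens_cong[of G "character \<theta>" "character \<rho>", OF e] by simp_all
qed

context fin_pair
begin

text \<open>The density is evaluated at \<lfloor>1, x\<rfloor> for a root x. An element g that maps
  \<lfloor>1, y\<rfloor> into the copy of \<open>K\<close> at the identity lies in \<open>H\<close>,
  which is the disjointness demanded by \<open>vdens_embed\<close>.\<close>

lemma rdens_ind:
 assumes \<rho>: "is_rep G \<rho>" and c: "c\<in>SC 1 D HG"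
 shows "rdens G D n (character \<rho>) (indc D c) = of_nat (card H) / of_nat (card (carrier G)) * rdens HG D n (character \<rho>) c"
proof -
 obtain K P where r: "rep c=(K, P)" by fastforce
 note K = SC1_rep(1)[OF c r]
 note KG = markedD[OF K]
 have P: "P\<in>set [P]" by simp
 define x where "x=(SOME x. x\<in>P)"
 have xP: "x\<in>P" unfolding x_def using root_invariant(2)[OF K P] some_in_eq by blast
 have x: "x\<in>verts K" using root_subset[OF K P] xP by blast
 obtain L Q where r': "rep (indc D c)=(L, Q)" by fastforce
 have "(L, [Q])\<in>mclass D G (ind K) [iset (act K) P]"
  using rep_mem[OF indc_SC[OF c] r'] indc_eq[OF c rep_mem[OF c r]] by simp
 hence "marked_iso G (ind K, [iset (act K) P]) (L, [Q])" using mem_mclassD by blast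
 then obtain f where f: "giso G f (ind K) L" "f ` iset (act K) P=Q" unfolding marked_iso_iff by auto
 note GI = G_complex_ind[OF KG(1)] and dI = degree_le_ind[OF KG(1,2)]
 have pv: "pt K \<one> x\<in>verts (ind K)" by (rule pt_in_verts[OF one_closed x])
 have "pt K \<one> x\<in>iset (act K) P" using xP unfolding iset_def by blast
 hence fQ: "f (pt K \<one> x)\<in>Q" using f(2) by blast
 have "vdens G D n (character \<rho>) (ind K) (pt K \<one> x) = of_nat (card H) / of_nat (card (carrier G)) * vdens HG D n (character \<rho>) K x"
 proof (rule vdens_embed[OF gembed_pt[OF KG(1) one_closed] KG(1,2) GI dI x])
  fix h y assume h: "h\<in>H" and y: "y\<in>verts K"
  show "pt K \<one> (act K h y)=act (ind K) h (pt K \<one> y)"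
   using pt_shift[OF KG(1) one_closed h y] act_ind[OF H_sub[OF h] one_closed y] H_sub[OF h] by simp
 next
  fix g y assume g: "g\<in>carrier G" "g \<notin> H" and y: "y\<in>verts K"
  show "act (ind K) g (pt K \<one> y) \<notin> pt K \<one> ` verts K"
  proof
   assume "act (ind K) g (pt K \<one> y)\<in>pt K \<one> ` verts K"
   then obtain z where z: "z\<in>verts K" "pt K g y=pt K \<one> z" using act_ind[OF g(1) one_closed y] g(1) by auto
   obtain h where h: "h\<in>H" "\<one>=g \<otimes> h" using pt_eqD[OF KG(1) y z(1) g(1) one_closed z(2)] by blast
   have "g=inv h" using inv_equality[OF h(2)[symmetric] H_sub[OF h(1)] g(1)] by simp
   thus False using g(2) H_closed(3)[OF h(1)] by simp
  qed
 qed
 moreover have "vdens G D n (character \<rho>) (ind K) (pt K \<one> x) = rdens G D n (character \<rho>) (indc D c)"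
  by (rule rdens_eq[OF \<rho> indc_SC[OF c] r' GI dI f(1) pv fQ])
 ultimately show ?thesis by (simp add: rdens_def[of HG] r x_def)
qed

lemma l2_multiplicity_ind:
 assumes \<mu>: "random_rooted_complex D HG \<mu>" and R: "orbit_reps G R" "realisation D G R \<Psi>"
  and R': "orbit_reps HG R'" "realisation D HG R' \<Psi>'" and \<rho>: "\<Theta>\<in>Irr G" "\<rho>\<in>\<Theta>"
 shows "l2_multiplicity D G R \<Psi> n \<rho> (ind_measure D G H \<mu>) = of_nat (card H) / of_nat (card (carrier G)) *
  (\<Sum>C\<in>Irr HG. let \<theta>=(SOME \<theta>. \<theta>\<in>C) in of_nat (multiplicity_in HG \<theta> \<rho>) * l2_multiplicity D HG R' \<Psi>' n \<theta> \<mu>)"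
proof -
 interpret HH: fin_group HG by (rule HG_fin)
 let ?r = "of_nat (card H) / of_nat (card (carrier G)) :: complex"
 let ?\<theta> = "%C. SOME \<theta>. \<theta>\<in>C"
 have \<mu>': "prob_space \<mu>" "space \<mu>=SC 1 D HG" "sets \<mu> = sets (SC_borel 1 D HG)"
  using \<mu> by (auto simp: random_rooted_complex_def)
 have \<nu>: "prob_space (ind_measure D G H \<mu>)" "space (ind_measure D G H \<mu>)=SC 1 D G" "sets (ind_measure D G H \<mu>) = sets (SC_borel 1 D G)"
  using random_rooted_complex_ind[OF \<mu>] by (auto simp: random_rooted_complex_def)
 have rep: "is_rep G \<rho>" using IrrE[OF \<rho>(1)] \<rho>(2) by blast
 \<comment> \<open>The restriction of \<rho> is the same matrix function read over the smaller
   carrier; being a representation passes down.\<close>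
 hence repH: "is_rep HG \<rho>" using H_sub by (simp add: is_rep_def rep_dim_def)
 note L = l2_multiplicity_Irr[OF R \<nu> \<rho>, of n]
 have i: "C\<in>Irr HG ==> integrable \<mu> (rdens HG D n (character (?\<theta> C)))"
  and l: "C\<in>Irr HG ==> l2_multiplicity D HG R' \<Psi>' n (?\<theta> C) \<mu>=(\<integral>c. cnj (rdens HG D n (character (?\<theta> C)) c) \<partial>\<mu>) / of_nat (n + 1)" for C
  using HH.l2_multiplicity_Irr[OF R' \<mu>' _ HH.Irr_some] by blast+
 have "rdens G D n (character \<rho>)\<in>borel_measurable (SC_borel 1 D G)"
  using borel_measurable_integrable[OF L(2)] by (simp add: measurable_cong_sets[OF \<nu>(3) refl])
 hence "(\<integral>c. cnj (rdens G D n (character \<rho>) c) \<partial>ind_measure D G H \<mu>)=(\<integral>c. cnj (rdens G D n (character \<rho>) (ind_map D G H c)) \<partial>\<mu>)"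
  unfolding ind_measure_def by (rule integral_distr[OF measurable_ind_map[OF \<mu>'(2,3)] measurable_cnj])
 also have "...=(\<integral>c. ?r*(\<Sum>C\<in>Irr HG. of_nat (multiplicity_in HG (?\<theta> C) \<rho>) * cnj (rdens HG D n (character (?\<theta> C)) c)) \<partial>\<mu>)"
 proof (rule Bochner_Integration.integral_cong[OF refl])
  fix c assume "c\<in>space \<mu>"
  hence c: "c\<in>SC 1 D HG" using \<mu>'(2) by simp
  have "rdens HG D n (character \<rho>) c=(\<Sum>C\<in>Irr HG. of_nat (multiplicity_in HG (?\<theta> C) \<rho>) * rdens HG D n (character (?\<theta> C)) c)"
   by (rule rdens_sum) (use HH.character_decomposition[OF repH] in \<open>simp add: Let_def\<close>)
  thus "cnj (rdens G D n (character \<rho>) (ind_map D G H c)) =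
    ?r*(\<Sum>C\<in>Irr HG. of_nat (multiplicity_in HG (?\<theta> C) \<rho>) * cnj (rdens HG D n (character (?\<theta> C)) c))"
   unfolding ind_map_eq[OF c] rdens_ind[OF rep c] by simp
 qed
 also have "...=?r*(\<integral>c. (\<Sum>C\<in>Irr HG. of_nat (multiplicity_in HG (?\<theta> C) \<rho>) * cnj (rdens HG D n (character (?\<theta> C)) c)) \<partial>\<mu>)"
  by (rule integral_mult_right_zero)
 also have "(\<integral>c. (\<Sum>C\<in>Irr HG. of_nat (multiplicity_in HG (?\<theta> C) \<rho>) * cnj (rdens HG D n (character (?\<theta> C)) c)) \<partial>\<mu>) =
   (\<Sum>C\<in>Irr HG. \<integral>c. of_nat (multiplicity_in HG (?\<theta> C) \<rho>) * cnj (rdens HG D n (character (?\<theta> C)) c) \<partial>\<mu>)"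
  by (rule Bochner_Integration.integral_sum) (intro integrable_mult_right integrable_cnj i)
 also have "...=(\<Sum>C\<in>Irr HG. of_nat (multiplicity_in HG (?\<theta> C) \<rho>)*(\<integral>c. cnj (rdens HG D n (character (?\<theta> C)) c) \<partial>\<mu>))"
  by (rule sum.cong[OF refl integral_mult_right_zero])
 finally have "l2_multiplicity D G R \<Psi> n \<rho> (ind_measure D G H \<mu>) =
   ?r*(\<Sum>C\<in>Irr HG. of_nat (multiplicity_in HG (?\<theta> C) \<rho>)*(\<integral>c. cnj (rdens HG D n (character (?\<theta> C)) c) \<partial>\<mu>)) / of_nat (n + 1)"
  unfolding L(1) by simp
 also have "...=?r*(\<Sum>C\<in>Irr HG. of_nat (multiplicity_in HG (?\<theta> C) \<rho>) * l2_multiplicity D HG R' \<Psi>' n (?\<theta> C) \<mu>)"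
  unfolding times_divide_eq_right[symmetric] sum_divide_distrib
  by (rule arg_cong[where f = "(*) ?r"], rule sum.cong[OF refl]) (simp only: l times_divide_eq_right)
 finally show ?thesis by (simp only: Let_def)
qed

end

theorem theorem4p10:
  fixes G :: "('g, 'b) monoid_scheme" and H :: "'g set" and D :: nat
    and \<mu> :: "'g iso_class measure"
  assumes "group G" and "finite (carrier G)" and "subgroup H G" and "D > 0"
    and "random_rooted_complex D (G\<lparr>carrier := H\<rparr>) \<mu>"
    and "sofic D (G\<lparr>carrier := H\<rparr>) \<mu>"
  shows "sofic D G (ind_measure D G H \<mu>) \<and>
    (\<forall>R \<Psi> R' \<Psi>'.
       orbit_reps G R \<and> realisation D G R \<Psi> \<and>
       orbit_reps (G\<lparr>carrier := H\<rparr>) R' \<and> realisation D (G\<lparr>carrier := H\<rparr>) R' \<Psi>' \<longrightarrow>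
       (\<forall>\<Theta>\<in>Irr G. \<forall>\<rho>\<in>\<Theta>. \<forall>n.
          l2_multiplicity D G R \<Psi> n \<rho> (ind_measure D G H \<mu>) =
          of_nat (card H) / of_nat (card (carrier G)) *
          (\<Sum>C\<in>Irr (G\<lparr>carrier := H\<rparr>). let \<theta> = (SOME \<theta>. \<theta> \<in> C) in
             of_nat (multiplicity_in (G\<lparr>carrier := H\<rparr>) \<theta> \<rho>) *
             l2_multiplicity D (G\<lparr>carrier := H\<rparr>) R' \<Psi>' n \<theta> \<mu>)))"
proof -
  interpret fin_pair G H using assms(1-3) by (simp add: fin_pair_def fin_group_def fin_group_axioms_def fin_pair_axioms_def)
  show ?thesis
    using sofic_ind[OF assms(6)] l2_multiplicity_ind[OF assms(5)] by blast
qed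

end
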